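(* Let $A:\gamma_{i,k}\mapsto\alpha_k\gamma_{i,k}$ with $|\alpha_k|\le K|k|^\mu$ ($k\neq0$) for some $K,\mu>0$. Then the star-products $\star^A_\hbar$ and $\star_\hbar$ are equivalent on the Connes space $\mathrm{CO}_{\infty-}$. That is, there is a $\mathbb K[[\hbar]]$-linear map $T:\mathrm{CO}_{\infty-}[[\hbar]]\to\mathrm{CO}_{\infty-}[[\hbar]]$ of the form $T=I+\sum_{r\ge1}\hbar^rT_r$, where $I$ is the identity and each $T_r:\mathrm{CO}_{\infty-}\to\mathrm{CO}_{\infty-}$ ($r\ge1$) is a continuous linear operator, such that for all $F,G\in\mathrm{CO}_{\infty-}$ $$T(F\star^A_\hbar G)=T(F)\star_\hbar T(G).$$
   Context: Let $\mathbb K=\mathbb R$ or $\mathbb C$ be the scalar field, $S^1=[0,1]/(0\sim 1)$, $d\ge 1$. $\mathcal H=\mathcal H(S^1,\mathbb R^d)$ is the Hilbert space of maps $\gamma:S^1\to\mathbb R^d$ with $\|\gamma\|^2=\int_0^1|\gamma(s)|^2ds+\int_0^1|\dot\gamma(s)|^2ds<\infty$; its dual $\mathcal H^*$ is identified with $\mathcal H$, and elements of $\mathcal H\oplus\mathcal H^*$ are regarded as functions $S^1\to\mathbb R^d\oplus\mathbb R^d=\mathbb R^{2d}$. Basis: with $(e_i)_{1\le i\le d}$ the canonical basis of $\mathbb R^d$ and $\lambda=4\pi^2$, the orthonormal Fourier basis $(\gamma_{i,k})_{1\le i\le d,\,k\in\mathbb Z}$ of $\mathcal H$ is $\gamma_{i,k}(s)=c_k\frac{\cos(2k\pi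 s)}{\sqrt{\lambda k^2+1}}e_i$ for $k\ge 0$ and $\gamma_{i,k}(s)=c_k\frac{\sin(2k\pi s)}{\sqrt{\lambda k^2+1}}e_i$ for $k<0$, where $c_0=1$, $c_k=\sqrt2$ for $k\neq0$. $(\gamma^*_{i,k})$ is the dual basis of $\mathcal H^*\simeq\mathcal H$. Connes space over $\mathcal H\oplus\mathcal H^*$: consider formal sums $F=\sum_{n\ge 0}F^n$ with $F^n\in(\mathcal H\oplus\mathcal H^* )^{\widehat\otimes n}$ (symmetric tensor power, complexified if $\mathbb K=\mathbb C$), regarded as a symmetric function $(S^1)^n\to(\mathbb K^{2d})^{\otimes n}$, of class $C^\infty$ in its $n$ variables ($F^0$ is a constant). For $k\in\mathbb N$ put $$\|F^n\|_k=\sum_{(m_1,\dots,m_n)\in\{0,\dots,k\}^n}\Big\|\frac{\partial^{m_1+\cdots+m_n}}{\partial s_1^{m_1}\cdots\partial s_n^{m_n}}F^n\Big\|_\infty,$$ and for $C>0$ put $\|F\|_{k,C}=\sum_n C^n\|F^n\|_k$. $\mathrm{CO}_{k,C}$ is the space of such $F$ with $\|F\|_{k,C}<\infty$, and $\mathrm{CO}_{\infty-}=\bigcap_{k,C}\mathrm{CO}_{k,C}$, with the topology given by all the norms $\|\cdot\|_{k,C}$. $\mathrm{CO}_{\infty-}[[\hbar]]$ is the set of formal power series in $\hbar$ with coefficients in $\mathrm{CO}_{\infty-}$. Multiple Stratonovich integral: for $F\in\mathrm{CO}_{\infty-}$ and a continuous path $B\oplus B^*=:X:S^1\to\mathbb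 R^{2d}$, $$I^S_m(F)=\sum_n\sum_{J\subset\{1,\dots,n\}}\int_{(S^1)^n}(-1)^{|J|}\Big\langle \prod_{j\in J}\frac{\partial^2}{\partial s_j^2}F^n(s_1,\dots,s_n),X(s_1)\otimes\cdots\otimes X(s_n)\Big\rangle ds_1\cdots ds_n$$ (the index $m$ is only notation). The map $F\mapsto I^S_m(F)$ is injective; $\mathrm{CO}_{\infty-}$ is identified with its image, with $\|I^S_m(F)\|_{k,C}:=\|F\|_{k,C}$; under this identification the product $F\cdot G$ of functionals is pointwise (it corresponds to the symmetrized tensor product ${:F.G:}=\sum_{n,m}F^n\widehat\otimes G^m$). $D_{\gamma_{i,k}}$ (resp. $D_{\gamma^*_{i,k}}$) is the Gâteaux derivative in the direction $\gamma_{i,k}\oplus0$ (resp. $0\oplus\gamma^*_{i,k}$). Star-products (with elements of $\mathrm{CO}_{\infty-}$ regarded as functionals): the Poisson bracket is $\{F,G\}=\sum_{i,k}[D_{\gamma_{i,k}}F\,D_{\gamma^*_{i,k}}G-D_{\gamma_{i,k}}G\,D_{\gamma^*_{i,k}}F]$. Put $$C^A_1(F,G)=\{F,G\}+E_A(F,G)=\sum_{i=1}^d\sum_{k\in\mathbb Z}\big[(\alpha_k+1)D_{\gamma_{i,k}}F\,D_{\gamma^*_{i,k}}G+(\alpha_k-1)D_{\gamma_{i,k}}G\,D_{\gamma^*_{i,k}}F\big],$$ where $E_A(F,G)=\sum_{i,k}\alpha_k[D_{\gamma_{i,k}}F\,D_{\gamma^*_{i,k}}G+D_{\gamma_{i,k}}G\,D_{\gamma^*_{i,k}}F]$,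 and let $C^A_r=(C^A_1)^r$ be the $r$-th power in the sense of bidifferential operators: $$C^A_r(F,G)=\sum_{i_1,\dots,i_r}\sum_{k_1,\dots,k_r}\sum_{\varepsilon\in\{+1,-1\}^r}\prod_{l=1}^r(\alpha_{k_l}+\varepsilon_l)\,\big(D^{\varepsilon_1}_{i_1,k_1}\cdots D^{\varepsilon_r}_{i_r,k_r}F\big)\big(D^{-\varepsilon_1}_{i_1,k_1}\cdots D^{-\varepsilon_r}_{i_r,k_r}G\big),$$ with $D^{+1}_{i,k}=D_{\gamma_{i,k}}$, $D^{-1}_{i,k}=D_{\gamma^*_{i,k}}$. Then $$F\star^A_\hbar G=F\cdot G+\sum_{r\ge1}\frac{\hbar^r}{r!}C^A_r(F,G),$$ extended $\mathbb K[[\hbar]]$-bilinearly to $\mathrm{CO}_{\infty-}[[\hbar]]$, and the Moyal star-product $\star_\hbar$ is $F\star_\hbar G=F\cdot G+\sum_{r\ge1}\frac{\hbar^r}{r!}P^r(F,G)$, where $P^r$ is the $r$-th power, in the same sense, of the Poisson bracket (i.e. $\star_\hbar$ is given by the formula for $\star^A_\hbar$ with all $\alpha_k=0$). *)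

theory Defs
  imports "HOL-Analysis.Analysis"
begin

text \<open>
  The circle is \<open>[0,1]\<close> with endpoints identified, and maps on it are \<open>1\<close>-periodic maps on the reals.
  The scalar field is a type \<open>'k :: {real_normed_field, euclidean_space}\<close>; up to isometric isomorphism
  the only such fields are \<^typ>\<open>real\<close> and \<^typ>\<open>complex\<close>, and both are instances.
  The dimension is \<open>CARD('d)\<close>, and \<open>'d + 'd\<close> indexes the canonical basis of
  \<open>\<real>\<^sup>d \<oplus> \<real>\<^sup>d\<close>, with \<^const>\<open>Inl\<close> for the first summand.

  A formal sum \<open>F = \<Sum>n. F\<^sup>n\<close> of tensor-valued functions is encoded by its coordinates as one function
  on lists: \<open>F [(s\<^sub>1,a\<^sub>1),\<dots>,(s\<^sub>n,a\<^sub>n)]\<close> is the \<open>(a\<^sub>1,\<dots>,a\<^sub>n)\<close>-coordinate of \<open>F\<^sup>n(s\<^sub>1,\<dots>,s\<^sub>n)\<close>.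
\<close>

type_synonym ('d, 'k) kernel = "(real \<times> ('d + 'd)) list \<Rightarrow> 'k"
type_synonym ('d, 'k) functional = "(real \<Rightarrow> real ^ ('d + 'd)) \<Rightarrow> 'k"


subsection \<open>Fourier basis\<close>

definition fourier_basis :: "'d::finite \<Rightarrow> int \<Rightarrow> real \<Rightarrow> real ^ 'd" where
  "fourier_basis i k s =
    ((if k = 0 then 1 else sqrt 2)
      * (if k \<ge> 0 then cos (2 * of_int k * pi * s) else sin (2 * of_int k * pi * s))
      / sqrt (4 * pi\<^sup>2 * (of_int k)\<^sup>2 + 1)) *\<^sub>R axis i 1"

definition dsum :: "(real \<Rightarrow> real ^ 'd) \<Rightarrow> (real \<Rightarrow> real ^ 'd) \<Rightarrow> real \<Rightarrow> real ^ ('d::finite + 'd)" where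
  "dsum u v s = (\<chi> a. case a of Inl i \<Rightarrow> u s $ i | Inr i \<Rightarrow> v s $ i)"

text \<open>
  Under the Riesz identification of the dual with the space itself, the dual of an orthonormal basis
  is that basis; only its position in the direct sum changes.
\<close>

definition basis_dir :: "int \<Rightarrow> 'd::finite \<Rightarrow> int \<Rightarrow> real \<Rightarrow> real ^ ('d + 'd)" where
  "basis_dir e i k =
    (if e = 1 then dsum (fourier_basis i k) (\<lambda>_. 0) else dsum (\<lambda>_. 0) (fourier_basis i k))"


subsection \<open>Kernels and the norms\<close>

text \<open>Partial derivative in the \<open>i\<close>-th (from 0) circle variable.\<close>

definition partial :: "nat \<Rightarrow> ('d, 'k::real_normed_vector) kernel \<Rightarrow> ('d, 'k) kernel" where
  "partial i F xs = vector_derivative (\<lambda>t. F (xs[i := (t, snd (xs ! i))])) (at (fst (xs ! i)))"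

definition mixed_partial :: "nat list \<Rightarrow> ('d, 'k::real_normed_vector) kernel \<Rightarrow> ('d, 'k) kernel" where
  "mixed_partial m F = fold (\<lambda>i. partial i ^^ (m ! i)) [0..<length m] F"

definition symmetric_kernel :: "('d, 'k) kernel \<Rightarrow> bool" where
  "symmetric_kernel F \<longleftrightarrow> (\<forall>xs ys. mset xs = mset ys \<longrightarrow> F xs = F ys)"

definition periodic_kernel :: "('d, 'k) kernel \<Rightarrow> bool" where
  "periodic_kernel F \<longleftrightarrow>
    (\<forall>xs i t a. i < length xs \<longrightarrow> F (xs[i := (t + 1, a)]) = F (xs[i := (t, a)]))"

text \<open>All iterated partial derivatives, in any order, exist and are jointly continuous.\<close>

definition smooth_kernel :: "('d, 'k::real_normed_vector) kernel \<Rightarrow> bool" where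
  "smooth_kernel F \<longleftrightarrow>
    (\<forall>n js. set js \<subseteq> {..<n} \<longrightarrow>
      (\<forall>a. continuous_on UNIV
        (\<lambda>s :: nat \<Rightarrow> real. foldr partial js F (map (\<lambda>i. (s i, a i)) [0..<n]))) \<and>
      (\<forall>i<n. \<forall>xs. length xs = n \<longrightarrow>
        (\<lambda>t. foldr partial js F (xs[i := (t, snd (xs ! i))])) differentiable (at (fst (xs ! i)))))"

text \<open>The tensor power carries the Euclidean (Hermitian) norm, which is the \<open>L2_set\<close> below.\<close>

definition sup_norm :: "nat \<Rightarrow> ('d::finite, 'k::real_normed_vector) kernel \<Rightarrow> real" where
  "sup_norm n F =
    (SUP s\<in>{s. length s = n}. L2_set (\<lambda>a. norm (F (zip s a))) {a. length a = n})"

definition degree_norm :: "nat \<Rightarrow> nat \<Rightarrow> ('d::finite, 'k::real_normed_vector) kernel \<Rightarrow> real" where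
  "degree_norm k n F =
    (\<Sum>m\<in>{m. length m = n \<and> set m \<subseteq> {0..k}}. sup_norm n (mixed_partial m F))"

definition kernel_norm :: "nat \<Rightarrow> real \<Rightarrow> ('d::finite, 'k::real_normed_vector) kernel \<Rightarrow> real" where
  "kernel_norm k C F = (\<Sum>n. C ^ n * degree_norm k n F)"

definition connes_kernels :: "('d::finite, 'k::real_normed_vector) kernel set" where
  "connes_kernels =
    {F. symmetric_kernel F \<and> periodic_kernel F \<and> smooth_kernel F \<and>
        (\<forall>k C. C > 0 \<longrightarrow> summable (\<lambda>n. C ^ n * degree_norm k n F))}"


subsection \<open>Multiple Stratonovich integrals and the Connes space\<close>

definition loops :: "(real \<Rightarrow> real ^ 'a::finite) set" where
  "loops = {X. continuous_on UNIV X \<and> (\<forall>s. X (s + 1) = X s)}"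

text \<open>
  Functionals live on continuous loops only. They are extended by \<open>0\<close>, a convention preserved by all
  the operations used here, so that equality on loops is equality of functions.
\<close>

definition stratonovich ::
    "('d::finite, 'k::{real_normed_field, euclidean_space}) kernel \<Rightarrow> ('d, 'k) functional" where
  "stratonovich F X =
    (if X \<in> loops then
      \<Sum>n. \<Sum>J\<in>Pow {..<n}.
        LINT s|Pi\<^sub>M {..<n} (\<lambda>_. restrict_space lborel {0..1}).
          (-1) ^ card J *
          (\<Sum>a\<in>{a. length a = n}.
            mixed_partial (map (\<lambda>j. if j \<in> J then 2 else 0) [0..<n]) F (zip (map s [0..<n]) a)
            * of_real (\<Prod>j<n. X (s j) $ (a ! j)))
     else 0)"

definition connes ::
    "('d::finite, 'k::{real_normed_field, euclidean_space}) functional set" where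
  "connes = stratonovich ` connes_kernels"

definition connes_norm ::
    "nat \<Rightarrow> real \<Rightarrow> ('d::finite, 'k::{real_normed_field, euclidean_space}) functional \<Rightarrow> real" where
  "connes_norm k C \<Phi> = kernel_norm k C (the_inv_into connes_kernels stratonovich \<Phi>)"

definition connes_topology ::
    "('d::finite, 'k::{real_normed_field, euclidean_space}) functional topology" where
  "connes_topology = topology_generated_by
    {{\<Psi> \<in> connes. connes_norm k C (\<lambda>X. \<Psi> X - \<Phi> X) < \<epsilon>} | \<Phi> k C \<epsilon>.
      \<Phi> \<in> connes \<and> C > 0 \<and> \<epsilon> > 0}"

definition linear_on_connes ::
    "(('d::finite, 'k::{real_normed_field, euclidean_space}) functional \<Rightarrow> ('d, 'k) functional) \<Rightarrow> bool" where
  "linear_on_connes S \<longleftrightarrow>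
    (\<forall>\<Phi>\<in>connes. \<forall>\<Psi>\<in>connes. \<forall>a b.
      S (\<lambda>X. a * \<Phi> X + b * \<Psi> X) = (\<lambda>X. a * S \<Phi> X + b * S \<Psi> X))"


subsection \<open>Star-products\<close>

definition gateaux ::
    "(real \<Rightarrow> real ^ ('d::finite + 'd)) \<Rightarrow> ('d, 'k::real_normed_vector) functional \<Rightarrow> ('d, 'k) functional" where
  "gateaux v \<Phi> X = vector_derivative (\<lambda>t. \<Phi> (\<lambda>s. X s + t *\<^sub>R v s)) (at 0)"

text \<open>
  \<open>bidiff \<alpha> r\<close> is the \<open>r\<close>-th power of the bidifferential operator with coefficients \<open>\<alpha>\<^sub>k \<plusminus> 1\<close>; an entry
  \<open>(i, k, e)\<close> of the list \<open>w\<close> collects the three summation indices of one factor.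
\<close>

definition bidiff ::
    "(int \<Rightarrow> 'k::real_normed_field) \<Rightarrow> nat \<Rightarrow>
      ('d::finite, 'k) functional \<Rightarrow> ('d, 'k) functional \<Rightarrow> ('d, 'k) functional" where
  "bidiff \<alpha> r \<Phi> \<Psi> X =
    (\<Sum>\<^sub>\<infinity>w\<in>{w. length w = r \<and> set w \<subseteq> UNIV \<times> UNIV \<times> {1, -1}}.
      (\<Prod>(i, k, e)\<leftarrow>w. \<alpha> k + of_int e)
      * foldr (\<lambda>(i, k, e). gateaux (basis_dir e i k)) w \<Phi> X
      * foldr (\<lambda>(i, k, e). gateaux (basis_dir (- e) i k)) w \<Psi> X)"

definition star_term ::
    "(int \<Rightarrow> 'k::real_normed_field) \<Rightarrow> nat \<Rightarrow>
      ('d::finite, 'k) functional \<Rightarrow> ('d, 'k) functional \<Rightarrow> ('d, 'k) functional" where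
  "star_term \<alpha> r \<Phi> \<Psi> X = (if r = 0 then \<Phi> X * \<Psi> X else bidiff \<alpha> r \<Phi> \<Psi> X / fact r)"

text \<open>Formal power series in \<open>\<hbar>\<close> with functionals as coefficients.\<close>

type_synonym ('d, 'k) hseries = "nat \<Rightarrow> ('d, 'k) functional"

definition connes_hseries ::
    "('d::finite, 'k::{real_normed_field, euclidean_space}) hseries set" where
  "connes_hseries = {\<Phi>. \<forall>n. \<Phi> n \<in> connes}"

definition hconst :: "('d, 'k::zero) functional \<Rightarrow> ('d, 'k) hseries" where
  "hconst \<Phi> n = (if n = 0 then \<Phi> else (\<lambda>X. 0))"

definition hscale :: "'k::comm_ring_1 fps \<Rightarrow> ('d, 'k) hseries \<Rightarrow> ('d, 'k) hseries" where
  "hscale c \<Phi> n X = (\<Sum>j\<le>n. fps_nth c j * \<Phi> (n - j) X)"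

definition hlinear_on_connes ::
    "(('d::finite, 'k::{real_normed_field, euclidean_space}) hseries \<Rightarrow> ('d, 'k) hseries) \<Rightarrow> bool" where
  "hlinear_on_connes T \<longleftrightarrow>
    (\<forall>\<Phi>\<in>connes_hseries. \<forall>\<Psi>\<in>connes_hseries. T (\<lambda>n X. \<Phi> n X + \<Psi> n X) = (\<lambda>n X. T \<Phi> n X + T \<Psi> n X)) \<and>
    (\<forall>c. \<forall>\<Phi>\<in>connes_hseries. T (hscale c \<Phi>) = hscale c (T \<Phi>))"

text \<open>The \<open>\<hbar>\<close>-bilinear extension of \<open>\<Sum>r. \<hbar>\<^sup>r star_term \<alpha> r\<close>.\<close>

definition star ::
    "(int \<Rightarrow> 'k::real_normed_field) \<Rightarrow>
      ('d::finite, 'k) hseries \<Rightarrow> ('d, 'k) hseries \<Rightarrow> ('d, 'k) hseries" where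
  "star \<alpha> \<Phi> \<Psi> n X = (\<Sum>p\<le>n. \<Sum>q\<le>n - p. star_term \<alpha> (n - p - q) (\<Phi> p) (\<Psi> q) X)"

definition moyal ::
    "('d::finite, 'k::real_normed_field) hseries \<Rightarrow> ('d, 'k) hseries \<Rightarrow> ('d, 'k) hseries" where
  "moyal = star (\<lambda>_. 0)"

end

theory Submission
  imports Defs
begin

text \<open>
  Both star-products are exponentials of bidifferential operators with constant coefficients, so the
  equivalence is a change of ordering.  Let \<open>\<Delta> = \<Sum>\<^sub>i\<^sub>,\<^sub>k \<alpha>\<^sub>k D\<^sub>\<gamma> D\<^sub>\<gamma>\<^sub>*\<close>.  By the Leibniz rule \<open>\<Delta>\<close> acts on a product
  \<open>F G\<close> as \<open>\<Delta> \<otimes> 1 + 1 \<otimes> \<Delta> + E\<^sub>A\<close>, where the crossed terms are exactly the difference between \<open>C\<^sup>A\<^sub>1\<close> and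
  the Poisson bracket \<open>P\<close>.  All these operators commute, hence with \<open>T = exp (-\<hbar>\<Delta>)\<close> and \<open>m\<close> the
  multiplication
    \<open>T \<circ> m \<circ> exp (\<hbar> (P + E\<^sub>A)) = m \<circ> exp (-\<hbar> (\<Delta> \<otimes> 1 + 1 \<otimes> \<Delta> + E\<^sub>A)) \<circ> exp (\<hbar> (P + E\<^sub>A))
      = m \<circ> exp (\<hbar> P) \<circ> (T \<otimes> T)\<close>.

  The analytic content is that these infinite sums converge and act continuously.  The coefficients
  \<open>\<alpha>\<^sub>k\<close> grow polynomially, whereas the derivatives of a functional with smooth kernels along the Fourier
  modes decay faster than every power of the frequency.  To use this, a functional is encoded by its
  Taylor coefficients at the zero loop, \<open>f l = D\<^bsub>l\<^sub>1\<^esub> \<dots> D\<^bsub>l\<^sub>n\<^esub> \<Phi> 0\<close>, a function on words of modes.  The Connes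
  space is then the space of functionals \<open>Phi f\<close> with \<open>f\<close> symmetric and rapidly decreasing (\<open>connes_eq\<close>).
  A Gateaux derivative prepends a letter (\<open>gateaux_Phi\<close>); a product is the restriction to the diagonal of
  a function on two copies of the variables (\<open>taylor_eval_tens\<close>, \<open>taylor_eval_diagonal\<close>); \<open>\<Delta>\<close>, \<open>P\<close> and
  \<open>E\<^sub>A\<close> all become contractions of words by two letters.  The identity above becomes
  \<open>star_coef_equivalence\<close>, an application of the binomial theorem for commuting operators in every
  order of \<open>\<hbar>\<close>.

  The passage between kernels and coefficients goes through Fourier series in each variable.
  From a coefficient function one synthesizes a kernel whose Stratonovich integral is \<open>Phi f\<close>
  (\<open>stratonovich_synth\<close>): the factors \<open>1 - \<partial>\<^sub>j\<^sup>2\<close> hidden in the sum over subsets turn the pairing of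
  \<open>\<H>\<close> into integration.  Conversely, iterated Fourier coefficients of a kernel, integrated by parts,
  decay rapidly and recover the kernel (\<open>kernel_eq_synth_fourier\<close>).  Each passage bounds
  the norms on one side by those on the other (\<open>connes_norm_le\<close>, \<open>bnd_connes_norm\<close>), so that
  continuity may be checked on coefficients, where it is an estimate for contractions (\<open>bnd_T_coef\<close>).
\<close>

(* Two notions of summability share this infix; it is kept for summability along the filter of
   finite subsets. *)
no_notation Infinite_Set_Sum.abs_summable_on (infix \<open>abs'_summable'_on\<close> 50)

section \<open>Formal sums of multilinear forms with rapidly decreasing coefficients\<close>

lemma abs_le_summable:
  fixes f :: "'i \<Rightarrow> 'b::banach"
  assumes "g summable_on A" and "\<And>x. x \<in> A \<Longrightarrow> norm (f x) \<le> g x"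
  shows "f abs_summable_on A" and "f summable_on A" and "norm (infsum f A) \<le> infsum g A"
proof -
  show a: "f abs_summable_on A"
    using assms by (rule Infinite_Sum.abs_summable_on_comparison_test')
  then show s: "f summable_on A" by (rule abs_summable_summable)
  show "norm (infsum f A) \<le> infsum g A"
    by (rule norm_infsum_le[OF has_sum_infsum[OF s] has_sum_infsum[OF assms(1)] assms(2)])
qed

lemma bij_betw_Cons:
  "bij_betw (\<lambda>(j, l). j # l) (UNIV \<times> {l. length l = n}) {l. length l = Suc n}"
  unfolding bij_betw_def
proof
  show "inj_on (\<lambda>(j, l). j # l) (UNIV \<times> {l. length l = n})"
    by (auto simp: inj_on_def)
  show "(\<lambda>(j, l). j # l) ` (UNIV \<times> {l. length l = n}) = {l. length l = Suc n}"
    by (auto simp: length_Suc_conv image_iff)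
qed

lemma infsum_lists_Suc:
  fixes g :: "'i list \<Rightarrow> 'b::banach"
  assumes "g abs_summable_on {l. length l = Suc n}"
  shows "infsum g {l. length l = Suc n} = (\<Sum>\<^sub>\<infinity>j. \<Sum>\<^sub>\<infinity>l\<in>{l. length l = n}. g (j # l))"
    and "(\<lambda>j. \<Sum>\<^sub>\<infinity>l\<in>{l. length l = n}. g (j # l)) abs_summable_on UNIV"
    and "(\<lambda>l. g (j # l)) abs_summable_on {l. length l = n}"
proof -
  let ?L = "{l::'i list. length l = n}"
  have 1: "(\<lambda>p. g ((\<lambda>(j, l). j # l) p)) abs_summable_on UNIV \<times> ?L"
    using assms summable_on_reindex_bij_betw[OF bij_betw_Cons[of n], of "\<lambda>l. norm (g l)"] by simp
  have 2: "(\<lambda>(j, l). g (j # l)) summable_on UNIV \<times> ?L"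
    using abs_summable_summable[OF 1] by (simp add: case_prod_unfold)
  have "infsum g {l. length l = Suc n} = infsum (\<lambda>(j, l). g (j # l)) (UNIV \<times> ?L)"
    using infsum_reindex_bij_betw[OF bij_betw_Cons[of n], of g, symmetric]
    by (simp add: case_prod_unfold)
  also have "\<dots> = (\<Sum>\<^sub>\<infinity>j. \<Sum>\<^sub>\<infinity>l\<in>?L. g (j # l))"
    by (rule infsum_Sigma'_banach[OF 2, symmetric])
  finally show "infsum g {l. length l = Suc n} = (\<Sum>\<^sub>\<infinity>j. \<Sum>\<^sub>\<infinity>l\<in>?L. g (j # l))" .
  have 3: "\<forall>j. (\<lambda>l. g (j # l)) abs_summable_on ?L"
    "(\<lambda>j. infsum (\<lambda>l. norm (g (j # l))) ?L) abs_summable_on UNIV"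
    using Infinite_Sum.abs_summable_on_Sigma_iff[THEN iffD1, OF 1] by simp_all
  then show "(\<lambda>l. g (j # l)) abs_summable_on ?L" by blast
  show "(\<lambda>j. \<Sum>\<^sub>\<infinity>l\<in>?L. g (j # l)) abs_summable_on UNIV"
  proof (rule abs_le_summable(1))
    show "(\<lambda>j. infsum (\<lambda>l. norm (g (j # l))) ?L) summable_on UNIV"
      using 3(2) by (rule abs_summable_summable)
    show "norm (\<Sum>\<^sub>\<infinity>l\<in>?L. g (j # l)) \<le> (\<Sum>\<^sub>\<infinity>l\<in>?L. norm (g (j # l)))" for j
      using Infinite_Sum.norm_infsum_bound[OF 3(1)[rule_format]] .
  qed
qed

lemma has_sum_lists_Suc:
  fixes g :: "'i list \<Rightarrow> real"
  assumes "\<And>l. g l \<ge> 0"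
    and "\<And>j. ((\<lambda>l. g (j # l)) has_sum h j) {l. length l = n}"
    and "(h has_sum S) UNIV"
  shows "(g has_sum S) {l. length l = Suc n}"
proof -
  have "((\<lambda>p. g ((\<lambda>(j, l). j # l) p)) has_sum S) (UNIV \<times> {l. length l = n})"
  proof (rule has_sum_SigmaI)
    show "((\<lambda>y. g ((\<lambda>(j, l). j # l) (x, y))) has_sum h x) {l. length l = n}" for x
      using assms(2) by simp
    show "(h has_sum S) UNIV" by fact
    show "(\<lambda>p. g ((\<lambda>(j, l). j # l) p)) summable_on UNIV \<times> {l. length l = n}"
    proof (rule summable_on_SigmaI)
      show "((\<lambda>y. g ((\<lambda>(j, l). j # l) (x, y))) has_sum h x) {l. length l = n}" for x
        using assms(2) by simp
      show "h summable_on UNIV" using assms(3) by (rule has_sum_imp_summable)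
    qed (use assms(1) in auto)
  qed
  then show ?thesis
    using has_sum_reindex_bij_betw[OF bij_betw_Cons[of n], of g S] by simp
qed

text \<open>
  Sums over words of fixed length factor into sums over letters. This is where all bounds that are
  geometric in the degree come from.
\<close>

lemma has_sum_prod_lists:
  fixes G :: "nat \<Rightarrow> 'i \<Rightarrow> real"
  assumes "\<And>i j. i < n \<Longrightarrow> G i j \<ge> 0" and "\<And>i. i < n \<Longrightarrow> (G i has_sum S i) UNIV"
  shows "((\<lambda>l. \<Prod>i<n. G i (l ! i)) has_sum (\<Prod>i<n. S i)) {l. length l = n}"
  using assms
proof (induction n arbitrary: G S)
  case 0
  show ?case by (simp, rule has_sum_finiteI) auto
next
  case (Suc n)
  define g where "g l = (if length l = Suc n then \<Prod>i<Suc n. G i (l ! i) else 0)" for l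
  have "(g has_sum (\<Prod>i<Suc n. S i)) {l. length l = Suc n}"
  proof (rule has_sum_lists_Suc)
    show "g l \<ge> 0" for l
      unfolding g_def using Suc.prems(1) by (auto intro!: prod_nonneg simp del: prod.lessThan_Suc)
    have ih: "((\<lambda>l. \<Prod>i<n. G (Suc i) (l ! i)) has_sum (\<Prod>i<n. S (Suc i))) {l. length l = n}"
      using Suc.prems by (intro Suc.IH) auto
    show "((\<lambda>l. g (j # l)) has_sum (G 0 j * (\<Prod>i<n. S (Suc i)))) {l. length l = n}" for j
    proof (rule has_sum_cong[THEN iffD1, OF _ has_sum_cmult_right[OF ih]])
      fix l :: "'i list" assume "l \<in> {l. length l = n}"
      then show "G 0 j * (\<Prod>i<n. G (Suc i) (l ! i)) = g (j # l)"
        by (simp add: g_def prod.lessThan_Suc_shift del: prod.lessThan_Suc)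
    qed
    show "((\<lambda>j. G 0 j * (\<Prod>i<n. S (Suc i))) has_sum (\<Prod>i<Suc n. S i)) UNIV"
      unfolding prod.lessThan_Suc_shift
      by (intro has_sum_cmult_left Suc.prems) auto
  qed
  then show ?case
    by (rule has_sum_cong[THEN iffD1, rotated]) (simp add: g_def)
qed

text \<open>
  The summand 1 keeps the weight at least 1 at frequency 0, so that its powers increase with the
  exponent for every mode.
\<close>

definition wt :: "'c \<times> int \<Rightarrow> real" where
  "wt j = 1 + real_of_int \<bar>snd j\<bar>"

lemma wt_ge_1 [simp]: "wt j \<ge> 1"
  by (simp add: wt_def)

lemma wt_pos [simp]: "wt j > 0"
  using wt_ge_1[of j] by linarith

lemma wt_nonneg [simp]: "wt j \<ge> 0" and wt_nz [simp]: "wt j \<noteq> 0"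
  using wt_pos[of j] by linarith+

lemma summable_int_inverse_square: "(\<lambda>k::int. 1 / (1 + real_of_int \<bar>k\<bar>)\<^sup>2) summable_on UNIV"
proof -
  have "summable (\<lambda>n. inverse (real (Suc n) ^ 2))"
    using inverse_power_summable[of 2, where 'a = real] summable_Suc_iff[of "\<lambda>n. inverse (real n ^ 2)"]
    by simp
  then have s: "summable (\<lambda>n. 1 / (1 + real n)\<^sup>2)"
    by (simp add: field_simps)
  have n: "(\<lambda>n. 1 / (1 + real n)\<^sup>2) summable_on UNIV"
    by (rule summable_nonneg_imp_summable_on[OF s]) simp
  have "(\<lambda>k::int. 1 / (1 + real_of_int \<bar>k\<bar>)\<^sup>2) summable_on range int"
    by (subst summable_on_reindex) (use n in \<open>auto simp: o_def\<close>)
  moreover have "(\<lambda>k::int. 1 / (1 + real_of_int \<bar>k\<bar>)\<^sup>2) summable_on range (\<lambda>n. - int n)"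
    by (subst summable_on_reindex) (use n in \<open>auto simp: o_def inj_on_def\<close>)
  ultimately have "(\<lambda>k::int. 1 / (1 + real_of_int \<bar>k\<bar>)\<^sup>2) summable_on (range int \<union> range (\<lambda>n. - int n))"
    by (rule summable_on_union)
  moreover have "range int \<union> range (\<lambda>n. - int n) = UNIV"
    by (metis (no_types, lifting) UNIV_eq_I UnCI int_cases2 rangeI)
  ultimately show ?thesis by simp
qed

lemma summable_wt: "(\<lambda>j::'c::finite \<times> int. 1 / (wt j)\<^sup>2) summable_on UNIV"
proof -
  have "(\<lambda>j::'c \<times> int. 1 / (wt j)\<^sup>2) summable_on UNIV \<times> UNIV"
    by (rule summable_on_SigmaI[where g = "\<lambda>_. \<Sum>\<^sub>\<infinity>k::int. 1 / (1 + real_of_int \<bar>k\<bar>)\<^sup>2"])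
      (auto simp: wt_def summable_int_inverse_square simp del: of_int_abs)
  then show ?thesis by simp
qed

text \<open>
  An absolutely convergent sum over modes costs two powers of the weight and this constant.
  The argument only selects the type of components.
\<close>

definition wsum :: "'c::finite itself \<Rightarrow> real" where
  "wsum _ = (\<Sum>\<^sub>\<infinity>j::'c \<times> int. 1 / (wt j)\<^sup>2)"

lemma wsum_nonneg: "wsum TYPE('c::finite) \<ge> 0"
  unfolding wsum_def by (rule infsum_nonneg) simp

lemma has_sum_wt: "((\<lambda>j::'c::finite \<times> int. 1 / (wt j)\<^sup>2) has_sum wsum TYPE('c)) UNIV"
  unfolding wsum_def by (rule has_sum_infsum[OF summable_wt])

definition wt_prod :: "nat \<Rightarrow> real \<Rightarrow> ('c \<times> int) list \<Rightarrow> real" where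
  "wt_prod k C l = (\<Prod>j\<leftarrow>l. C * wt j ^ k)"

lemma wt_prod_simps [simp]: "wt_prod k C [] = 1" "wt_prod k C (j # l) = C * wt j ^ k * wt_prod k C l"
  "wt_prod k C (l @ l') = wt_prod k C l * wt_prod k C l'"
  by (simp_all add: wt_prod_def)

lemma wt_prod_nth: "wt_prod k C l = (\<Prod>i<length l. C * wt (l ! i) ^ k)"
  by (induction l) (simp_all add: prod.lessThan_Suc_shift del: prod.lessThan_Suc)

lemma wt_prod_pos: "C > 0 \<Longrightarrow> wt_prod k C l > 0"
  by (induction l) auto

lemma wt_prod_mono: "0 < C \<Longrightarrow> C \<le> C' \<Longrightarrow> k \<le> k' \<Longrightarrow> wt_prod k C l \<le> wt_prod k' C' l"
proof (induction l)
  case (Cons j l)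
  have "C * wt j ^ k * wt_prod k C l \<le> C' * wt j ^ k' * wt_prod k' C' l"
  proof (intro mult_mono)
    show "wt j ^ k \<le> wt j ^ k'" using Cons.prems by (intro power_increasing) auto
    show "0 \<le> wt_prod k C l" using wt_prod_pos[of C k l] Cons.prems by simp
  qed (use Cons in auto)
  then show ?case by simp
qed simp

lemma wt_prod_scale: "wt_prod k (a * C) l = a ^ length l * wt_prod k C l"
  by (induction l) (auto simp: algebra_simps)

text \<open>
  The seminorms of coefficient functions. The factorial cancels the one in the Taylor series, and the
  factor \<open>C\<close> per letter makes the degree \<open>n\<close> part of that series of size \<open>C\<close> to the power \<open>- n\<close>.
\<close>

definition bnd :: "nat \<Rightarrow> real \<Rightarrow> real \<Rightarrow> (('c \<times> int) list \<Rightarrow> 'k::real_normed_vector) \<Rightarrow> bool" where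
  "bnd k C M f \<longleftrightarrow> (\<forall>l. norm (f l) * wt_prod k C l \<le> M * fact (length l))"

lemma bndD: "bnd k C M f \<Longrightarrow> norm (f l) * wt_prod k C l \<le> M * fact (length l)"
  by (simp add: bnd_def)

lemma bnd_nonneg: "bnd k C M f \<Longrightarrow> M \<ge> 0"
  using bndD[of k C M f "[]"] norm_ge_zero[of "f []"] by (simp del: norm_ge_zero)

lemma bnd_mono:
  assumes "bnd k' C' M f" "0 < C" "C \<le> C'" "k \<le> k'" "M \<le> M'"
  shows "bnd k C M' f"
  unfolding bnd_def
proof
  fix l
  have "norm (f l) * wt_prod k C l \<le> norm (f l) * wt_prod k' C' l"
    using wt_prod_mono[OF assms(2-4), of l] by (intro mult_left_mono) auto
  also have "\<dots> \<le> M * fact (length l)" by (rule bndD[OF assms(1)])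
  also have "\<dots> \<le> M' * fact (length l)" using assms(5) by (intro mult_right_mono) auto
  finally show "norm (f l) * wt_prod k C l \<le> M' * fact (length l)" .
qed

definition rapid :: "(('c \<times> int) list \<Rightarrow> 'k::real_normed_vector) \<Rightarrow> bool" where
  "rapid f \<longleftrightarrow> (\<forall>k C. C > 0 \<longrightarrow> (\<exists>M. bnd k C M f))"

lemma rapidD: assumes "rapid f" "C > 0" obtains M where "bnd k C M f" "M \<ge> 0"
proof -
  have "\<exists>M. bnd k C M f" using assms unfolding rapid_def by simp
  then obtain M where M: "bnd k C M f" ..
  show ?thesis by (rule that[OF M bnd_nonneg[OF M]])
qed

definition symm :: "('i list \<Rightarrow> 'b) \<Rightarrow> bool" where
  "symm f \<longleftrightarrow> (\<forall>xs ys. mset xs = mset ys \<longrightarrow> f xs = f ys)"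

lemma symmD: "symm f \<Longrightarrow> mset xs = mset ys \<Longrightarrow> f xs = f ys"
  unfolding symm_def by blast

lemma symmI: "(\<And>xs ys. mset xs = mset ys \<Longrightarrow> f xs = f ys) \<Longrightarrow> symm f"
  unfolding symm_def by blast

text \<open>
  When \<open>f\<close> lists Taylor coefficients, this is the derivative in direction \<open>j\<close>.
\<close>

definition shift :: "'i \<Rightarrow> ('i list \<Rightarrow> 'b) \<Rightarrow> 'i list \<Rightarrow> 'b" where
  "shift j f l = f (j # l)"

lemma symm_shift: "symm f \<Longrightarrow> symm (shift j f)"
  unfolding shift_def by (rule symmI, erule symmD) simp

lemma shift_commute: "symm f \<Longrightarrow> shift i (shift j f) = shift j (shift i f)"
  unfolding shift_def fun_eq_iff by (intro allI symmD[of f]) simp_all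

lemma Suc_le_two_power: "real (Suc n) \<le> 2 * 2 ^ n"
  by (induction n) auto

text \<open>
  The longer word has a factorial larger by \<open>n + 1 \<le> 2 * 2 ^ n\<close>, which is absorbed by halving the factor
  per letter; the removed letter leaves its own weight as a gain.
\<close>

lemma bnd_shift:
  fixes f :: "('c \<times> int) list \<Rightarrow> 'k::real_normed_vector"
  assumes "bnd k (2 * C) M f" "C > 0"
  shows "bnd k C (M / (C * wt j ^ k)) (shift j f)"
  unfolding bnd_def
proof
  fix l :: "('c \<times> int) list"
  let ?n = "length l"
  have M: "M \<ge> 0" using bnd_nonneg[OF assms(1)] .
  have "norm (f (j # l)) * (2 * C * wt j ^ k * (2 ^ ?n * wt_prod k C l)) \<le> M * (real (Suc ?n) * fact ?n)"
    using bndD[OF assms(1), of "j # l"] by (simp add: wt_prod_scale)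
  also have "\<dots> \<le> M * (2 * 2 ^ ?n * fact ?n)"
    using M by (intro mult_left_mono mult_right_mono Suc_le_two_power) auto
  finally have "(2 * 2 ^ ?n) * (norm (f (j # l)) * wt_prod k C l * (C * wt j ^ k)) \<le> (2 * 2 ^ ?n) * (M * fact ?n)"
    by (simp only: mult_ac)
  then have "norm (f (j # l)) * wt_prod k C l * (C * wt j ^ k) \<le> M * fact ?n"
    by (subst (asm) mult_le_cancel_left_pos) auto
  then show "norm (shift j f l) * wt_prod k C l \<le> M / (C * wt j ^ k) * fact ?n"
    using assms(2) by (simp add: shift_def field_simps)
qed

lemma rapid_shift: "rapid f \<Longrightarrow> rapid (shift j f)"
  unfolding rapid_def
proof (intro allI impI)
  fix k :: nat and C :: real
  assume f: "\<forall>k C. C > 0 \<longrightarrow> (\<exists>M. bnd k C M f)" and C: "C > 0"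
  then obtain M where "bnd k (2 * C) M f" by fastforce
  then show "\<exists>M. bnd k C M (shift j f)" using bnd_shift C by blast
qed

text \<open>
  The growth condition dual to \<open>rapid\<close>. The Fourier coordinates of a loop, point evaluations of
  derivatives and the numbers \<open>\<alpha>\<^sub>k\<close> all satisfy it.
\<close>

definition tame :: "nat \<Rightarrow> real \<Rightarrow> ('c \<times> int \<Rightarrow> 'k::real_normed_vector) \<Rightarrow> bool" where
  "tame N A \<xi> \<longleftrightarrow> (\<forall>j. norm (\<xi> j) \<le> A * wt j ^ N)"

lemma tameD: "tame N A \<xi> \<Longrightarrow> norm (\<xi> j) \<le> A * wt j ^ N"
  unfolding tame_def by blast

lemma tame_nonneg:
  fixes \<xi> :: "'c \<times> int \<Rightarrow> 'k::real_normed_vector"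
  assumes "tame N A \<xi>" shows "A \<ge> 0"
proof -
  have "0 \<le> norm (\<xi> (undefined :: 'c, 0))" by (rule norm_ge_zero)
  also have "\<dots> \<le> A * wt (undefined :: 'c, 0) ^ N" by (rule tameD[OF assms])
  finally show ?thesis by (simp add: wt_def)
qed

lemma tame_mono: assumes "tame N A \<xi>" "N \<le> N'" "A \<le> A'" shows "tame N' A' \<xi>"
  unfolding tame_def
proof
  fix j
  have "norm (\<xi> j) \<le> A * wt j ^ N" by (rule tameD[OF assms(1)])
  also have "\<dots> \<le> A' * wt j ^ N'"
    using assms tame_nonneg[OF assms(1)] by (intro mult_mono power_increasing) auto
  finally show "norm (\<xi> j) \<le> A' * wt j ^ N'" .
qed

text \<open>
  The multilinear form with coordinates \<open>f\<close>, evaluated at one vector per slot. Different vectors are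
  needed when a kernel is differentiated or integrated in one variable only.
\<close>

definition form_eval :: "nat \<Rightarrow> ('i list \<Rightarrow> 'k::{real_normed_field,banach}) \<Rightarrow> (nat \<Rightarrow> 'i \<Rightarrow> 'k) \<Rightarrow> 'k" where
  "form_eval n f \<Xi> = (\<Sum>\<^sub>\<infinity>l\<in>{l. length l = n}. f l * (\<Prod>i<n. \<Xi> i (l ! i)))"

lemma form_eval_0 [simp]: "form_eval 0 f \<Xi> = f []"
  by (simp add: form_eval_def)

text \<open>
  Of the \<open>k\<close> powers of the weight in the bound for \<open>f\<close>, \<open>N\<close> absorb the growth of the arguments and two
  remain to make the sum over the letters converge.
\<close>

lemma norm_form_eval_term_le:
  fixes f :: "('c::finite \<times> int) list \<Rightarrow> 'k::{real_normed_field,banach}"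
  assumes B: "norm (f l) * wt_prod k C l \<le> B"
    and \<Xi>: "\<And>i. i < n \<Longrightarrow> tame N A (\<Xi> i)"
    and k: "N + 2 \<le> k" and C: "C > 0" and len: "length l = n"
  shows "norm (f l * (\<Prod>i<n. \<Xi> i (l ! i))) \<le> B * (\<Prod>i<n. A / C * (1 / (wt (l ! i))\<^sup>2))"
proof -
  have A: "A \<ge> 0" if "i < n" for i using tame_nonneg[OF \<Xi>[OF that]] .
  have "norm (\<Prod>i<n. \<Xi> i (l ! i)) \<le> (\<Prod>i<n. A * wt (l ! i) ^ N)"
    unfolding prod_norm[symmetric] by (intro prod_mono conjI norm_ge_zero tameD \<Xi>) auto
  also have "\<dots> \<le> (\<Prod>i<n. (C * wt (l ! i) ^ k) * (A / C * (1 / (wt (l ! i))\<^sup>2)))"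
  proof (intro prod_mono conjI)
    fix i assume i: "i \<in> {..<n}"
    have "wt (l ! i) ^ N * (wt (l ! i))\<^sup>2 \<le> wt (l ! i) ^ k"
      unfolding power_add[symmetric] using k by (intro power_increasing) auto
    then have "A * wt (l ! i) ^ N * (wt (l ! i))\<^sup>2 \<le> A * wt (l ! i) ^ k"
      using A i by (simp add: mult.assoc mult_left_mono)
    then show "A * wt (l ! i) ^ N \<le> C * wt (l ! i) ^ k * (A / C * (1 / (wt (l ! i))\<^sup>2))"
      using C by (simp add: field_simps)
    show "0 \<le> A * wt (l ! i) ^ N" using A i by simp
  qed
  also have "\<dots> = wt_prod k C l * (\<Prod>i<n. A / C * (1 / (wt (l ! i))\<^sup>2))"
    unfolding wt_prod_nth len prod.distrib ..
  finally have *: "norm (\<Prod>i<n. \<Xi> i (l ! i)) \<le> wt_prod k C l * (\<Prod>i<n. A / C * (1 / (wt (l ! i))\<^sup>2))" .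
  have nn: "0 \<le> (\<Prod>i<n. A / C * (1 / (wt (l ! i))\<^sup>2))"
    using A C by (intro prod_nonneg) auto
  have "norm (f l * (\<Prod>i<n. \<Xi> i (l ! i))) \<le> norm (f l) * (wt_prod k C l * (\<Prod>i<n. A / C * (1 / (wt (l ! i))\<^sup>2)))"
    unfolding norm_mult using * by (intro mult_left_mono) auto
  also have "\<dots> \<le> B * (\<Prod>i<n. A / C * (1 / (wt (l ! i))\<^sup>2))"
    using B nn by (simp add: mult.assoc[symmetric] mult_right_mono)
  finally show ?thesis .
qed

lemma has_sum_form_eval_bound:
  "((\<lambda>l. B * (\<Prod>i<n. A / C * (1 / (wt (l ! i))\<^sup>2))) has_sum B * (A / C * wsum TYPE('c)) ^ n)
    {l::('c::finite \<times> int) list. length l = n}" if "A \<ge> 0" "C > 0"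
proof -
  have "((\<lambda>l::('c \<times> int) list. \<Prod>i<n. A / C * (1 / (wt (l ! i))\<^sup>2)) has_sum (\<Prod>i<n. A / C * wsum TYPE('c)))
      {l. length l = n}"
    using that by (intro has_sum_prod_lists[where G = "\<lambda>_ j. A / C * (1 / (wt j)\<^sup>2)" for C] has_sum_cmult_right has_sum_wt) auto
  from has_sum_cmult_right[OF this, of B] show ?thesis by simp
qed

lemma
  fixes f :: "('c::finite \<times> int) list \<Rightarrow> 'k::{real_normed_field,banach}"
  assumes B: "\<And>l. length l = n \<Longrightarrow> norm (f l) * wt_prod k C l \<le> B"
    and \<Xi>: "\<And>i. i < n \<Longrightarrow> tame N A (\<Xi> i)"
    and k: "N + 2 \<le> k" and C: "C > 0" and A: "A \<ge> 0"
  shows form_eval_abs_summable: "(\<lambda>l. f l * (\<Prod>i<n. \<Xi> i (l ! i))) abs_summable_on {l. length l = n}"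
    and norm_form_eval_le: "norm (form_eval n f \<Xi>) \<le> B * (A / C * wsum TYPE('c)) ^ n"
proof -
  note h = has_sum_form_eval_bound[OF A C, where B = B and n = n and 'c = 'c]
  have le: "norm (f l * (\<Prod>i<n. \<Xi> i (l ! i))) \<le> B * (\<Prod>i<n. A / C * (1 / (wt (l ! i))\<^sup>2))"
    if "l \<in> {l. length l = n}" for l
    using that norm_form_eval_term_le[where n = n and l = l, OF _ \<Xi> k C, of f B] B by auto
  show "(\<lambda>l. f l * (\<Prod>i<n. \<Xi> i (l ! i))) abs_summable_on {l. length l = n}"
    by (rule abs_le_summable(1)[OF has_sum_imp_summable[OF h] le])
  show "norm (form_eval n f \<Xi>) \<le> B * (A / C * wsum TYPE('c)) ^ n"
    using abs_le_summable(3)[OF has_sum_imp_summable[OF h] le] infsumI[OF h] by (simp add: form_eval_def)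
qed

lemma rapid_form_eval_abs_summable:
  fixes f :: "('c::finite \<times> int) list \<Rightarrow> 'k::{real_normed_field,banach}"
  assumes "rapid f" and "\<And>i. i < n \<Longrightarrow> tame N A (\<Xi> i)"
  shows "(\<lambda>l. f l * (\<Prod>i<n. \<Xi> i (l ! i))) abs_summable_on {l. length l = n}"
proof -
  obtain M where M: "bnd (N + 2) 1 M f" using rapidD[OF assms(1), of 1 "N + 2"] by auto
  have "tame N (max A 0) (\<Xi> i)" if "i < n" for i
    using tame_mono[OF assms(2)[OF that]] by simp
  then show ?thesis
    using bndD[OF M] by (intro form_eval_abs_summable[where k = "N + 2" and C = 1 and B = "M * fact n" and N = N and A = "max A 0"]) auto
qed

lemmas rapid_form_eval_summable = abs_summable_summable[OF rapid_form_eval_abs_summable]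

text \<open>
  Inductions on the degree split off the first slot; the remaining letters see a shifted \<open>f\<close>.
\<close>

lemma form_eval_Suc:
  fixes f :: "('c::finite \<times> int) list \<Rightarrow> 'k::{real_normed_field,banach}"
  assumes "rapid f" and "\<And>i. i < Suc n \<Longrightarrow> tame N A (\<Xi> i)"
  shows "form_eval (Suc n) f \<Xi> = (\<Sum>\<^sub>\<infinity>j. \<Xi> 0 j * form_eval n (shift j f) (\<lambda>i. \<Xi> (Suc i)))"
    and "(\<lambda>j. \<Xi> 0 j * form_eval n (shift j f) (\<lambda>i. \<Xi> (Suc i))) abs_summable_on UNIV"
proof -
  have eq: "(\<Sum>\<^sub>\<infinity>l\<in>{l. length l = n}. f (j # l) * (\<Prod>i<Suc n. \<Xi> i ((j # l) ! i)))
      = \<Xi> 0 j * form_eval n (shift j f) (\<lambda>i. \<Xi> (Suc i))" for j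
    unfolding form_eval_def shift_def
    by (subst infsum_cmult_right'[symmetric])
      (auto intro!: infsum_cong simp: prod.lessThan_Suc_shift algebra_simps simp del: prod.lessThan_Suc)
  note * = infsum_lists_Suc[OF rapid_form_eval_abs_summable[OF assms(1), where \<Xi> = \<Xi> and n = "Suc n", OF assms(2)]]
  show "form_eval (Suc n) f \<Xi> = (\<Sum>\<^sub>\<infinity>j. \<Xi> 0 j * form_eval n (shift j f) (\<lambda>i. \<Xi> (Suc i)))"
    using *(1) unfolding eq form_eval_def[of "Suc n", symmetric] .
  show "(\<lambda>j. \<Xi> 0 j * form_eval n (shift j f) (\<lambda>i. \<Xi> (Suc i))) abs_summable_on UNIV"
    using *(2) unfolding eq .
qed

lemma form_eval_add:
  fixes f :: "('c::finite \<times> int) list \<Rightarrow> 'k::{real_normed_field,banach}"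
  assumes "rapid f" "rapid g" and "\<And>i. i < n \<Longrightarrow> tame N A (\<Xi> i)"
  shows "form_eval n (\<lambda>l. f l + g l) \<Xi> = form_eval n f \<Xi> + form_eval n g \<Xi>"
  unfolding form_eval_def distrib_right
  by (rule infsum_add[OF rapid_form_eval_summable[OF assms(1) assms(3)] rapid_form_eval_summable[OF assms(2) assms(3)]])

lemma form_eval_scale: "form_eval n (\<lambda>l. c * f l) \<Xi> = c * form_eval n f \<Xi>"
  unfolding form_eval_def by (simp add: mult.assoc infsum_cmult_right')

lemma form_eval_cong:
  assumes "\<And>l. length l = n \<Longrightarrow> f l = g l" "\<And>i j. i < n \<Longrightarrow> \<Xi> i j = \<Xi>' i j"
  shows "form_eval n f \<Xi> = form_eval n g \<Xi>'"
  unfolding form_eval_def using assms by (intro infsum_cong) (auto intro!: prod.cong)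

section \<open>Taylor series and their directional derivatives\<close>

text \<open>
  The inductive step of binomial expansions.
\<close>

lemma pascal_sum:
  fixes h :: "nat \<Rightarrow> 'a::comm_semiring_1"
  shows "(\<Sum>k\<le>n. of_nat (n choose k) * h k) + (\<Sum>k\<le>n. of_nat (n choose k) * h (Suc k))
    = (\<Sum>k\<le>Suc n. of_nat (Suc n choose k) * h k)"
proof -
  have "(\<Sum>k\<le>n. of_nat (n choose k) * h k) = (\<Sum>k\<le>Suc n. of_nat (n choose k) * h k)"
    by (simp add: binomial_eq_0)
  also have "\<dots> = h 0 + (\<Sum>k\<le>n. of_nat (n choose Suc k) * h (Suc k))"
    by (subst sum.atMost_Suc_shift) simp
  finally show ?thesis
    by (subst sum.atMost_Suc_shift) (simp add: sum.distrib[symmetric] distrib_right add_ac)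
qed

lemma infsum_finite_sum:
  fixes F :: "'k \<Rightarrow> 'i \<Rightarrow> 'b::{topological_comm_monoid_add,t2_space}"
  assumes "finite K" and "\<And>k. k \<in> K \<Longrightarrow> F k summable_on A"
  shows "(\<Sum>\<^sub>\<infinity>j\<in>A. \<Sum>k\<in>K. F k j) = (\<Sum>k\<in>K. \<Sum>\<^sub>\<infinity>j\<in>A. F k j)"
proof -
  have "((\<lambda>j. \<Sum>k\<in>K. F k j) has_sum (\<Sum>k\<in>K. \<Sum>\<^sub>\<infinity>j\<in>A. F k j)) A"
    using assms
  proof (induction K rule: finite_induct)
    case (insert k K)
    then show ?case by (simp, intro has_sum_add has_sum_infsum insert.IH) auto
  qed simp
  then show ?thesis by (simp add: has_sum_iff)
qed

lemma infsum_single: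
  fixes f :: "'i \<Rightarrow> 'k::{comm_monoid_add,t2_space}"
  assumes "\<And>j. j \<noteq> a \<Longrightarrow> f j = 0"
  shows "(\<Sum>\<^sub>\<infinity>j. f j) = f a"
proof -
  have "infsum f UNIV = infsum f {a}"
    by (rule infsum_cong_neutral) (use assms in auto)
  then show ?thesis by simp
qed

definition delta :: "'i \<Rightarrow> 'i \<Rightarrow> 'k::zero_neq_one" where
  "delta a j = (if j = a then 1 else 0)"

lemma rapid_shift_pow: "rapid f \<Longrightarrow> rapid ((shift a ^^ k) f)"
  by (induction k) (simp_all add: rapid_shift)

lemma symm_shift_pow: "symm f \<Longrightarrow> symm ((shift a ^^ k) f)"
  by (induction k) (simp_all add: symm_shift)

lemma shift_pow_commute: "symm f \<Longrightarrow> (shift a ^^ k) (shift j f) = shift j ((shift a ^^ k) f)"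
  by (induction k) (simp_all add: shift_commute symm_shift_pow)

lemma shift_pow_apply: "(shift a ^^ k) f l = f (replicate k a @ l)"
  by (induction k arbitrary: l) (simp_all add: shift_def replicate_app_Cons_same)

lemma tame_delta:
  fixes t :: "'k::real_normed_field" and x :: "'c \<times> int \<Rightarrow> 'k"
  assumes "tame N A x"
  shows "tame N (A + norm t) (\<lambda>j. x j + t * delta a j)"
  unfolding tame_def
proof
  fix j :: "'c \<times> int"
  have "norm (x j + t * delta a j) \<le> norm (x j) + norm (t * delta a j)" by (rule norm_triangle_ineq)
  also have "\<dots> \<le> A * wt j ^ N + norm t * wt j ^ N"
  proof (intro add_mono tameD[OF assms])
    have "norm (t * delta a j) \<le> norm t * 1" by (simp add: delta_def)
    also have "\<dots> \<le> norm t * wt j ^ N" by (intro mult_left_mono one_le_power) auto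
    finally show "norm (t * delta a j) \<le> norm t * wt j ^ N" .
  qed
  finally show "norm (x j + t * delta a j) \<le> (A + norm t) * wt j ^ N" by (simp add: distrib_right)
qed

text \<open>
  By symmetry it does not matter which \<open>k\<close> of the \<open>n\<close> slots receive the increment, hence the binomial
  coefficient.
\<close>

lemma form_eval_translate:
  fixes f :: "('c::finite \<times> int) list \<Rightarrow> 'k::{real_normed_field,banach}"
  assumes "rapid f" "symm f" and x: "tame N A x"
  shows "form_eval n f (\<lambda>_ j. x j + t * delta a j) =
    (\<Sum>k\<le>n. of_nat (n choose k) * (t ^ k * form_eval (n - k) ((shift a ^^ k) f) (\<lambda>_. x)))"
  using assms(1,2)
proof (induction n arbitrary: f)
  case 0
  then show ?case by simp
next
  case (Suc n)
  let ?y = "\<lambda>j. x j + t * delta a j"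
  let ?A = "A + norm t"
  have y: "tame N ?A ?y" by (rule tame_delta[OF x])
  have x': "tame N ?A x" by (rule tame_mono[OF x]) auto
  have d': "tame N ?A (\<lambda>j. t * delta a j)"
    using tame_delta[of N 0 "\<lambda>_. 0" t a] tame_mono[of N "norm t" _ N ?A] tame_nonneg[OF x] by (simp add: tame_def)
  define E where "E k m = form_eval m ((shift a ^^ k) f) (\<lambda>_. x)" for k m
  have s1: "(\<lambda>j. x j * form_eval n (shift j f) (\<lambda>_. ?y)) summable_on UNIV"
    using abs_summable_summable[OF form_eval_Suc(2)[OF Suc.prems(1), where \<Xi> = "\<lambda>i. if i = 0 then x else ?y" and N = N and A = ?A and n = n]]
      x' y by auto
  have s2: "(\<lambda>j. t * delta a j * form_eval n (shift j f) (\<lambda>_. ?y)) summable_on UNIV"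
    using abs_summable_summable[OF form_eval_Suc(2)[OF Suc.prems(1), where \<Xi> = "\<lambda>i. if i = 0 then (\<lambda>j. t * delta a j) else ?y" and N = N and A = ?A and n = n]]
      d' y by auto
  have "form_eval (Suc n) f (\<lambda>_. ?y) = (\<Sum>\<^sub>\<infinity>j. ?y j * form_eval n (shift j f) (\<lambda>_. ?y))"
    by (rule form_eval_Suc(1)[OF Suc.prems(1) y])
  also have "\<dots> = (\<Sum>\<^sub>\<infinity>j. x j * form_eval n (shift j f) (\<lambda>_. ?y)) + (\<Sum>\<^sub>\<infinity>j. t * delta a j * form_eval n (shift j f) (\<lambda>_. ?y))"
    unfolding distrib_right by (rule infsum_add[OF s1 s2])
  also have "(\<Sum>\<^sub>\<infinity>j. t * delta a j * form_eval n (shift j f) (\<lambda>_. ?y)) = t * form_eval n (shift a f) (\<lambda>_. ?y)"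
    by (subst infsum_single[where a = a]) (auto simp: delta_def)
  also have "\<dots> = (\<Sum>k\<le>n. of_nat (n choose k) * (t ^ Suc k * E (Suc k) (Suc n - Suc k)))"
    unfolding E_def
    by (subst Suc.IH[OF rapid_shift[OF Suc.prems(1)] symm_shift[OF Suc.prems(2)]])
      (simp add: sum_distrib_left funpow_Suc_right algebra_simps del: funpow.simps)
  also have "(\<Sum>\<^sub>\<infinity>j. x j * form_eval n (shift j f) (\<lambda>_. ?y))
      = (\<Sum>\<^sub>\<infinity>j. \<Sum>k\<le>n. of_nat (n choose k) * t ^ k * (x j * form_eval (n - k) (shift j ((shift a ^^ k) f)) (\<lambda>_. x)))"
    by (subst Suc.IH[OF rapid_shift[OF Suc.prems(1)] symm_shift[OF Suc.prems(2)]])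
      (simp add: sum_distrib_left algebra_simps shift_pow_commute[OF Suc.prems(2)])
  also have "\<dots> = (\<Sum>k\<le>n. \<Sum>\<^sub>\<infinity>j. of_nat (n choose k) * t ^ k * (x j * form_eval (n - k) (shift j ((shift a ^^ k) f)) (\<lambda>_. x)))"
  proof (rule infsum_finite_sum)
    fix k
    show "(\<lambda>j. of_nat (n choose k) * t ^ k * (x j * form_eval (n - k) (shift j ((shift a ^^ k) f)) (\<lambda>_. x))) summable_on UNIV"
      by (rule summable_on_cmult_right[OF abs_summable_summable[OF form_eval_Suc(2)[OF rapid_shift_pow[OF Suc.prems(1)] x]]])
  qed simp
  also have "\<dots> = (\<Sum>k\<le>n. of_nat (n choose k) * (t ^ k * E k (Suc n - k)))"
  proof (rule sum.cong[OF refl])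
    fix k assume k: "k \<in> {..n}"
    have "(\<Sum>\<^sub>\<infinity>j. x j * form_eval (n - k) (shift j ((shift a ^^ k) f)) (\<lambda>_. x)) = E k (Suc n - k)"
      using k form_eval_Suc(1)[OF rapid_shift_pow[OF Suc.prems(1), where a = a and k = k] x, of "n - k"]
      by (simp add: E_def Suc_diff_le)
    then show "(\<Sum>\<^sub>\<infinity>j. of_nat (n choose k) * t ^ k * (x j * form_eval (n - k) (shift j ((shift a ^^ k) f)) (\<lambda>_. x)))
        = of_nat (n choose k) * (t ^ k * E k (Suc n - k))"
      by (simp add: infsum_cmult_right' mult.assoc)
  qed
  finally show ?case
    using pascal_sum[of n "\<lambda>k. t ^ k * E k (Suc n - k)"] by (simp only: E_def)
qed

text \<open>
  The Taylor series at 0 of the function with derivatives \<open>f\<close>.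
\<close>

definition taylor_eval :: "('i list \<Rightarrow> 'k::{real_normed_field,banach}) \<Rightarrow> ('i \<Rightarrow> 'k) \<Rightarrow> 'k" where
  "taylor_eval f x = (\<Sum>n. form_eval n f (\<lambda>_. x) / fact n)"

text \<open>
  The condition on \<open>C\<close> makes the series geometric with ratio 1/2.
\<close>

lemma
  fixes f :: "('c::finite \<times> int) list \<Rightarrow> 'k::{real_normed_field,banach}"
  assumes f: "bnd k C M f" and x: "tame N A x" and k: "N + 2 \<le> k"
    and C: "C > 0" "2 * (A * wsum TYPE('c)) \<le> C"
  shows norm_taylor_eval_term_le: "norm (form_eval n f (\<lambda>_. x) / fact n) \<le> M * (1 / 2) ^ n"
    and summable_norm_taylor_eval: "summable (\<lambda>n. norm (form_eval n f (\<lambda>_. x) / fact n))"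
    and norm_taylor_eval_le: "norm (taylor_eval f x) \<le> 2 * M"
proof -
  have A: "A \<ge> 0" by (rule tame_nonneg[OF x])
  have le: "norm (form_eval n f (\<lambda>_. x) / fact n) \<le> M * (1 / 2) ^ n" for n
  proof -
    have "norm (form_eval n f (\<lambda>_. x)) \<le> (M * fact n) * (A / C * wsum TYPE('c)) ^ n"
      using bndD[OF f] by (intro norm_form_eval_le[OF _ x k C(1) A]) auto
    also have "\<dots> \<le> (M * fact n) * (1 / 2) ^ n"
      using C A wsum_nonneg[where 'c = 'c] bnd_nonneg[OF f]
      by (intro mult_left_mono power_mono) (auto simp: field_simps)
    finally show ?thesis
      by (simp add: norm_divide divide_le_eq algebra_simps)
  qed
  then show "norm (form_eval n f (\<lambda>_. x) / fact n) \<le> M * (1 / 2) ^ n" .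
  have s: "(\<lambda>n. M * (1 / 2) ^ n) sums (M * 2)"
    using geometric_sums[of "1 / 2 :: real"] by (intro sums_mult) simp
  show s': "summable (\<lambda>n. norm (form_eval n f (\<lambda>_. x) / fact n))"
    by (rule summable_comparison_test'[OF sums_summable[OF s]]) (use le in auto)
  have "norm (taylor_eval f x) \<le> (\<Sum>n. norm (form_eval n f (\<lambda>_. x) / fact n))"
    unfolding taylor_eval_def by (rule summable_norm[OF s'])
  also have "\<dots> \<le> (\<Sum>n. M * (1 / 2) ^ n)"
    by (rule suminf_le[OF le s' sums_summable[OF s]])
  finally show "norm (taylor_eval f x) \<le> 2 * M" using sums_unique[OF s] by simp
qed

lemma rapid_summable_taylor_eval:
  fixes f :: "('c::finite \<times> int) list \<Rightarrow> 'k::{real_normed_field,banach}"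
  assumes "rapid f" "tame N A x"
  shows "summable (\<lambda>n. norm (form_eval n f (\<lambda>_. x) / fact n))"
proof -
  let ?C = "2 * (A * wsum TYPE('c)) + 1"
  have C: "?C > 0" using tame_nonneg[OF assms(2)] wsum_nonneg[where 'c = 'c] by (simp add: add_nonneg_pos)
  obtain M where "bnd (N + 2) ?C M f" using rapidD[OF assms(1) C] .
  then show ?thesis using C by (intro summable_norm_taylor_eval[OF _ assms(2)]) auto
qed

lemma taylor_eval_sums:
  fixes f :: "('c::finite \<times> int) list \<Rightarrow> 'k::{real_normed_field,banach}"
  assumes "rapid f" "tame N A x"
  shows "(\<lambda>n. form_eval n f (\<lambda>_. x) / fact n) sums taylor_eval f x"
  unfolding taylor_eval_def by (rule summable_sums[OF summable_norm_cancel[OF rapid_summable_taylor_eval[OF assms]]])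

lemma has_vector_derivative_of_quadratic:
  fixes F :: "real \<Rightarrow> 'b::real_normed_vector"
  assumes "\<And>t. \<bar>t\<bar> \<le> 1 \<Longrightarrow> norm (F t - F 0 - t *\<^sub>R D) \<le> c * t\<^sup>2"
  shows "(F has_vector_derivative D) (at 0)"
  unfolding has_vector_derivative_def has_derivative_at
proof
  show "bounded_linear (\<lambda>x. x *\<^sub>R D)" by (rule bounded_linear_scaleR_left)
  have "((\<lambda>h. c * \<bar>h\<bar>) \<longlongrightarrow> c * \<bar>0\<bar>) (at (0::real))"
    by (intro tendsto_intros)
  then have *: "((\<lambda>h. c * \<bar>h\<bar>) \<longlongrightarrow> 0) (at (0::real))" by simp
  show "(\<lambda>h. norm (F (0 + h) - F 0 - h *\<^sub>R D) / norm h) \<midarrow>0\<rightarrow> 0"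
  proof (rule tendsto_sandwich[OF _ _ tendsto_const *])
    show "\<forall>\<^sub>F h in at 0. 0 \<le> norm (F (0 + h) - F 0 - h *\<^sub>R D) / norm h" by simp
    show "\<forall>\<^sub>F h in at 0. norm (F (0 + h) - F 0 - h *\<^sub>R D) / norm h \<le> c * \<bar>h\<bar>"
      unfolding eventually_at
    proof (intro exI[of _ 1] conjI ballI impI)
      fix h :: real assume h: "h \<noteq> 0 \<and> dist h 0 < 1"
      then have "norm (F h - F 0 - h *\<^sub>R D) \<le> c * h\<^sup>2" by (intro assms) simp
      then show "norm (F (0 + h) - F 0 - h *\<^sub>R D) / norm h \<le> c * \<bar>h\<bar>"
        using h by (simp add: divide_le_eq power2_eq_square abs_mult_self_eq)
    qed simp
  qed
qed

text \<open>
  One bound for all terms of degree \<open>n\<close> in the translated series. The ratio \<open>\<theta>\<close> can be made small by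
  enlarging \<open>C\<close>, which leaves room for the sum \<open>2 ^ n\<close> of the binomial coefficients.
\<close>

lemma norm_form_eval_shift_pow_le:
  fixes f :: "('c::finite \<times> int) list \<Rightarrow> 'k::{real_normed_field,banach}"
  assumes f: "bnd K C M f" and x: "tame N A x" and K: "N + 2 \<le> K" and C: "C > 0"
    and \<theta>: "A * wsum TYPE('c) + 1 \<le> \<theta> * C" and k: "k \<le> n"
  shows "norm (form_eval (n - k) ((shift a ^^ k) f) (\<lambda>_. x)) \<le> M * fact n * \<theta> ^ n"
proof -
  have A: "A \<ge> 0" by (rule tame_nonneg[OF x])
  have M: "M \<ge> 0" by (rule bnd_nonneg[OF f])
  have "norm ((shift a ^^ k) f l) * wt_prod K C l \<le> M * fact n * (1 / C) ^ k" if "length l = n - k" for l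
  proof -
    have "1 \<le> wt_prod K 1 (replicate k a)"
      by (induction k) (auto intro!: mult_ge1_I one_le_power)
    then have "C ^ k * 1 \<le> C ^ k * wt_prod K 1 (replicate k a)"
      using C by (intro mult_left_mono) auto
    then have r: "C ^ k \<le> wt_prod K C (replicate k a)"
      using wt_prod_scale[of K C 1 "replicate k a"] by simp
    have "norm (f (replicate k a @ l)) * wt_prod K C l * C ^ k
        \<le> norm (f (replicate k a @ l)) * wt_prod K C l * wt_prod K C (replicate k a)"
      using r wt_prod_pos[OF C, of K l] by (intro mult_left_mono) auto
    also have "\<dots> \<le> M * fact n"
      using bndD[OF f, of "replicate k a @ l"] that k by (simp add: mult_ac)
    finally show ?thesis using C by (simp add: shift_pow_apply power_divide field_simps)
  qed
  then have "norm (form_eval (n - k) ((shift a ^^ k) f) (\<lambda>_. x))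
      \<le> M * fact n * (1 / C) ^ k * (A / C * wsum TYPE('c)) ^ (n - k)"
    by (intro norm_form_eval_le[OF _ x K C A])
  also have "\<dots> \<le> M * fact n * \<theta> ^ k * \<theta> ^ (n - k)"
  proof (intro mult_mono power_mono)
    have w: "0 \<le> A * wsum TYPE('c)" using A wsum_nonneg[where 'c = 'c] by simp
    show "1 / C \<le> \<theta>" "A / C * wsum TYPE('c) \<le> \<theta>"
      using w \<theta> C by (auto simp: divide_le_eq mult.commute[of _ "wsum _"])
    show "0 \<le> A / C * wsum TYPE('c)" using w C by simp
    have "0 < \<theta> * C" using w \<theta> by linarith
    then have "0 < \<theta>" using C by (simp add: zero_less_mult_iff)
    then show "0 \<le> M * fact n * \<theta> ^ k" using M by simp
  qed (use C A wsum_nonneg[where 'c = 'c] M in auto)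
  also have "\<dots> = M * fact n * \<theta> ^ n" using k by (simp add: power_add[symmetric])
  finally show ?thesis .
qed

text \<open>
  After the constant and the linear term of the binomial expansion are removed, every remaining term
  carries \<open>t\<^sup>2\<close>, and the sum of their bounds over all degrees converges. So the difference quotient
  converges at a linear rate to the shifted series.
\<close>

lemma taylor_eval_deriv:
  fixes f :: "('c::finite \<times> int) list \<Rightarrow> 'k::{real_normed_field,banach}"
  assumes f: "rapid f" "symm f" and x: "tame N A x"
  shows "((\<lambda>t. taylor_eval f (\<lambda>j. x j + of_real t * delta a j)) has_vector_derivative taylor_eval (shift a f) x) (at 0)"
proof -
  \<comment> \<open>The factor 4 beats the sum \<open>2 ^ n\<close> of the binomial coefficients and leaves the ratio 1/2.\<close>
  define C where "C = 4 * (A * wsum TYPE('c) + 1)"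
  have w: "0 \<le> A * wsum TYPE('c)" using tame_nonneg[OF x] wsum_nonneg[where 'c = 'c] by simp
  then have C: "C > 0" by (simp add: C_def)
  obtain M where M: "bnd (N + 2) C M f" "M \<ge> 0" using rapidD[OF f(1) C] .
  define e where "e k m = form_eval m ((shift a ^^ k) f) (\<lambda>_. x)" for k m
  have e: "norm (e k (n - k)) \<le> M * fact n * (1 / 4) ^ n" if "k \<le> n" for k n
    unfolding e_def by (rule norm_form_eval_shift_pow_le[OF M(1) x _ C _ that]) (auto simp: C_def)
  define d where "d n = (case n of 0 \<Rightarrow> 0 | Suc m \<Rightarrow> e 1 m / fact m)" for n
  have d: "d sums taylor_eval (shift a f) x"
  proof -
    have "(\<lambda>n. d (Suc n)) sums taylor_eval (shift a f) x"
      using taylor_eval_sums[OF rapid_shift[OF f(1)] x] by (simp add: d_def e_def)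
    then show ?thesis using sums_Suc_iff[of d] by (simp add: d_def)
  qed
  have s0: "(\<lambda>n. e 0 n / fact n) sums taylor_eval f x"
    using taylor_eval_sums[OF f(1) x] by (simp add: e_def)
  show ?thesis
  proof (rule has_vector_derivative_of_quadratic[where c = "2 * M"])
    fix t :: real assume t: "\<bar>t\<bar> \<le> 1"
    let ?y = "\<lambda>j. x j + of_real t * delta a j"
    define r where "r n = form_eval n f (\<lambda>_. ?y) / fact n - e 0 n / fact n - t *\<^sub>R d n" for n
    have r: "norm (r n) \<le> M * t\<^sup>2 * (1 / 2) ^ n" for n
    proof -
      let ?h = "\<lambda>k. of_nat (n choose k) * (of_real t ^ k * e k (n - k)) :: 'k"
      have ev: "form_eval n f (\<lambda>_. ?y) = (\<Sum>k\<le>n. ?h k)"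
        unfolding e_def by (rule form_eval_translate[OF f x])
      have "fact n * r n = (\<Sum>k\<in>{2..n}. ?h k)"
      proof (cases n)
        case 0
        then show ?thesis by (simp add: r_def d_def ev e_def)
      next
        case (Suc m)
        have "{..n} = insert 0 (insert 1 {2..n})" using Suc by auto
        then have "(\<Sum>k\<le>n. ?h k) = ?h 0 + ?h 1 + (\<Sum>k\<in>{2..n}. ?h k)"
          by (simp add: add_ac)
        moreover have "fact n * (t *\<^sub>R d n) = ?h 1"
          using Suc by (simp add: d_def scaleR_conv_of_real field_simps del: of_nat_Suc)
        ultimately show ?thesis
          by (simp add: r_def ev right_diff_distrib)
      qed
      then have "norm (fact n * r n) \<le> (\<Sum>k\<in>{2..n}. norm (?h k))"
        by (simp only: norm_sum)
      also have "\<dots> \<le> (\<Sum>k\<in>{2..n}. real (n choose k) * (t\<^sup>2 * (M * fact n * (1 / 4) ^ n)))"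
      proof (rule sum_mono)
        fix k assume k: "k \<in> {2..n}"
        have "\<bar>t\<bar> ^ k \<le> \<bar>t\<bar> ^ 2" using k t by (intro power_decreasing) auto
        then show "norm (?h k) \<le> real (n choose k) * (t\<^sup>2 * (M * fact n * (1 / 4) ^ n))"
          unfolding norm_mult norm_power norm_of_nat norm_of_real
          using k e[of k n] M(2) by (intro mult_mono mult_left_mono) auto
      qed
      also have "\<dots> \<le> (\<Sum>k\<le>n. real (n choose k) * (t\<^sup>2 * (M * fact n * (1 / 4) ^ n)))"
        using M(2) by (intro sum_mono2) auto
      also have "\<dots> = 2 ^ n * (t\<^sup>2 * (M * fact n * (1 / 4) ^ n))"
        unfolding sum_distrib_right[symmetric] of_nat_sum[symmetric] choose_row_sum by simp
      also have "\<dots> = fact n * (M * t\<^sup>2 * (1 / 2) ^ n)"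
      proof -
        have "(2::real) ^ n * (1 / 4) ^ n = (1 / 2) ^ n" by (simp add: power_mult_distrib[symmetric])
        then have "(t\<^sup>2 * (M * fact n)) * ((2::real) ^ n * (1 / 4) ^ n) = (t\<^sup>2 * (M * fact n)) * (1 / 2) ^ n" by simp
        then show ?thesis by (simp only: mult_ac)
      qed
      finally show ?thesis
        by (simp add: norm_mult)
    qed
    have rs: "r sums (taylor_eval f ?y - taylor_eval f x - t *\<^sub>R taylor_eval (shift a f) x)"
      unfolding r_def
      by (intro sums_diff sums_scaleR_right d s0 taylor_eval_sums[OF f(1) tame_delta[OF x]])
    have g: "(\<lambda>n. M * t\<^sup>2 * (1 / 2) ^ n) sums (M * t\<^sup>2 * 2)"
      using geometric_sums[of "1 / 2 :: real"] by (intro sums_mult) simp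
    have rn: "summable (\<lambda>n. norm (r n))"
      by (rule summable_comparison_test'[OF sums_summable[OF g]]) (use r in auto)
    have "norm (\<Sum>n. r n) \<le> (\<Sum>n. norm (r n))"
      by (rule summable_norm[OF rn])
    also have "\<dots> \<le> (\<Sum>n. M * t\<^sup>2 * (1 / 2) ^ n)"
      by (rule suminf_le[OF r rn sums_summable[OF g]])
    also have "\<dots> = 2 * M * t\<^sup>2" using sums_unique[OF g] by simp
    finally show "norm (taylor_eval f ?y - taylor_eval f (\<lambda>j. x j + of_real 0 * delta a j) - t *\<^sub>R taylor_eval (shift a f) x) \<le> 2 * M * t\<^sup>2"
      using sums_unique[OF rs] by simp
  qed
qed

lemma taylor_eval_add:
  fixes f :: "('c::finite \<times> int) list \<Rightarrow> 'k::{real_normed_field,banach}"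
  assumes "rapid f" "rapid g" "tame N A x"
  shows "taylor_eval (\<lambda>l. f l + g l) x = taylor_eval f x + taylor_eval g x"
proof -
  have "(\<lambda>n. form_eval n f (\<lambda>_. x) / fact n + form_eval n g (\<lambda>_. x) / fact n) sums (taylor_eval f x + taylor_eval g x)"
    by (intro sums_add taylor_eval_sums[OF _ assms(3)] assms)
  moreover have "form_eval n (\<lambda>l. f l + g l) (\<lambda>_. x) / fact n = form_eval n f (\<lambda>_. x) / fact n + form_eval n g (\<lambda>_. x) / fact n" for n
    by (simp only: form_eval_add[OF assms] add_divide_distrib)
  ultimately show ?thesis
    unfolding taylor_eval_def[of "\<lambda>l. f l + g l"] by (simp only: sums_unique[symmetric])
qed

lemma taylor_eval_scale:
  fixes f :: "('c::finite \<times> int) list \<Rightarrow> 'k::{real_normed_field,banach}"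
  assumes "rapid f" "tame N A x"
  shows "taylor_eval (\<lambda>l. c * f l) x = c * taylor_eval f x"
proof -
  have "(\<lambda>n. c * (form_eval n f (\<lambda>_. x) / fact n)) sums (c * taylor_eval f x)"
    by (intro sums_mult taylor_eval_sums[OF _ assms(2)] assms)
  then show ?thesis
    unfolding taylor_eval_def[of "\<lambda>l. c * f l"] by (simp add: form_eval_scale sums_iff)
qed

section \<open>Products as restrictions to a diagonal\<close>

text \<open>
  The variables of \<open>F\<close> and of \<open>G\<close> are kept apart by a Boolean tag, so that \<open>F x * G y\<close> is again one
  Taylor series, in the variable \<open>both x y\<close>, and the results for single series apply to it.
\<close>

definition side :: "('c \<times> bool) \<times> int \<Rightarrow> bool" where "side j = snd (fst j)"
definition base :: "('c \<times> bool) \<times> int \<Rightarrow> 'c \<times> int" where "base j = (fst (fst j), snd j)"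
definition tag :: "bool \<Rightarrow> 'c \<times> int \<Rightarrow> ('c \<times> bool) \<times> int" where "tag b j = ((fst j, b), snd j)"

lemma tag_simps [simp]: "side (tag b j) = b" "base (tag b j) = j" "tag (side i) (base i) = i"
  "wt (tag b j) = wt j" "wt (base i) = wt i"
  by (simp_all add: side_def base_def tag_def wt_def)

lemma inj_tag: "inj (tag b)"
  by (rule inj_on_inverseI[where g = base]) simp

lemma range_tag: "range (tag True) \<union> range (tag False) = UNIV" "range (tag True) \<inter> range (tag False) = {}"
proof -
  have "i \<in> range (tag True) \<union> range (tag False)" for i :: "('a \<times> bool) \<times> int"
    using tag_simps(3)[of i] by (cases "side i") (metis UnI1 UnI2 rangeI)+
  then show "range (tag True) \<union> range (tag False) = (UNIV :: (('a \<times> bool) \<times> int) set)" by blast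
  show "range (tag True) \<inter> range (tag False) = ({} :: (('b \<times> bool) \<times> int) set)"
    by (auto simp: tag_def)
qed

lemma infsum_tag:
  fixes f :: "('c \<times> bool) \<times> int \<Rightarrow> 'b::banach"
  assumes "f abs_summable_on UNIV"
  shows "(\<lambda>j. f (tag b j)) abs_summable_on UNIV"
    and "(\<Sum>\<^sub>\<infinity>i. f i) = (\<Sum>\<^sub>\<infinity>j. f (tag True j)) + (\<Sum>\<^sub>\<infinity>j. f (tag False j))"
proof -
  have a: "f abs_summable_on range (tag b)" for b
    using summable_on_subset_banach[OF assms] by blast
  then show "(\<lambda>j. f (tag b j)) abs_summable_on UNIV"
    using summable_on_reindex[OF inj_tag, of "\<lambda>i. norm (f i)" b] by (simp add: o_def)
  have "infsum f UNIV = infsum f (range (tag True)) + infsum f (range (tag False))"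
    using infsum_Un_disjoint[OF abs_summable_summable[OF a] abs_summable_summable[OF a] range_tag(2)]
    by (simp add: range_tag(1))
  then show "(\<Sum>\<^sub>\<infinity>i. f i) = (\<Sum>\<^sub>\<infinity>j. f (tag True j)) + (\<Sum>\<^sub>\<infinity>j. f (tag False j))"
    by (simp only: infsum_reindex[OF inj_tag] o_def)
qed

text \<open>
  A derivative of \<open>F x * G y\<close> falls on \<open>F\<close> or on \<open>G\<close> according to the tag of its direction.
\<close>

definition tens :: "(('c \<times> int) list \<Rightarrow> 'k) \<Rightarrow> (('c \<times> int) list \<Rightarrow> 'k) \<Rightarrow> (('c \<times> bool) \<times> int) list \<Rightarrow> 'k::times" where
  "tens f g l = f (map base (filter side l)) * g (map base (filter (\<lambda>j. \<not> side j) l))"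

definition both :: "('c \<times> int \<Rightarrow> 'k) \<Rightarrow> ('c \<times> int \<Rightarrow> 'k) \<Rightarrow> ('c \<times> bool) \<times> int \<Rightarrow> 'k" where
  "both x y j = (if side j then x (base j) else y (base j))"

lemma tame_both:
  assumes "tame N A x" "tame N A y" shows "tame N A (both x y)"
  unfolding tame_def[of _ _ "both x y"]
proof
  fix j
  show "norm (both x y j) \<le> A * wt j ^ N"
    using tameD[OF assms(1), of "base j"] tameD[OF assms(2), of "base j"] by (simp add: both_def)
qed

lemma both_tag [simp]: "both x y (tag b j) = (if b then x j else y j)"
  by (simp add: both_def)

lemma shift_tens: "shift j (tens f g) = (if side j then tens (shift (base j) f) g else tens f (shift (base j) g))"
  by (auto simp: shift_def tens_def fun_eq_iff)

lemma symm_tens: "symm f \<Longrightarrow> symm g \<Longrightarrow> symm (tens f g)"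
proof (rule symmI)
  fix xs ys :: "(('a \<times> bool) \<times> int) list"
  assume f: "symm f" "symm g" and xy: "mset xs = mset ys"
  have "mset (map base (filter P xs)) = mset (map base (filter P ys))" for P :: "('a \<times> bool) \<times> int \<Rightarrow> bool"
    using xy by simp
  then show "tens f g xs = tens f g ys"
    unfolding tens_def using symmD[OF f(1)] symmD[OF f(2)] by metis
qed

lemma wt_prod_base: "wt_prod k C (map base l) = wt_prod k C l"
  by (induction l) simp_all

lemma wt_prod_filter: "wt_prod k C l = wt_prod k C (map base (filter side l)) * wt_prod k C (map base (filter (\<lambda>j. \<not> side j) l))"
  by (induction l) auto

lemma fact_mult_le_fact_add: "fact m * fact n \<le> (fact (m + n) :: real)"
proof -
  have "fact m * fact n \<le> (fact (m + n) :: nat)"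
    by (rule dvd_imp_le[OF fact_fact_dvd_fact]) simp
  then have "real (fact m * fact n) \<le> real (fact (m + n))" by (rule of_nat_mono)
  then show ?thesis by simp
qed

text \<open>
  No loss in \<open>C\<close> occurs because \<open>m! n! \<le> (m + n)!\<close>.
\<close>

lemma bnd_tens:
  fixes f g :: "('c \<times> int) list \<Rightarrow> 'k::real_normed_div_algebra"
  assumes f: "bnd k C M f" and g: "bnd k C M' g" and C: "C > 0"
  shows "bnd k C (M * M') (tens f g)"
  unfolding bnd_def
proof
  fix l :: "(('c \<times> bool) \<times> int) list"
  let ?a = "map base (filter side l)" and ?b = "map base (filter (\<lambda>j. \<not> side j) l)"
  have "length ?a + length ?b = length l" by (simp add: sum_length_filter_compl)
  then have F: "fact (length ?a) * fact (length ?b) \<le> (fact (length l) :: real)"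
    using fact_mult_le_fact_add by metis
  have "norm (tens f g l) * wt_prod k C l = (norm (f ?a) * wt_prod k C ?a) * (norm (g ?b) * wt_prod k C ?b)"
    by (simp add: tens_def norm_mult wt_prod_filter[of k C l])
  also have "\<dots> \<le> (M * fact (length ?a)) * (M' * fact (length ?b))"
    using bndD[OF f] bndD[OF g] bnd_nonneg[OF f] wt_prod_pos[OF C, of k ?b] bnd_nonneg[OF g] by (auto intro!: mult_mono[of "norm (f ?a) * wt_prod k C ?a"] simp del: length_map)
  also have "\<dots> = (M * M') * (fact (length ?a) * fact (length ?b))" by simp
  also have "\<dots> \<le> (M * M') * fact (length l)"
    using F bnd_nonneg[OF f] bnd_nonneg[OF g] by (intro mult_left_mono) auto
  finally show "norm (tens f g l) * wt_prod k C l \<le> M * M' * fact (length l)" .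
qed

lemma rapid_tens:
  fixes f g :: "('c \<times> int) list \<Rightarrow> 'k::real_normed_div_algebra"
  assumes "rapid f" "rapid g"
  shows "rapid (tens f g)"
  unfolding rapid_def
proof (intro allI impI)
  fix k :: nat and C :: real assume C: "C > 0"
  obtain M where M: "bnd k C M f" using rapidD[OF assms(1) C] .
  obtain M' where M': "bnd k C M' g" using rapidD[OF assms(2) C] .
  show "\<exists>M. bnd k C M (tens f g)" using bnd_tens[OF M M' C] by blast
qed

text \<open>
  Splitting the first slot by its tag produces the two halves of the rule of Pascal.
\<close>

lemma form_eval_tens:
  fixes f g :: "('c::finite \<times> int) list \<Rightarrow> 'k::{real_normed_field,banach}"
  assumes "rapid f" "rapid g" and x: "tame N A x" and y: "tame N A y"
  shows "form_eval n (tens f g) (\<lambda>_. both x y) =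
    (\<Sum>k\<le>n. of_nat (n choose k) * (form_eval k f (\<lambda>_. x) * form_eval (n - k) g (\<lambda>_. y)))"
  using assms(1,2)
proof (induction n arbitrary: f g)
  case 0
  then show ?case by (simp add: tens_def)
next
  case (Suc n)
  note fg = Suc.prems
  let ?h = "\<lambda>k. form_eval k f (\<lambda>_. x) * form_eval (Suc n - k) g (\<lambda>_. y)"
  note E = form_eval_Suc[OF rapid_tens[OF fg] tame_both[OF x y], of n]
  have left: "(\<Sum>\<^sub>\<infinity>j. x j * form_eval n (tens (shift j f) g) (\<lambda>_. both x y)) = (\<Sum>k\<le>n. of_nat (n choose k) * ?h (Suc k))"
  proof -
    have s: "(\<lambda>j. of_nat (n choose k) * form_eval (n - k) g (\<lambda>_. y) * (x j * form_eval k (shift j f) (\<lambda>_. x))) summable_on UNIV" for k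
      by (rule summable_on_cmult_right[OF abs_summable_summable[OF form_eval_Suc(2)[OF fg(1) x]]])
    have "(\<Sum>\<^sub>\<infinity>j. x j * form_eval n (tens (shift j f) g) (\<lambda>_. both x y))
        = (\<Sum>\<^sub>\<infinity>j. \<Sum>k\<le>n. of_nat (n choose k) * form_eval (n - k) g (\<lambda>_. y) * (x j * form_eval k (shift j f) (\<lambda>_. x)))"
      by (subst Suc.IH[OF rapid_shift[OF fg(1)] fg(2)]) (simp add: sum_distrib_left mult_ac)
    also have "\<dots> = (\<Sum>k\<le>n. \<Sum>\<^sub>\<infinity>j. of_nat (n choose k) * form_eval (n - k) g (\<lambda>_. y) * (x j * form_eval k (shift j f) (\<lambda>_. x)))"
      by (rule infsum_finite_sum[OF finite_atMost s])
    also have "\<dots> = (\<Sum>k\<le>n. of_nat (n choose k) * ?h (Suc k))"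
      by (simp only: infsum_cmult_right' form_eval_Suc(1)[OF fg(1) x, symmetric] diff_Suc_Suc) (simp only: mult_ac)
    finally show ?thesis .
  qed
  have right: "(\<Sum>\<^sub>\<infinity>j. y j * form_eval n (tens f (shift j g)) (\<lambda>_. both x y)) = (\<Sum>k\<le>n. of_nat (n choose k) * ?h k)"
  proof -
    have s: "(\<lambda>j. of_nat (n choose k) * form_eval k f (\<lambda>_. x) * (y j * form_eval (n - k) (shift j g) (\<lambda>_. y))) summable_on UNIV" for k
      by (rule summable_on_cmult_right[OF abs_summable_summable[OF form_eval_Suc(2)[OF fg(2) y]]])
    have "(\<Sum>\<^sub>\<infinity>j. y j * form_eval n (tens f (shift j g)) (\<lambda>_. both x y))
        = (\<Sum>\<^sub>\<infinity>j. \<Sum>k\<le>n. of_nat (n choose k) * form_eval k f (\<lambda>_. x) * (y j * form_eval (n - k) (shift j g) (\<lambda>_. y)))"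
      by (subst Suc.IH[OF fg(1) rapid_shift[OF fg(2)]]) (simp add: sum_distrib_left mult_ac)
    also have "\<dots> = (\<Sum>k\<le>n. \<Sum>\<^sub>\<infinity>j. of_nat (n choose k) * form_eval k f (\<lambda>_. x) * (y j * form_eval (n - k) (shift j g) (\<lambda>_. y)))"
      by (rule infsum_finite_sum[OF finite_atMost s])
    also have "\<dots> = (\<Sum>k\<le>n. of_nat (n choose k) * ?h k)"
      by (rule sum.cong[OF refl], simp only: infsum_cmult_right' form_eval_Suc(1)[OF fg(2) y, symmetric] atMost_iff Suc_diff_le)
        (simp only: mult_ac)
    finally show ?thesis .
  qed
  show ?case
    unfolding E(1) infsum_tag(2)[OF E(2)]
    by (simp only: shift_tens both_tag tag_simps if_True if_False left right, subst add.commute, rule pascal_sum)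
qed

lemma taylor_eval_tens:
  fixes f g :: "('c::finite \<times> int) list \<Rightarrow> 'k::{real_normed_field,banach}"
  assumes "rapid f" "rapid g" and x: "tame N A x" and y: "tame N A y"
  shows "taylor_eval (tens f g) (both x y) = taylor_eval f x * taylor_eval g y"
proof -
  have "taylor_eval f x * taylor_eval g y = (\<Sum>n. \<Sum>i\<le>n. (form_eval i f (\<lambda>_. x) / fact i) * (form_eval (n - i) g (\<lambda>_. y) / fact (n - i)))"
    unfolding taylor_eval_def using rapid_summable_taylor_eval[OF assms(1) x] rapid_summable_taylor_eval[OF assms(2) y]
    by (rule Cauchy_product)
  also have "\<dots> = taylor_eval (tens f g) (both x y)"
    unfolding taylor_eval_def form_eval_tens[OF assms]
  proof (intro suminf_cong)
    fix n
    show "(\<Sum>i\<le>n. (form_eval i f (\<lambda>_. x) / fact i) * (form_eval (n - i) g (\<lambda>_. y) / fact (n - i)))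
      = (\<Sum>k\<le>n. of_nat (n choose k) * (form_eval k f (\<lambda>_. x) * form_eval (n - k) g (\<lambda>_. y))) / fact n"
      unfolding sum_divide_distrib
      by (rule sum.cong) (auto simp: binomial_fact field_simps)
  qed
  finally show ?thesis by simp
qed

text \<open>
  The Taylor coefficients of \<open>x \<mapsto> h (x, x)\<close>: by the chain rule a derivative in direction \<open>j\<close> is the sum of
  the derivatives in the two tagged copies of \<open>j\<close>, and a word of length \<open>n\<close> becomes \<open>2 ^ n\<close> tagged words.
  The recursion applies to the function, not to the word, so that a shift commutes with it.
\<close>

primrec merge_tags :: "('c \<times> int) list \<Rightarrow> ((('c \<times> bool) \<times> int) list \<Rightarrow> 'k) \<Rightarrow> 'k::ab_group_add" where
  "merge_tags [] h = h []"
| "merge_tags (j # l) h = merge_tags l (\<lambda>l'. h (tag True j # l') + h (tag False j # l'))"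

definition diagonal :: "((('c \<times> bool) \<times> int) list \<Rightarrow> 'k) \<Rightarrow> ('c \<times> int) list \<Rightarrow> 'k::ab_group_add" where
  "diagonal h l = merge_tags l h"

lemma shift_diagonal: "shift j (diagonal h) = diagonal (\<lambda>l. shift (tag True j) h l + shift (tag False j) h l)"
  by (simp add: diagonal_def shift_def fun_eq_iff)

lemma norm_merge_tags_le:
  fixes h :: "(('c \<times> bool) \<times> int) list \<Rightarrow> 'k::real_normed_vector"
  assumes "\<And>l'. map base l' = l \<Longrightarrow> norm (h l') \<le> B"
  shows "norm (merge_tags l h) \<le> 2 ^ length l * B"
  using assms
proof (induction l arbitrary: h B)
  case (Cons j l)
  have "norm (merge_tags l (\<lambda>l'. h (tag True j # l') + h (tag False j # l'))) \<le> 2 ^ length l * (B + B)"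
  proof (rule Cons.IH)
    fix l' assume "map base l' = l"
    then show "norm (h (tag True j # l') + h (tag False j # l')) \<le> B + B"
      by (intro norm_triangle_mono Cons.prems) auto
  qed
  then show ?case by simp
qed simp

text \<open>
  Doubling \<open>C\<close> pays for the \<open>2 ^ n\<close> tagged words.
\<close>

lemma bnd_diagonal:
  fixes h :: "(('c \<times> bool) \<times> int) list \<Rightarrow> 'k::real_normed_vector"
  assumes "bnd k (2 * C) M h" "C > 0"
  shows "bnd k C M (diagonal h)"
  unfolding bnd_def
proof
  fix l :: "('c \<times> int) list"
  let ?B = "M * fact (length l) / wt_prod k (2 * C) l"
  have r: "wt_prod k C l > 0" "wt_prod k (2 * C) l > 0" using wt_prod_pos assms(2) by (metis mult_pos_pos zero_less_numeral)+
  have "norm (merge_tags l h) \<le> 2 ^ length l * ?B"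
  proof (rule norm_merge_tags_le)
    fix l' assume l': "map base l' = l"
    then have "norm (h l') * wt_prod k (2 * C) l \<le> M * fact (length l)"
      using bndD[OF assms(1), of l'] wt_prod_base[of k "2 * C" l'] by auto
    then show "norm (h l') \<le> ?B" using r by (simp add: field_simps)
  qed
  then have "norm (merge_tags l h) * wt_prod k (2 * C) l \<le> 2 ^ length l * (M * fact (length l))"
    using r(2) by (simp only: times_divide_eq_right pos_le_divide_eq)
  then have "2 ^ length l * (norm (merge_tags l h) * wt_prod k C l) \<le> 2 ^ length l * (M * fact (length l))"
    by (simp only: wt_prod_scale[of k 2 C]) (simp only: mult_ac)
  then show "norm (diagonal h l) * wt_prod k C l \<le> M * fact (length l)"
    by (subst (asm) mult_le_cancel_left_pos) (simp_all add: diagonal_def)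
qed

lemma rapid_diagonal:
  fixes h :: "(('c \<times> bool) \<times> int) list \<Rightarrow> 'k::real_normed_vector"
  assumes "rapid h"
  shows "rapid (diagonal h)"
  unfolding rapid_def
proof (intro allI impI)
  fix k :: nat and C :: real assume C: "C > 0"
  then have C2: "2 * C > 0" by simp
  obtain M where "bnd k (2 * C) M h" using rapidD[OF assms C2] .
  then show "\<exists>M. bnd k C M (diagonal h)" using bnd_diagonal C by blast
qed

lemma symmI_swap:
  fixes f :: "'i list \<Rightarrow> 'b"
  assumes swap: "\<And>u a b v. f (u @ a # b # v) = f (u @ b # a # v)"
  shows "symm f"
proof (rule symmI)
  have move: "f (w @ x # u @ v) = f (w @ u @ x # v)" for w x u v
  proof (induction u arbitrary: w)
    case (Cons y u)
    have "f (w @ x # (y # u) @ v) = f ((w @ [y]) @ x # u @ v)" using swap[of w x y "u @ v"] by simp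
    also have "\<dots> = f ((w @ [y]) @ u @ x # v)" by (rule Cons.IH)
    finally show ?case by simp
  qed simp
  fix xs ys :: "'i list" assume "mset xs = mset ys"
  then have "f (w @ xs) = f (w @ ys)" for w
  proof (induction xs arbitrary: w ys)
    case (Cons x xs)
    then have "x \<in> set ys" by (metis list.set_intros(1) set_mset_mset)
    then obtain u v where ys: "ys = u @ x # v" by (metis split_list)
    then have "mset xs = mset (u @ v)" using Cons.prems by simp
    then have "f ((w @ [x]) @ xs) = f ((w @ [x]) @ u @ v)" by (rule Cons.IH)
    also have "\<dots> = f (w @ u @ x # v)" using move[of w x u v] by simp
    finally show ?case using ys by simp
  qed simp
  from this[of "[]"] show "f xs = f ys" by simp
qed

lemma symm_add: "symm f \<Longrightarrow> symm g \<Longrightarrow> symm (\<lambda>l. f l + g l)"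
  unfolding symm_def by metis

lemma symm_scale: "symm f \<Longrightarrow> symm (\<lambda>l. c * f l)"
  unfolding symm_def by metis

lemma symm_diagonal:
  fixes h :: "(('c \<times> bool) \<times> int) list \<Rightarrow> 'k::ab_group_add"
  assumes "symm h" shows "symm (diagonal h)"
proof (rule symmI_swap)
  fix u v :: "('c \<times> int) list" and a b
  show "diagonal h (u @ a # b # v) = diagonal h (u @ b # a # v)"
    using assms
  proof (induction u arbitrary: h)
    case Nil
    have e: "h (tag s a # tag t b # l) = h (tag t b # tag s a # l)" for s t l
      by (rule symmD[OF Nil]) simp
    show ?case by (simp add: diagonal_def e add_ac)
  next
    case (Cons j u)
    have "symm (\<lambda>l'. h (tag True j # l') + h (tag False j # l'))"
      using symm_add[OF symm_shift[OF Cons.prems] symm_shift[OF Cons.prems]] by (simp add: shift_def)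
    from Cons.IH[OF this] show ?case by (simp add: diagonal_def)
  qed
qed

lemma rapid_add: assumes "rapid f" "rapid g" shows "rapid (\<lambda>l. f l + g l)"
  unfolding rapid_def
proof (intro allI impI)
  fix k :: nat and C :: real assume C: "C > 0"
  obtain M where M: "bnd k C M f" using rapidD[OF assms(1) C] .
  obtain M' where M': "bnd k C M' g" using rapidD[OF assms(2) C] .
  have "bnd k C (M + M') (\<lambda>l. f l + g l)"
    unfolding bnd_def
  proof
    fix l
    have "norm (f l + g l) * wt_prod k C l \<le> (norm (f l) + norm (g l)) * wt_prod k C l"
      using wt_prod_pos[OF C, of k l] by (intro mult_right_mono norm_triangle_ineq) simp
    also have "\<dots> \<le> (M + M') * fact (length l)"
      using bndD[OF M, of l] bndD[OF M', of l] by (simp add: distrib_right)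
    finally show "norm (f l + g l) * wt_prod k C l \<le> (M + M') * fact (length l)" .
  qed
  then show "\<exists>M. bnd k C M (\<lambda>l. f l + g l)" by blast
qed

lemma bnd_scale:
  fixes f :: "('c \<times> int) list \<Rightarrow> 'k::real_normed_div_algebra"
  assumes "bnd k C M f" shows "bnd k C (norm c * M) (\<lambda>l. c * f l)"
  unfolding bnd_def
proof
  fix l
  have "norm c * (norm (f l) * wt_prod k C l) \<le> norm c * (M * fact (length l))"
    by (intro mult_left_mono bndD[OF assms]) simp
  then show "norm (c * f l) * wt_prod k C l \<le> norm c * M * fact (length l)"
    by (simp add: norm_mult mult.assoc)
qed

lemma rapid_scale:
  fixes f :: "('c \<times> int) list \<Rightarrow> 'k::real_normed_div_algebra"
  assumes "rapid f" shows "rapid (\<lambda>l. c * f l)"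
  unfolding rapid_def
proof (intro allI impI)
  fix k :: nat and C :: real assume C: "C > 0"
  obtain M where "bnd k C M f" using rapidD[OF assms C] .
  then show "\<exists>M. bnd k C M (\<lambda>l. c * f l)" using bnd_scale by blast
qed

lemma form_eval_diagonal:
  fixes h :: "(('c::finite \<times> bool) \<times> int) list \<Rightarrow> 'k::{real_normed_field,banach}"
  assumes "rapid h" and x: "tame N A x"
  shows "form_eval n (diagonal h) (\<lambda>_. x) = form_eval n h (\<lambda>_. both x x)"
  using assms(1)
proof (induction n arbitrary: h)
  case 0
  then show ?case by (simp add: diagonal_def)
next
  case (Suc n)
  note E = form_eval_Suc[OF Suc.prems tame_both[OF x x], of n]
  note T = infsum_tag[OF E(2), simplified]
  have s: "(\<lambda>j. x j * form_eval n (shift (tag b j) h) (\<lambda>_. both x x)) summable_on UNIV" for b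
    using abs_summable_summable[OF infsum_tag(1)[OF E(2), of b]] by simp
  have "form_eval (Suc n) (diagonal h) (\<lambda>_. x) = (\<Sum>\<^sub>\<infinity>j. x j * form_eval n (shift j (diagonal h)) (\<lambda>_. x))"
    by (rule form_eval_Suc(1)[OF rapid_diagonal[OF Suc.prems] x])
  also have "\<dots> = (\<Sum>\<^sub>\<infinity>j. x j * form_eval n (shift (tag True j) h) (\<lambda>_. both x x) + x j * form_eval n (shift (tag False j) h) (\<lambda>_. both x x))"
  proof (rule infsum_cong)
    fix j
    have r: "rapid (shift (tag b j) h)" for b by (rule rapid_shift[OF Suc.prems])
    have "form_eval n (shift j (diagonal h)) (\<lambda>_. x) = form_eval n (shift (tag True j) h) (\<lambda>_. both x x) + form_eval n (shift (tag False j) h) (\<lambda>_. both x x)"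
      unfolding shift_diagonal
      by (subst Suc.IH[OF rapid_add[OF r r]], rule form_eval_add[OF r r tame_both[OF x x]])
    then show "x j * form_eval n (shift j (diagonal h)) (\<lambda>_. x)
        = x j * form_eval n (shift (tag True j) h) (\<lambda>_. both x x) + x j * form_eval n (shift (tag False j) h) (\<lambda>_. both x x)"
      by (simp add: distrib_left)
  qed
  also have "\<dots> = (\<Sum>\<^sub>\<infinity>j. x j * form_eval n (shift (tag True j) h) (\<lambda>_. both x x)) + (\<Sum>\<^sub>\<infinity>j. x j * form_eval n (shift (tag False j) h) (\<lambda>_. both x x))"
    by (rule infsum_add[OF s s])
  also have "\<dots> = form_eval (Suc n) h (\<lambda>_. both x x)"
    unfolding E(1) infsum_tag(2)[OF E(2)] by simp
  finally show ?case .
qed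

lemma taylor_eval_diagonal:
  fixes h :: "(('c::finite \<times> bool) \<times> int) list \<Rightarrow> 'k::{real_normed_field,banach}"
  assumes "rapid h" "tame N A x"
  shows "taylor_eval (diagonal h) x = taylor_eval h (both x x)"
  unfolding taylor_eval_def form_eval_diagonal[OF assms] ..

section \<open>Second-order contractions of coefficients\<close>

lemma summable_on_mult_Times:
  fixes g :: "'a \<Rightarrow> real" and h :: "'b \<Rightarrow> real"
  assumes "g summable_on A" "h summable_on B" "\<And>x. x \<in> A \<Longrightarrow> g x \<ge> 0" "\<And>y. y \<in> B \<Longrightarrow> h y \<ge> 0"
  shows "(\<lambda>(x, y). g x * h y) summable_on A \<times> B"
proof (rule summable_on_SigmaI)
  show "((\<lambda>y. case (x, y) of (x, y) \<Rightarrow> g x * h y) has_sum g x * infsum h B) B" for x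
    using has_sum_cmult_right[OF has_sum_infsum[OF assms(2)], of "g x"] by simp
  show "(\<lambda>x. g x * infsum h B) summable_on A"
    by (rule summable_on_cmult_left[OF assms(1)])
qed (use assms(3,4) in auto)

lemma infsum_swap_dominated:
  fixes F :: "'a \<Rightarrow> 'b \<Rightarrow> 'k::banach"
  assumes "g summable_on A" "h summable_on B" "\<And>x. x \<in> A \<Longrightarrow> g x \<ge> 0" "\<And>y. y \<in> B \<Longrightarrow> h y \<ge> 0"
    and "\<And>x y. x \<in> A \<Longrightarrow> y \<in> B \<Longrightarrow> norm (F x y) \<le> g x * h y"
  shows "(\<Sum>\<^sub>\<infinity>x\<in>A. \<Sum>\<^sub>\<infinity>y\<in>B. F x y) = (\<Sum>\<^sub>\<infinity>y\<in>B. \<Sum>\<^sub>\<infinity>x\<in>A. F x y)"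
proof (rule infsum_swap_banach)
  show "(\<lambda>(x, y). F x y) summable_on A \<times> B"
    by (rule abs_le_summable(2)[OF summable_on_mult_Times[OF assms(1-4)]]) (use assms(5) in auto)
qed

definition pos :: "('q \<Rightarrow> 'c) \<Rightarrow> 'q \<times> int \<Rightarrow> 'c \<times> int" where
  "pos u t = (u (fst t), snd t)"

lemma wt_pos_eq [simp]: "wt (pos u t) = wt t"
  by (simp add: wt_def pos_def)

text \<open>
  The differential operator \<open>\<Sum>t. \<beta> t * D\<^bsub>pos u t\<^esub> D\<^bsub>pos v t\<^esub>\<close> on coefficients. The maps \<open>u\<close> and \<open>v\<close> choose the components of
  the two directions of differentiation, so that \<open>\<Delta>\<close> on one function and bidifferential operators on two tagged
  copies are instances of one operator.
\<close>

definition contract :: "('q \<times> int \<Rightarrow> 'k) \<Rightarrow> ('q \<Rightarrow> 'c) \<Rightarrow> ('q \<Rightarrow> 'c) \<Rightarrow> (('c \<times> int) list \<Rightarrow> 'k) \<Rightarrow>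
    ('c \<times> int) list \<Rightarrow> 'k::{real_normed_field,banach}" where
  "contract \<beta> u v f l = (\<Sum>\<^sub>\<infinity>t. \<beta> t * f (pos u t # pos v t # l))"

text \<open>
  These are the Taylor coefficients of the functionals in the Connes space, see \<open>connes_eq\<close> below.
\<close>

definition connes_coef :: "(('c \<times> int) list \<Rightarrow> 'k::real_normed_vector) \<Rightarrow> bool" where
  "connes_coef f \<longleftrightarrow> rapid f \<and> symm f"

lemma connes_coefD: "connes_coef f \<Longrightarrow> rapid f" "connes_coef f \<Longrightarrow> symm f"
  by (simp_all add: connes_coef_def)

lemma connes_coef_shift: "connes_coef f \<Longrightarrow> connes_coef (shift j f)"
  by (simp add: connes_coef_def rapid_shift symm_shift)

lemma connes_coef_add: "connes_coef f \<Longrightarrow> connes_coef g \<Longrightarrow> connes_coef (\<lambda>l. f l + g l)"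
  by (simp add: connes_coef_def rapid_add symm_add)

lemma connes_coef_scale:
  fixes f :: "('c \<times> int) list \<Rightarrow> 'k::real_normed_div_algebra"
  shows "connes_coef f \<Longrightarrow> connes_coef (\<lambda>l. c * f l)"
  by (simp add: connes_coef_def rapid_scale symm_scale)

lemma connes_coef_0: "connes_coef (\<lambda>l. 0)"
  by (auto simp: connes_coef_def rapid_def bnd_def symm_def intro!: exI[of _ 0])

lemma connes_coef_sum: "finite K \<Longrightarrow> (\<And>k. k \<in> K \<Longrightarrow> connes_coef (F k)) \<Longrightarrow> connes_coef (\<lambda>l. \<Sum>k\<in>K. F k l)"
  by (induction K rule: finite_induct) (simp_all add: connes_coef_0 connes_coef_add)

lemma connes_coef_tens:
  fixes f g :: "('c \<times> int) list \<Rightarrow> 'k::real_normed_field"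
  shows "connes_coef f \<Longrightarrow> connes_coef g \<Longrightarrow> connes_coef (tens f g)"
  by (simp add: connes_coef_def rapid_tens symm_tens)

lemma connes_coef_diagonal:
  fixes h :: "(('c \<times> bool) \<times> int) list \<Rightarrow> 'k::real_normed_vector"
  shows "connes_coef h \<Longrightarrow> connes_coef (diagonal h)"
  by (simp add: connes_coef_def rapid_diagonal symm_diagonal)

lemma bnd_shift2:
  fixes f :: "('c \<times> int) list \<Rightarrow> 'k::real_normed_vector"
  assumes "bnd k (4 * C) M f" "C > 0"
  shows "bnd k C (M / (2 * C\<^sup>2) / (wt t ^ k * wt t ^ k)) (shift (pos v t) (shift (pos u t) f))"
proof -
  have "bnd k (2 * C) (M / (2 * C * wt (pos u t) ^ k)) (shift (pos u t) f)"
    using assms by (intro bnd_shift) (simp_all add: mult.assoc[symmetric])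
  then have "bnd k C (M / (2 * C * wt (pos u t) ^ k) / (C * wt (pos v t) ^ k)) (shift (pos v t) (shift (pos u t) f))"
    using assms(2) by (rule bnd_shift)
  then show ?thesis by (simp add: power2_eq_square mult_ac)
qed

text \<open>
  Removing two letters of the same frequency gains the weight to the power \<open>2 k\<close>; this beats the growth
  of \<open>\<beta>\<close> and leaves a summable factor.
\<close>

lemma contract_term_le:
  fixes f :: "('c \<times> int) list \<Rightarrow> 'k::{real_normed_field,banach}"
  assumes \<beta>: "tame N A \<beta>" and k: "N + 2 \<le> k" and f: "bnd k (4 * C) M f" and C: "C > 0"
  shows "norm (\<beta> t * f (pos u t # pos v t # l)) * wt_prod k C l \<le> (A * M / (2 * C\<^sup>2) * fact (length l)) * (1 / (wt t)\<^sup>2)"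
proof -
  have M: "M \<ge> 0" by (rule bnd_nonneg[OF f])
  have 1: "norm (f (pos u t # pos v t # l)) * wt_prod k C l \<le> M / (2 * C\<^sup>2) / (wt t ^ k * wt t ^ k) * fact (length l)"
    using bndD[OF bnd_shift2[OF f C, of t v u], of l] by (simp add: shift_def)
  have "wt t ^ N * (wt t)\<^sup>2 \<le> wt t ^ k"
    unfolding power_add[symmetric] using k by (intro power_increasing) auto
  also have "\<dots> \<le> wt t ^ k * wt t ^ k"
    using one_le_power[OF wt_ge_1, of t k] by simp
  finally have 2: "wt t ^ N / (wt t ^ k * wt t ^ k) \<le> 1 / (wt t)\<^sup>2"
    by (simp add: field_simps)
  have "norm (\<beta> t * f (pos u t # pos v t # l)) * wt_prod k C l
      = norm (\<beta> t) * (norm (f (pos u t # pos v t # l)) * wt_prod k C l)"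
    by (simp add: norm_mult)
  also have "\<dots> \<le> (A * wt t ^ N) * (M / (2 * C\<^sup>2) / (wt t ^ k * wt t ^ k) * fact (length l))"
    using 1 tameD[OF \<beta>, of t] tame_nonneg[OF \<beta>] wt_prod_pos[OF C, of k l]
    by (intro mult_mono[of "norm (\<beta> t)"]) auto
  also have "\<dots> = (A * M / (2 * C\<^sup>2) * fact (length l)) * (wt t ^ N / (wt t ^ k * wt t ^ k))"
    by simp
  also have "\<dots> \<le> (A * M / (2 * C\<^sup>2) * fact (length l)) * (1 / (wt t)\<^sup>2)"
    using 2 tame_nonneg[OF \<beta>] M by (intro mult_left_mono) auto
  finally show ?thesis .
qed

lemma
  fixes f :: "('c \<times> int) list \<Rightarrow> 'k::{real_normed_field,banach}" and u :: "'q::finite \<Rightarrow> 'c"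
  assumes \<beta>: "tame N A \<beta>" and k: "N + 2 \<le> k" and f: "bnd k (4 * C) M f" and C: "C > 0"
  shows contract_abs_summable: "(\<lambda>t. \<beta> t * f (pos u t # pos v t # l)) abs_summable_on UNIV"
    and bnd_contract: "bnd k C (A * wsum TYPE('q) / (2 * C\<^sup>2) * M) (contract \<beta> u v f)"
proof -
  let ?D = "\<lambda>l. A * M / (2 * C\<^sup>2) * fact (length l) / wt_prod k C l"
  have le: "norm (\<beta> t * f (pos u t # pos v t # l)) \<le> ?D l * (1 / (wt t)\<^sup>2)" for t l
  proof -
    have "norm (\<beta> t * f (pos u t # pos v t # l))
        \<le> (A * M / (2 * C\<^sup>2) * fact (length l)) * (1 / (wt t)\<^sup>2) / wt_prod k C l"
      using contract_term_le[OF \<beta> k f C, of t u v l] by (simp only: pos_le_divide_eq[OF wt_prod_pos[OF C]])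
    then show ?thesis by (simp only: times_divide_eq_left)
  qed
  have s: "((\<lambda>t::'q \<times> int. ?D l * (1 / (wt t)\<^sup>2)) has_sum (?D l * wsum TYPE('q))) UNIV" for l :: "('c \<times> int) list"
    by (rule has_sum_cmult_right[OF has_sum_wt])
  show "(\<lambda>t. \<beta> t * f (pos u t # pos v t # l)) abs_summable_on UNIV"
    by (rule abs_le_summable(1)[OF has_sum_imp_summable[OF s[of l]]]) (use le in auto)
  show "bnd k C (A * wsum TYPE('q) / (2 * C\<^sup>2) * M) (contract \<beta> u v f)"
    unfolding bnd_def
  proof
    fix l
    have "norm (contract \<beta> u v f l) \<le> ?D l * wsum TYPE('q)"
      unfolding contract_def infsumI[OF s, symmetric]
      by (rule abs_le_summable(3)[OF has_sum_imp_summable[OF s]]) (use le in auto)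
    also have "?D l * wsum TYPE('q) = A * wsum TYPE('q) / (2 * C\<^sup>2) * M * fact (length l) / wt_prod k C l"
      by simp
    finally show "norm (contract \<beta> u v f l) * wt_prod k C l \<le> A * wsum TYPE('q) / (2 * C\<^sup>2) * M * fact (length l)"
      by (simp only: pos_le_divide_eq[OF wt_prod_pos[OF C]])
  qed
qed

lemma rapid_contract_summable:
  fixes f :: "('c \<times> int) list \<Rightarrow> 'k::{real_normed_field,banach}" and u :: "'q::finite \<Rightarrow> 'c"
  assumes \<beta>: "tame N A \<beta>" and f: "rapid f"
  shows "(\<lambda>t. \<beta> t * f (pos u t # pos v t # l)) abs_summable_on UNIV"
proof -
  obtain M where "bnd (N + 2) (4 * 1) M f" using rapidD[OF f, of "4 * 1" "N + 2"] by auto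
  then show ?thesis by (intro contract_abs_summable[OF \<beta>, where C = 1 and M = M and k = "N + 2"]) auto
qed

lemma rapid_contract:
  fixes f :: "('c \<times> int) list \<Rightarrow> 'k::{real_normed_field,banach}" and u :: "'q::finite \<Rightarrow> 'c"
  assumes \<beta>: "tame N A \<beta>" and f: "rapid f"
  shows "rapid (contract \<beta> u v f)"
  unfolding rapid_def
proof (intro allI impI)
  fix k :: nat and C :: real assume C: "C > 0"
  then have C4: "4 * C > 0" by simp
  obtain M where M: "bnd (max k (N + 2)) (4 * C) M f" using rapidD[OF f C4] .
  have "bnd (max k (N + 2)) C (A * wsum TYPE('q) / (2 * C\<^sup>2) * M) (contract \<beta> u v f)"
    by (rule bnd_contract[OF \<beta> _ M C]) simp
  then show "\<exists>M. bnd k C M (contract \<beta> u v f)"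
    using bnd_mono[OF _ C order_refl _ order_refl] max.cobounded1 by blast
qed

lemma symm_contract:
  fixes f :: "('b \<times> int) list \<Rightarrow> 'k::{real_normed_field,banach}"
  assumes "symm f" shows "symm (contract \<beta> u v f)"
proof (rule symmI)
  fix xs ys :: "('b \<times> int) list" assume "mset xs = mset ys"
  then have "f (pos u t # pos v t # xs) = f (pos u t # pos v t # ys)" for t
    by (intro symmD[OF assms]) simp
  then show "contract \<beta> u v f xs = contract \<beta> u v f ys" by (simp add: contract_def)
qed

lemma connes_coef_contract:
  fixes f :: "('c \<times> int) list \<Rightarrow> 'k::{real_normed_field,banach}" and u :: "'q::finite \<Rightarrow> 'c"
  assumes "tame N A \<beta>" "connes_coef f" shows "connes_coef (contract \<beta> u v f)"
  using assms by (simp add: connes_coef_def rapid_contract symm_contract)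

lemma connes_coef_contract_pow:
  fixes f :: "('c \<times> int) list \<Rightarrow> 'k::{real_normed_field,banach}" and u :: "'q::finite \<Rightarrow> 'c"
  assumes "tame N A \<beta>" "connes_coef f" shows "connes_coef ((contract \<beta> u v ^^ n) f)"
  by (induction n) (simp_all add: assms(2) connes_coef_contract[OF assms(1)])

lemma shift_contract:
  assumes "symm f" shows "shift j (contract \<beta> u v f) = contract \<beta> u v (shift j f)"
proof
  fix l
  have "f (pos u t # pos v t # j # l) = f (j # pos u t # pos v t # l)" for t
    by (rule symmD[OF assms]) simp
  then show "shift j (contract \<beta> u v f) l = contract \<beta> u v (shift j f) l" by (simp add: contract_def shift_def)
qed

lemma contract_add:
  fixes f :: "('c \<times> int) list \<Rightarrow> 'k::{real_normed_field,banach}" and u :: "'q::finite \<Rightarrow> 'c"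
  assumes "tame N A \<beta>" "rapid f" "rapid g"
  shows "contract \<beta> u v (\<lambda>l. f l + g l) = (\<lambda>l. contract \<beta> u v f l + contract \<beta> u v g l)"
  unfolding contract_def distrib_left
  by (intro ext infsum_add[OF abs_summable_summable[OF rapid_contract_summable[OF assms(1,2)]]
        abs_summable_summable[OF rapid_contract_summable[OF assms(1,3)]]])

lemma contract_scale: "contract \<beta> u v (\<lambda>l. c * f l) = (\<lambda>l. c * contract \<beta> u v f l)"
proof
  fix l
  show "contract \<beta> u v (\<lambda>l. c * f l) l = c * contract \<beta> u v f l"
    unfolding contract_def by (subst infsum_cmult_right'[symmetric]) (simp add: mult_ac)
qed

lemma contract_sum:
  fixes F :: "'n \<Rightarrow> ('c \<times> int) list \<Rightarrow> 'k::{real_normed_field,banach}" and u :: "'q::finite \<Rightarrow> 'c"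
  assumes "tame N A \<beta>" "finite K" "\<And>k. k \<in> K \<Longrightarrow> rapid (F k)"
  shows "contract \<beta> u v (\<lambda>l. \<Sum>k\<in>K. F k l) = (\<lambda>l. \<Sum>k\<in>K. contract \<beta> u v (F k) l)"
proof
  fix l
  show "contract \<beta> u v (\<lambda>l. \<Sum>k\<in>K. F k l) l = (\<Sum>k\<in>K. contract \<beta> u v (F k) l)"
    unfolding contract_def sum_distrib_left
    by (rule infsum_finite_sum[OF assms(2) abs_summable_summable[OF rapid_contract_summable[OF assms(1,3)]]])
qed

lemma contract_plus:
  fixes f :: "('c \<times> int) list \<Rightarrow> 'k::{real_normed_field,banach}" and u :: "'q::finite \<Rightarrow> 'c"
  assumes "tame N A \<beta>" "tame N' A' \<gamma>" "rapid f"
  shows "contract (\<lambda>t. \<beta> t + \<gamma> t) u v f = (\<lambda>l. contract \<beta> u v f l + contract \<gamma> u v f l)"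
  unfolding contract_def distrib_right
  by (intro ext infsum_add[OF abs_summable_summable[OF rapid_contract_summable[OF assms(1,3)]]
        abs_summable_summable[OF rapid_contract_summable[OF assms(2,3)]]])

text \<open>
  By symmetry of \<open>f\<close> the two double sums have the same terms, and the decay of \<open>f\<close> justifies exchanging
  them.
\<close>

lemma contract_commute:
  fixes f :: "('c \<times> int) list \<Rightarrow> 'k::{real_normed_field,banach}" and u :: "'q::finite \<Rightarrow> 'c"
    and u' :: "'q'::finite \<Rightarrow> 'c"
  assumes \<beta>: "tame N A \<beta>" and \<gamma>: "tame N' A' \<gamma>" and f: "connes_coef f"
  shows "contract \<beta> u v (contract \<gamma> u' v' f) = contract \<gamma> u' v' (contract \<beta> u v f)"
proof
  fix l
  let ?K = "max N N' + 2"
  \<comment> \<open>Each of the two contractions consumes a factor 4.\<close>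
  obtain M where M: "bnd ?K 16 M f" using rapidD[OF connes_coefD(1)[OF f], of 16 ?K] by auto
  let ?f = "\<lambda>t t'. f (pos u' t' # pos v' t' # pos u t # pos v t # l)"
  have s: "?f t t' = f (pos u t # pos v t # pos u' t' # pos v' t' # l)" for t t'
    by (rule symmD[OF connes_coefD(2)[OF f]]) simp
  have b: "bnd ?K 4 (M / (2 * 4\<^sup>2) / (wt t ^ ?K * wt t ^ ?K)) (shift (pos v t) (shift (pos u t) f))" for t :: "'q \<times> int"
    using M by (intro bnd_shift2) auto
  let ?R = "wt_prod ?K 1 l"
  have R: "?R > 0" by (rule wt_prod_pos) simp
  let ?H = "A' * (A * M) * fact (length l) / ?R"
  have dom: "norm (\<beta> t * (\<gamma> t' * ?f t t')) \<le> (?H * (1 / (wt t)\<^sup>2)) * (1 / (wt t')\<^sup>2)" for t t'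
  proof -
    have W: "wt t ^ N * (wt t)\<^sup>2 \<le> wt t ^ ?K * wt t ^ ?K"
    proof -
      have "wt t ^ N * (wt t)\<^sup>2 \<le> wt t ^ ?K"
        unfolding power_add[symmetric] by (intro power_increasing) auto
      also have "\<dots> \<le> wt t ^ ?K * wt t ^ ?K"
        using one_le_power[OF wt_ge_1, of t ?K] by simp
      finally show ?thesis .
    qed
    have "norm (\<gamma> t' * shift (pos v t) (shift (pos u t) f) (pos u' t' # pos v' t' # l)) * ?R
        \<le> (A' * (M / (2 * 4\<^sup>2) / (wt t ^ ?K * wt t ^ ?K)) / (2 * 1\<^sup>2) * fact (length l)) * (1 / (wt t')\<^sup>2)"
      by (rule contract_term_le[OF \<gamma>]) (use b in auto)
    also have "\<dots> \<le> (A' * (M / (wt t ^ ?K * wt t ^ ?K)) * fact (length l)) * (1 / (wt t')\<^sup>2)"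
      using tame_nonneg[OF \<gamma>] bnd_nonneg[OF M]
      by (intro mult_right_mono) (auto simp: field_simps)
    finally have 1: "norm (\<gamma> t' * ?f t t') * ?R \<le> (A' * (M / (wt t ^ ?K * wt t ^ ?K)) * fact (length l)) * (1 / (wt t')\<^sup>2)"
      by (simp add: s shift_def)
    have "norm (\<beta> t * (\<gamma> t' * ?f t t')) * ?R = norm (\<beta> t) * (norm (\<gamma> t' * ?f t t') * ?R)"
      by (simp add: norm_mult)
    also have "\<dots> \<le> (A * wt t ^ N) * ((A' * (M / (wt t ^ ?K * wt t ^ ?K)) * fact (length l)) * (1 / (wt t')\<^sup>2))"
      using 1 tameD[OF \<beta>, of t] tame_nonneg[OF \<beta>] R by (intro mult_mono[of "norm (\<beta> t)"]) auto
    also have "\<dots> = (A' * (A * M) * fact (length l)) * (wt t ^ N / (wt t ^ ?K * wt t ^ ?K)) * (1 / (wt t')\<^sup>2)"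
      by simp
    also have "\<dots> \<le> (A' * (A * M) * fact (length l)) * (1 / (wt t)\<^sup>2) * (1 / (wt t')\<^sup>2)"
      using W tame_nonneg[OF \<beta>] tame_nonneg[OF \<gamma>] bnd_nonneg[OF M]
      by (intro mult_right_mono mult_left_mono) (auto simp: divide_simps mult_ac)
    finally show ?thesis using R by (simp add: field_simps)
  qed
  have H: "?H \<ge> 0" using tame_nonneg[OF \<beta>] tame_nonneg[OF \<gamma>] bnd_nonneg[OF M] R by simp
  have "contract \<beta> u v (contract \<gamma> u' v' f) l = (\<Sum>\<^sub>\<infinity>t. \<Sum>\<^sub>\<infinity>t'. \<beta> t * (\<gamma> t' * ?f t t'))"
    by (simp only: contract_def infsum_cmult_right')
  also have "\<dots> = (\<Sum>\<^sub>\<infinity>t'. \<Sum>\<^sub>\<infinity>t. \<beta> t * (\<gamma> t' * ?f t t'))"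
  proof (rule infsum_swap_dominated[OF summable_on_cmult_right[OF summable_wt] summable_wt _ _ dom])
    show "0 \<le> ?H * (1 / (wt t)\<^sup>2)" for t :: "'q \<times> int" using H by (intro mult_nonneg_nonneg) auto
  qed simp
  also have "\<dots> = contract \<gamma> u' v' (contract \<beta> u v f) l"
    unfolding contract_def s by (simp only: infsum_cmult_right'[symmetric] mult_ac)
  finally show "contract \<beta> u v (contract \<gamma> u' v' f) l = contract \<gamma> u' v' (contract \<beta> u v f) l" .
qed

lemma contract_pow_commute:
  fixes f :: "('c \<times> int) list \<Rightarrow> 'k::{real_normed_field,banach}" and u :: "'q::finite \<Rightarrow> 'c"
    and u' :: "'q'::finite \<Rightarrow> 'c"
  assumes \<beta>: "tame N A \<beta>" and \<gamma>: "tame N' A' \<gamma>" and f: "connes_coef f"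
  shows "contract \<beta> u v ((contract \<gamma> u' v' ^^ n) f) = (contract \<gamma> u' v' ^^ n) (contract \<beta> u v f)"
  by (induction n) (simp_all add: contract_commute[OF \<beta> \<gamma> connes_coef_contract_pow[OF \<gamma> f]])

lemma contract_binomial:
  fixes f :: "('c \<times> int) list \<Rightarrow> 'k::{real_normed_field,banach}" and u :: "'q::finite \<Rightarrow> 'c"
  assumes \<beta>: "tame N A \<beta>" and \<gamma>: "tame N' A' \<gamma>" and f: "connes_coef f"
  shows "(contract (\<lambda>t. \<beta> t + \<gamma> t) u v ^^ n) f l =
    (\<Sum>k\<le>n. of_nat (n choose k) * (contract \<beta> u v ^^ k) ((contract \<gamma> u v ^^ (n - k)) f) l)"
proof (induction n arbitrary: l)
  case 0
  then show ?case by simp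
next
  case (Suc n)
  let ?B = "contract \<beta> u v" and ?G = "contract \<gamma> u v"
  let ?h = "\<lambda>k. (?B ^^ k) ((?G ^^ (Suc n - k)) f) l"
  let ?F = "\<lambda>k. (?B ^^ k) ((?G ^^ (n - k)) f)"
  have g: "connes_coef (?F k)" for k by (rule connes_coef_contract_pow[OF \<beta> connes_coef_contract_pow[OF \<gamma> f]])
  then have r: "rapid (\<lambda>l. of_nat (n choose k) * ?F k l)" for k by (rule rapid_scale[OF connes_coefD(1)])
  have R: "rapid (\<lambda>l. \<Sum>k\<le>n. of_nat (n choose k) * ?F k l)"
    by (rule connes_coefD(1)[OF connes_coef_sum]) (auto intro: connes_coef_scale g)
  have "(contract (\<lambda>t. \<beta> t + \<gamma> t) u v ^^ n) f = (\<lambda>l. \<Sum>k\<le>n. of_nat (n choose k) * ?F k l)"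
    using Suc.IH by (intro ext)
  then have "(contract (\<lambda>t. \<beta> t + \<gamma> t) u v ^^ Suc n) f l
      = ?B (\<lambda>l. \<Sum>k\<le>n. of_nat (n choose k) * ?F k l) l + ?G (\<lambda>l. \<Sum>k\<le>n. of_nat (n choose k) * ?F k l) l"
    by (simp add: contract_plus[OF \<beta> \<gamma> R])
  also have "?B (\<lambda>l. \<Sum>k\<le>n. of_nat (n choose k) * ?F k l) l = (\<Sum>k\<le>n. of_nat (n choose k) * ?h (Suc k))"
    by (subst contract_sum[OF \<beta> finite_atMost r]) (simp add: contract_scale)
  also have "?G (\<lambda>l. \<Sum>k\<le>n. of_nat (n choose k) * ?F k l) l = (\<Sum>k\<le>n. of_nat (n choose k) * ?h k)"
    by (subst contract_sum[OF \<gamma> finite_atMost r])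
      (rule sum.cong, simp_all add: contract_scale contract_pow_commute[OF \<gamma> \<beta> connes_coef_contract_pow[OF \<gamma> f]] Suc_diff_le)
  finally show ?case
    using pascal_sum[of n ?h] by (simp only: add.commute)
qed

section \<open>The equivalence of the star-products on coefficients\<close>

lemma merge_tags_scale: "merge_tags l (\<lambda>l'. c * h l') = c * merge_tags l h" for c :: "'k::real_normed_field"
  by (induction l arbitrary: h) (simp_all flip: distrib_left)

lemma merge_tags_infsum:
  fixes F :: "'t \<Rightarrow> (('c \<times> bool) \<times> int) list \<Rightarrow> 'k::banach"
  assumes "\<And>l'. (\<lambda>t. F t l') summable_on S"
  shows "merge_tags l (\<lambda>l'. \<Sum>\<^sub>\<infinity>t\<in>S. F t l') = (\<Sum>\<^sub>\<infinity>t\<in>S. merge_tags l (F t))"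
proof -
  have "(\<lambda>t. merge_tags l (F t)) summable_on S \<and> merge_tags l (\<lambda>l'. \<Sum>\<^sub>\<infinity>t\<in>S. F t l') = (\<Sum>\<^sub>\<infinity>t\<in>S. merge_tags l (F t))"
    using assms
  proof (induction l arbitrary: F)
    case (Cons j l)
    have "(\<lambda>t. F t (tag True j # l') + F t (tag False j # l')) summable_on S" for l'
      by (rule summable_on_add[OF Cons.prems Cons.prems])
    from Cons.IH[OF this] show ?case
      by (simp add: infsum_add[OF Cons.prems Cons.prems])
  qed simp
  then show ?thesis by blast
qed

text \<open>
  On tagged variables a summation index carries two tags, one for each of the two directions. The inner tag
  is that of the first direction, the outer tag that of the second. A contraction then splits into four
  parts, according to which of the two functions each derivative acts on.
\<close>

definition dbl1 :: "('q \<Rightarrow> 'c) \<Rightarrow> ('q \<times> bool) \<times> bool \<Rightarrow> 'c \<times> bool" where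
  "dbl1 u q = (u (fst (fst q)), snd (fst q))"
definition dbl2 :: "('q \<Rightarrow> 'c) \<Rightarrow> ('q \<times> bool) \<times> bool \<Rightarrow> 'c \<times> bool" where
  "dbl2 v q = (v (fst (fst q)), snd q)"

lemma pos_dbl [simp]: "pos (dbl1 u) (tag y (tag x t)) = tag x (pos u t)"
  "pos (dbl2 v) (tag y (tag x t)) = tag y (pos v t)"
  by (simp_all add: pos_def dbl1_def dbl2_def tag_def)

lemma
  fixes G :: "(('q \<times> bool) \<times> bool) \<times> int \<Rightarrow> 'k::banach"
  assumes "G abs_summable_on UNIV"
  shows summable_tag_tag: "(\<lambda>t. G (tag y (tag x t))) summable_on UNIV"
   and infsum_tag_tag: "(\<Sum>\<^sub>\<infinity>t. G t) = (\<Sum>\<^sub>\<infinity>t. G (tag True (tag True t))) + (\<Sum>\<^sub>\<infinity>t. G (tag True (tag False t)))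
    + ((\<Sum>\<^sub>\<infinity>t. G (tag False (tag True t))) + (\<Sum>\<^sub>\<infinity>t. G (tag False (tag False t))))"
proof -
  note a = infsum_tag(1)[OF assms]
  show "(\<lambda>t. G (tag y (tag x t))) summable_on UNIV"
    by (rule abs_summable_summable[OF infsum_tag(1)[OF a]])
  show "(\<Sum>\<^sub>\<infinity>t. G t) = (\<Sum>\<^sub>\<infinity>t. G (tag True (tag True t))) + (\<Sum>\<^sub>\<infinity>t. G (tag True (tag False t)))
    + ((\<Sum>\<^sub>\<infinity>t. G (tag False (tag True t))) + (\<Sum>\<^sub>\<infinity>t. G (tag False (tag False t))))"
    by (simp only: infsum_tag(2)[OF assms] infsum_tag(2)[OF a])
qed

lemma contract_dbl:
  fixes h :: "(('c \<times> bool) \<times> int) list \<Rightarrow> 'k::{real_normed_field,banach}" and u :: "'q::finite \<Rightarrow> 'c"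
  assumes "tame N A \<beta>" "rapid h"
  shows "contract \<beta> (dbl1 u) (dbl2 v) h l =
    (\<Sum>\<^sub>\<infinity>t. \<beta> (tag True (tag True t)) * h (tag True (pos u t) # tag True (pos v t) # l))
    + (\<Sum>\<^sub>\<infinity>t. \<beta> (tag True (tag False t)) * h (tag False (pos u t) # tag True (pos v t) # l))
    + ((\<Sum>\<^sub>\<infinity>t. \<beta> (tag False (tag True t)) * h (tag True (pos u t) # tag False (pos v t) # l))
      + (\<Sum>\<^sub>\<infinity>t. \<beta> (tag False (tag False t)) * h (tag False (pos u t) # tag False (pos v t) # l)))"
  unfolding contract_def by (subst infsum_tag_tag[OF rapid_contract_summable[OF assms]]) (simp only: pos_dbl)

lemma tame_base: "tame N A \<beta> \<Longrightarrow> tame N A (\<lambda>t. \<beta> (base t))"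
  unfolding tame_def by (metis tag_simps(5))

text \<open>
  The Leibniz rule for a second-order operator: the coefficients do not see the tags, so all four parts
  occur with the same weight.
\<close>

lemma contract_diagonal:
  fixes h :: "(('c \<times> bool) \<times> int) list \<Rightarrow> 'k::{real_normed_field,banach}" and u :: "'q::finite \<Rightarrow> 'c"
  assumes \<beta>: "tame N A \<beta>" and h: "rapid h"
  shows "contract \<beta> u v (diagonal h) = diagonal (contract (\<lambda>t. \<beta> (base (base t))) (dbl1 u) (dbl2 v) h)"
proof
  fix l
  let ?G = "\<lambda>x y t l'. \<beta> t * h (tag x (pos u t) # tag y (pos v t) # l')"
  have b2: "tame N A (\<lambda>t. \<beta> (base (base t)))" by (rule tame_base[OF tame_base[OF \<beta>]])
  have s: "?G x y t l' = (\<lambda>t. \<beta> (base (base t)) * h (pos (dbl1 u) t # pos (dbl2 v) t # l')) (tag y (tag x t))" for x y t l'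
    by simp
  have S: "(\<lambda>t. ?G x y t l') summable_on UNIV" for x y l'
    unfolding s by (rule summable_tag_tag[OF rapid_contract_summable[OF b2 h]])
  have "contract (\<lambda>t. \<beta> (base (base t))) (dbl1 u) (dbl2 v) h l'
      = (\<Sum>\<^sub>\<infinity>t. (?G True True t l' + ?G False True t l') + (?G True False t l' + ?G False False t l'))" for l'
    unfolding contract_dbl[OF b2 h] by (simp add: infsum_add[OF summable_on_add[OF S S] summable_on_add[OF S S]] infsum_add[OF S S])
  then have "contract (\<lambda>t. \<beta> (base (base t))) (dbl1 u) (dbl2 v) h =
      (\<lambda>l'. \<Sum>\<^sub>\<infinity>t. (?G True True t l' + ?G False True t l') + (?G True False t l' + ?G False False t l'))"
    by (rule ext)
  then have "diagonal (contract (\<lambda>t. \<beta> (base (base t))) (dbl1 u) (dbl2 v) h) l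
      = merge_tags l (\<lambda>l'. \<Sum>\<^sub>\<infinity>t. (?G True True t l' + ?G False True t l') + (?G True False t l' + ?G False False t l'))"
    by (simp only: diagonal_def)
  also have "\<dots> = (\<Sum>\<^sub>\<infinity>t. merge_tags l (\<lambda>l'. (?G True True t l' + ?G False True t l') + (?G True False t l' + ?G False False t l')))"
    by (rule merge_tags_infsum[OF summable_on_add[OF summable_on_add[OF S S] summable_on_add[OF S S]]])
  also have "\<dots> = contract \<beta> u v (diagonal h) l"
    unfolding contract_def
  proof (rule infsum_cong)
    fix t
    have "(\<lambda>l'. (?G True True t l' + ?G False True t l') + (?G True False t l' + ?G False False t l'))
      = (\<lambda>l'. \<beta> t * ((h (tag True (pos u t) # tag True (pos v t) # l') + h (tag False (pos u t) # tag True (pos v t) # l'))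
        + (h (tag True (pos u t) # tag False (pos v t) # l') + h (tag False (pos u t) # tag False (pos v t) # l'))))"
      by (simp only: distrib_left)
    then show "merge_tags l (\<lambda>l'. (?G True True t l' + ?G False True t l') + (?G True False t l' + ?G False False t l'))
      = \<beta> t * diagonal h (pos u t # pos v t # l)"
      by (simp add: merge_tags_scale diagonal_def)
  qed
  finally show "contract \<beta> u v (diagonal h) l = diagonal (contract (\<lambda>t. \<beta> (base (base t))) (dbl1 u) (dbl2 v) h) l" ..
qed

text \<open>
  Coefficients for one of the four parts. In this way \<open>\<Delta> \<otimes> 1\<close>, \<open>1 \<otimes> \<Delta>\<close> and the two crossed parts are
  contractions with common directions: they commute, and sums of operators are sums of coefficients.
\<close>

definition at_pos :: "bool \<Rightarrow> bool \<Rightarrow> ('q \<times> int \<Rightarrow> 'k) \<Rightarrow> (('q \<times> bool) \<times> bool) \<times> int \<Rightarrow> 'k::zero" where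
  "at_pos x y \<beta> t = (if side (base t) = x \<and> side t = y then \<beta> (base (base t)) else 0)"

lemma tame_at_pos: assumes "tame N A \<beta>" shows "tame N A (at_pos x y \<beta>)"
  unfolding tame_def at_pos_def
proof
  fix j
  show "norm (if side (base j) = x \<and> side j = y then \<beta> (base (base j)) else 0) \<le> A * wt j ^ N"
    using tameD[OF assms, of "base (base j)"] tame_nonneg[OF assms] by simp
qed

lemma contract_at_pos:
  fixes h :: "(('c \<times> bool) \<times> int) list \<Rightarrow> 'k::{real_normed_field,banach}" and u :: "'q::finite \<Rightarrow> 'c"
  assumes \<beta>: "tame N A \<beta>" and h: "rapid h"
  shows "contract (at_pos x y \<beta>) (dbl1 u) (dbl2 v) h l = (\<Sum>\<^sub>\<infinity>t. \<beta> t * h (tag x (pos u t) # tag y (pos v t) # l))"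
  unfolding contract_dbl[OF tame_at_pos[OF \<beta>] h] by (cases x; cases y) (simp_all add: at_pos_def)

lemma contract_tens_left:
  fixes f g :: "('c \<times> int) list \<Rightarrow> 'k::{real_normed_field,banach}" and u :: "'q::finite \<Rightarrow> 'c"
  assumes \<beta>: "tame N A \<beta>" and fg: "rapid f" "rapid g"
  shows "contract (at_pos True True \<beta>) (dbl1 u) (dbl2 v) (tens f g) = tens (contract \<beta> u v f) g"
  unfolding fun_eq_iff contract_at_pos[OF \<beta> rapid_tens[OF fg]]
  by (simp add: tens_def contract_def infsum_cmult_left' flip: mult.assoc)

lemma contract_tens_right:
  fixes f g :: "('c \<times> int) list \<Rightarrow> 'k::{real_normed_field,banach}" and u :: "'q::finite \<Rightarrow> 'c"
  assumes \<beta>: "tame N A \<beta>" and fg: "rapid f" "rapid g"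
  shows "contract (at_pos False False \<beta>) (dbl1 u) (dbl2 v) (tens f g) = tens f (contract \<beta> u v g)"
proof
  fix l
  let ?F = "f (map base (filter side l))" and ?g = "\<lambda>t. g (pos u t # pos v t # map base (filter (\<lambda>j. \<not> side j) l))"
  have "contract (at_pos False False \<beta>) (dbl1 u) (dbl2 v) (tens f g) l = (\<Sum>\<^sub>\<infinity>t. ?F * (\<beta> t * ?g t))"
    unfolding contract_at_pos[OF \<beta> rapid_tens[OF fg]] by (intro infsum_cong) (simp add: tens_def)
  then show "contract (at_pos False False \<beta>) (dbl1 u) (dbl2 v) (tens f g) l = tens f (contract \<beta> u v g) l"
    by (simp add: infsum_cmult_right' tens_def contract_def)
qed

lemma contract_pow_tens_left:
  fixes f g :: "('c \<times> int) list \<Rightarrow> 'k::{real_normed_field,banach}" and u :: "'q::finite \<Rightarrow> 'c"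
  assumes \<beta>: "tame N A \<beta>" and fg: "connes_coef f" "connes_coef g"
  shows "(contract (at_pos True True \<beta>) (dbl1 u) (dbl2 v) ^^ n) (tens f g) = tens ((contract \<beta> u v ^^ n) f) g"
  by (induction n)
    (simp_all add: contract_tens_left[OF \<beta> connes_coefD(1)[OF connes_coef_contract_pow[OF \<beta> fg(1)]] connes_coefD(1)[OF fg(2)]])

lemma contract_pow_tens_right:
  fixes f g :: "('c \<times> int) list \<Rightarrow> 'k::{real_normed_field,banach}" and u :: "'q::finite \<Rightarrow> 'c"
  assumes \<beta>: "tame N A \<beta>" and fg: "connes_coef f" "connes_coef g"
  shows "(contract (at_pos False False \<beta>) (dbl1 u) (dbl2 v) ^^ n) (tens f g) = tens f ((contract \<beta> u v ^^ n) g)"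
  by (induction n)
    (simp_all add: contract_tens_right[OF \<beta> connes_coefD(1)[OF fg(1)] connes_coefD(1)[OF connes_coef_contract_pow[OF \<beta> fg(2)]]])

lemma contract_pow_diagonal:
  fixes h :: "(('c \<times> bool) \<times> int) list \<Rightarrow> 'k::{real_normed_field,banach}" and u :: "'q::finite \<Rightarrow> 'c"
  assumes \<beta>: "tame N A \<beta>" and h: "connes_coef h"
  shows "(contract \<beta> u v ^^ n) (diagonal h) = diagonal ((contract (\<lambda>t. \<beta> (base (base t))) (dbl1 u) (dbl2 v) ^^ n) h)"
proof (induction n)
  case (Suc n)
  have "connes_coef ((contract (\<lambda>t. \<beta> (base (base t))) (dbl1 u) (dbl2 v) ^^ n) h)"
    by (rule connes_coef_contract_pow[OF tame_base[OF tame_base[OF \<beta>]] h])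
  then show ?case by (simp add: Suc.IH contract_diagonal[OF \<beta> connes_coefD(1)])
qed simp

lemma diagonal_sum:
  "finite K \<Longrightarrow> diagonal (\<lambda>l. \<Sum>k\<in>K. F k l) l = (\<Sum>k\<in>K. diagonal (F k) l)"
proof -
  assume K: "finite K"
  have "merge_tags l (\<lambda>l. \<Sum>k\<in>K. F k l) = (\<Sum>k\<in>K. merge_tags l (F k))"
    by (induction l arbitrary: F) (simp_all flip: sum.distrib)
  then show ?thesis by (simp add: diagonal_def)
qed

lemma diagonal_scale: "diagonal (\<lambda>l'. c * h l') l = c * diagonal h l" for c :: "'k::real_normed_field"
  by (simp add: diagonal_def merge_tags_scale)

text \<open>
  The operator \<open>C\<^sup>A\<^sub>1\<close> before restriction to the diagonal, when \<open>u\<close> selects the directions \<open>\<gamma>\<close> and \<open>v\<close> the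
  dual directions \<open>\<gamma>\<^sup>*\<close>: the part with tags \<open>True\<close>, \<open>False\<close> differentiates \<open>F\<close> along \<open>\<gamma>\<close> and \<open>G\<close> along \<open>\<gamma>\<^sup>*\<close>.
\<close>

definition bidiff_op :: "('q \<times> int \<Rightarrow> 'k) \<Rightarrow> ('q \<Rightarrow> 'c) \<Rightarrow> ('q \<Rightarrow> 'c) \<Rightarrow>
    ((('c \<times> bool) \<times> int) list \<Rightarrow> 'k) \<Rightarrow> (('c \<times> bool) \<times> int) list \<Rightarrow> 'k::{real_normed_field,banach}" where
  "bidiff_op \<alpha> u v = contract (\<lambda>t. at_pos True False (\<lambda>t. \<alpha> t + 1) t + at_pos False True (\<lambda>t. \<alpha> t - 1) t) (dbl1 u) (dbl2 v)"

definition star_coef :: "('q \<times> int \<Rightarrow> 'k) \<Rightarrow> ('q \<Rightarrow> 'c) \<Rightarrow> ('q \<Rightarrow> 'c) \<Rightarrow> nat \<Rightarrow>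
    (('c \<times> int) list \<Rightarrow> 'k) \<Rightarrow> (('c \<times> int) list \<Rightarrow> 'k) \<Rightarrow> ('c \<times> int) list \<Rightarrow> 'k::{real_normed_field,banach}" where
  "star_coef \<alpha> u v r f g l = diagonal ((bidiff_op \<alpha> u v ^^ r) (tens f g)) l / fact r"

text \<open>
  The coefficient of \<open>\<hbar>\<close> to the power \<open>r\<close> in \<open>exp (-\<hbar>\<Delta>)\<close>.
\<close>

definition T_coef :: "('q \<times> int \<Rightarrow> 'k) \<Rightarrow> ('q \<Rightarrow> 'c) \<Rightarrow> ('q \<Rightarrow> 'c) \<Rightarrow> nat \<Rightarrow>
    (('c \<times> int) list \<Rightarrow> 'k) \<Rightarrow> ('c \<times> int) list \<Rightarrow> 'k::{real_normed_field,banach}" where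
  "T_coef \<alpha> u v r f l = (contract (\<lambda>t. - \<alpha> t) u v ^^ r) f l / fact r"

lemma sum_triangle:
  fixes F :: "nat \<Rightarrow> nat \<Rightarrow> nat \<Rightarrow> 'a::comm_monoid_add"
  shows "(\<Sum>m\<le>n. \<Sum>p\<le>n - m. F m p (n - m - p)) = (\<Sum>p\<le>n. \<Sum>q\<le>n - p. F (n - p - q) p q)"
proof -
  have "(\<Sum>m\<le>n. \<Sum>p\<le>n - m. F m p (n - m - p)) = (\<Sum>(m, p)\<in>(SIGMA m:{..n}. {..n - m}). F m p (n - m - p))"
    by (simp add: sum.Sigma)
  also have "\<dots> = (\<Sum>(p, q)\<in>(SIGMA p:{..n}. {..n - p}). F (n - p - q) p q)"
    by (rule sum.reindex_bij_witness[where j = "\<lambda>(m, p). (p, n - m - p)" and i = "\<lambda>(p, q). (n - p - q, p)"])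
      (auto simp: diff_diff_eq2)
  also have "\<dots> = (\<Sum>p\<le>n. \<Sum>q\<le>n - p. F (n - p - q) p q)"
    by (simp add: sum.Sigma)
  finally show ?thesis .
qed

lemma tame_plus:
  assumes "tame N A \<beta>" "tame N A' \<gamma>" shows "tame N (A + A') (\<lambda>t. \<beta> t + \<gamma> t)"
  unfolding tame_def
proof
  fix j show "norm (\<beta> j + \<gamma> j) \<le> (A + A') * wt j ^ N"
    unfolding distrib_right by (intro norm_triangle_mono tameD[OF assms(1)] tameD[OF assms(2)])
qed

lemma tame_uminus: "tame N A \<beta> \<Longrightarrow> tame N A (\<lambda>t. - \<beta> t)"
  unfolding tame_def by simp

lemma tame_const: "tame N (norm c) (\<lambda>t. c)"
  unfolding tame_def using mult_left_mono[OF one_le_power[OF wt_ge_1] norm_ge_zero] by fastforce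

lemma tame_bidiff_op:
  fixes \<alpha> :: "'q \<times> int \<Rightarrow> 'k::real_normed_field"
  assumes "tame N A \<alpha>"
  shows "tame N ((A + 1) + (A + 1)) (\<lambda>t. at_pos True False (\<lambda>t. \<alpha> t + 1) t + at_pos False True (\<lambda>t. \<alpha> t - 1) t)"
  using tame_plus[OF tame_at_pos[OF tame_plus[OF assms tame_const[of N 1]]] tame_at_pos[OF tame_plus[OF assms tame_const[of N "-1"]]], of True False False True]
  by simp

lemma fact_divide_choose: "k \<le> n \<Longrightarrow> of_nat (n choose k) / fact n = 1 / (fact k * fact (n - k) :: 'k::real_normed_field)"
  by (simp add: binomial_fact)

text \<open>
  Both sides equal the degree \<open>n\<close> part of \<open>exp (\<hbar> (P - \<Delta> \<otimes> 1 - 1 \<otimes> \<Delta>))\<close> applied to \<open>tens f g\<close> and restricted to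
  the diagonal. On the left \<open>- \<Delta>\<close> is moved inside the restriction by the Leibniz rule and combined with
  \<open>P + E\<^sub>A\<close>; on the right the two copies of \<open>\<Delta>\<close> are split off again. Each step is a binomial expansion.
\<close>

theorem star_coef_equivalence:
  fixes f g :: "('c \<times> int) list \<Rightarrow> 'k::{real_normed_field,banach}" and u :: "'q::finite \<Rightarrow> 'c"
  assumes \<alpha>: "tame N A \<alpha>" and f: "connes_coef f" and g: "connes_coef g"
  shows "(\<Sum>r\<le>n. T_coef \<alpha> u v r (star_coef \<alpha> u v (n - r) f g) l)
    = (\<Sum>p\<le>n. \<Sum>q\<le>n - p. star_coef (\<lambda>_. 0) u v (n - p - q) (T_coef \<alpha> u v p f) (T_coef \<alpha> u v q g) l)"
proof -
  let ?U = "dbl1 u" and ?V = "dbl2 v" and ?h = "tens f g"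
  let ?d = "\<lambda>t. - \<alpha> t"
  let ?D = "contract ?d u v"
  define bA where "bA = (\<lambda>t. at_pos True False (\<lambda>t. \<alpha> t + 1) t + at_pos False True (\<lambda>t. \<alpha> t - 1) t)"
  define b0 where "b0 = (\<lambda>t. at_pos True False (\<lambda>t::'q \<times> int. 0 + 1 :: 'k) t + at_pos False True (\<lambda>t. 0 - 1) t)"
  define d2 where "d2 = (\<lambda>t. ?d (base (base t)))"
  define dL where "dL = at_pos True True ?d"
  define dR where "dR = at_pos False False ?d"
  have d: "tame N A ?d" by (rule tame_uminus[OF \<alpha>])
  have tA: "tame N ((A + 1) + (A + 1)) bA" unfolding bA_def by (rule tame_bidiff_op[OF \<alpha>])
  have t0: "tame N ((0 + 1) + (0 + 1)) b0"
    unfolding b0_def using tame_bidiff_op[of N 0 "\<lambda>_. 0 :: 'k"] by (simp add: tame_def)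
  have td2: "tame N A d2" unfolding d2_def by (rule tame_base[OF tame_base[OF d]])
  have tL: "tame N A dL" and tR: "tame N A dR"
    unfolding dL_def dR_def by (rule tame_at_pos[OF d])+
  have h: "connes_coef ?h" by (rule connes_coef_tens[OF f g])
  \<comment> \<open>The numbers \<open>\<alpha>\<close> cancel in the crossed parts, where \<open>\<plusminus> 1\<close> remains, and survive with a minus sign in the other two.\<close>
  have eq: "(\<lambda>t. d2 t + bA t) = (\<lambda>t. b0 t + (dL t + dR t))"
    by (auto simp: fun_eq_iff d2_def bA_def b0_def dL_def dR_def at_pos_def)
  have L: "(\<Sum>r\<le>n. T_coef \<alpha> u v r (star_coef \<alpha> u v (n - r) f g) l)
    = diagonal ((contract (\<lambda>t. d2 t + bA t) ?U ?V ^^ n) ?h) l / fact n"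
  proof -
    have "T_coef \<alpha> u v r (star_coef \<alpha> u v (n - r) f g) l
        = of_nat (n choose r) * diagonal ((contract d2 ?U ?V ^^ r) ((contract bA ?U ?V ^^ (n - r)) ?h)) l / fact n"
      if r: "r \<le> n" for r
    proof -
      have *: "(?D ^^ r) (\<lambda>l. c * F l) = (\<lambda>l. c * (?D ^^ r) F l)" for c F
        by (induction r) (simp_all add: contract_scale)
      have **: "(?D ^^ r) (\<lambda>l. F l / c) = (\<lambda>l. (?D ^^ r) F l / c)" for c F
        using *[of "1 / c" F] by simp
      have "star_coef \<alpha> u v (n - r) f g = (\<lambda>l. (1 / fact (n - r)) * diagonal ((contract bA ?U ?V ^^ (n - r)) ?h) l)"
        by (simp add: star_coef_def bidiff_op_def bA_def fun_eq_iff)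
      then have "T_coef \<alpha> u v r (star_coef \<alpha> u v (n - r) f g) l
          = (1 / (fact r * fact (n - r))) * (?D ^^ r) (diagonal ((contract bA ?U ?V ^^ (n - r)) ?h)) l"
        by (simp add: T_coef_def **)
      also have "(?D ^^ r) (diagonal ((contract bA ?U ?V ^^ (n - r)) ?h)) = diagonal ((contract d2 ?U ?V ^^ r) ((contract bA ?U ?V ^^ (n - r)) ?h))"
        unfolding d2_def by (rule contract_pow_diagonal[OF d connes_coef_contract_pow[OF tA h]])
      finally show ?thesis using fact_divide_choose[OF r, where 'k = 'k, symmetric] by simp
    qed
    then have "(\<Sum>r\<le>n. T_coef \<alpha> u v r (star_coef \<alpha> u v (n - r) f g) l)
        = (\<Sum>r\<le>n. diagonal (\<lambda>l. of_nat (n choose r) * (contract d2 ?U ?V ^^ r) ((contract bA ?U ?V ^^ (n - r)) ?h) l) l) / fact n"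
      by (simp add: sum_divide_distrib diagonal_scale)
    also have "\<dots> = diagonal (\<lambda>l. (\<Sum>r\<le>n. of_nat (n choose r) * (contract d2 ?U ?V ^^ r) ((contract bA ?U ?V ^^ (n - r)) ?h) l)) l / fact n"
      by (simp only: diagonal_sum finite_atMost)
    also have "(\<lambda>l. \<Sum>r\<le>n. of_nat (n choose r) * (contract d2 ?U ?V ^^ r) ((contract bA ?U ?V ^^ (n - r)) ?h) l)
        = (contract (\<lambda>t. d2 t + bA t) ?U ?V ^^ n) ?h"
      by (rule ext) (rule contract_binomial[OF td2 tA h, symmetric])
    finally show ?thesis .
  qed
  define E where "E m p q = diagonal ((contract b0 ?U ?V ^^ m) (tens ((?D ^^ p) f) ((?D ^^ q) g))) l" for m p q
  have R0: "star_coef (\<lambda>_. 0) u v m (T_coef \<alpha> u v p f) (T_coef \<alpha> u v q g) l = E m p q / (fact m * fact p * fact q)" for m p q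
  proof -
    have *: "(contract b0 ?U ?V ^^ m) (\<lambda>l. c * F l) = (\<lambda>l. c * (contract b0 ?U ?V ^^ m) F l)" for c F
      by (induction m) (simp_all add: contract_scale)
    have "tens (T_coef \<alpha> u v p f) (T_coef \<alpha> u v q g) = (\<lambda>l. (1 / (fact p * fact q)) * tens ((?D ^^ p) f) ((?D ^^ q) g) l)"
      by (simp add: tens_def T_coef_def fun_eq_iff)
    moreover have "bidiff_op (\<lambda>_. 0) u v = contract b0 ?U ?V" by (simp add: bidiff_op_def b0_def)
    ultimately show ?thesis
      by (simp only: star_coef_def * diagonal_scale E_def) (simp add: field_simps)
  qed
  have "(contract (\<lambda>t. b0 t + (dL t + dR t)) ?U ?V ^^ n) ?h
      = (\<lambda>l. \<Sum>m\<le>n. \<Sum>p\<le>n - m. of_nat (n choose m) * of_nat ((n - m) choose p) * (contract b0 ?U ?V ^^ m) (tens ((?D ^^ p) f) ((?D ^^ (n - m - p)) g)) l)"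
  proof
    fix l'
    have rt: "rapid (\<lambda>l. of_nat k * tens ((?D ^^ p) f) ((?D ^^ q) g) l)" for k p q
      by (intro rapid_scale connes_coefD(1) connes_coef_tens connes_coef_contract_pow[OF d] f g)
    have B: "(contract b0 ?U ?V ^^ m) (\<lambda>l. \<Sum>p\<le>j. of_nat (c p) * tens ((?D ^^ p) f) ((?D ^^ (j - p)) g) l)
       = (\<lambda>l. \<Sum>p\<le>j. of_nat (c p) * (contract b0 ?U ?V ^^ m) (tens ((?D ^^ p) f) ((?D ^^ (j - p)) g)) l)" for m j c
    proof (induction m)
      case (Suc m)
      have "rapid (\<lambda>l. of_nat (c p) * (contract b0 ?U ?V ^^ m) (tens ((?D ^^ p) f) ((?D ^^ (j - p)) g)) l)" for p
        by (intro rapid_scale connes_coefD(1) connes_coef_contract_pow[OF t0] connes_coef_tens connes_coef_contract_pow[OF d] f g)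
      then show ?case by (simp add: Suc.IH contract_sum[OF t0 finite_atMost] contract_scale)
    qed simp
    have C: "(contract (\<lambda>t. dL t + dR t) ?U ?V ^^ j) ?h = (\<lambda>l. \<Sum>p\<le>j. of_nat (j choose p) * tens ((?D ^^ p) f) ((?D ^^ (j - p)) g) l)" for j
      unfolding contract_binomial[OF tL tR h, abs_def] fun_eq_iff dL_def dR_def
      by (simp add: contract_pow_tens_right[OF d f g] contract_pow_tens_left[OF d f connes_coef_contract_pow[OF d g]] contract_binomial[OF tL tR h, unfolded dL_def dR_def])
    show "(contract (\<lambda>t. b0 t + (dL t + dR t)) ?U ?V ^^ n) ?h l'
      = (\<Sum>m\<le>n. \<Sum>p\<le>n - m. of_nat (n choose m) * of_nat ((n - m) choose p) * (contract b0 ?U ?V ^^ m) (tens ((?D ^^ p) f) ((?D ^^ (n - m - p)) g)) l')"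
      by (simp only: contract_binomial[OF t0 tame_plus[OF tL tR] h] C B sum_distrib_left mult.assoc)
  qed
  then have "diagonal ((contract (\<lambda>t. b0 t + (dL t + dR t)) ?U ?V ^^ n) ?h) l / fact n
      = (\<Sum>m\<le>n. \<Sum>p\<le>n - m. of_nat (n choose m) * of_nat ((n - m) choose p) * E m p (n - m - p)) / fact n"
    by (simp add: diagonal_sum diagonal_scale E_def mult.assoc)
  also have "\<dots> = (\<Sum>m\<le>n. \<Sum>p\<le>n - m. E m p (n - m - p) / (fact m * fact p * fact (n - m - p)))"
    unfolding sum_divide_distrib
  proof (intro sum.cong refl)
    fix m p assume m: "m \<in> {..n}" and p: "p \<in> {..n - m}"
    then show "of_nat (n choose m) * of_nat ((n - m) choose p) * E m p (n - m - p) / fact n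
        = E m p (n - m - p) / (fact m * fact p * fact (n - m - p))"
      by (simp add: binomial_fact)
  qed
  also have "\<dots> = (\<Sum>p\<le>n. \<Sum>q\<le>n - p. E (n - p - q) p q / (fact (n - p - q) * fact p * fact q))"
    by (rule sum_triangle)
  finally show ?thesis unfolding L eq R0 .
qed

section \<open>Values of contracted series\<close>

lemma has_sum_of_summable_norm:
  fixes a :: "nat \<Rightarrow> 'b::banach"
  assumes "summable (\<lambda>n. norm (a n))"
  shows "(a has_sum suminf a) UNIV"
  by (rule norm_summable_imp_has_sum[OF assms summable_sums[OF summable_norm_cancel[OF assms]]])

text \<open>
  The bound is a product of a summable function of \<open>t\<close> and one of the degree and the word, so that the sums
  may be exchanged.
\<close>

lemma taylor_eval_infsum:
  fixes F :: "'t \<Rightarrow> ('c::finite \<times> int) list \<Rightarrow> 'k::{real_normed_field,banach}"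
  assumes F: "\<And>t. bnd k C (B t) (F t)" and B: "B summable_on UNIV" and x: "tame N A x"
    and k: "N + 2 \<le> k" and C: "C > 0" "2 * (A * wsum TYPE('c)) \<le> C"
  shows "taylor_eval (\<lambda>l. \<Sum>\<^sub>\<infinity>t. F t l) x = (\<Sum>\<^sub>\<infinity>t. taylor_eval (F t) x)"
proof -
  have A: "A \<ge> 0" by (rule tame_nonneg[OF x])
  have B0: "B t \<ge> 0" for t by (rule bnd_nonneg[OF F])
  have ev: "form_eval n (\<lambda>l. \<Sum>\<^sub>\<infinity>t. F t l) (\<lambda>_. x) = (\<Sum>\<^sub>\<infinity>t. form_eval n (F t) (\<lambda>_. x))" for n
  proof -
    let ?h = "\<lambda>l::('c \<times> int) list. fact n * (\<Prod>i<n. A / C * (1 / (wt (l ! i))\<^sup>2))"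
    have "form_eval n (\<lambda>l. \<Sum>\<^sub>\<infinity>t. F t l) (\<lambda>_. x)
        = (\<Sum>\<^sub>\<infinity>l\<in>{l. length l = n}. \<Sum>\<^sub>\<infinity>t. F t l * (\<Prod>i<n. x (l ! i)))"
      unfolding form_eval_def by (simp only: infsum_cmult_left')
    also have "\<dots> = (\<Sum>\<^sub>\<infinity>t. \<Sum>\<^sub>\<infinity>l\<in>{l. length l = n}. F t l * (\<Prod>i<n. x (l ! i)))"
    proof (rule infsum_swap_dominated[where g = ?h and h = B])
      show "?h summable_on {l. length l = n}"
        by (rule has_sum_imp_summable[OF has_sum_form_eval_bound[OF A C(1)]])
      show "0 \<le> ?h l" for l using A C by (auto intro!: mult_nonneg_nonneg prod_nonneg)
      show "norm (F t l * (\<Prod>i<n. x (l ! i))) \<le> ?h l * B t" if "l \<in> {l. length l = n}" for l t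
      proof -
        have "norm (F t l * (\<Prod>i<n. x (l ! i))) \<le> (B t * fact n) * (\<Prod>i<n. A / C * (1 / (wt (l ! i))\<^sup>2))"
          using that bndD[OF F[of t], of l] by (intro norm_form_eval_term_le[OF _ x k C(1)]) auto
        then show ?thesis by (simp only: mult_ac)
      qed
    qed (use B B0 in auto)
    finally show ?thesis by (simp only: form_eval_def)
  qed
  let ?a = "\<lambda>n t. form_eval n (F t) (\<lambda>_. x) / fact n"
  have le: "norm (?a n t) \<le> (1 / 2) ^ n * B t" for n t
    using norm_taylor_eval_term_le[OF F x k C, of n t] by (simp only: mult.commute)
  have g: "(\<lambda>n. (1 / 2 :: real) ^ n) summable_on UNIV"
    by (rule summable_nonneg_imp_summable_on) (auto intro: summable_geometric)
  have "taylor_eval (\<lambda>l. \<Sum>\<^sub>\<infinity>t. F t l) x = (\<Sum>n. \<Sum>\<^sub>\<infinity>t. ?a n t)"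
    unfolding taylor_eval_def ev by (simp only: divide_inverse infsum_cmult_left')
  also have "\<dots> = (\<Sum>\<^sub>\<infinity>n. \<Sum>\<^sub>\<infinity>t. ?a n t)"
  proof (rule infsumI[OF has_sum_of_summable_norm, symmetric])
    have "norm (\<Sum>\<^sub>\<infinity>t. ?a n t) \<le> (1 / 2) ^ n * infsum B UNIV" for n
      unfolding infsum_cmult_right'[symmetric]
      by (rule abs_le_summable(3)[OF summable_on_cmult_right[OF B] le])
    then show "summable (\<lambda>n. norm (\<Sum>\<^sub>\<infinity>t. ?a n t))"
      by (intro summable_comparison_test'[OF summable_mult2[OF summable_geometric[of "1 / 2 :: real"]]]) auto
  qed
  also have "\<dots> = (\<Sum>\<^sub>\<infinity>t. \<Sum>\<^sub>\<infinity>n. ?a n t)"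
    by (rule infsum_swap_dominated[OF g B _ _ le]) (use B0 in auto)
  also have "\<dots> = (\<Sum>\<^sub>\<infinity>t. taylor_eval (F t) x)"
    unfolding taylor_eval_def
    by (intro infsum_cong infsumI has_sum_of_summable_norm summable_norm_taylor_eval[OF F x k C])
  finally show "taylor_eval (\<lambda>l. \<Sum>\<^sub>\<infinity>t. F t l) x = (\<Sum>\<^sub>\<infinity>t. taylor_eval (F t) x)" .
qed

definition shift2 :: "('q \<Rightarrow> 'c) \<Rightarrow> ('q \<Rightarrow> 'c) \<Rightarrow> 'q \<times> int \<Rightarrow> (('c \<times> int) list \<Rightarrow> 'k) \<Rightarrow> ('c \<times> int) list \<Rightarrow> 'k" where
  "shift2 u v t f = shift (pos v t) (shift (pos u t) f)"

lemma connes_coef_shift2: "connes_coef f \<Longrightarrow> connes_coef (shift2 u v t f)"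
  by (simp add: shift2_def connes_coef_shift)

lemma tame_le_inverse_square:
  fixes t :: "'q \<times> int"
  assumes "tame N A \<beta>" "N + 2 \<le> k"
  shows "norm (\<beta> t) * (1 / (wt t ^ k * wt t ^ k)) \<le> A * (1 / (wt t)\<^sup>2)"
proof -
  have "wt t ^ N * (wt t)\<^sup>2 \<le> wt t ^ k"
    unfolding power_add[symmetric] using assms(2) by (intro power_increasing) auto
  also have "\<dots> \<le> wt t ^ k * wt t ^ k"
    using one_le_power[OF wt_ge_1, of t k] by simp
  finally have 2: "wt t ^ N * (1 / (wt t ^ k * wt t ^ k)) \<le> 1 / (wt t)\<^sup>2"
    by (simp add: field_simps)
  have "norm (\<beta> t) * (1 / (wt t ^ k * wt t ^ k)) \<le> A * wt t ^ N * (1 / (wt t ^ k * wt t ^ k))"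
    by (rule mult_right_mono[OF tameD[OF assms(1)]]) simp
  also have "\<dots> \<le> A * (1 / (wt t)\<^sup>2)"
    unfolding mult.assoc by (rule mult_left_mono[OF 2 tame_nonneg[OF assms(1)]])
  finally show ?thesis .
qed

lemma taylor_eval_contract:
  fixes f :: "('c::finite \<times> int) list \<Rightarrow> 'k::{real_normed_field,banach}" and u :: "'q::finite \<Rightarrow> 'c"
  assumes \<beta>: "tame N A \<beta>" and f: "rapid f" and x: "tame N' A' x"
  shows "taylor_eval (contract \<beta> u v f) x = (\<Sum>\<^sub>\<infinity>t. \<beta> t * taylor_eval (shift2 u v t f) x)"
proof -
  let ?k = "max N N' + 2"
  let ?C = "2 * (A' * wsum TYPE('c)) + 1"
  have C: "?C > 0" "2 * (A' * wsum TYPE('c)) \<le> ?C"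
    using tame_nonneg[OF x] wsum_nonneg[where 'c = 'c] by (simp_all add: add_nonneg_pos)
  have C4: "4 * ?C > 0" using C(1) by simp
  obtain M where M: "bnd ?k (4 * ?C) M f" using rapidD[OF f C4] .
  let ?D = "M / (2 * ?C\<^sup>2)"
  have D: "?D \<ge> 0" using bnd_nonneg[OF M] by simp
  have b: "bnd ?k ?C (norm (\<beta> t) * (?D / (wt t ^ ?k * wt t ^ ?k))) (\<lambda>l. \<beta> t * shift2 u v t f l)" for t
    unfolding shift2_def by (rule bnd_scale[OF bnd_shift2[OF M C(1)]])
  have b': "bnd ?k ?C (?D * A * (1 / (wt t)\<^sup>2)) (\<lambda>l. \<beta> t * shift2 u v t f l)" for t
  proof (rule bnd_mono[OF b C(1)])
    have "?D * (norm (\<beta> t) * (1 / (wt t ^ ?k * wt t ^ ?k))) \<le> ?D * (A * (1 / (wt t)\<^sup>2))"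
      by (rule mult_left_mono[OF tame_le_inverse_square[OF \<beta>] D]) simp
    then show "norm (\<beta> t) * (?D / (wt t ^ ?k * wt t ^ ?k)) \<le> ?D * A * (1 / (wt t)\<^sup>2)"
      by (simp add: mult_ac)
  qed auto
  have "taylor_eval (contract \<beta> u v f) x = taylor_eval (\<lambda>l. \<Sum>\<^sub>\<infinity>t. \<beta> t * shift2 u v t f l) x"
    by (simp only: contract_def[abs_def] shift2_def shift_def)
  also have "\<dots> = (\<Sum>\<^sub>\<infinity>t. taylor_eval (\<lambda>l. \<beta> t * shift2 u v t f l) x)"
    by (rule taylor_eval_infsum[OF b' summable_on_cmult_right[OF summable_wt] x _ C]) simp
  also have "\<dots> = (\<Sum>\<^sub>\<infinity>t. \<beta> t * taylor_eval (shift2 u v t f) x)"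
    by (intro infsum_cong taylor_eval_scale[OF _ x]) (simp add: shift2_def rapid_shift f)
  finally show ?thesis .
qed

text \<open>
  The derivatives produced by one term of a power of a contraction: each letter of \<open>w\<close> stands for one factor.
\<close>

definition shiftw :: "('q \<Rightarrow> 'c) \<Rightarrow> ('q \<Rightarrow> 'c) \<Rightarrow> ('q \<times> int) list \<Rightarrow> (('c \<times> int) list \<Rightarrow> 'k) \<Rightarrow> ('c \<times> int) list \<Rightarrow> 'k" where
  "shiftw u v w f = foldr (shift2 u v) w f"

lemma connes_coef_shiftw: "connes_coef f \<Longrightarrow> connes_coef (shiftw u v w f)"
  by (induction w) (simp_all add: shiftw_def connes_coef_shift2)

lemma shift2_commute: "symm f \<Longrightarrow> shift2 u v t (shift2 u v s f) = shift2 u v s (shift2 u v t f)"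
  unfolding shift2_def shift_def fun_eq_iff by (intro allI symmD[of f]) simp_all

lemma shiftw_Cons: "connes_coef f \<Longrightarrow> shiftw u v (t # w) f = shiftw u v w (shift2 u v t f)"
proof -
  assume f: "connes_coef f"
  have "shift2 u v t (shiftw u v w f) = shiftw u v w (shift2 u v t f)"
  proof (induction w)
    case (Cons s w)
    then show ?case
      using shift2_commute[OF connes_coefD(2)[OF connes_coef_shiftw[OF f]], of u v t s u v w] by (simp add: shiftw_def)
  qed (simp add: shiftw_def)
  then show ?thesis by (simp add: shiftw_def)
qed

lemma shift2_contract:
  assumes "connes_coef f"
  shows "shift2 u v t ((contract \<beta> u' v' ^^ n) f) = (contract \<beta> u' v' ^^ n) (shift2 u v t f)"
proof -
  have s: "symm ((contract \<beta> u' v' ^^ n) f)" for n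
    by (induction n) (simp_all add: connes_coefD(2)[OF assms] symm_contract)
  show ?thesis
    by (induction n) (simp_all add: shift2_def shift_contract s symm_shift)
qed

text \<open>
  For \<open>C \<ge> 1\<close> the constants produced by the single shifts are at most 1 and can be dropped, which keeps the
  bound a product over the letters of \<open>w\<close>.
\<close>

lemma bnd_shiftw:
  fixes f :: "('c \<times> int) list \<Rightarrow> 'k::real_normed_vector"
  assumes "bnd k (4 ^ length w * C) M f" "C \<ge> 1"
  shows "bnd k C (M * (\<Prod>t\<leftarrow>w. 1 / (wt t ^ k * wt t ^ k))) (shiftw u v w f)"
  using assms
proof (induction w arbitrary: C)
  case Nil
  then show ?case by (simp add: shiftw_def)
next
  case (Cons t w)
  let ?M = "M * (\<Prod>t\<leftarrow>w. 1 / (wt t ^ k * wt t ^ k))"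
  have "bnd k (4 * C) ?M (shiftw u v w f)"
    using Cons.prems by (intro Cons.IH) (simp_all add: mult_ac)
  note b = this bnd_shift2[OF this, of t v u]
  have "1 \<le> C\<^sup>2" using Cons.prems(2) by (rule one_le_power)
  then have "?M / (2 * C\<^sup>2) \<le> ?M / 1"
    using bnd_nonneg[OF b(1)] by (intro divide_left_mono) auto
  then have "?M / (2 * C\<^sup>2) / (wt t ^ k * wt t ^ k) \<le> ?M / 1 / (wt t ^ k * wt t ^ k)"
    by (intro divide_right_mono) auto
  then have le: "?M / (2 * C\<^sup>2) / (wt t ^ k * wt t ^ k) \<le> M * (\<Prod>t\<leftarrow>t # w. 1 / (wt t ^ k * wt t ^ k))"
    by (simp add: mult_ac)
  have sw: "shiftw u v (t # w) f = shift (pos v t) (shift (pos u t) (shiftw u v w f))"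
    by (simp add: shiftw_def shift2_def)
  have C0: "C > 0" using Cons.prems(2) by simp
  show ?case unfolding sw by (rule bnd_mono[OF b(2)[OF C0] C0 order_refl order_refl le])
qed

lemma prod_list_nth: "(\<Prod>t\<leftarrow>w. g t) = (\<Prod>i<length w. g (w ! i) :: 'a::comm_monoid_mult)"
  by (induction w) (simp_all add: prod.lessThan_Suc_shift del: prod.lessThan_Suc)

text \<open>
  The powers of bidifferential operators are given as sums over words, the powers of a contraction by
  iteration; the two agree because the sum over words converges absolutely.
\<close>

lemma taylor_eval_contract_pow:
  fixes f :: "('c::finite \<times> int) list \<Rightarrow> 'k::{real_normed_field,banach}" and u :: "'q::finite \<Rightarrow> 'c"
  assumes \<beta>: "tame N A \<beta>" and f: "connes_coef f" and x: "tame N' A' x"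
  shows "(\<Sum>\<^sub>\<infinity>w\<in>{w. length w = r}. (\<Prod>t\<leftarrow>w. \<beta> t) * taylor_eval (shiftw u v w f) x) = taylor_eval ((contract \<beta> u v ^^ r) f) x"
proof -
  have summ: "(\<lambda>w. (\<Prod>t\<leftarrow>w. \<beta> t) * taylor_eval (shiftw u v w f) x) abs_summable_on {w. length w = r}" for r
  proof -
    let ?k = "max N N' + 2"
    let ?C = "2 * (A' * wsum TYPE('c)) + 1"
    have C: "?C > 0" "2 * (A' * wsum TYPE('c)) \<le> ?C" "?C \<ge> 1"
      using tame_nonneg[OF x] wsum_nonneg[where 'c = 'c] by (simp_all add: add_nonneg_pos)
    have C4: "4 ^ r * ?C > 0" using C(1) by simp
    obtain M where M: "bnd ?k (4 ^ r * ?C) M f" using rapidD[OF connes_coefD(1)[OF f] C4] .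
    have M0: "M \<ge> 0" by (rule bnd_nonneg[OF M])
    have hs: "((\<lambda>w::('q \<times> int) list. \<Prod>i<r. A * (1 / (wt (w ! i))\<^sup>2)) has_sum (\<Prod>i<r. A * wsum TYPE('q))) {w. length w = r}"
      using tame_nonneg[OF \<beta>]
      by (intro has_sum_prod_lists[where G = "\<lambda>_ t. A * (1 / (wt t)\<^sup>2)"] has_sum_cmult_right has_sum_wt) auto
    show ?thesis
    proof (rule abs_le_summable(1)[OF summable_on_cmult_right[OF has_sum_imp_summable[OF hs], of "2 * M"]])
      fix w :: "('q \<times> int) list" assume "w \<in> {w. length w = r}"
      then have r: "length w = r" by simp
      have "bnd ?k ?C (M * (\<Prod>t\<leftarrow>w. 1 / (wt t ^ ?k * wt t ^ ?k))) (shiftw u v w f)"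
        by (rule bnd_shiftw) (use M C r in auto)
      then have P: "norm (taylor_eval (shiftw u v w f) x) \<le> 2 * (M * (\<Prod>t\<leftarrow>w. 1 / (wt t ^ ?k * wt t ^ ?k)))"
        by (rule norm_taylor_eval_le[OF _ x _ C(1,2)]) simp
      have "norm ((\<Prod>t\<leftarrow>w. \<beta> t) * taylor_eval (shiftw u v w f) x)
          \<le> norm (\<Prod>t\<leftarrow>w. \<beta> t) * (2 * (M * (\<Prod>t\<leftarrow>w. 1 / (wt t ^ ?k * wt t ^ ?k))))"
        unfolding norm_mult by (rule mult_left_mono[OF P]) simp
      also have "\<dots> = 2 * M * (\<Prod>i<r. norm (\<beta> (w ! i)) * (1 / (wt (w ! i) ^ ?k * wt (w ! i) ^ ?k)))"
        unfolding prod_list_nth r prod_norm[symmetric] prod.distrib by simp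
      also have "\<dots> \<le> 2 * M * (\<Prod>i<r. A * (1 / (wt (w ! i))\<^sup>2))"
        using M0 by (intro mult_left_mono prod_mono conjI tame_le_inverse_square[OF \<beta>]) auto
      finally show "norm ((\<Prod>t\<leftarrow>w. \<beta> t) * taylor_eval (shiftw u v w f) x) \<le> 2 * M * (\<Prod>i<r. A * (1 / (wt (w ! i))\<^sup>2))" .
    qed
  qed
  show "(\<Sum>\<^sub>\<infinity>w\<in>{w. length w = r}. (\<Prod>t\<leftarrow>w. \<beta> t) * taylor_eval (shiftw u v w f) x) = taylor_eval ((contract \<beta> u v ^^ r) f) x"
    using f summ
  proof (induction r arbitrary: f)
    case 0
    then show ?case by (simp add: shiftw_def)
  next
    case (Suc r)
    \<comment> \<open>For \<open>\<beta> t = 0\<close> summability cannot be cancelled back, but the term with \<open>t\<close> vanishes anyway.\<close>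
    have summ': "(\<lambda>w. (\<Prod>t\<leftarrow>w. \<beta> t) * taylor_eval (shiftw u v w (shift2 u v t f)) x) abs_summable_on {w. length w = n}" if "\<beta> t \<noteq> 0" for t n
    proof -
      have "(\<lambda>w. \<beta> t * ((\<Prod>t\<leftarrow>w. \<beta> t) * taylor_eval (shiftw u v w (shift2 u v t f)) x)) abs_summable_on {w. length w = n}"
        using infsum_lists_Suc(3)[OF Suc.prems(2), of t n]
        by (simp add: shiftw_Cons[OF Suc.prems(1)] mult.assoc)
      then show ?thesis using that by (simp add: norm_mult summable_on_cmult_right')
    qed
    have "(\<Sum>\<^sub>\<infinity>w\<in>{w. length w = Suc r}. (\<Prod>t\<leftarrow>w. \<beta> t) * taylor_eval (shiftw u v w f) x)
        = (\<Sum>\<^sub>\<infinity>t. \<Sum>\<^sub>\<infinity>w\<in>{w. length w = r}. \<beta> t * ((\<Prod>t\<leftarrow>w. \<beta> t) * taylor_eval (shiftw u v w (shift2 u v t f)) x))"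
      unfolding infsum_lists_Suc(1)[OF Suc.prems(2)]
      by (simp add: shiftw_Cons[OF Suc.prems(1)] mult.assoc)
    also have "\<dots> = (\<Sum>\<^sub>\<infinity>t. \<beta> t * taylor_eval (shift2 u v t ((contract \<beta> u v ^^ r) f)) x)"
    proof (rule infsum_cong)
      fix t
      show "(\<Sum>\<^sub>\<infinity>w\<in>{w. length w = r}. \<beta> t * ((\<Prod>t\<leftarrow>w. \<beta> t) * taylor_eval (shiftw u v w (shift2 u v t f)) x))
          = \<beta> t * taylor_eval (shift2 u v t ((contract \<beta> u v ^^ r) f)) x"
      proof (cases "\<beta> t = 0")
        case False
        have "(\<Sum>\<^sub>\<infinity>w\<in>{w. length w = r}. (\<Prod>t\<leftarrow>w. \<beta> t) * taylor_eval (shiftw u v w (shift2 u v t f)) x)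
            = taylor_eval ((contract \<beta> u v ^^ r) (shift2 u v t f)) x"
          by (rule Suc.IH[OF connes_coef_shift2[OF Suc.prems(1)] summ'[OF False]])
        then show ?thesis by (simp add: infsum_cmult_right' shift2_contract[OF Suc.prems(1)])
      qed simp
    qed
    also have "\<dots> = taylor_eval ((contract \<beta> u v ^^ Suc r) f) x"
      by (simp add: taylor_eval_contract[OF \<beta> connes_coefD(1)[OF connes_coef_contract_pow[OF \<beta> Suc.prems(1)]] x])
    finally show ?case .
  qed
qed

text \<open>
  Every contraction is continuous for the seminorms, at the price of a larger \<open>k\<close> and of the factor 4 in
  \<open>C\<close>. This is the continuity of the operator \<open>T\<^sub>r\<close>.
\<close>

lemma bnd_T_coef:
  fixes u :: "'q::finite \<Rightarrow> 'c"
  assumes \<alpha>: "tame N A \<alpha>" and C: "C > 0"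
  obtains c k' C' where "c \<ge> 0" "C' > 0"
    "\<And>M (f :: ('c \<times> int) list \<Rightarrow> 'k::{real_normed_field,banach}). bnd k' C' M f \<Longrightarrow> bnd k C (c * M) (T_coef \<alpha> u v r f)"
proof -
  define D where "D = A * wsum TYPE('q)"
  have D: "D \<ge> 0" using tame_nonneg[OF \<alpha>] wsum_nonneg[where 'c = 'q] by (simp add: D_def)
  have "\<exists>c k' C'. c \<ge> 0 \<and> C' > 0 \<and> N + 2 \<le> k' \<and> (\<forall>M (f :: ('c \<times> int) list \<Rightarrow> 'k). bnd k' C' M f \<longrightarrow> bnd k C (c * M) ((contract (\<lambda>t. - \<alpha> t) u v ^^ r) f))"
    using C
  proof (induction r arbitrary: k C)
    case 0
    show ?case
      by (rule exI[of _ 1], rule exI[of _ "max k (N + 2)"], rule exI[of _ C])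
        (use 0 in \<open>auto intro: bnd_mono\<close>)
  next
    case (Suc r)
    let ?k = "max k (N + 2)"
    have "4 * C > 0" using Suc.prems by simp
    from Suc.IH[OF this, of ?k] obtain c k' C' where c: "c \<ge> 0" "C' > 0" "N + 2 \<le> k'"
      and b: "\<And>M (f :: ('c \<times> int) list \<Rightarrow> 'k). bnd k' C' M f \<Longrightarrow> bnd ?k (4 * C) (c * M) ((contract (\<lambda>t. - \<alpha> t) u v ^^ r) f)"
      by blast
    have "bnd k C ((D / (2 * C\<^sup>2) * c) * M) ((contract (\<lambda>t. - \<alpha> t) u v ^^ Suc r) f)"
      if "bnd k' C' M f" for M and f :: "('c \<times> int) list \<Rightarrow> 'k"
    proof -
      have "bnd ?k C (A * wsum TYPE('q) / (2 * C\<^sup>2) * (c * M)) (contract (\<lambda>t. - \<alpha> t) u v ((contract (\<lambda>t. - \<alpha> t) u v ^^ r) f))"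
        by (rule bnd_contract[OF tame_uminus[OF \<alpha>] _ b[OF that] Suc.prems]) simp
      then show ?thesis
        using Suc.prems by (intro bnd_mono[of ?k C "A * wsum TYPE('q) / (2 * C\<^sup>2) * (c * M)" _ C k]) (auto simp: D_def mult_ac)
    qed
    moreover have "D / (2 * C\<^sup>2) * c \<ge> 0" using D c by simp
    ultimately show ?case using c by blast
  qed
  then obtain c k' C' where c: "c \<ge> 0" "C' > 0"
    and b: "\<And>M (f :: ('c \<times> int) list \<Rightarrow> 'k). bnd k' C' M f \<Longrightarrow> bnd k C (c * M) ((contract (\<lambda>t. - \<alpha> t) u v ^^ r) f)" by blast
  show ?thesis
  proof (rule that[of "1 / fact r * c" C' k'])
    fix M and f :: "('c \<times> int) list \<Rightarrow> 'k" assume "bnd k' C' M f"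
    from bnd_scale[OF b[OF this], of "1 / fact r"]
    show "bnd k C (1 / fact r * c * M) (T_coef \<alpha> u v r f)"
      by (simp add: T_coef_def[abs_def] norm_divide)
  qed (use c in auto)
qed

lemma connes_coef_T_coef:
  fixes f :: "('c \<times> int) list \<Rightarrow> 'k::{real_normed_field,banach}" and u :: "'q::finite \<Rightarrow> 'c"
  assumes "tame N A \<alpha>" "connes_coef f"
  shows "connes_coef (T_coef \<alpha> u v r f)"
  using connes_coef_scale[OF connes_coef_contract_pow[OF tame_uminus[OF assms(1)] assms(2)], of "1 / fact r" r u v]
  by (simp add: T_coef_def[abs_def])

lemma connes_coef_star_coef:
  fixes f g :: "('c \<times> int) list \<Rightarrow> 'k::{real_normed_field,banach}" and u :: "'q::finite \<Rightarrow> 'c"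
  assumes "tame N A \<alpha>" "connes_coef f" "connes_coef g"
  shows "connes_coef (star_coef \<alpha> u v r f g)"
  using connes_coef_scale[OF connes_coef_diagonal[OF connes_coef_contract_pow[OF tame_bidiff_op[OF assms(1)] connes_coef_tens[OF assms(2,3)]]], of "1 / fact r" r "dbl1 u" "dbl2 v"]
  by (simp add: star_coef_def[abs_def] bidiff_op_def)

section \<open>Functionals on loops and their Gateaux derivatives\<close>

definition amplitude :: "int \<Rightarrow> real" where
  "amplitude k = (if k = 0 then 1 else sqrt 2) / sqrt (4 * pi\<^sup>2 * (of_int k)\<^sup>2 + 1)"

definition phase :: "int \<Rightarrow> real" where
  "phase k = (if k \<ge> 0 then 0 else - (pi / 2))"

text \<open>
  The \<open>m\<close>-th derivative of a basis function. With the phase \<open>- pi / 2\<close> at negative frequencies the sines become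
  cosines, and differentiation is a quarter turn of the phase, so that one formula covers all cases.
\<close>

definition trig :: "nat \<Rightarrow> int \<Rightarrow> real \<Rightarrow> real" where
  "trig m k s = amplitude k * (2 * pi * of_int k) ^ m * cos (2 * pi * of_int k * s + phase k + of_nat m * (pi / 2))"

text \<open>
  The operator \<open>1 - d\<^sup>2/ds\<^sup>2\<close> turns the inner product of \<open>\<H>\<close> into that of \<open>L\<^sup>2\<close>; this is its eigenvalue at
  frequency \<open>k\<close>.
\<close>

definition eigenvalue :: "int \<Rightarrow> real" where
  "eigenvalue k = 4 * pi\<^sup>2 * (of_int k)\<^sup>2 + 1"

lemma eigenvalue_ge_1: "eigenvalue k \<ge> 1" by (simp add: eigenvalue_def)

lemma eigenvalue_pos [simp]: "eigenvalue k > 0" "eigenvalue k \<noteq> 0" using eigenvalue_ge_1[of k] by linarith+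

lemma eigenvalue_le: "eigenvalue (snd j) \<le> eigenvalue 1 * (wt j)\<^sup>2"
proof -
  have "(of_int (snd j))\<^sup>2 \<le> (wt j)\<^sup>2"
    unfolding wt_def by (rule power2_le_iff_abs_le[THEN iffD2]) auto
  moreover have "1 \<le> (wt j)\<^sup>2" by (rule one_le_power) simp
  ultimately show ?thesis
    unfolding eigenvalue_def by (auto simp: distrib_right intro!: add_mono mult_left_mono)
qed

lemma amplitude_sq: "amplitude k * amplitude k = (if k = 0 then 1 else 2) / eigenvalue k"
  using eigenvalue_ge_1[of k] by (simp add: amplitude_def eigenvalue_def)

lemma abs_amplitude_le: "\<bar>amplitude k\<bar> \<le> 2"
proof -
  have "(amplitude k)\<^sup>2 \<le> 2\<^sup>2"
    unfolding power2_eq_square amplitude_sq using eigenvalue_ge_1[of k] by (cases "k = 0") (auto simp: divide_le_eq)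
  then show ?thesis by (rule power2_le_imp_le[of "\<bar>amplitude k\<bar>" 2, unfolded power2_abs]) simp
qed

lemma fourier_basis_eq: "fourier_basis i k s = trig 0 k s *\<^sub>R axis i 1"
proof -
  have "sin (2 * of_int k * pi * s) = cos (2 * pi * of_int k * s + - (pi / 2))"
    using sin_cos_eq[of "2 * of_int k * pi * s"] cos_minus[of "2 * pi * of_int k * s + - (pi / 2)"]
    by (simp add: mult_ac)
  then show ?thesis
    by (simp add: fourier_basis_def trig_def amplitude_def phase_def mult_ac)
qed

lemma trig_deriv: "(trig m k has_real_derivative trig (Suc m) k s) (at s)"
proof -
  have "cos (2 * pi * of_int k * s + phase k + of_nat (Suc m) * (pi / 2))
      = - sin (2 * pi * of_int k * s + phase k + of_nat m * (pi / 2))"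
    unfolding minus_sin_cos_eq by (simp add: algebra_simps add_divide_distrib)
  moreover have "(trig m k has_real_derivative amplitude k * (2 * pi * of_int k) ^ m *
      (- sin (2 * pi * of_int k * s + phase k + of_nat m * (pi / 2)) * (2 * pi * of_int k))) (at s)"
    unfolding trig_def by (auto intro!: derivative_eq_intros)
  ultimately show ?thesis
    by (simp add: trig_def mult_ac)
qed

lemma trig_continuous [continuous_intros]: "continuous_on S (trig m k)"
  by (rule DERIV_continuous_on) (rule DERIV_subset[OF trig_deriv], simp)

lemma trig_continuous_compose [continuous_intros]:
  "continuous_on S g \<Longrightarrow> continuous_on S (\<lambda>x. trig m k (g x))"
  by (rule continuous_on_compose2[OF trig_continuous[of UNIV]]) auto

lemma trig_Suc_Suc: "trig (Suc (Suc m)) k s = - (2 * pi * of_int k)\<^sup>2 * trig m k s"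
proof -
  have "2 * pi * of_int k * s + phase k + of_nat (Suc (Suc m)) * (pi / 2)
      = (2 * pi * of_int k * s + phase k + of_nat m * (pi / 2)) + pi"
    by (simp add: algebra_simps add_divide_distrib)
  then show ?thesis unfolding trig_def by (simp only: cos_periodic_pi) (simp add: power2_eq_square)
qed

lemma trig_periodic: "trig m k (s + 1) = trig m k s"
proof -
  have "2 * pi * of_int k * (s + 1) + phase k + of_nat m * (pi / 2)
      = (2 * pi * of_int k * s + phase k + of_nat m * (pi / 2)) + 2 * pi * of_int k"
    by (simp add: algebra_simps)
  moreover have "cos (\<theta> + 2 * pi * of_int k) = cos \<theta>" for \<theta>
    by (simp only: cos_add cos_int_2pin sin_int_2pin)
  ultimately show ?thesis unfolding trig_def by (simp only:)
qed

lemma abs_trig_le: "\<bar>trig m k s\<bar> \<le> 2 * (2 * pi) ^ m * wt (c, k) ^ m"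
proof -
  have "\<bar>trig m k s\<bar> = \<bar>amplitude k\<bar> * \<bar>2 * pi * of_int k\<bar> ^ m * \<bar>cos (2 * pi * of_int k * s + phase k + of_nat m * (pi / 2))\<bar>"
    by (simp add: trig_def abs_mult power_abs)
  also have "\<dots> \<le> 2 * (2 * pi * wt (c, k)) ^ m * 1"
  proof (intro mult_mono power_mono)
    show "\<bar>2 * pi * of_int k\<bar> \<le> 2 * pi * wt (c, k)" by (simp add: wt_def abs_mult)
  qed (use abs_amplitude_le in auto)
  finally show ?thesis by (simp add: power_mult_distrib mult.assoc)
qed

lemma has_integral_cos:
  "((\<lambda>s. cos (2 * pi * of_int n * s + \<phi>)) has_integral (if n = 0 then cos \<phi> else 0)) {0..1}"
proof (cases "n = 0")
  case True
  then show ?thesis using has_integral_const_real[of "cos \<phi>" 0 1] by simp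
next
  case False
  let ?F = "\<lambda>s. sin (2 * pi * of_int n * s + \<phi>) / (2 * pi * of_int n)"
  have "((\<lambda>s. cos (2 * pi * of_int n * s + \<phi>)) has_integral (?F 1 - ?F 0)) {0..1}"
  proof (rule fundamental_theorem_of_calculus)
    fix x :: real
    have "(?F has_real_derivative cos (2 * pi * of_int n * x + \<phi>)) (at x)"
      using False by (auto intro!: derivative_eq_intros)
    then have "(?F has_vector_derivative cos (2 * pi * of_int n * x + \<phi>)) (at x)"
      by (simp only: has_real_derivative_iff_has_vector_derivative)
    then show "(?F has_vector_derivative cos (2 * pi * of_int n * x + \<phi>)) (at x within {0..1})"
      by (rule has_vector_derivative_at_within)
  qed simp
  moreover have "sin (2 * pi * of_int n + \<phi>) = sin \<phi>" by (simp add: sin_add)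
  ultimately show ?thesis using False by simp
qed

text \<open>
  The basis is orthonormal in \<open>\<H>\<close>, hence orthogonal in \<open>L\<^sup>2\<close> with squared norms the inverse eigenvalues.
\<close>

lemma integral_trig_trig:
  "integral {0..1} (\<lambda>s. trig 0 k s * trig 0 k' s) = (if k = k' then 1 / eigenvalue k else 0)"
proof -
  have eq: "trig 0 k s * trig 0 k' s = amplitude k * amplitude k' / 2 *
      (cos (2 * pi * of_int (k - k') * s + (phase k - phase k')) + cos (2 * pi * of_int (k + k') * s + (phase k + phase k')))" for s
  proof -
    have "trig 0 k s * trig 0 k' s = amplitude k * amplitude k' * (cos (2 * pi * of_int k * s + phase k) * cos (2 * pi * of_int k' * s + phase k'))"
      by (simp add: trig_def)
    also have "cos (2 * pi * of_int k * s + phase k) * cos (2 * pi * of_int k' * s + phase k') =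
        (cos (2 * pi * of_int (k - k') * s + (phase k - phase k')) + cos (2 * pi * of_int (k + k') * s + (phase k + phase k'))) / 2"
      unfolding cos_times_cos
      by (intro arg_cong2[of _ _ _ _ "\<lambda>x y. (cos x + cos y) / 2"]) (simp_all add: algebra_simps)
    finally show ?thesis by simp
  qed
  have "((\<lambda>s. trig 0 k s * trig 0 k' s) has_integral (amplitude k * amplitude k' / 2 *
      ((if k - k' = 0 then cos (phase k - phase k') else 0) + (if k + k' = 0 then cos (phase k + phase k') else 0)))) {0..1}"
    unfolding eq by (intro has_integral_mult_right has_integral_add has_integral_cos)
  then have "integral {0..1} (\<lambda>s. trig 0 k s * trig 0 k' s) = amplitude k * amplitude k' / 2 *
      ((if k - k' = 0 then cos (phase k - phase k') else 0) + (if k + k' = 0 then cos (phase k + phase k') else 0))"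
    by (rule integral_unique)
  also have "\<dots> = (if k = k' then 1 / eigenvalue k else 0)"
    using amplitude_sq[of k] by (auto simp: phase_def)
  finally show ?thesis .
qed

text \<open>
  The inner product in \<open>\<H>\<close> of \<open>X\<close> with a basis vector, integrated by parts so that it makes sense for a
  loop that is only continuous.
\<close>

definition loop_coeff :: "(real \<Rightarrow> real ^ 'a::finite) \<Rightarrow> 'a \<times> int \<Rightarrow> 'k::real_normed_field" where
  "loop_coeff X j = of_real (eigenvalue (snd j) * integral {0..1} (\<lambda>s. trig 0 (snd j) s * X s $ fst j))"

lemma loopsD: "X \<in> loops \<Longrightarrow> continuous_on S X" "X \<in> loops \<Longrightarrow> X (s + 1) = X s"
  by (auto simp: loops_def intro: continuous_on_subset)

lemma loop_bounded:
  assumes "X \<in> loops" obtains B where "B \<ge> 0" "\<forall>s\<in>{0..1}. \<forall>a. \<bar>X s $ a\<bar> \<le> B"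
proof -
  have "compact (X ` {0..1})"
    by (rule compact_continuous_image[OF loopsD(1)[OF assms]]) simp
  then obtain B where B: "\<And>y. y \<in> X ` {0..1} \<Longrightarrow> norm y \<le> B"
    using compact_imp_bounded bounded_iff by metis
  have "\<bar>X s $ a\<bar> \<le> B" if "s \<in> {0..1}" for s a
    using component_le_norm_cart[of "X s" a] B[of "X s"] that by auto
  moreover have "norm (X 0) \<le> B" by (rule B) simp
  then have "B \<ge> 0" using norm_ge_zero[of "X 0"] by linarith
  ultimately show ?thesis using that by simp
qed

lemma tame_loop_coeff:
  assumes "X \<in> loops" obtains A where "tame 2 A (loop_coeff X :: 'a::finite \<times> int \<Rightarrow> 'k::real_normed_field)"
proof -
  obtain B where B: "B \<ge> 0" "\<forall>s\<in>{0..1}. \<forall>a. \<bar>X s $ a\<bar> \<le> B" using loop_bounded[OF assms] .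
  have "tame 2 (eigenvalue 1 * (2 * B)) (loop_coeff X :: 'a \<times> int \<Rightarrow> 'k)"
    unfolding tame_def
  proof
    fix j :: "'a \<times> int"
    have "norm (integral {0..1} (\<lambda>s. trig 0 (snd j) s * X s $ fst j)) \<le> (2 * B) * (1 - 0)"
    proof (rule integral_bound)
      show "continuous_on {0..1} (\<lambda>s. trig 0 (snd j) s * X s $ fst j)"
        by (intro continuous_intros loopsD(1)[OF assms])
      fix t :: real assume "t \<in> {0..1}"
      then show "norm (trig 0 (snd j) t * X t $ fst j) \<le> 2 * B"
        unfolding real_norm_def abs_mult
        using abs_trig_le[of 0 "snd j" t "()"] B by (intro mult_mono) auto
    qed simp
    then have "norm (loop_coeff X j :: 'k) \<le> eigenvalue (snd j) * (2 * B)"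
      unfolding loop_coeff_def norm_of_real abs_mult abs_of_pos[OF eigenvalue_pos(1)]
      by (simp add: mult_left_mono less_imp_le)
    also have "\<dots> \<le> (eigenvalue 1 * (wt j)\<^sup>2) * (2 * B)"
      using B(1) by (intro mult_right_mono eigenvalue_le) auto
    finally show "norm (loop_coeff X j :: 'k) \<le> eigenvalue 1 * (2 * B) * (wt j)\<^sup>2" by (simp add: mult_ac)
  qed
  then show ?thesis by (rule that)
qed

definition dir :: "int \<Rightarrow> 'd \<Rightarrow> 'd + 'd" where
  "dir e i = (if e = 1 then Inl i else Inr i)"

lemma basis_dir_nth: "basis_dir e i k s $ a = (if a = dir e i then trig 0 k s else 0)"
  by (cases a) (auto simp: basis_dir_def dsum_def dir_def fourier_basis_eq axis_def)

lemma basis_dir_loop: "basis_dir e i k \<in> loops"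
  unfolding loops_def
proof safe
  show "continuous_on UNIV (basis_dir e i k)"
  proof -
    have "basis_dir e i k = (\<lambda>s. trig 0 k s *\<^sub>R axis (dir e i) 1)"
      by (simp add: fun_eq_iff vec_eq_iff basis_dir_nth axis_def)
    then show ?thesis by (auto intro!: continuous_intros)
  qed
  show "basis_dir e i k (s + 1) = basis_dir e i k s" for s
    by (simp add: vec_eq_iff basis_dir_nth trig_periodic)
qed

text \<open>
  Functionals vanish outside of the loops. Since translation along a basis vector does not change whether
  a path is a loop, directional derivatives vanish there as well.
\<close>

lemma loops_shift_iff:
  assumes "v \<in> loops" shows "(\<lambda>s. X s + t *\<^sub>R v s) \<in> loops \<longleftrightarrow> X \<in> loops"
proof
  assume X: "X \<in> loops"
  then show "(\<lambda>s. X s + t *\<^sub>R v s) \<in> loops"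
    using loopsD(2)[OF assms] loopsD(2)[OF X]
    by (auto simp: loops_def intro!: continuous_intros loopsD(1)[OF assms] loopsD(1)[OF X])
next
  assume Y: "(\<lambda>s. X s + t *\<^sub>R v s) \<in> loops"
  have "continuous_on UNIV (\<lambda>s. (X s + t *\<^sub>R v s) - t *\<^sub>R v s)"
    by (intro continuous_intros loopsD(1)[OF assms] loopsD(1)[OF Y])
  moreover have "X (s + 1) = X s" for s
    using loopsD(2)[OF Y, of s] loopsD(2)[OF assms, of s] by simp
  ultimately show "X \<in> loops" by (simp add: loops_def)
qed

lemma loop_coeff_shift:
  assumes "X \<in> loops"
  shows "loop_coeff (\<lambda>s. X s + t *\<^sub>R basis_dir e i k s) j = loop_coeff X j + of_real t * delta (dir e i, k) j"
proof -
  have i1: "(\<lambda>s. trig 0 (snd j) s * X s $ fst j) integrable_on {0..1}"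
    by (intro integrable_continuous_interval continuous_intros loopsD(1)[OF assms])
  have i2: "(\<lambda>s. trig 0 (snd j) s * trig 0 k s) integrable_on {0..1}"
    by (intro integrable_continuous_interval continuous_intros)
  define c where "c = (if fst j = dir e i then t else 0)"
  have "integral {0..1} (\<lambda>s. trig 0 (snd j) s * (X s + t *\<^sub>R basis_dir e i k s) $ fst j)
      = integral {0..1} (\<lambda>s. trig 0 (snd j) s * X s $ fst j + c * (trig 0 (snd j) s * trig 0 k s))"
    by (rule integral_cong) (simp add: basis_dir_nth c_def distrib_left)
  also have "\<dots> = integral {0..1} (\<lambda>s. trig 0 (snd j) s * X s $ fst j) + c * (if snd j = k then 1 / eigenvalue k else 0)"
    by (simp add: integral_add[OF i1 integrable_on_mult_right[OF i2]] integral_trig_trig)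
  finally show ?thesis
    by (cases j) (auto simp: loop_coeff_def c_def delta_def distrib_left)
qed

text \<open>
  The functional with Taylor coefficients \<open>f\<close> at the zero loop.
\<close>

definition Phi :: "(('a::finite \<times> int) list \<Rightarrow> 'k::{real_normed_field,banach}) \<Rightarrow> (real \<Rightarrow> real ^ 'a) \<Rightarrow> 'k" where
  "Phi f X = (if X \<in> loops then taylor_eval f (loop_coeff X) else 0)"

lemma gateaux_Phi:
  fixes f :: "(('d::finite + 'd) \<times> int) list \<Rightarrow> 'k::{real_normed_field,banach}"
  assumes f: "connes_coef f"
  shows "gateaux (basis_dir e i k) (Phi f) = Phi (shift (dir e i, k) f)"
proof
  fix X :: "real \<Rightarrow> real ^ ('d + 'd)"
  show "gateaux (basis_dir e i k) (Phi f) X = Phi (shift (dir e i, k) f) X"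
  proof (cases "X \<in> loops")
    case True
    obtain A where A: "tame 2 A (loop_coeff X :: ('d + 'd) \<times> int \<Rightarrow> 'k)" using tame_loop_coeff[OF True] .
    have eq: "Phi f (\<lambda>s. X s + t *\<^sub>R basis_dir e i k s) = taylor_eval f (\<lambda>j. loop_coeff X j + of_real t * delta (dir e i, k) j)" for t
    proof -
      have "(loop_coeff (\<lambda>s. X s + t *\<^sub>R basis_dir e i k s) :: _ \<Rightarrow> 'k) = (\<lambda>j. loop_coeff X j + of_real t * delta (dir e i, k) j)"
        by (rule ext) (rule loop_coeff_shift[OF True])
      then show ?thesis using True by (simp add: Phi_def loops_shift_iff[OF basis_dir_loop])
    qed
    show ?thesis
      unfolding gateaux_def eq
      using vector_derivative_at[OF taylor_eval_deriv[OF connes_coefD[OF f] A]] True by (simp add: Phi_def)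
  next
    case False
    then show ?thesis by (simp add: gateaux_def Phi_def loops_shift_iff[OF basis_dir_loop])
  qed
qed

lemma taylor_eval_zero: "taylor_eval f (\<lambda>_. 0) = f []"
proof -
  have "form_eval n f (\<lambda>_ _. 0) = 0" if "n \<noteq> 0" for n
    using that by (cases n) (simp_all add: form_eval_def)
  then have "(\<lambda>n. form_eval n f (\<lambda>_ _. 0) / fact n) sums (\<Sum>n\<in>{0}. form_eval n f (\<lambda>_ _. 0) / fact n)"
    by (intro sums_finite) auto
  then show ?thesis by (simp add: taylor_eval_def sums_iff)
qed

lemma zero_loop: "(\<lambda>_. 0) \<in> loops" by (simp add: loops_def)

lemma Phi_zero:
  fixes f :: "('a::finite \<times> int) list \<Rightarrow> 'k::{real_normed_field,banach}"
  shows "Phi f (\<lambda>_. 0) = f []"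
proof -
  have "loop_coeff (\<lambda>_. 0 :: real ^ 'a) = (\<lambda>_. 0 :: 'k)" by (simp add: loop_coeff_def fun_eq_iff)
  then show ?thesis by (simp add: Phi_def zero_loop taylor_eval_zero)
qed

text \<open>
  A Taylor coefficient is an iterated Gateaux derivative at the zero loop.
\<close>

lemma Phi_inj:
  fixes f g :: "(('d::finite + 'd) \<times> int) list \<Rightarrow> 'k::{real_normed_field,banach}"
  assumes "connes_coef f" "connes_coef g" "Phi f = Phi g"
  shows "f = g"
proof
  fix l show "f l = g l"
    using assms
  proof (induction l arbitrary: f g)
    case Nil
    then show ?case using Phi_zero by metis
  next
    case (Cons j l)
    obtain e i where e: "fst j = dir e i"
    proof (cases "fst j")
      case (Inl i) then show ?thesis using that[of 1 i] by (simp add: dir_def)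
    next
      case (Inr i) then show ?thesis using that[of 0 i] by (simp add: dir_def)
    qed
    have "Phi (shift (dir e i, snd j) f) = Phi (shift (dir e i, snd j) g)"
      using Cons.prems(3) gateaux_Phi[OF Cons.prems(1)] gateaux_Phi[OF Cons.prems(2)] by metis
    then have "shift j f l = shift j g l"
      using e by (intro Cons.IH connes_coef_shift Cons.prems) (metis prod.collapse)
    then show ?case by (simp add: shift_def)
  qed
qed

definition dirs :: "('d \<times> int \<times> int) list \<Rightarrow> ((('d + 'd) \<times> int) list \<Rightarrow> 'k) \<Rightarrow> (('d + 'd) \<times> int) list \<Rightarrow> 'k" where
  "dirs w f = foldr (\<lambda>(i, k, e). shift (dir e i, k)) w f"

definition flip :: "'d \<times> int \<times> int \<Rightarrow> 'd \<times> int \<times> int" where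
  "flip = (\<lambda>(i, k, e). (i, k, - e))"

lemma connes_coef_dirs: "connes_coef f \<Longrightarrow> connes_coef (dirs w f)"
  by (induction w) (auto simp: dirs_def connes_coef_shift)

lemma gateaux_word:
  fixes f :: "(('d::finite + 'd) \<times> int) list \<Rightarrow> 'k::{real_normed_field,banach}"
  assumes f: "connes_coef f"
  shows "foldr (\<lambda>(i, k, e). gateaux (basis_dir e i k)) w (Phi f) = Phi (dirs w f)"
  and "foldr (\<lambda>(i, k, e). gateaux (basis_dir (- e) i k)) w (Phi f) = Phi (dirs (map flip w) f)"
proof -
  have 1: "foldr (\<lambda>(i, k, e). gateaux (basis_dir e i k)) w (Phi f) = Phi (dirs w f)" for w
  proof (induction w)
    case (Cons p w)
    then show ?case
      using gateaux_Phi[OF connes_coef_dirs[OF f, of w]] by (cases p) (simp add: dirs_def)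
  qed (simp add: dirs_def)
  then show "foldr (\<lambda>(i, k, e). gateaux (basis_dir e i k)) w (Phi f) = Phi (dirs w f)" .
  have "foldr (\<lambda>(i, k, e). gateaux (basis_dir (- e) i k)) w (Phi f)
      = foldr (\<lambda>(i, k, e). gateaux (basis_dir e i k)) (map flip w) (Phi f)"
    by (simp add: foldr_map o_def flip_def case_prod_unfold)
  then show "foldr (\<lambda>(i, k, e). gateaux (basis_dir (- e) i k)) w (Phi f) = Phi (dirs (map flip w) f)"
    by (simp only: 1)
qed

text \<open>
  The index of a contraction that corresponds to one factor of a bidifferential operator: for \<open>e = 1\<close> the
  derivative along \<open>\<gamma>\<close> falls on the first function (inner tag \<open>True\<close>) and the one along \<open>\<gamma>\<^sup>*\<close> on the second
  (outer tag \<open>False\<close>), for \<open>e = -1\<close> the other way round.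
\<close>

definition factor_code :: "'d \<times> int \<times> int \<Rightarrow> (('d \<times> bool) \<times> bool) \<times> int" where
  "factor_code = (\<lambda>(i, k, e). tag (e \<noteq> 1) (tag (e = 1) (i, k)))"

lemma shiftw_factor_code:
  fixes f g :: "(('d + 'd) \<times> int) list \<Rightarrow> 'k::real_normed_field"
  assumes "set w \<subseteq> UNIV \<times> UNIV \<times> {1, -1}"
  shows "shiftw (dbl1 Inl) (dbl2 Inr) (map factor_code w) (tens f g) = tens (dirs w f) (dirs (map flip w) g)"
  using assms
proof (induction w)
  case Nil
  then show ?case by (simp add: shiftw_def dirs_def)
next
  case (Cons p w)
  obtain i k e where p: "p = (i, k, e)" by (cases p)
  have e: "e = 1 \<or> e = -1" using Cons.prems p by auto
  have IH: "shiftw (dbl1 Inl) (dbl2 Inr) (map factor_code w) (tens f g) = tens (dirs w f) (dirs (map flip w) g)"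
    using Cons by simp
  have "shiftw (dbl1 Inl) (dbl2 Inr) (map factor_code (p # w)) (tens f g)
      = shift2 (dbl1 Inl) (dbl2 Inr) (factor_code p) (tens (dirs w f) (dirs (map flip w) g))"
    unfolding IH[symmetric] by (simp add: shiftw_def)
  also have "\<dots> = tens (dirs (p # w) f) (dirs (map flip (p # w)) g)"
    using e by (auto simp: shift2_def p factor_code_def shift_tens dirs_def flip_def dir_def) (simp_all add: pos_def)
  finally show ?case .
qed

definition factor_decode :: "(('d \<times> bool) \<times> bool) \<times> int \<Rightarrow> 'd \<times> int \<times> int" where
  "factor_decode t = (fst (base (base t)), snd t, if side (base t) then 1 else -1)"

lemma bij_factor_code:
  "bij_betw (map factor_code) {w :: ('b \<times> int \<times> int) list. length w = r \<and> set w \<subseteq> UNIV \<times> UNIV \<times> {1, -1}}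
    {w. length w = r \<and> (\<forall>t\<in>set w. side t \<noteq> side (base t))}"
proof (rule bij_betw_byWitness[where f' = "map factor_decode"])
  have c: "factor_decode (factor_code p) = p" if "p \<in> UNIV \<times> UNIV \<times> {1, -1}" for p :: "'b \<times> int \<times> int"
    using that by (auto simp: factor_decode_def factor_code_def) (simp_all add: tag_def)
  show "\<forall>w\<in>{w :: ('b \<times> int \<times> int) list. length w = r \<and> set w \<subseteq> UNIV \<times> UNIV \<times> {1, -1}}. map factor_decode (map factor_code w) = w"
  proof
    fix w :: "('b \<times> int \<times> int) list"
    assume "w \<in> {w. length w = r \<and> set w \<subseteq> UNIV \<times> UNIV \<times> {1, -1}}"
    then have "factor_decode (factor_code p) = p" if "p \<in> set w" for p using that by (intro c) blast
    then show "map factor_decode (map factor_code w) = w" unfolding map_map o_def by (rule map_idI)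
  qed
  have d: "factor_code (factor_decode t) = t" if "side t \<noteq> side (base t)" for t :: "(('b \<times> bool) \<times> bool) \<times> int"
  proof -
    obtain q x y k where t: "t = (((q, x), y), k)" by (metis prod.collapse)
    show ?thesis using that by (auto simp: t factor_decode_def factor_code_def side_def base_def tag_def)
  qed
  show "\<forall>w\<in>{w :: ((('b \<times> bool) \<times> bool) \<times> int) list. length w = r \<and> (\<forall>t\<in>set w. side t \<noteq> side (base t))}. map factor_code (map factor_decode w) = w"
  proof
    fix w :: "((('b \<times> bool) \<times> bool) \<times> int) list"
    assume "w \<in> {w. length w = r \<and> (\<forall>t\<in>set w. side t \<noteq> side (base t))}"
    then have "factor_code (factor_decode t) = t" if "t \<in> set w" for t using that by (intro d) blast
    then show "map factor_code (map factor_decode w) = w" unfolding map_map o_def by (rule map_idI)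
  qed
  show "map factor_code ` {w :: ('b \<times> int \<times> int) list. length w = r \<and> set w \<subseteq> UNIV \<times> UNIV \<times> {1, -1}} \<subseteq> {w. length w = r \<and> (\<forall>t\<in>set w. side t \<noteq> side (base t))}"
    by (auto simp: factor_code_def)
  show "map factor_decode ` {w :: ((('b \<times> bool) \<times> bool) \<times> int) list. length w = r \<and> (\<forall>t\<in>set w. side t \<noteq> side (base t))} \<subseteq> {w. length w = r \<and> set w \<subseteq> UNIV \<times> UNIV \<times> {1, -1}}"
    by (auto simp: factor_decode_def)
qed

text \<open>
  The iterated Gateaux derivatives are shifts of \<open>tens f g\<close>, so the defining sum over words is, after coding
  the factors, the expansion of a power of a contraction.
\<close>

lemma bidiff_Phi:
  fixes f g :: "(('d::finite + 'd) \<times> int) list \<Rightarrow> 'k::{real_normed_field,banach}"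
  assumes \<alpha>: "tame N A (\<lambda>t::'d \<times> int. \<alpha> (snd t))" and f: "connes_coef f" and g: "connes_coef g"
  shows "bidiff \<alpha> r (Phi f) (Phi g) = Phi (diagonal ((bidiff_op (\<lambda>t. \<alpha> (snd t)) Inl Inr ^^ r) (tens f g)))"
proof
  fix X :: "real \<Rightarrow> real ^ ('d + 'd)"
  let ?W = "{w :: ('d \<times> int \<times> int) list. length w = r \<and> set w \<subseteq> UNIV \<times> UNIV \<times> {1, -1}}"
  let ?R = "{w. length w = r \<and> (\<forall>t\<in>set w. side t \<noteq> side (base t))}"
  define \<beta> where "\<beta> = (\<lambda>t::(('d \<times> bool) \<times> bool) \<times> int. at_pos True False (\<lambda>t. \<alpha> (snd t) + 1) t + at_pos False True (\<lambda>t. \<alpha> (snd t) - 1) t)"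
  have B: "bidiff_op (\<lambda>t. \<alpha> (snd t)) Inl Inr = contract \<beta> (dbl1 Inl) (dbl2 Inr)" by (simp add: bidiff_op_def \<beta>_def)
  have b: "tame N ((A + 1) + (A + 1)) \<beta>" unfolding \<beta>_def by (rule tame_bidiff_op[OF \<alpha>])
  have h: "connes_coef (tens f g)" by (rule connes_coef_tens[OF f g])
  show "bidiff \<alpha> r (Phi f) (Phi g) X = Phi (diagonal ((bidiff_op (\<lambda>t. \<alpha> (snd t)) Inl Inr ^^ r) (tens f g))) X"
  proof (cases "X \<in> loops")
    case False
    then show ?thesis by (simp add: bidiff_def gateaux_word[OF f] gateaux_word[OF g] Phi_def)
  next
    case True
    obtain A' where x: "tame 2 A' (loop_coeff X :: ('d + 'd) \<times> int \<Rightarrow> 'k)" using tame_loop_coeff[OF True] .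
    let ?z = "both (loop_coeff X) (loop_coeff X) :: (('d + 'd) \<times> bool) \<times> int \<Rightarrow> 'k"
    let ?t = "\<lambda>w. (\<Prod>t\<leftarrow>w. \<beta> t) * taylor_eval (shiftw (dbl1 Inl) (dbl2 Inr) w (tens f g)) ?z"
    have p: "(\<Prod>(i, k, e)\<leftarrow>w. \<alpha> k + of_int e) = (\<Prod>t\<leftarrow>map factor_code w. \<beta> t)" if "set w \<subseteq> UNIV \<times> UNIV \<times> {1, -1}" for w
      using that
    proof (induction w)
      case (Cons p w)
      obtain i k e where p: "p = (i, k, e)" by (cases p)
      have "e = 1 \<or> e = -1" using Cons.prems p by auto
      then have "\<beta> (factor_code p) = \<alpha> k + of_int e"
        by (auto simp: p \<beta>_def factor_code_def at_pos_def tag_def side_def base_def)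
      then show ?case using Cons by (simp add: p)
    qed simp
    have "bidiff \<alpha> r (Phi f) (Phi g) X = (\<Sum>\<^sub>\<infinity>w\<in>?W. ?t (map factor_code w))"
      unfolding bidiff_def gateaux_word[OF f] gateaux_word(2)[OF g]
    proof (rule infsum_cong)
      fix w assume w: "w \<in> ?W"
      show "(\<Prod>(i, k, e)\<leftarrow>w. \<alpha> k + of_int e) * Phi (dirs w f) X * Phi (dirs (map flip w) g) X = ?t (map factor_code w)"
        using w True
        by (simp add: p shiftw_factor_code Phi_def taylor_eval_tens[OF connes_coefD(1)[OF connes_coef_dirs[OF f]] connes_coefD(1)[OF connes_coef_dirs[OF g]] x x])
    qed
    also have "\<dots> = (\<Sum>\<^sub>\<infinity>w\<in>?R. ?t w)"
      by (rule infsum_reindex_bij_betw[OF bij_factor_code])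
    \<comment> \<open>Words with a factor that differentiates one function twice have coefficient 0.\<close>
    also have "\<dots> = (\<Sum>\<^sub>\<infinity>w\<in>{w. length w = r}. ?t w)"
    proof (rule infsum_cong_neutral)
      fix w :: "((('d \<times> bool) \<times> bool) \<times> int) list" assume "w \<in> {w. length w = r} - ?R"
      then obtain t where "t \<in> set w" "side t = side (base t)" by auto
      then have "\<beta> t = 0" by (auto simp: \<beta>_def at_pos_def)
      then have "(\<Prod>t\<leftarrow>w. \<beta> t) = 0" using \<open>t \<in> set w\<close> by (force simp: prod_list_zero_iff)
      then show "?t w = 0" by simp
    qed auto
    also have "\<dots> = taylor_eval ((contract \<beta> (dbl1 Inl) (dbl2 Inr) ^^ r) (tens f g)) ?z"
      by (rule taylor_eval_contract_pow[OF b h tame_both[OF x x]])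
    also have "\<dots> = Phi (diagonal ((contract \<beta> (dbl1 Inl) (dbl2 Inr) ^^ r) (tens f g))) X"
      using True by (simp add: Phi_def taylor_eval_diagonal[OF connes_coefD(1)[OF connes_coef_contract_pow[OF b h]] x])
    finally show ?thesis by (simp only: B)
  qed
qed

lemma Phi_scale:
  assumes "rapid f" shows "Phi (\<lambda>l. c * f l) X = c * Phi f X"
proof (cases "X \<in> loops")
  case True
  obtain A where "tame 2 A (loop_coeff X :: 'a \<times> int \<Rightarrow> 'b)" using tame_loop_coeff[OF True] .
  then show ?thesis using True taylor_eval_scale[OF assms] by (simp add: Phi_def)
qed (simp add: Phi_def)

lemma Phi_add:
  assumes "rapid f" "rapid g" shows "Phi (\<lambda>l. f l + g l) X = Phi f X + Phi g X"
proof (cases "X \<in> loops")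
  case True
  obtain A where "tame 2 A (loop_coeff X :: 'a \<times> int \<Rightarrow> 'b)" using tame_loop_coeff[OF True] .
  then show ?thesis using True taylor_eval_add[OF assms] by (simp add: Phi_def)
qed (simp add: Phi_def)

lemma star_term_Phi:
  fixes f g :: "(('d::finite + 'd) \<times> int) list \<Rightarrow> 'k::{real_normed_field,banach}"
  assumes \<alpha>: "tame N A (\<lambda>t::'d \<times> int. \<alpha> (snd t))" and f: "connes_coef f" and g: "connes_coef g"
  shows "star_term \<alpha> r (Phi f) (Phi g) X = Phi (star_coef (\<lambda>t. \<alpha> (snd t)) Inl Inr r f g) X"
proof -
  have h: "connes_coef (diagonal ((bidiff_op (\<lambda>t. \<alpha> (snd t)) Inl Inr ^^ r) (tens f g)))"
    unfolding bidiff_op_def by (rule connes_coef_diagonal[OF connes_coef_contract_pow[OF tame_bidiff_op[OF \<alpha>] connes_coef_tens[OF f g]]])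
  have "Phi (star_coef (\<lambda>t. \<alpha> (snd t)) Inl Inr r f g) X
      = Phi (\<lambda>l. (1 / fact r) * diagonal ((bidiff_op (\<lambda>t. \<alpha> (snd t)) Inl Inr ^^ r) (tens f g)) l) X"
    by (simp add: star_coef_def[abs_def])
  also have "\<dots> = Phi (diagonal ((bidiff_op (\<lambda>t. \<alpha> (snd t)) Inl Inr ^^ r) (tens f g))) X / fact r"
    by (simp only: Phi_scale[OF connes_coefD(1)[OF h]]) simp
  finally have *: "Phi (star_coef (\<lambda>t. \<alpha> (snd t)) Inl Inr r f g) X
      = Phi (diagonal ((bidiff_op (\<lambda>t. \<alpha> (snd t)) Inl Inr ^^ r) (tens f g))) X / fact r" .
  show ?thesis
  proof (cases "r = 0")
    case False
    then show ?thesis by (simp add: star_term_def bidiff_Phi[OF assms] *)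
  next
    case True
    have "Phi f X * Phi g X = Phi (diagonal (tens f g)) X"
    proof (cases "X \<in> loops")
      case True
      obtain A where x: "tame 2 A (loop_coeff X :: ('d + 'd) \<times> int \<Rightarrow> 'k)" using tame_loop_coeff[OF True] .
      show ?thesis using True
        by (simp add: Phi_def taylor_eval_diagonal[OF connes_coefD(1)[OF connes_coef_tens[OF f g]] x] taylor_eval_tens[OF connes_coefD(1)[OF f] connes_coefD(1)[OF g] x x])
    qed (simp add: Phi_def)
    then show ?thesis using True * by (simp add: star_term_def)
  qed
qed

section \<open>Synthesis of kernels from coefficients\<close>

lemma continuous_on_infsum:
  fixes F :: "'i \<Rightarrow> 'a::topological_space \<Rightarrow> 'b::banach"
  assumes "\<And>x. x \<in> S \<Longrightarrow> continuous_on U (F x)"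
    and "\<And>x y. x \<in> S \<Longrightarrow> y \<in> U \<Longrightarrow> norm (F x y) \<le> b x" and "b summable_on S"
  shows "continuous_on U (\<lambda>y. \<Sum>\<^sub>\<infinity>x\<in>S. F x y)"
proof (rule uniform_limit_theorem)
  show "uniform_limit U (\<lambda>X y. \<Sum>x\<in>X. F x y) (\<lambda>y. \<Sum>\<^sub>\<infinity>x\<in>S. F x y) (finite_subsets_at_top S)"
    by (rule Weierstrass_m_test_general) (use assms in auto)
  show "\<forall>\<^sub>F X in finite_subsets_at_top S. continuous_on U (\<lambda>y. \<Sum>x\<in>X. F x y)"
    by (rule eventually_finite_subsets_at_top_weakI) (use assms(1) in \<open>auto intro!: continuous_on_sum\<close>)
qed simp

lemma has_vector_derivative_iff_quotient:
  fixes f :: "real \<Rightarrow> 'b::real_normed_vector"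
  shows "(f has_vector_derivative D) (at t) \<longleftrightarrow> ((\<lambda>h. (f (t + h) - f t) /\<^sub>R h) \<longlongrightarrow> D) (at 0)"
proof -
  have eq: "norm (f (t + h) - f t - h *\<^sub>R D) / norm h = norm ((f (t + h) - f t) /\<^sub>R h - D)" if "h \<noteq> 0" for h
  proof -
    have "(f (t + h) - f t) /\<^sub>R h - D = (f (t + h) - f t - h *\<^sub>R D) /\<^sub>R h"
      using that by (simp add: scaleR_diff_right)
    then show ?thesis by (simp only: norm_scaleR norm_inverse divide_inverse) (simp add: mult.commute)
  qed
  have "(f has_vector_derivative D) (at t) \<longleftrightarrow> ((\<lambda>h. norm (f (t + h) - f t - h *\<^sub>R D) / norm h) \<longlongrightarrow> 0) (at 0)"
    by (simp add: has_vector_derivative_def has_derivative_at bounded_linear_scaleR_left)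
  also have "\<dots> \<longleftrightarrow> ((\<lambda>h. norm ((f (t + h) - f t) /\<^sub>R h - D)) \<longlongrightarrow> 0) (at 0)"
    by (rule tendsto_cong, unfold eventually_at_filter, rule always_eventually) (use eq in blast)
  also have "\<dots> \<longleftrightarrow> ((\<lambda>h. (f (t + h) - f t) /\<^sub>R h) \<longlongrightarrow> D) (at 0)"
    by (simp only: tendsto_norm_zero_iff LIM_zero_iff)
  finally show ?thesis .
qed

text \<open>
  The bound on the derivatives is a Lipschitz bound, hence dominates the difference quotients; the limit
  may therefore be taken term by term.
\<close>

lemma has_vector_derivative_infsum:
  fixes F :: "'i \<Rightarrow> real \<Rightarrow> 'b::banach"
  assumes d: "\<And>x t. x \<in> S \<Longrightarrow> (F x has_vector_derivative F' x t) (at t)"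
    and b: "\<And>x t. x \<in> S \<Longrightarrow> norm (F x t) \<le> b x" and b': "\<And>x t. x \<in> S \<Longrightarrow> norm (F' x t) \<le> b x"
    and s: "b summable_on S"
  shows "((\<lambda>t. \<Sum>\<^sub>\<infinity>x\<in>S. F x t) has_vector_derivative (\<Sum>\<^sub>\<infinity>x\<in>S. F' x t)) (at t)"
proof -
  define q where "q x h = (F x (t + h) - F x t) /\<^sub>R h" for x h
  have lip: "norm (F x (t + h) - F x t) \<le> b x * norm h" if "x \<in> S" for x h
  proof -
    have "norm (F x (t + h) - F x t) \<le> b x * norm ((t + h) - t)"
    proof (rule differentiable_bound)
      show "(F x has_derivative (\<lambda>y. y *\<^sub>R F' x z)) (at z within UNIV)" for z
        using d[OF that, of z] by (simp add: has_vector_derivative_def)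
      show "onorm (\<lambda>y. y *\<^sub>R F' x z) \<le> b x" for z
        using b'[OF that, of z] order_trans[OF norm_ge_zero b'[OF that, of z]]
        by (intro onorm_bound) (auto simp: mult.commute[of "b x"] intro!: mult_left_mono)
    qed auto
    then show ?thesis by simp
  qed
  have q: "norm (q x h) \<le> b x" if x: "x \<in> S" for x h
  proof (cases "h = 0")
    case True
    then show ?thesis using order_trans[OF norm_ge_zero b[OF x]] by (simp add: q_def)
  next
    case False
    have "norm (q x h) = norm (F x (t + h) - F x t) / norm h"
      by (simp only: q_def norm_scaleR norm_inverse) (simp add: divide_inverse mult.commute)
    then show ?thesis using lip[OF x, of h] False by (simp add: divide_le_eq)
  qed
  have lim: "((\<lambda>h. \<Sum>\<^sub>\<infinity>x\<in>S. q x h) \<longlongrightarrow> (\<Sum>\<^sub>\<infinity>x\<in>S. F' x t)) (at 0 within UNIV)"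
  proof (rule swap_uniform_limit)
    show "uniform_limit UNIV (\<lambda>X h. \<Sum>x\<in>X. q x h) (\<lambda>h. \<Sum>\<^sub>\<infinity>x\<in>S. q x h) (finite_subsets_at_top S)"
      by (rule Weierstrass_m_test_general[OF q s])
    show "((\<lambda>X. \<Sum>x\<in>X. F' x t) \<longlongrightarrow> (\<Sum>\<^sub>\<infinity>x\<in>S. F' x t)) (finite_subsets_at_top S)"
      by (rule infsum_tendsto[OF abs_le_summable(2)[OF s b']])
    show "\<forall>\<^sub>F X in finite_subsets_at_top S. ((\<lambda>h. \<Sum>x\<in>X. q x h) \<longlongrightarrow> (\<Sum>x\<in>X. F' x t)) (at 0 within UNIV)"
    proof (rule eventually_finite_subsets_at_top_weakI)
      fix X assume X: "X \<subseteq> S" "finite X"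
      show "((\<lambda>h. \<Sum>x\<in>X. q x h) \<longlongrightarrow> (\<Sum>x\<in>X. F' x t)) (at 0 within UNIV)"
      proof (rule tendsto_sum)
        fix x assume "x \<in> X"
        then have "(F x has_vector_derivative F' x t) (at t)" using d X by blast
        then show "((\<lambda>h. q x h) \<longlongrightarrow> F' x t) (at 0 within UNIV)"
          by (simp add: has_vector_derivative_iff_quotient q_def)
      qed
    qed
  qed simp
  have "(\<Sum>\<^sub>\<infinity>x\<in>S. q x h) = ((\<Sum>\<^sub>\<infinity>x\<in>S. F x (t + h)) - (\<Sum>\<^sub>\<infinity>x\<in>S. F x t)) /\<^sub>R h" for h
  proof -
    have s1: "(\<lambda>x. F x z) summable_on S" for z by (rule abs_le_summable(2)[OF s b])
    have "((\<lambda>x. F x (t + h) + - F x t) has_sum ((\<Sum>\<^sub>\<infinity>x\<in>S. F x (t + h)) + - (\<Sum>\<^sub>\<infinity>x\<in>S. F x t))) S"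
      by (intro has_sum_add has_sum_infsum s1 has_sum_uminus[THEN iffD2]) (simp add: s1)
    then have "((\<lambda>x. q x h) has_sum ((\<Sum>\<^sub>\<infinity>x\<in>S. F x (t + h)) - (\<Sum>\<^sub>\<infinity>x\<in>S. F x t)) /\<^sub>R h) S"
      unfolding q_def by (intro has_sum_bounded_linear[OF bounded_linear_scaleR_right]) simp
    then show ?thesis by (rule infsumI)
  qed
  then show ?thesis
    using lim by (simp add: has_vector_derivative_iff_quotient)
qed

text \<open>
  The coordinates of the functional that sends a loop to the \<open>m\<close>-th derivative of component \<open>a\<close> at \<open>s\<close>,
  where \<open>p = (s, a)\<close>.
\<close>

definition slot :: "nat \<Rightarrow> real \<times> 'a \<Rightarrow> 'a \<times> int \<Rightarrow> 'k::real_normed_field" where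
  "slot m p j = (if fst j = snd p then of_real (trig m (snd j) (fst p)) else 0)"

text \<open>
  The kernel with Fourier coefficients \<open>f l / n!\<close>, differentiated \<open>\<mu> i\<close> times in variable number \<open>i\<close>.
  The orders are carried along because differentiation then only changes \<open>\<mu>\<close>.
\<close>

definition synth_deriv :: "(('a::finite \<times> int) list \<Rightarrow> 'k::{real_normed_field,banach}) \<Rightarrow> (nat \<Rightarrow> nat) \<Rightarrow> (real \<times> 'a) list \<Rightarrow> 'k" where
  "synth_deriv f \<mu> xs = form_eval (length xs) f (\<lambda>i. slot (\<mu> i) (xs ! i)) / fact (length xs)"

abbreviation synth :: "(('a::finite \<times> int) list \<Rightarrow> 'k::{real_normed_field,banach}) \<Rightarrow> (real \<times> 'a) list \<Rightarrow> 'k" where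
  "synth f \<equiv> synth_deriv f (\<lambda>_. 0)"

lemma norm_slot_le: "norm (slot m p j) \<le> 2 * (2 * pi) ^ m * wt j ^ m"
  using abs_trig_le[of m "snd j" "fst p" "fst j"] by (simp add: slot_def)

lemma one_le_2pi: "1 \<le> 2 * pi" using pi_ge_two by simp

lemma tame_slot: assumes "m \<le> k" shows "tame k (2 * (2 * pi) ^ k) (slot m p)"
proof -
  have t: "tame m (2 * (2 * pi) ^ m) (slot m p)" unfolding tame_def by (intro allI norm_slot_le)
  have "(2 * pi) ^ m \<le> (2 * pi) ^ k" by (rule power_increasing[OF assms one_le_2pi])
  then have "2 * (2 * pi) ^ m \<le> 2 * (2 * pi) ^ k" by (rule mult_left_mono) simp
  then show ?thesis by (rule tame_mono[OF t assms])
qed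

lemma slot_deriv: "((\<lambda>t. slot m (t, a) j) has_vector_derivative slot (Suc m) (t, a) j) (at t)"
proof (cases "fst j = a")
  case True
  then show ?thesis
    unfolding slot_def using has_vector_derivative_of_real[OF trig_deriv] by simp
qed (simp add: slot_def)

lemma form_eval_slot_deriv:
  fixes f :: "('a::finite \<times> int) list \<Rightarrow> 'k::{real_normed_field,banach}"
  assumes f: "rapid f" and i: "i < n" and \<Xi>: "\<And>i. i < n \<Longrightarrow> tame N A (\<Xi> i)"
  shows "((\<lambda>t. form_eval n f (\<Xi>(i := slot m (t, a)))) has_vector_derivative form_eval n f (\<Xi>(i := slot (Suc m) (t, a)))) (at t)"
proof -
  let ?N = "max N (Suc m)"
  let ?A = "max A (2 * (2 * pi) ^ ?N)"
  have A: "?A \<ge> 0" by (simp add: le_max_iff_disj)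
  obtain M where M: "bnd (?N + 2) 1 M f" using rapidD[OF f, of 1 "?N + 2"] by auto
  have T: "tame ?N ?A ((\<Xi>(i := slot m' (t, a))) i')" if "i' < n" "m' \<le> Suc m" for m' t i'
  proof (cases "i' = i")
    case True
    have "tame ?N (2 * (2 * pi) ^ ?N) (slot m' (t, a) :: 'a \<times> int \<Rightarrow> 'k)"
      using that(2) by (intro tame_slot) simp
    then show ?thesis using True tame_mono[of ?N "2 * (2 * pi) ^ ?N" _ ?N ?A] by simp
  next
    case False
    then show ?thesis using tame_mono[OF \<Xi>[OF that(1)], of ?N ?A] by simp
  qed
  let ?b = "\<lambda>l::('a \<times> int) list. (M * fact n) * (\<Prod>i<n. ?A / 1 * (1 / (wt (l ! i))\<^sup>2))"
  have le: "norm (f l * (\<Prod>i'<n. (\<Xi>(i := slot m' (t, a))) i' (l ! i'))) \<le> ?b l"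
    if "l \<in> {l. length l = n}" "m' \<le> Suc m" for l t m'
    using that bndD[OF M, of l] by (intro norm_form_eval_term_le[where N = ?N and k = "?N + 2"] T) auto
  show ?thesis
    unfolding form_eval_def
  proof (rule has_vector_derivative_infsum[where b = ?b])
    fix l :: "('a \<times> int) list" and t :: real assume l: "l \<in> {l. length l = n}"
    have eq: "f l * (\<Prod>i'<n. (\<Xi>(i := slot m' (t, a))) i' (l ! i'))
        = (f l * (\<Prod>i'\<in>{..<n} - {i}. \<Xi> i' (l ! i'))) * slot m' (t, a) (l ! i)" for m' t
    proof -
      have "(\<Prod>i'<n. (\<Xi>(i := slot m' (t, a))) i' (l ! i'))
          = slot m' (t, a) (l ! i) * (\<Prod>i'\<in>{..<n} - {i}. (\<Xi>(i := slot m' (t, a))) i' (l ! i'))"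
        using i by (subst prod.remove[of _ i]) auto
      also have "(\<Prod>i'\<in>{..<n} - {i}. (\<Xi>(i := slot m' (t, a))) i' (l ! i')) = (\<Prod>i'\<in>{..<n} - {i}. \<Xi> i' (l ! i'))"
        by (rule prod.cong) auto
      finally show ?thesis by (simp only: mult_ac)
    qed
    show "((\<lambda>t. f l * (\<Prod>i'<n. (\<Xi>(i := slot m (t, a))) i' (l ! i'))) has_vector_derivative
        f l * (\<Prod>i'<n. (\<Xi>(i := slot (Suc m) (t, a))) i' (l ! i'))) (at t)"
      unfolding eq by (rule has_vector_derivative_mult_right[OF slot_deriv])
  next
    show "?b summable_on {l. length l = n}"
      by (rule has_sum_imp_summable[OF has_sum_form_eval_bound[OF A]]) simp
  qed (use le in auto)
qed

lemma synth_deriv_upd: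
  assumes "i < length xs"
  shows "synth_deriv f \<mu> (xs[i := p]) = form_eval (length xs) f ((\<lambda>i. slot (\<mu> i) (xs ! i))(i := slot (\<mu> i) p)) / fact (length xs)"
  unfolding synth_deriv_def length_list_update
  by (intro arg_cong2[of _ _ _ _ "(/)"] refl form_eval_cong) (use assms in \<open>auto simp: nth_list_update\<close>)

lemma synth_deriv_deriv:
  fixes f :: "('a::finite \<times> int) list \<Rightarrow> 'k::{real_normed_field,banach}"
  assumes f: "rapid f" and i: "i < length xs"
  shows "((\<lambda>t. synth_deriv f \<mu> (xs[i := (t, a)])) has_vector_derivative synth_deriv f (\<mu>(i := Suc (\<mu> i))) (xs[i := (t, a)])) (at t)"
proof -
  let ?N = "Max (\<mu> ` {..<length xs})"
  have "tame ?N (2 * (2 * pi) ^ ?N) (slot (\<mu> j) (xs ! j) :: 'a \<times> int \<Rightarrow> 'k)" if "j < length xs" for j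
    using that by (intro tame_slot) simp
  note d = form_eval_slot_deriv[OF f i this, where m = "\<mu> i" and a = a and t = t]
  have eq: "synth_deriv f (\<mu>(i := Suc (\<mu> i))) (xs[i := (t, a)])
     = form_eval (length xs) f ((\<lambda>i. slot (\<mu> i) (xs ! i))(i := slot (Suc (\<mu> i)) (t, a))) / fact (length xs)"
    unfolding synth_deriv_upd[OF i] by (intro arg_cong2[of _ _ _ _ "(/)"] refl form_eval_cong) auto
  show ?thesis
    unfolding eq unfolding synth_deriv_upd[OF i] by (rule has_vector_derivative_divide[OF d])
qed

lemma partial_synth_deriv:
  assumes "rapid f" "i < length xs"
  shows "partial i (synth_deriv f \<mu>) xs = synth_deriv f (\<mu>(i := Suc (\<mu> i))) xs"
proof -
  have "xs[i := (fst (xs ! i), snd (xs ! i))] = xs" by simp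
  then show ?thesis
    unfolding partial_def using vector_derivative_at[OF synth_deriv_deriv[OF assms, of \<mu> "snd (xs ! i)" "fst (xs ! i)"]] by metis
qed

lemma partial_cong:
  assumes "\<And>ys. length ys = length xs \<Longrightarrow> F ys = G ys" shows "partial i F xs = partial i G xs"
  unfolding partial_def using assms by (simp del: fun_upd_apply)

lemma foldr_partial_synth_deriv:
  assumes "rapid f" "set js \<subseteq> {..<length xs}"
  shows "foldr partial js (synth f) xs = synth_deriv f (count_list js) xs"
  using assms(2)
proof (induction js arbitrary: xs)
  case Nil
  then show ?case by (simp add: synth_deriv_def)
next
  case (Cons i js)
  have "foldr partial (i # js) (synth f) xs = partial i (synth_deriv f (count_list js)) xs"
    using Cons.prems by (simp, intro partial_cong Cons.IH) auto
  also have "\<dots> = synth_deriv f ((count_list js)(i := Suc (count_list js i))) xs"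
    using Cons.prems by (intro partial_synth_deriv assms) auto
  also have "(count_list js)(i := Suc (count_list js i)) = count_list (i # js)"
    by (auto simp: fun_eq_iff)
  finally show ?case .
qed

lemma smooth_synth:
  fixes f :: "(('d::finite + 'd) \<times> int) list \<Rightarrow> 'k::{real_normed_field,banach}"
  assumes f: "rapid f" shows "smooth_kernel (synth f)"
  unfolding smooth_kernel_def
proof (intro allI impI conjI)
  fix n and js :: "nat list" and a :: "nat \<Rightarrow> 'd + 'd" assume js: "set js \<subseteq> {..<n}"
  let ?\<mu> = "count_list js"
  let ?N = "Max (insert 0 (?\<mu> ` {..<n}))"
  let ?A = "2 * (2 * pi) ^ ?N"
  obtain M where M: "bnd (?N + 2) 1 M f" using rapidD[OF f, of 1 "?N + 2"] by auto
  have eq: "foldr partial js (synth f) (map (\<lambda>i. (s i, a i)) [0..<n])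
      = form_eval n f (\<lambda>i. slot (?\<mu> i) (s i, a i)) / fact n" for s :: "nat \<Rightarrow> real"
  proof -
    have "foldr partial js (synth f) (map (\<lambda>i. (s i, a i)) [0..<n]) = synth_deriv f ?\<mu> (map (\<lambda>i. (s i, a i)) [0..<n])"
      using js by (intro foldr_partial_synth_deriv f) simp
    also have "\<dots> = form_eval n f (\<lambda>i. slot (?\<mu> i) (s i, a i)) / fact n"
      unfolding synth_deriv_def by (auto intro!: form_eval_cong)
    finally show ?thesis .
  qed
  have T: "tame ?N ?A (slot (?\<mu> i) p :: ('d + 'd) \<times> int \<Rightarrow> 'k)" if "i < n" for i p
    using that by (intro tame_slot) simp
  show "continuous_on UNIV (\<lambda>s :: nat \<Rightarrow> real. foldr partial js (synth f) (map (\<lambda>i. (s i, a i)) [0..<n]))"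
    unfolding eq form_eval_def
  proof (intro continuous_on_divide continuous_on_const continuous_on_infsum)
    show "(\<lambda>l::(('d + 'd) \<times> int) list. (M * fact n) * (\<Prod>i<n. ?A / 1 * (1 / (wt (l ! i))\<^sup>2))) summable_on {l. length l = n}"
      by (rule has_sum_imp_summable[OF has_sum_form_eval_bound]) auto
    fix l :: "(('d + 'd) \<times> int) list" assume l: "l \<in> {l. length l = n}"
    show "norm (f l * (\<Prod>i<n. slot (?\<mu> i) (s i, a i) (l ! i))) \<le> (M * fact n) * (\<Prod>i<n. ?A / 1 * (1 / (wt (l ! i))\<^sup>2))" for s
      using l bndD[OF M, of l] by (intro norm_form_eval_term_le[where N = ?N and k = "?N + 2"] T) auto
    have "continuous_on UNIV (\<lambda>s :: nat \<Rightarrow> real. slot (?\<mu> i) (s i, a i) (l ! i) :: 'k)" for i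
      unfolding slot_def by (cases "fst (l ! i) = a i") (auto intro!: continuous_intros)
    then show "continuous_on UNIV (\<lambda>s :: nat \<Rightarrow> real. f l * (\<Prod>i<n. slot (?\<mu> i) (s i, a i) (l ! i)))"
      by (intro continuous_intros)
  qed simp
next
  fix n i and js :: "nat list" and xs :: "(real \<times> ('d + 'd)) list"
  assume js: "set js \<subseteq> {..<n}" and i: "i < n" and xs: "length xs = n"
  have eq: "foldr partial js (synth f) (xs[i := p]) = synth_deriv f (count_list js) (xs[i := p])" for p
    using js xs by (intro foldr_partial_synth_deriv f) simp
  show "(\<lambda>t. foldr partial js (synth f) (xs[i := (t, snd (xs ! i))])) differentiable at (fst (xs ! i))"
    unfolding eq using synth_deriv_deriv[OF f, of i xs] i xs differentiableI_vector by blast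
qed

lemma form_eval_permute:
  fixes f :: "'i list \<Rightarrow> 'k::{real_normed_field,banach}"
  assumes f: "symm f" and p: "p permutes {..<n}"
  shows "form_eval n f (\<lambda>i. \<Xi> (p i)) = form_eval n f \<Xi>"
proof -
  have q: "inv p permutes {..<n}" by (rule permutes_inv[OF p])
  have bij: "bij_betw (permute_list p) {l::'i list. length l = n} {l. length l = n}"
  proof (rule bij_betw_byWitness[where f' = "permute_list (inv p)"])
    show "\<forall>l\<in>{l::'i list. length l = n}. permute_list (inv p) (permute_list p l) = l"
    proof
      fix l :: "'i list" assume "l \<in> {l. length l = n}"
      then have "inv p permutes {..<length l}" using q by simp
      from permute_list_compose[OF this, of p] show "permute_list (inv p) (permute_list p l) = l"
        using permutes_inv_o(1)[OF p] by simp
    qed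
    show "\<forall>l\<in>{l::'i list. length l = n}. permute_list p (permute_list (inv p) l) = l"
    proof
      fix l :: "'i list" assume "l \<in> {l. length l = n}"
      then have "p permutes {..<length l}" using p by simp
      from permute_list_compose[OF this, of "inv p"] show "permute_list p (permute_list (inv p) l) = l"
        using permutes_inv_o(2)[OF p] by simp
    qed
  qed auto
  have "form_eval n f \<Xi> = (\<Sum>\<^sub>\<infinity>l\<in>{l. length l = n}. f l * (\<Prod>i<n. \<Xi> (p i) (l ! p i)))"
    unfolding form_eval_def by (intro infsum_cong arg_cong2[of _ _ _ _ "(*)"] refl) (rule prod.permute[OF p, unfolded o_def])
  also have "\<dots> = (\<Sum>\<^sub>\<infinity>l\<in>{l. length l = n}. f (permute_list p l) * (\<Prod>i<n. \<Xi> (p i) (permute_list p l ! i)))"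
  proof (rule infsum_cong)
    fix l :: "'i list" assume l: "l \<in> {l. length l = n}"
    then have "f (permute_list p l) = f l" using p by (intro symmD[OF f]) simp
    moreover have "(\<Prod>i<n. \<Xi> (p i) (permute_list p l ! i)) = (\<Prod>i<n. \<Xi> (p i) (l ! p i))"
      using l p by (intro prod.cong) (auto simp: permute_list_nth)
    ultimately show "f l * (\<Prod>i<n. \<Xi> (p i) (l ! p i)) = f (permute_list p l) * (\<Prod>i<n. \<Xi> (p i) (permute_list p l ! i))"
      by simp
  qed
  also have "\<dots> = form_eval n f (\<lambda>i. \<Xi> (p i))"
    unfolding form_eval_def by (rule infsum_reindex_bij_betw[OF bij])
  finally show ?thesis by simp
qed

lemma symmetric_synth:
  fixes f :: "(('d::finite + 'd) \<times> int) list \<Rightarrow> 'k::{real_normed_field,banach}"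
  assumes f: "symm f" shows "symmetric_kernel (synth f)"
  unfolding symmetric_kernel_def
proof (intro allI impI)
  fix xs ys :: "(real \<times> ('d + 'd)) list" assume m: "mset xs = mset ys"
  then obtain p where p: "p permutes {..<length ys}" "permute_list p ys = xs" by (rule mset_eq_permutation)
  have len: "length xs = length ys" using m by (rule mset_eq_length)
  have "form_eval (length ys) f (\<lambda>i. slot 0 (xs ! i)) = form_eval (length ys) f (\<lambda>i. (\<lambda>i. slot 0 (ys ! i)) (p i))"
    using p by (intro form_eval_cong) (auto simp: permute_list_nth)
  then show "synth f xs = synth f ys"
    unfolding synth_deriv_def len using form_eval_permute[OF f p(1), of "\<lambda>i. slot 0 (ys ! i)"] by simp
qed

lemma periodic_synth:
  fixes f :: "(('d::finite + 'd) \<times> int) list \<Rightarrow> 'k::{real_normed_field,banach}"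
  shows "periodic_kernel (synth f)"
  unfolding periodic_kernel_def
proof (intro allI impI)
  fix xs :: "(real \<times> ('d + 'd)) list" and i t and a :: "'d + 'd" assume i: "i < length xs"
  have "slot 0 (t + 1, a) = (slot 0 (t, a) :: _ \<Rightarrow> 'k)" by (simp add: slot_def trig_periodic fun_eq_iff)
  then show "synth f (xs[i := (t + 1, a)]) = synth f (xs[i := (t, a)])"
    unfolding synth_deriv_upd[OF i] by simp
qed

text \<open>
  A mixed derivative as a word of single derivatives. It is reversed because \<open>foldr\<close> applies the last
  letter first.
\<close>

definition derivative_word :: "nat list \<Rightarrow> nat list" where
  "derivative_word m = rev (concat (map (\<lambda>i. replicate (m ! i) i) [0..<length m]))"

lemma mixed_partial_eq: "mixed_partial m F = foldr partial (derivative_word m) F"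
proof -
  have "fold (\<lambda>i. partial i ^^ (m ! i)) is F = fold partial (concat (map (\<lambda>i. replicate (m ! i) i) is)) F" for "is"
    by (induction "is" arbitrary: F) (simp_all add: fold_replicate)
  then show ?thesis by (simp add: mixed_partial_def derivative_word_def foldr_conv_fold)
qed

lemma set_derivative_word: "set (derivative_word m) \<subseteq> {..<length m}"
  by (auto simp: derivative_word_def)

lemma count_list_replicate: "count_list (replicate n x) y = (if x = y then n else 0)"
  by (induction n) auto

lemma count_list_derivative_word: "count_list (derivative_word m) j = (if j < length m then m ! j else 0)"
proof -
  have "distinct is \<Longrightarrow> count_list (concat (map (\<lambda>i. replicate (m ! i) i) is)) j = (if j \<in> set is then m ! j else 0)" for "is"
    by (induction "is") (auto simp: count_list_append count_list_replicate)
  from this[of "[0..<length m]"] show ?thesis by (simp add: derivative_word_def count_list_rev)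
qed

lemma mixed_partial_synth:
  assumes "rapid f" "length m = length xs"
  shows "mixed_partial m (synth f) xs = synth_deriv f (\<lambda>j. if j < length m then m ! j else 0) xs"
  unfolding mixed_partial_eq using foldr_partial_synth_deriv[OF assms(1), of "derivative_word m" xs] set_derivative_word[of m] assms(2)
  by (simp add: count_list_derivative_word[abs_def])

text \<open>
  The contribution of one variable to the degree norm of a synthesized kernel: the number of possible
  orders of differentiation, the number of components, the size of a derivative of a mode, and the sum over
  all modes.
\<close>

definition synth_const :: "'d::finite itself \<Rightarrow> nat \<Rightarrow> real" where
  "synth_const _ k = (real k + 1) * real CARD('d + 'd) * (2 * (2 * pi) ^ k) * wsum TYPE('d + 'd)"

lemma
  fixes f :: "(('d::finite + 'd) \<times> int) list \<Rightarrow> 'k::{real_normed_field,banach}"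
  assumes f: "rapid f" and M: "bnd (k + 2) C M f" and C: "C > 0"
  shows degree_norm_synth_nonneg: "0 \<le> degree_norm k n (synth f)"
    and degree_norm_synth_le: "degree_norm k n (synth f) \<le> M * (synth_const TYPE('d) k / C) ^ n"
proof -
  let ?A = "2 * (2 * pi) ^ k"
  let ?B = "M * (?A / C * wsum TYPE('d + 'd)) ^ n"
  let ?m = "{m. length m = n \<and> set m \<subseteq> {0..k}}"
  let ?L = "\<lambda>m s. L2_set (\<lambda>a. norm (mixed_partial m (synth f) (zip s a))) {a::('d + 'd) list. length a = n}"
  have fin: "finite {a::('d + 'd) list. length a = n}" and card: "card {a::('d + 'd) list. length a = n} = CARD('d + 'd) ^ n"
    using finite_lists_length_eq[of "UNIV :: ('d + 'd) set" n] card_lists_length_eq[of "UNIV :: ('d + 'd) set" n] by simp_all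
  have le: "norm (mixed_partial m (synth f) (zip s a)) \<le> ?B"
    if m: "m \<in> ?m" and s: "length s = n" and a: "length a = n" for m and s :: "real list" and a :: "('d + 'd) list"
  proof -
    let ?x = "zip s a"
    have len: "length ?x = n" using s a by simp
    have mj: "m ! j \<le> k" if "j < n" for j
    proof -
      have "m ! j \<in> set m" using m that by auto
      then show ?thesis using m by auto
    qed
    have "norm (form_eval n f (\<lambda>i. slot (if i < n then m ! i else 0) (?x ! i))) \<le> (M * fact n) * (?A / C * wsum TYPE('d + 'd)) ^ n"
      using bndD[OF M] mj by (intro norm_form_eval_le[where N = k and k = "k + 2"] tame_slot C) auto
    then have "norm (synth_deriv f (\<lambda>j. if j < n then m ! j else 0) ?x) \<le> ?B"
      unfolding synth_deriv_def len by (simp add: norm_divide divide_le_eq mult_ac)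
    moreover have "mixed_partial m (synth f) ?x = synth_deriv f (\<lambda>j. if j < n then m ! j else 0) ?x"
      using mixed_partial_synth[OF f, of m ?x] m len by auto
    ultimately show ?thesis by (simp only:)
  qed
  have B0: "?B \<ge> 0" using bnd_nonneg[OF M] C wsum_nonneg[where 'c = "'d + 'd"] by simp
  have L: "?L m s \<le> real CARD('d + 'd) ^ n * ?B" if m: "m \<in> ?m" and s: "s \<in> {s. length s = n}" for m s
  proof -
    have "?L m s \<le> (\<Sum>a\<in>{a::('d + 'd) list. length a = n}. norm (mixed_partial m (synth f) (zip s a)))"
      by (rule L2_set_le_sum) simp
    also have "\<dots> \<le> (\<Sum>a\<in>{a::('d + 'd) list. length a = n}. ?B)"
      by (rule sum_mono) (use le[OF m] s in auto)
    also have "\<dots> = real CARD('d + 'd) ^ n * ?B" by (simp only: sum_constant card of_nat_power)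
    finally show ?thesis .
  qed
  have ne: "replicate n 0 \<in> {s::real list. length s = n}" by simp
  have sup: "sup_norm n (mixed_partial m (synth f)) \<le> real CARD('d + 'd) ^ n * ?B" "0 \<le> sup_norm n (mixed_partial m (synth f))" if m: "m \<in> ?m" for m
  proof -
    show "sup_norm n (mixed_partial m (synth f)) \<le> real CARD('d + 'd) ^ n * ?B"
      unfolding sup_norm_def
    proof (rule cSUP_least)
      show "{s::real list. length s = n} \<noteq> {}" using ne by blast
    qed (rule L[OF m])
    have "bdd_above (?L m ` {s. length s = n})" using L[OF m] by (intro bdd_aboveI2)
    then show "0 \<le> sup_norm n (mixed_partial m (synth f))"
      unfolding sup_norm_def by (intro cSUP_upper2[OF _ ne] L2_set_nonneg)
  qed
  show "0 \<le> degree_norm k n (synth f)"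
    unfolding degree_norm_def by (intro sum_nonneg sup(2))
  have "card ?m = (k + 1) ^ n"
    using card_lists_length_eq[of "{0..k}" n] by (simp add: conj_commute)
  then have "degree_norm k n (synth f) \<le> (real k + 1) ^ n * (real CARD('d + 'd) ^ n * ?B)"
    unfolding degree_norm_def using sum_mono[of ?m "\<lambda>m. sup_norm n (mixed_partial m (synth f))", OF sup(1)]
    by (simp add: add.commute)
  also have "\<dots> = M * (synth_const TYPE('d) k / C) ^ n"
  proof -
    have "synth_const TYPE('d) k / C = (real k + 1) * (real CARD('d + 'd) * (?A / C * wsum TYPE('d + 'd)))"
      by (simp add: synth_const_def)
    then show ?thesis by (simp only: power_mult_distrib[of _ _ n]) (simp only: mult_ac)
  qed
  finally show "degree_norm k n (synth f) \<le> M * (synth_const TYPE('d) k / C) ^ n" .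
qed

lemma synth_const_nonneg: "synth_const TYPE('d::finite) k \<ge> 0"
  by (simp add: synth_const_def wsum_nonneg)

text \<open>
  The choice of \<open>C'\<close> makes the series for the norm geometric with ratio at most 1/2.
\<close>

lemma
  fixes f :: "(('d::finite + 'd) \<times> int) list \<Rightarrow> 'k::{real_normed_field,banach}"
  assumes f: "rapid f" and M: "bnd (k + 2) C' M f" and C: "C > 0" and C': "C' = 2 * C * (synth_const TYPE('d) k + 1)"
  shows summable_degree_norm_synth: "summable (\<lambda>n. C ^ n * degree_norm k n (synth f))"
    and kernel_norm_synth_le: "kernel_norm k C (synth f) \<le> 2 * M"
proof -
  have C'0: "C' > 0" using C synth_const_nonneg[where 'd = 'd, of k] by (simp add: C')
  have "C * (synth_const TYPE('d) k / C') = synth_const TYPE('d) k / (2 * (synth_const TYPE('d) k + 1))"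
    using C by (simp add: C')
  then have q: "C * (synth_const TYPE('d) k / C') \<le> 1 / 2" "0 \<le> C * (synth_const TYPE('d) k / C')"
    using synth_const_nonneg[where 'd = 'd, of k] by (simp_all add: divide_le_eq)
  have le: "C ^ n * degree_norm k n (synth f) \<le> M * (1 / 2) ^ n" for n
  proof -
    have "C ^ n * degree_norm k n (synth f) \<le> C ^ n * (M * (synth_const TYPE('d) k / C') ^ n)"
      using C by (intro mult_left_mono degree_norm_synth_le[OF f M C'0]) auto
    also have "\<dots> = M * (C * (synth_const TYPE('d) k / C')) ^ n" by (simp only: power_mult_distrib mult_ac)
    also have "\<dots> \<le> M * (1 / 2) ^ n"
      using q bnd_nonneg[OF M] by (intro mult_left_mono power_mono) auto
    finally show ?thesis .
  qed
  have s: "(\<lambda>n. M * (1 / 2) ^ n) sums (M * 2)"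
    using geometric_sums[of "1 / 2 :: real"] by (intro sums_mult) simp
  show su: "summable (\<lambda>n. C ^ n * degree_norm k n (synth f))"
    by (rule summable_comparison_test'[OF sums_summable[OF s]])
      (use le degree_norm_synth_nonneg[OF f M C'0] C in \<open>simp add: abs_mult\<close>)
  show "kernel_norm k C (synth f) \<le> 2 * M"
    unfolding kernel_norm_def using suminf_le[OF le su sums_summable[OF s]] sums_unique[OF s] by simp
qed

lemma synth_in_connes_kernels:
  fixes f :: "(('d::finite + 'd) \<times> int) list \<Rightarrow> 'k::{real_normed_field,banach}"
  assumes f: "connes_coef f" shows "synth f \<in> connes_kernels"
proof -
  have "summable (\<lambda>n. C ^ n * degree_norm k n (synth f))" if C: "C > 0" for k C
  proof -
    have "2 * C * (synth_const TYPE('d) k + 1) > 0" using C synth_const_nonneg[where 'd = 'd, of k] by simp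
    then obtain M where M: "bnd (k + 2) (2 * C * (synth_const TYPE('d) k + 1)) M f" using rapidD[OF connes_coefD(1)[OF f]] by blast
    show ?thesis by (rule summable_degree_norm_synth[OF connes_coefD(1)[OF f] M C refl])
  qed
  then show ?thesis
    using smooth_synth symmetric_synth periodic_synth connes_coefD[OF f] by (auto simp: connes_kernels_def)
qed

section \<open>Stratonovich integrals of synthesized kernels\<close>

lemma integral_infsum_dominated:
  fixes F :: "'i \<Rightarrow> 's \<Rightarrow> 'b::{banach,second_countable_topology}"
  assumes M: "finite_measure M" and S: "countable S"
    and meas: "\<And>x. x \<in> S \<Longrightarrow> F x \<in> borel_measurable M"
    and le: "\<And>x s. x \<in> S \<Longrightarrow> s \<in> space M \<Longrightarrow> norm (F x s) \<le> b x" and b: "b summable_on S"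
  shows "(LINT s|M. (\<Sum>\<^sub>\<infinity>x\<in>S. F x s)) = (\<Sum>\<^sub>\<infinity>x\<in>S. (LINT s|M. F x s))"
proof -
  interpret finite_measure M by (rule M)
  have int: "integrable M (F x)" if "x \<in> S" for x
    by (rule integrable_const_bound[where B = "b x"]) (use le[OF that] meas[OF that] in auto)
  have int_le: "norm (LINT s|M. norm (F x s)) \<le> measure M (space M) * b x" if "x \<in> S" for x
  proof -
    have "(LINT s|M. norm (F x s)) \<le> (LINT s|M. b x)"
      by (rule integral_mono_AE) (use int[OF that] le[OF that] in auto)
    then show ?thesis by (simp add: mult.commute)
  qed
  show ?thesis
  proof (cases "finite S")
    case True
    then show ?thesis using int by (simp add: Bochner_Integration.integral_sum)
  next
    case False
    let ?e = "from_nat_into S"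
    have e: "bij_betw ?e UNIV S" by (rule bij_betw_from_nat_into[OF S False])
    have eS: "?e n \<in> S" for n using e by (auto simp: bij_betw_def)
    have be: "summable (\<lambda>n. b (?e n))"
      using summable_on_reindex_bij_betw[OF e, of b] b summable_on_imp_summable by blast
    have sum: "summable (\<lambda>n. norm (F (?e n) s))" if "s \<in> space M" for s
      by (rule summable_comparison_test'[OF be]) (use le[OF eS that] in simp)
    have eq: "(\<Sum>\<^sub>\<infinity>x\<in>S. F x s) = (\<Sum>n. F (?e n) s)" if "s \<in> space M" for s
      using infsum_reindex_bij_betw[OF e, of "\<lambda>x. F x s"] infsumI[OF has_sum_of_summable_norm[OF sum[OF that]]] by simp
    have i: "norm (LINT s|M. F (?e n) s) \<le> measure M (space M) * b (?e n)" for n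
      using order_trans[OF integral_norm_bound abs_le_D1[OF int_le[OF eS, unfolded real_norm_def]]] .
    have si: "summable (\<lambda>n. norm (LINT s|M. F (?e n) s))"
      by (rule summable_comparison_test'[OF summable_mult[OF be]]) (use i in simp)
    have "(LINT s|M. (\<Sum>\<^sub>\<infinity>x\<in>S. F x s)) = (LINT s|M. (\<Sum>n. F (?e n) s))"
      by (rule Bochner_Integration.integral_cong[OF refl eq])
    also have "\<dots> = (\<Sum>n. (LINT s|M. F (?e n) s))"
    proof (rule integral_suminf)
      show "integrable M (F (?e n))" for n by (rule int[OF eS])
      show "AE s in M. summable (\<lambda>n. norm (F (?e n) s))" using sum by simp
      show "summable (\<lambda>n. LINT s|M. norm (F (?e n) s))"
        by (rule summable_comparison_test'[OF summable_mult[OF be]]) (rule int_le[OF eS])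
    qed
    also have "\<dots> = (\<Sum>\<^sub>\<infinity>x\<in>S. (LINT s|M. F x s))"
      using infsum_reindex_bij_betw[OF e, of "\<lambda>x. LINT s|M. F x s"] infsumI[OF has_sum_of_summable_norm[OF si]] by simp
    finally show ?thesis .
  qed
qed

abbreviation unit_measure :: "real measure" where
  "unit_measure \<equiv> restrict_space lborel {0..1}"

lemma space_unit_measure [simp]: "space unit_measure = {0..1}"
  by (simp add: space_restrict_space)

lemma finite_unit_measure: "finite_measure unit_measure"
  by (rule finite_measureI) (simp add: emeasure_restrict_space)

lemma finite_PiM_unit: "finite_measure (Pi\<^sub>M {..<n::nat} (\<lambda>_. unit_measure))"
proof (rule finite_measureI)
  interpret u: finite_measure unit_measure by (rule finite_unit_measure)
  interpret product_sigma_finite "\<lambda>_::nat. unit_measure" by standard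
  have "emeasure (Pi\<^sub>M {..<n} (\<lambda>_. unit_measure)) (Pi\<^sub>E {..<n} (\<lambda>_. space unit_measure)) = (\<Prod>i<n. emeasure unit_measure (space unit_measure))"
    by (rule emeasure_PiM) (simp_all only: finite_lessThan sets.top)
  also have "\<dots> = 1" by (simp add: emeasure_restrict_space)
  finally show "emeasure (Pi\<^sub>M {..<n} (\<lambda>_. unit_measure)) (space (Pi\<^sub>M {..<n} (\<lambda>_. unit_measure))) \<noteq> \<infinity>"
    by (simp add: space_PiM)
qed

lemma integral_unit_measure:
  fixes g :: "real \<Rightarrow> real"
  assumes g: "continuous_on UNIV g"
  shows "(LINT s|unit_measure. of_real (g s)) = (of_real (integral {0..1} g) :: 'k::{real_normed_field,euclidean_space})"
proof -
  have c: "continuous_on {0..1} (\<lambda>s. of_real (g s) :: 'k)"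
    by (intro continuous_intros continuous_on_subset[OF g]) simp
  have "set_integrable lborel {0..1} (\<lambda>s. of_real (g s) :: 'k)"
    unfolding set_integrable_def by (rule borel_integrable_compact[OF compact_Icc c])
  note s = set_borel_integral_eq_integral(2)[OF this]
  have gi: "g integrable_on {0..1}"
    by (rule integrable_continuous_interval[OF continuous_on_subset[OF g]]) simp
  have "(LINT s|unit_measure. of_real (g s) :: 'k) = (LINT s : {0..1} | lborel. of_real (g s))"
    unfolding set_lebesgue_integral_def by (rule integral_restrict_space) simp
  also have "\<dots> = integral {0..1} (\<lambda>s. of_real (g s))" by (rule s)
  also have "\<dots> = of_real (integral {0..1} g)"
    using integral_linear[OF gi bounded_linear_of_real] by (simp add: o_def)
  finally show ?thesis .
qed

lemma sum_eq_single:
  "finite A \<Longrightarrow> a \<in> A \<Longrightarrow> (\<And>x. x \<in> A \<Longrightarrow> x \<noteq> a \<Longrightarrow> g x = 0) \<Longrightarrow> sum g A = g a"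
  by (simp add: sum.remove sum.neutral)

text \<open>
  The pairing of a differentiated slot with \<open>X s\<close>; \<open>theta\<close> below is its integral over the circle.
\<close>

definition eta :: "(real \<Rightarrow> real ^ 'a::finite) \<Rightarrow> nat \<Rightarrow> real \<Rightarrow> 'a \<times> int \<Rightarrow> 'k::real_normed_field" where
  "eta X m s j = of_real (trig m (snd j) s * X s $ fst j)"

definition theta :: "(real \<Rightarrow> real ^ 'a::finite) \<Rightarrow> nat \<Rightarrow> 'a \<times> int \<Rightarrow> 'k::real_normed_field" where
  "theta X m j = of_real (integral {0..1} (\<lambda>s. trig m (snd j) s * X s $ fst j))"

lemma tame_eta_theta:
  assumes X: "X \<in> loops"
  obtains A where "A \<ge> 0" "\<And>m s. m \<le> 2 \<Longrightarrow> s \<in> {0..1} \<Longrightarrow> tame 2 A (eta X m s :: 'a::finite \<times> int \<Rightarrow> 'k::real_normed_field)"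
    "\<And>m. m \<le> 2 \<Longrightarrow> tame 2 A (theta X m :: 'a \<times> int \<Rightarrow> 'k)"
proof -
  obtain B where B: "B \<ge> 0" "\<forall>s\<in>{0..1}. \<forall>a. \<bar>X s $ a\<bar> \<le> B" using loop_bounded[OF X] .
  let ?A = "2 * (2 * pi)\<^sup>2 * B"
  have le: "\<bar>trig m (snd j) s * X s $ fst j\<bar> \<le> ?A * (wt j)\<^sup>2" if "m \<le> 2" "s \<in> {0..1}" for m s and j :: "'a \<times> int"
  proof -
    have "\<bar>trig m (snd j) s\<bar> \<le> 2 * (2 * pi)\<^sup>2 * (wt j)\<^sup>2"
    proof -
      have "\<bar>trig m (snd j) s\<bar> \<le> 2 * (2 * pi) ^ m * wt j ^ m"
        using abs_trig_le[of m "snd j" s "fst j"] by simp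
      also have "\<dots> \<le> 2 * (2 * pi)\<^sup>2 * (wt j)\<^sup>2"
        using that(1) one_le_2pi by (intro mult_mono mult_left_mono power_increasing) auto
      finally show ?thesis .
    qed
    then have "\<bar>trig m (snd j) s\<bar> * \<bar>X s $ fst j\<bar> \<le> (2 * (2 * pi)\<^sup>2 * (wt j)\<^sup>2) * B"
      using B that(2) by (intro mult_mono) auto
    then show ?thesis by (simp add: abs_mult mult_ac)
  qed
  show ?thesis
  proof (rule that[of ?A])
    show "tame 2 ?A (eta X m s :: 'a \<times> int \<Rightarrow> 'k)" if "m \<le> 2" "s \<in> {0..1}" for m s
      unfolding tame_def eta_def norm_of_real using le[OF that] by blast
    show "tame 2 ?A (theta X m :: 'a \<times> int \<Rightarrow> 'k)" if "m \<le> 2" for m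
      unfolding tame_def theta_def norm_of_real
    proof
      fix j :: "'a \<times> int"
      have "norm (integral {0..1} (\<lambda>s. trig m (snd j) s * X s $ fst j)) \<le> (?A * (wt j)\<^sup>2) * (1 - 0)"
        by (rule integral_bound) (use le[OF that] in \<open>auto intro!: continuous_intros loopsD(1)[OF X]\<close>)
      then show "\<bar>integral {0..1} (\<lambda>s. trig m (snd j) s * X s $ fst j)\<bar> \<le> ?A * (wt j)\<^sup>2" by simp
    qed
  qed (use B in auto)
qed

lemma theta_2: "theta X 2 j = - (of_real ((2 * pi * of_int (snd j))\<^sup>2)) * (theta X 0 j :: 'k::real_normed_field)"
proof -
  have "trig 2 (snd j) s * X s $ fst j = - (2 * pi * of_int (snd j))\<^sup>2 * (trig 0 (snd j) s * X s $ fst j)" for s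
    using trig_Suc_Suc[of 0 "snd j" s] by (simp add: numeral_2_eq_2 mult.assoc)
  then have "integral {0..1} (\<lambda>s. trig 2 (snd j) s * X s $ fst j) = - (2 * pi * of_int (snd j))\<^sup>2 * integral {0..1} (\<lambda>s. trig 0 (snd j) s * X s $ fst j)"
    by (simp only: integral_mult_right)
  then show ?thesis by (simp add: theta_def)
qed

lemma loop_coeff_theta: "loop_coeff X j = of_real ((2 * pi * of_int (snd j))\<^sup>2) * theta X 0 j + (theta X 0 j :: 'k::real_normed_field)"
proof -
  have "eigenvalue (snd j) = (2 * pi * of_int (snd j))\<^sup>2 + 1" by (simp add: eigenvalue_def power_mult_distrib)
  then show ?thesis by (simp add: loop_coeff_def theta_def distrib_right)
qed

text \<open>
  The Stratonovich integral differentiates twice in the variables belonging to \<open>J\<close>.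
\<close>

definition order_two_on :: "nat set \<Rightarrow> nat \<Rightarrow> nat" where "order_two_on J j = (if j \<in> J then 2 else 0)"

lemma order_two_on_le: "order_two_on J j \<le> 2" by (simp add: order_two_on_def)

text \<open>
  A slot is supported on one component, so for every word only one tuple \<open>a\<close> of components contributes to
  the contraction with \<open>X\<close>.
\<close>

lemma sum_components_synth:
  fixes f :: "(('d::finite + 'd) \<times> int) list \<Rightarrow> 'k::{real_normed_field,banach}"
  assumes f: "rapid f"
  shows "(\<Sum>a\<in>{a. length a = n}. mixed_partial (map (\<lambda>j. if j \<in> J then 2 else 0) [0..<n]) (synth f) (zip (map s [0..<n]) a)
      * of_real (\<Prod>j<n. X (s j) $ (a ! j))) = form_eval n f (\<lambda>j. eta X (order_two_on J j) (s j)) / fact n"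
proof -
  let ?A = "{a::('d + 'd) list. length a = n}"
  have fin: "finite ?A" using finite_lists_length_eq[of "UNIV :: ('d + 'd) set" n] by simp
  let ?c = "\<lambda>a. of_real (\<Prod>j<n. X (s j) $ (a ! j)) :: 'k"
  have T: "tame 2 (2 * (2 * pi)\<^sup>2) (slot (order_two_on J i) p :: ('d + 'd) \<times> int \<Rightarrow> 'k)" for i p
    by (rule tame_slot[OF order_two_on_le])
  have mp: "mixed_partial (map (\<lambda>j. if j \<in> J then 2 else 0) [0..<n]) (synth f) (zip (map s [0..<n]) a)
      = form_eval n f (\<lambda>j. slot (order_two_on J j) (s j, a ! j)) / fact n" if "a \<in> ?A" for a
  proof -
    have "mixed_partial (map (\<lambda>j. if j \<in> J then 2 else 0) [0..<n]) (synth f) (zip (map s [0..<n]) a)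
      = synth_deriv f (\<lambda>j. if j < n then map (\<lambda>j. if j \<in> J then 2 else 0) [0..<n] ! j else 0) (zip (map s [0..<n]) a)"
      using that by (subst mixed_partial_synth[OF f]) auto
    also have "\<dots> = form_eval n f (\<lambda>j. slot (order_two_on J j) (s j, a ! j)) / fact n"
      unfolding synth_deriv_def using that by (auto intro!: form_eval_cong simp: order_two_on_def)
    finally show ?thesis .
  qed
  have s: "(\<lambda>l. f l * (\<Prod>j<n. slot (order_two_on J j) (s j, a ! j) (l ! j)) * ?c a) summable_on {l. length l = n}" for a
    by (rule summable_on_cmult_left[OF rapid_form_eval_summable[OF f T]])
  have "(\<Sum>a\<in>?A. form_eval n f (\<lambda>j. slot (order_two_on J j) (s j, a ! j)) * ?c a)
      = (\<Sum>a\<in>?A. \<Sum>\<^sub>\<infinity>l\<in>{l. length l = n}. f l * (\<Prod>j<n. slot (order_two_on J j) (s j, a ! j) (l ! j)) * ?c a)"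
    unfolding form_eval_def by (simp only: infsum_cmult_left')
  also have "\<dots> = (\<Sum>\<^sub>\<infinity>l\<in>{l. length l = n}. \<Sum>a\<in>?A. f l * (\<Prod>j<n. slot (order_two_on J j) (s j, a ! j) (l ! j)) * ?c a)"
    by (rule infsum_finite_sum[OF fin s, symmetric])
  also have "\<dots> = form_eval n f (\<lambda>j. eta X (order_two_on J j) (s j))"
    unfolding form_eval_def
  proof (rule infsum_cong)
    fix l :: "(('d + 'd) \<times> int) list" assume l: "l \<in> {l. length l = n}"
    have "(\<Sum>a\<in>?A. f l * (\<Prod>j<n. slot (order_two_on J j) (s j, a ! j) (l ! j)) * ?c a)
        = f l * (\<Prod>j<n. slot (order_two_on J j) (s j, map fst l ! j) (l ! j)) * ?c (map fst l)"
    proof (rule sum_eq_single[OF fin])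
      show "map fst l \<in> ?A" using l by simp
      fix a assume a: "a \<in> ?A" "a \<noteq> map fst l"
      then obtain j where "j < n" "a ! j \<noteq> fst (l ! j)"
        using l by (auto simp: list_eq_iff_nth_eq)
      then have "(\<Prod>j<n. slot (order_two_on J j) (s j, a ! j) (l ! j)) = (0 :: 'k)"
        by (intro prod_zero) (auto simp: slot_def intro!: bexI[of _ j])
      then show "f l * (\<Prod>j<n. slot (order_two_on J j) (s j, a ! j) (l ! j)) * ?c a = 0" by simp
    qed
    also have "\<dots> = f l * (\<Prod>j<n. eta X (order_two_on J j) (s j) (l ! j))"
      using l by (simp add: slot_def eta_def prod.distrib mult.assoc)
    finally show "(\<Sum>a\<in>?A. f l * (\<Prod>j<n. slot (order_two_on J j) (s j, a ! j) (l ! j)) * ?c a)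
        = f l * (\<Prod>j<n. eta X (order_two_on J j) (s j) (l ! j))" .
  qed
  finally show ?thesis by (simp add: mp sum_divide_distrib[symmetric])
qed

lemma integral_form_eval_eta:
  fixes f :: "('a::finite \<times> int) list \<Rightarrow> 'k::{real_normed_field,euclidean_space}"
  assumes f: "rapid f" and X: "X \<in> loops"
  shows "(LINT s|Pi\<^sub>M {..<n} (\<lambda>_. unit_measure). form_eval n f (\<lambda>j. eta X (order_two_on J j) (s j))) = form_eval n f (\<lambda>j. theta X (order_two_on J j))"
proof -
  let ?M = "Pi\<^sub>M {..<n} (\<lambda>_. unit_measure)"
  obtain A where A: "A \<ge> 0" "\<And>m s. m \<le> 2 \<Longrightarrow> s \<in> {0..1} \<Longrightarrow> tame 2 A (eta X m s :: 'a \<times> int \<Rightarrow> 'k)"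
    using tame_eta_theta[OF X] by metis
  obtain M where M: "bnd (2 + 2) 1 M f" using rapidD[OF f, of 1 "2 + 2"] by auto
  interpret u: finite_measure unit_measure by (rule finite_unit_measure)
  interpret product_sigma_finite "\<lambda>_::nat. unit_measure" by standard
  have c: "continuous_on UNIV (\<lambda>s. trig m k s * X s $ a)" for m k a
    by (intro continuous_intros loopsD(1)[OF X])
  have mb: "(\<lambda>s. eta X m s j :: 'k) \<in> borel_measurable unit_measure" for m j
  proof -
    have "(\<lambda>s. of_real (trig m (snd j) s * X s $ fst j) :: 'k) \<in> borel_measurable borel"
      by (intro borel_measurable_continuous_onI continuous_on_of_real c)
    then have "(\<lambda>s. of_real (trig m (snd j) s * X s $ fst j) :: 'k) \<in> borel_measurable lborel"
      by (simp only: measurable_lborel2)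
    then show ?thesis unfolding eta_def by (rule measurable_restrict_space1)
  qed
  have "(LINT s|?M. form_eval n f (\<lambda>j. eta X (order_two_on J j) (s j)))
      = (\<Sum>\<^sub>\<infinity>l\<in>{l. length l = n}. (LINT s|?M. f l * (\<Prod>j<n. eta X (order_two_on J j) (s j) (l ! j))))"
    unfolding form_eval_def
  proof (rule integral_infsum_dominated[OF finite_PiM_unit])
    show "(\<lambda>l::('a \<times> int) list. (M * fact n) * (\<Prod>i<n. A / 1 * (1 / (wt (l ! i))\<^sup>2))) summable_on {l. length l = n}"
      by (rule has_sum_imp_summable[OF has_sum_form_eval_bound[OF A(1)]]) simp
    fix l :: "('a \<times> int) list" assume l: "l \<in> {l. length l = n}"
    have "(\<lambda>s. eta X (order_two_on J j) (s j) (l ! j) :: 'k) \<in> borel_measurable ?M" if "j \<in> {..<n}" for j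
      using measurable_component_singleton[OF that, of "\<lambda>_. unit_measure"] mb[of "order_two_on J j" "l ! j"]
      by (rule measurable_compose)
    then show "(\<lambda>s. f l * (\<Prod>j<n. eta X (order_two_on J j) (s j) (l ! j))) \<in> borel_measurable ?M"
      by (intro borel_measurable_times borel_measurable_const borel_measurable_prod)
    fix s assume s: "s \<in> space ?M"
    have "s j \<in> {0..1}" if "j < n" for j
      using s that by (auto simp: space_PiM PiE_iff)
    then show "norm (f l * (\<Prod>j<n. eta X (order_two_on J j) (s j) (l ! j))) \<le> (M * fact n) * (\<Prod>i<n. A / 1 * (1 / (wt (l ! i))\<^sup>2))"
      using l bndD[OF M, of l] by (intro norm_form_eval_term_le[where N = 2 and k = "2 + 2"] A order_two_on_le) auto
  qed (rule countableI_type)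
  also have "\<dots> = (\<Sum>\<^sub>\<infinity>l\<in>{l. length l = n}. f l * (\<Prod>j<n. theta X (order_two_on J j) (l ! j)))"
  proof (rule infsum_cong)
    fix l :: "('a \<times> int) list"
    have int: "integrable unit_measure (\<lambda>s. eta X (order_two_on J j) s (l ! j) :: 'k)" for j
    proof (rule u.integrable_const_bound[where B = "A * (wt (l ! j))\<^sup>2"])
      show "AE s in unit_measure. norm (eta X (order_two_on J j) s (l ! j) :: 'k) \<le> A * (wt (l ! j))\<^sup>2"
        by (rule AE_I2, rule tameD[OF A(2)[OF order_two_on_le]]) simp
    qed (rule mb)
    have "(LINT s|?M. (\<Prod>j<n. eta X (order_two_on J j) (s j) (l ! j))) = (\<Prod>j<n. LINT s|unit_measure. eta X (order_two_on J j) s (l ! j) :: 'k)"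
      by (rule product_integral_prod[where f = "\<lambda>j s. eta X (order_two_on J j) s (l ! j)"]) (use int in auto)
    also have "\<dots> = (\<Prod>j<n. theta X (order_two_on J j) (l ! j))"
      unfolding eta_def theta_def by (intro prod.cong refl integral_unit_measure c)
    finally show "(LINT s|?M. f l * (\<Prod>j<n. eta X (order_two_on J j) (s j) (l ! j))) = f l * (\<Prod>j<n. theta X (order_two_on J j) (l ! j))"
      by simp
  qed
  finally show ?thesis by (simp only: form_eval_def)
qed

text \<open>
  The alternating sum over \<open>J\<close> expands the product of the operators \<open>1 - \<partial>\<^sub>j\<^sup>2\<close>, and on a single mode
  \<open>1 - \<partial>\<^sup>2\<close> is multiplication by the eigenvalue that occurs in \<open>loop_coeff\<close>.
\<close>

lemma sum_subsets_theta:
  fixes f :: "('a::finite \<times> int) list \<Rightarrow> 'k::{real_normed_field,banach}"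
  assumes f: "rapid f" and X: "X \<in> loops"
  shows "(\<Sum>J\<in>Pow {..<n}. (-1) ^ card J * form_eval n f (\<lambda>j. theta X (order_two_on J j))) = form_eval n f (\<lambda>_. loop_coeff X)"
proof -
  obtain A where A: "A \<ge> 0" "\<And>m. m \<le> 2 \<Longrightarrow> tame 2 A (theta X m :: 'a \<times> int \<Rightarrow> 'k)"
    using tame_eta_theta[OF X] by metis
  have s: "(\<lambda>l. (-1) ^ card J * (f l * (\<Prod>j<n. theta X (order_two_on J j) (l ! j)))) summable_on {l. length l = n}" for J
    by (rule summable_on_cmult_right[OF rapid_form_eval_summable[OF f A(2)[OF order_two_on_le]]])
  have "(\<Sum>J\<in>Pow {..<n}. (-1) ^ card J * form_eval n f (\<lambda>j. theta X (order_two_on J j)))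
      = (\<Sum>J\<in>Pow {..<n}. \<Sum>\<^sub>\<infinity>l\<in>{l. length l = n}. (-1) ^ card J * (f l * (\<Prod>j<n. theta X (order_two_on J j) (l ! j))))"
    unfolding form_eval_def by (simp only: infsum_cmult_right')
  also have "\<dots> = (\<Sum>\<^sub>\<infinity>l\<in>{l. length l = n}. \<Sum>J\<in>Pow {..<n}. (-1) ^ card J * (f l * (\<Prod>j<n. theta X (order_two_on J j) (l ! j))))"
    by (rule infsum_finite_sum[OF _ s, symmetric]) simp
  also have "\<dots> = form_eval n f (\<lambda>_. loop_coeff X)"
    unfolding form_eval_def
  proof (rule infsum_cong)
    fix l :: "('a \<times> int) list"
    let ?g = "\<lambda>j. theta X 0 (l ! j) :: 'k"
    have "(-1) ^ card J * (\<Prod>j<n. theta X (order_two_on J j) (l ! j)) = (\<Prod>j\<in>J. - theta X 2 (l ! j)) * (\<Prod>j\<in>{..<n} - J. ?g j)"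
      if J: "J \<in> Pow {..<n}" for J
    proof -
      have "(\<Prod>j<n. theta X (order_two_on J j) (l ! j)) = (\<Prod>j\<in>J. theta X (order_two_on J j) (l ! j)) * (\<Prod>j\<in>{..<n} - J. theta X (order_two_on J j) (l ! j) :: 'k)"
        using J by (subst prod.subset_diff[of J "{..<n}"]) (auto simp: mult.commute)
      also have "(\<Prod>j\<in>J. theta X (order_two_on J j) (l ! j)) = (\<Prod>j\<in>J. theta X 2 (l ! j) :: 'k)"
        by (rule prod.cong) (auto simp: order_two_on_def)
      also have "(\<Prod>j\<in>{..<n} - J. theta X (order_two_on J j) (l ! j)) = (\<Prod>j\<in>{..<n} - J. ?g j)"
        by (rule prod.cong) (auto simp: order_two_on_def)
      also have "(-1) ^ card J * ((\<Prod>j\<in>J. theta X 2 (l ! j)) * (\<Prod>j\<in>{..<n} - J. ?g j))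
          = (\<Prod>j\<in>J. (-1) * theta X 2 (l ! j)) * (\<Prod>j\<in>{..<n} - J. ?g j)"
        unfolding prod.distrib prod_constant by (simp only: mult.assoc)
      finally show ?thesis by simp
    qed
    then have "(\<Sum>J\<in>Pow {..<n}. (-1) ^ card J * (f l * (\<Prod>j<n. theta X (order_two_on J j) (l ! j))))
        = f l * (\<Sum>J\<in>Pow {..<n}. (\<Prod>j\<in>J. - theta X 2 (l ! j)) * (\<Prod>j\<in>{..<n} - J. ?g j))"
      unfolding sum_distrib_left by (intro sum.cong refl) (simp add: mult.left_commute)
    also have "(\<Sum>J\<in>Pow {..<n}. (\<Prod>j\<in>J. - theta X 2 (l ! j)) * (\<Prod>j\<in>{..<n} - J. ?g j)) = (\<Prod>j<n. - theta X 2 (l ! j) + ?g j)"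
      by (rule prod_add[symmetric]) simp
    also have "\<dots> = (\<Prod>j<n. loop_coeff X (l ! j))"
      by (simp add: theta_2 loop_coeff_theta)
    finally show "(\<Sum>J\<in>Pow {..<n}. (-1) ^ card J * (f l * (\<Prod>j<n. theta X (order_two_on J j) (l ! j)))) = f l * (\<Prod>j<n. loop_coeff X (l ! j))" .
  qed
  finally show ?thesis .
qed

theorem stratonovich_synth:
  fixes f :: "(('d::finite + 'd) \<times> int) list \<Rightarrow> 'k::{real_normed_field,euclidean_space}"
  assumes f: "rapid f"
  shows "stratonovich (synth f) = Phi f"
proof
  fix X :: "real \<Rightarrow> real ^ ('d + 'd)"
  show "stratonovich (synth f) X = Phi f X"
  proof (cases "X \<in> loops")
    case True
    have "stratonovich (synth f) X = (\<Sum>n. \<Sum>J\<in>Pow {..<n}. LINT s|Pi\<^sub>M {..<n} (\<lambda>_. unit_measure).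
        (-1) ^ card J * (form_eval n f (\<lambda>j. eta X (order_two_on J j) (s j)) / fact n))"
      unfolding stratonovich_def sum_components_synth[OF f] using True by simp
    also have "\<dots> = (\<Sum>n. form_eval n f (\<lambda>_. loop_coeff X) / fact n)"
    proof (rule suminf_cong)
      fix n
      have "(\<Sum>J\<in>Pow {..<n}. LINT s|Pi\<^sub>M {..<n} (\<lambda>_. unit_measure). (-1) ^ card J * (form_eval n f (\<lambda>j. eta X (order_two_on J j) (s j)) / fact n))
          = (\<Sum>J\<in>Pow {..<n}. (-1) ^ card J * form_eval n f (\<lambda>j. theta X (order_two_on J j))) / fact n"
        unfolding sum_divide_distrib
        by (intro sum.cong refl) (simp add: integral_form_eval_eta[OF f True])
      then show "(\<Sum>J\<in>Pow {..<n}. LINT s|Pi\<^sub>M {..<n} (\<lambda>_. unit_measure). (-1) ^ card J * (form_eval n f (\<lambda>j. eta X (order_two_on J j) (s j)) / fact n))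
          = form_eval n f (\<lambda>_. loop_coeff X) / fact n"
        by (simp only: sum_subsets_theta[OF f True])
    qed
    also have "\<dots> = Phi f X" using True by (simp add: Phi_def taylor_eval_def)
    finally show ?thesis .
  qed (simp add: stratonovich_def Phi_def)
qed

section \<open>Pointwise inversion of Fourier series\<close>

lemma periodic_of_int:
  fixes w :: "real \<Rightarrow> 'b"
  assumes "\<And>s. w (s + 1) = w s" shows "w (s + of_int k) = w s"
proof (induction k rule: int_induct[where k = 0])
  case (step1 i)
  then show ?case using assms[of "s + of_int i"] by (simp add: add.assoc)
next
  case (step2 i)
  then show ?case using assms[of "s + of_int (i - 1)"] by (simp add: algebra_simps)
qed simp

lemma integral_periodic_shift:
  fixes w :: "real \<Rightarrow> 'b::banach"
  assumes w: "continuous_on UNIV w" "\<And>s. w (s + 1) = w s" and c: "0 \<le> c" "c \<le> 1"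
  shows "integral {0..1} (\<lambda>t. w (t + c)) = integral {0..1} w"
proof -
  have int: "w integrable_on {a..b}" for a b
    by (rule integrable_continuous_interval[OF continuous_on_subset[OF w(1)]]) simp
  have "integral {0..1} (\<lambda>t. w (t + c)) = integral {c..1 + c} w"
    using integral_shift_real_ivl[of c c "1 + c" w] by simp
  also have "\<dots> = integral {c..1} w + integral {1..1 + c} w"
    using c by (intro Henstock_Kurzweil_Integration.integral_combine[symmetric] int) auto
  also have "integral {1..1 + c} w = integral {0..c} w"
    using integral_shift_real_ivl[of 1 1 "1 + c" w] w(2) by simp
  also have "integral {c..1} w + integral {0..c} w = integral {0..1} w"
    using c Henstock_Kurzweil_Integration.integral_combine[OF _ _ int, of 0 c 1] by (simp add: add.commute)
  finally show ?thesis .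
qed

lemma integral_periodic_reflect:
  fixes w :: "real \<Rightarrow> 'b::banach"
  assumes w: "\<And>s. w (s + 1) = w s"
  shows "integral {0..1} (\<lambda>t. w (- t)) = integral {0..1} w"
proof -
  have "integral {0..1} (\<lambda>t. w (- t)) = integral {-1..0} w"
    using Henstock_Kurzweil_Integration.integral_reflect_real[of 0 "-1" w] by simp
  also have "\<dots> = integral {0..1} (\<lambda>x. w (x - 1))"
    using integral_shift_real_ivl[of "-1" "-1" 0 w] by simp
  also have "(\<lambda>x. w (x - 1)) = w" using w[of "_ - 1"] by (simp add: fun_eq_iff)
  finally show ?thesis .
qed

lemma amplitude_nz: "amplitude k \<noteq> 0"
  using eigenvalue_pos(1)[of k] by (simp add: amplitude_def eigenvalue_def)

lemma cos_eq_trig: "cos (2 * pi * of_int k * t) = trig 0 \<bar>k\<bar> t / amplitude \<bar>k\<bar>"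
  using amplitude_nz[of "\<bar>k\<bar>"] by (cases "k \<ge> 0") (simp_all add: trig_def phase_def)

lemma sin_eq_trig: "k \<ge> 0 \<Longrightarrow> sin (2 * pi * of_int k * t) = (if k = 0 then 0 else - trig 0 (- k) t / amplitude k)"
proof (cases "k = 0")
  case False
  assume k: "k \<ge> 0"
  have "cos (2 * pi * of_int (- k) * t + - (pi / 2)) = cos (2 * pi * of_int k * t + pi / 2)"
    using cos_minus[of "2 * pi * of_int k * t + pi / 2"] by simp
  also have "\<dots> = - sin (2 * pi * of_int k * t)" using minus_sin_cos_eq[of "2 * pi * of_int k * t"] by simp
  finally have "trig 0 (- k) t = - amplitude (- k) * sin (2 * pi * of_int k * t)"
    using False k by (simp add: trig_def phase_def)
  moreover have "amplitude (- k) = amplitude k" by (simp add: amplitude_def)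
  ultimately show ?thesis using False amplitude_nz[of k] by simp
qed simp

lemma cos_2pi_periodic: "cos (2 * pi * of_int k * (t + 1) + \<phi>) = cos (2 * pi * of_int k * t + \<phi>)"
proof -
  have "2 * pi * of_int k * (t + 1) + \<phi> = (2 * pi * of_int k * t + \<phi>) + 2 * pi * of_int k"
    by (simp add: algebra_simps)
  moreover have "cos (\<theta> + 2 * pi * of_int k) = cos \<theta>" for \<theta>
    by (simp only: cos_add cos_int_2pin sin_int_2pin)
  ultimately show ?thesis by (simp only:)
qed

text \<open>
  Symmetrize \<open>v\<close> about a point \<open>s0\<close>. The result is even, hence a continuous function of \<open>cos (2 * pi * t)\<close>, and is
  orthogonal to all powers of that cosine. Approximation by polynomials shows that it is orthogonal to
  itself, so it vanishes, in particular at 0, where its value is \<open>2 * v s0\<close>.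
\<close>

lemma fourier_unique_real:
  fixes v :: "real \<Rightarrow> real"
  assumes v: "continuous_on UNIV v" "\<And>s. v (s + 1) = v s"
    and zero: "\<And>k. integral {0..1} (\<lambda>s. trig 0 k s * v s) = 0"
  shows "v s = 0"
proof -
  have vc: "continuous_on S (\<lambda>x. v (g x))" if "continuous_on S g" for S and g :: "real \<Rightarrow> real"
    by (rule continuous_on_compose2[OF v(1) that]) simp
  have main: "v s0 = 0" if s0: "0 \<le> s0" "s0 \<le> 1" for s0
  proof -
    \<comment> \<open>Only cosines survive the symmetrization.\<close>
    define e where "e t = v (s0 + t) + v (s0 - t)" for t
    have ec: "continuous_on S e" for S
      unfolding e_def by (intro continuous_intros vc)
    have vm: "v (s - 1) = v s" for s using v(2)[of "s - 1"] by simp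
    have ep: "e (t + 1) = e t" for t
    proof -
      have "v (s0 + (t + 1)) = v (s0 + t)" using v(2)[of "s0 + t"] by (simp add: add.assoc)
      moreover have "v (s0 - (t + 1)) = v (s0 - t)" using vm[of "s0 - t"] by (simp add: diff_diff_add)
      ultimately show ?thesis by (simp add: e_def)
    qed
    have cosv: "integral {0..1} (\<lambda>s. v s * cos (2 * pi * of_int k * s)) = 0" for k
    proof -
      have "integral {0..1} (\<lambda>s. (1 / amplitude \<bar>k\<bar>) * (trig 0 \<bar>k\<bar> s * v s)) = 0"
        by (simp only: integral_mult_right zero mult_zero_right)
      then show ?thesis unfolding cos_eq_trig by (simp add: mult.commute)
    qed
    have sinv: "integral {0..1} (\<lambda>s. v s * sin (2 * pi * of_int k * s)) = 0" if k: "k \<ge> 0" for k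
    proof -
      have "integral {0..1} (\<lambda>s. (if k = 0 then 0 else - 1 / amplitude k) * (trig 0 (- k) s * v s)) = 0"
        by (simp only: integral_mult_right zero mult_zero_right)
      then show ?thesis unfolding sin_eq_trig[OF k] by (cases "k = 0") (simp_all add: mult.commute)
    qed
    have E1: "integral {0..1} (\<lambda>t. e t * cos (2 * pi * of_int k * t)) = 0" if k: "k \<ge> 0" for k
    proof -
      let ?r = "\<lambda>t. v (s0 + t) * cos (2 * pi * of_int k * t)"
      let ?q = "\<lambda>x. v x * cos (2 * pi * of_int k * x + - (2 * pi * of_int k * s0))"
      have rp: "?r (t + 1) = ?r t" for t
        using v(2)[of "s0 + t"] cos_2pi_periodic[of k t 0] by (simp only: add.assoc add_0_right)
      have qp: "?q (t + 1) = ?q t" for t by (simp only: v(2) cos_2pi_periodic)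
      have qc: "continuous_on UNIV ?q" by (intro continuous_intros v(1))
      have "integral {0..1} ?r = integral {0..1} (\<lambda>t. ?q (t + s0))"
        by (rule integral_cong) (simp add: algebra_simps)
      also have "\<dots> = integral {0..1} ?q"
        by (rule integral_periodic_shift[OF qc qp s0])
      also have "\<dots> = integral {0..1} (\<lambda>x. cos (2 * pi * of_int k * s0) * (v x * cos (2 * pi * of_int k * x))
          + sin (2 * pi * of_int k * s0) * (v x * sin (2 * pi * of_int k * x)))"
        by (rule integral_cong) (simp only: cos_add cos_minus sin_minus, simp add: algebra_simps)
      also have "\<dots> = cos (2 * pi * of_int k * s0) * integral {0..1} (\<lambda>x. v x * cos (2 * pi * of_int k * x))
          + sin (2 * pi * of_int k * s0) * integral {0..1} (\<lambda>x. v x * sin (2 * pi * of_int k * x))"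
        unfolding integral_mult_right[symmetric]
        by (intro integral_add integrable_continuous_interval continuous_intros vc)
      also have "\<dots> = 0" by (simp only: cosv sinv[OF k])
      finally have r0: "integral {0..1} ?r = 0" .
      have rc: "?r integrable_on {0..1}" "(\<lambda>t. ?r (- t)) integrable_on {0..1}"
        by (intro integrable_continuous_interval continuous_intros vc)+
      have "integral {0..1} (\<lambda>t. e t * cos (2 * pi * of_int k * t)) = integral {0..1} (\<lambda>t. ?r t + ?r (- t))"
        by (rule integral_cong) (simp add: e_def distrib_right)
      also have "\<dots> = integral {0..1} ?r + integral {0..1} (\<lambda>t. ?r (- t))"
        by (rule integral_add[OF rc])
      also have "integral {0..1} (\<lambda>t. ?r (- t)) = integral {0..1} ?r"
        by (rule integral_periodic_reflect[of ?r, OF rp])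
      finally show ?thesis using r0 by simp
    qed
    have E2: "integral {0..1} (\<lambda>t. e t * cos (2 * pi * of_int k * t)) = 0" for k
    proof (cases "k \<ge> 0")
      case False
      have "cos (2 * pi * of_int k * t) = cos (2 * pi * of_int (- k) * t)" for t
        using cos_minus[of "2 * pi * of_int k * t"] by simp
      then show ?thesis using E1[of "- k"] False by simp
    qed (rule E1)
    \<comment> \<open>The product formula for cosines reduces powers of the cosine to higher frequencies.\<close>
    have E3: "integral {0..1} (\<lambda>t. e t * cos (2 * pi * t) ^ m * cos (2 * pi * of_int k * t)) = 0" for m k
    proof (induction m arbitrary: k)
      case 0
      then show ?case using E2 by simp
    next
      case (Suc m)
      have "e t * cos (2 * pi * t) ^ Suc m * cos (2 * pi * of_int k * t)
          = (1 / 2) * (e t * cos (2 * pi * t) ^ m * cos (2 * pi * of_int (k - 1) * t))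
            + (1 / 2) * (e t * cos (2 * pi * t) ^ m * cos (2 * pi * of_int (k + 1) * t))" for t
      proof -
        have "cos (2 * pi * of_int k * t) * cos (2 * pi * t)
            = (cos (2 * pi * of_int (k - 1) * t) + cos (2 * pi * of_int (k + 1) * t)) / 2"
          unfolding cos_times_cos by (simp add: algebra_simps)
        then have "e t * cos (2 * pi * t) ^ m * (cos (2 * pi * of_int k * t) * cos (2 * pi * t))
          = e t * cos (2 * pi * t) ^ m * ((cos (2 * pi * of_int (k - 1) * t) + cos (2 * pi * of_int (k + 1) * t)) / 2)"
          by simp
        then show ?thesis by (simp only: power_Suc distrib_left add_divide_distrib) (simp add: mult_ac)
      qed
      then have "integral {0..1} (\<lambda>t. e t * cos (2 * pi * t) ^ Suc m * cos (2 * pi * of_int k * t))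
          = integral {0..1} (\<lambda>t. (1 / 2) * (e t * cos (2 * pi * t) ^ m * cos (2 * pi * of_int (k - 1) * t))
            + (1 / 2) * (e t * cos (2 * pi * t) ^ m * cos (2 * pi * of_int (k + 1) * t)))"
        by (simp only:)
      also have "\<dots> = integral {0..1} (\<lambda>t. (1 / 2) * (e t * cos (2 * pi * t) ^ m * cos (2 * pi * of_int (k - 1) * t)))
            + integral {0..1} (\<lambda>t. (1 / 2) * (e t * cos (2 * pi * t) ^ m * cos (2 * pi * of_int (k + 1) * t)))"
        by (intro integral_add integrable_continuous_interval continuous_intros ec)
      also have "\<dots> = 0" by (simp only: integral_mult_right Suc.IH)
      finally show ?case .
    qed
    have E4: "integral {0..1} (\<lambda>t. e t * cos (2 * pi * t) ^ m) = 0" for m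
      using E3[of m 0] by simp
    \<comment> \<open>On the second half of the period \<open>arccos\<close> returns \<open>1 - t\<close>, where \<open>e\<close> has the same value.\<close>
    define H where "H y = e (arccos y / (2 * pi))" for y
    have Hc: "continuous_on {-1..1} H"
      unfolding H_def by (rule continuous_on_compose2[OF ec[of UNIV]]) (auto intro!: continuous_intros)
    have He: "e t = H (cos (2 * pi * t))" if t: "t \<in> {0..1}" for t
    proof (cases "t \<le> 1 / 2")
      case True
      then have "arccos (cos (2 * pi * t)) = 2 * pi * t"
        using t by (intro arccos_cos) (auto simp: field_simps)
      then show ?thesis by (simp add: H_def)
    next
      case False
      have "cos (2 * pi * t) = cos (2 * pi * (1 - t))"
      proof -
        have "2 * pi * (1 - t) = - (2 * pi * t) + 2 * pi" by (simp add: algebra_simps)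
        then show ?thesis by (simp only: cos_periodic cos_minus)
      qed
      moreover have "arccos (cos (2 * pi * (1 - t))) = 2 * pi * (1 - t)"
        using t False by (intro arccos_cos) (auto simp: field_simps)
      ultimately have "H (cos (2 * pi * t)) = e (1 - t)" by (simp add: H_def)
      also have "\<dots> = e (- t)" using ep[of "- t"] by (simp add: add.commute)
      also have "\<dots> = e t" by (simp add: e_def)
      finally show ?thesis by simp
    qed
    have "compact (e ` {0..1})" by (rule compact_continuous_image[OF ec]) simp
    then obtain B0 where "\<forall>y\<in>e ` {0..1}. norm y \<le> B0"
      using compact_imp_bounded bounded_iff by metis
    then have B0: "\<bar>e t\<bar> \<le> B0" if "t \<in> {0..1}" for t using that by simp
    have "\<bar>integral {0..1} (\<lambda>t. e t * e t)\<bar> \<le> d * (\<bar>B0\<bar> + 1)" if d: "d > 0" for d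
    proof -
      obtain g where g: "real_polynomial_function g" "\<And>y. y \<in> {-1..1} \<Longrightarrow> \<bar>H y - g y\<bar> < d"
        using Stone_Weierstrass_real_polynomial_function[OF compact_Icc Hc d] by blast
      obtain a n where gn: "g = (\<lambda>x. \<Sum>i\<le>n. a i * x ^ i)"
        using g(1) unfolding real_polynomial_function_iff_sum by blast
      have gc: "continuous_on S (\<lambda>t. g (cos (2 * pi * t)))" for S :: "real set"
        unfolding gn by (intro continuous_intros)
      have "integral {0..1} (\<lambda>t. e t * g (cos (2 * pi * t))) = integral {0..1} (\<lambda>t. \<Sum>i\<le>n. a i * (e t * cos (2 * pi * t) ^ i))"
        unfolding gn by (rule integral_cong) (simp add: sum_distrib_left mult_ac)
      also have "\<dots> = (\<Sum>i\<le>n. integral {0..1} (\<lambda>t. a i * (e t * cos (2 * pi * t) ^ i)))"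
        by (intro integral_sum integrable_continuous_interval continuous_intros ec) simp
      also have "\<dots> = 0" by (simp only: integral_mult_right E4 mult_zero_right sum.neutral_const)
      finally have g0: "integral {0..1} (\<lambda>t. e t * g (cos (2 * pi * t))) = 0" .
      have "integral {0..1} (\<lambda>t. e t * e t) = integral {0..1} (\<lambda>t. e t * e t) - integral {0..1} (\<lambda>t. e t * g (cos (2 * pi * t)))"
        using g0 by simp
      also have "\<dots> = integral {0..1} (\<lambda>t. e t * e t - e t * g (cos (2 * pi * t)))"
        by (rule integral_diff[symmetric]) (intro integrable_continuous_interval continuous_intros ec gc)+
      also have "norm \<dots> \<le> (d * (\<bar>B0\<bar> + 1)) * (1 - 0)"
      proof (rule integral_bound)
        show "continuous_on {0..1} (\<lambda>t. e t * e t - e t * g (cos (2 * pi * t)))"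
          by (intro continuous_intros ec gc)
        fix t :: real assume t: "t \<in> {0..1}"
        have "\<bar>e t * e t - e t * g (cos (2 * pi * t))\<bar> = \<bar>e t\<bar> * \<bar>H (cos (2 * pi * t)) - g (cos (2 * pi * t))\<bar>"
          using He[OF t] by (simp add: right_diff_distrib[symmetric] abs_mult)
        also have "\<dots> \<le> (\<bar>B0\<bar> + 1) * d"
          using B0[OF t] g(2)[of "cos (2 * pi * t)"] by (intro mult_mono) auto
        finally show "norm (e t * e t - e t * g (cos (2 * pi * t))) \<le> d * (\<bar>B0\<bar> + 1)" by (simp add: mult.commute)
      qed simp
      finally show ?thesis by simp
    qed
    note small = this
    have "\<bar>integral {0..1} (\<lambda>t. e t * e t)\<bar> \<le> 0"
    proof (rule field_le_epsilon)
      fix \<epsilon> :: real assume "\<epsilon> > 0"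
      then have "\<epsilon> / (\<bar>B0\<bar> + 1) > 0" by simp
      from small[OF this] show "\<bar>integral {0..1} (\<lambda>t. e t * e t)\<bar> \<le> 0 + \<epsilon>" by simp
    qed
    then have "integral {0..1} (\<lambda>t. e t * e t) = 0" by simp
    then have "\<forall>t\<in>{0..1}. e t * e t = 0"
      by (subst (asm) integral_eq_0_iff) (auto intro!: continuous_intros ec)
    then have "e 0 = 0" by simp
    then show ?thesis by (simp add: e_def)
  qed
  have "v s = v (frac s + of_int \<lfloor>s\<rfloor>)" by (simp add: frac_def)
  also have "\<dots> = v (frac s)" by (rule periodic_of_int[where w = v, OF v(2)])
  also have "\<dots> = 0" by (rule main) (simp_all add: less_imp_le frac_lt_1)
  finally show ?thesis .
qed

lemma fourier_unique:
  fixes v :: "real \<Rightarrow> 'b::euclidean_space"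
  assumes v: "continuous_on UNIV v" "\<And>s. v (s + 1) = v s"
    and zero: "\<And>k. integral {0..1} (\<lambda>s. trig 0 k s *\<^sub>R v s) = 0"
  shows "v s = 0"
proof (rule euclidean_eqI)
  fix b :: 'b assume "b \<in> Basis"
  have "(\<lambda>s. v s \<bullet> b) s = 0"
  proof (rule fourier_unique_real[where v = "\<lambda>s. v s \<bullet> b"])
    show "continuous_on UNIV (\<lambda>s. v s \<bullet> b)" by (intro continuous_intros v(1))
    show "v (s + 1) \<bullet> b = v s \<bullet> b" for s by (simp only: v(2))
    show "integral {0..1} (\<lambda>s. trig 0 k s * (v s \<bullet> b)) = 0" for k
    proof -
      have "(\<lambda>s. trig 0 k s *\<^sub>R v s) integrable_on {0..1}"
        by (intro integrable_continuous_interval continuous_intros continuous_on_subset[OF v(1)]) simp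
      from integral_linear[OF this bounded_linear_inner_left[of b]] show ?thesis
        by (simp add: o_def zero)
    qed
  qed
  then show "v s \<bullet> b = 0 \<bullet> b" by simp
qed

lemma integral_unit_measure':
  fixes h :: "real \<Rightarrow> 'b::euclidean_space"
  assumes h: "continuous_on UNIV h"
  shows "integrable unit_measure h" and "(LINT s|unit_measure. h s) = integral {0..1} h"
proof -
  have "set_integrable lborel {0..1} h"
    unfolding set_integrable_def
    by (rule borel_integrable_compact[OF compact_Icc continuous_on_subset[OF h]]) simp
  note s = this set_borel_integral_eq_integral(2)[OF this]
  show "integrable unit_measure h"
    using s(1) by (simp add: integrable_restrict_space set_integrable_def)
  have "(LINT s|unit_measure. h s) = (LINT s : {0..1} | lborel. h s)"
    unfolding set_lebesgue_integral_def by (rule integral_restrict_space) simp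
  then show "(LINT s|unit_measure. h s) = integral {0..1} h" by (simp only: s(2))
qed

text \<open>
  The decay of the coefficients makes the series converge uniformly to a continuous function with the same
  coefficients as \<open>h\<close>; uniqueness identifies the two.
\<close>

theorem fourier_inversion:
  fixes h :: "real \<Rightarrow> 'b::euclidean_space"
  assumes h: "continuous_on UNIV h" "\<And>s. h (s + 1) = h s"
    and c: "\<And>k. c k = eigenvalue k *\<^sub>R integral {0..1} (\<lambda>s. trig 0 k s *\<^sub>R h s)"
    and D: "\<And>k. norm (c k) \<le> D * (1 / (1 + real_of_int \<bar>k\<bar>)\<^sup>2)"
  shows "h s = (\<Sum>\<^sub>\<infinity>k. trig 0 k s *\<^sub>R c k)"
proof -
  let ?b = "\<lambda>k::int. 2 * (D * (1 / (1 + real_of_int \<bar>k\<bar>)\<^sup>2))"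
  have bs: "?b summable_on UNIV"
    by (intro summable_on_cmult_right summable_int_inverse_square)
  have tl: "\<bar>trig 0 k s\<bar> \<le> 2" for k s using abs_trig_le[of 0 k s "()"] by simp
  have le: "norm (trig 0 k s *\<^sub>R c k) \<le> ?b k" for k s
    unfolding norm_scaleR by (rule mult_mono[OF tl D]) auto
  define g where "g s = (\<Sum>\<^sub>\<infinity>k. trig 0 k s *\<^sub>R c k)" for s
  have gc: "continuous_on UNIV g"
    unfolding g_def by (rule continuous_on_infsum[OF _ le bs]) (intro continuous_intros)
  have gp: "g (s + 1) = g s" for s by (simp add: g_def trig_periodic)
  have gk: "integral {0..1} (\<lambda>s. trig 0 k s *\<^sub>R g s) = (1 / eigenvalue k) *\<^sub>R c k" for k
  proof -
    have cont: "continuous_on UNIV (\<lambda>s. trig 0 k s *\<^sub>R (trig 0 k' s *\<^sub>R c k'))" for k'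
      by (intro continuous_intros)
    have "integral {0..1} (\<lambda>s. trig 0 k s *\<^sub>R g s) = (LINT s|unit_measure. trig 0 k s *\<^sub>R g s)"
      by (rule integral_unit_measure'(2)[symmetric]) (intro continuous_intros gc)
    also have "\<dots> = (LINT s|unit_measure. (\<Sum>\<^sub>\<infinity>k'. trig 0 k s *\<^sub>R (trig 0 k' s *\<^sub>R c k')))"
      unfolding g_def by (simp only: infsum_scaleR_right)
    also have "\<dots> = (\<Sum>\<^sub>\<infinity>k'. (LINT s|unit_measure. trig 0 k s *\<^sub>R (trig 0 k' s *\<^sub>R c k')))"
    proof (rule integral_infsum_dominated[OF finite_unit_measure])
      show "(\<lambda>s. trig 0 k s *\<^sub>R (trig 0 k' s *\<^sub>R c k')) \<in> borel_measurable unit_measure" for k'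
        using integral_unit_measure'(1)[OF cont] by (rule borel_measurable_integrable)
      show "norm (trig 0 k s *\<^sub>R (trig 0 k' s *\<^sub>R c k')) \<le> 2 * ?b k'" for k' s
        unfolding norm_scaleR[of "trig 0 k s"] by (rule mult_mono[OF tl le]) auto
      show "(\<lambda>k'. 2 * ?b k') summable_on UNIV" by (rule summable_on_cmult_right[OF bs])
    qed auto
    also have "\<dots> = (\<Sum>\<^sub>\<infinity>k'. (if k = k' then 1 / eigenvalue k else 0) *\<^sub>R c k')"
    proof (rule infsum_cong)
      fix k'
      have "(LINT s|unit_measure. trig 0 k s *\<^sub>R (trig 0 k' s *\<^sub>R c k')) = integral {0..1} (\<lambda>s. (trig 0 k s * trig 0 k' s) *\<^sub>R c k')"
        using integral_unit_measure'(2)[OF cont] by simp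
      also have "\<dots> = integral {0..1} (\<lambda>s. trig 0 k s * trig 0 k' s) *\<^sub>R c k'"
      proof -
        have "(\<lambda>s. trig 0 k s * trig 0 k' s) integrable_on {0..1}"
          by (intro integrable_continuous_interval continuous_intros)
        from integral_linear[OF this bounded_linear_scaleR_left[of "c k'"]] show ?thesis by (simp add: o_def)
      qed
      finally show "(LINT s|unit_measure. trig 0 k s *\<^sub>R (trig 0 k' s *\<^sub>R c k')) = (if k = k' then 1 / eigenvalue k else 0) *\<^sub>R c k'"
        by (simp only: integral_trig_trig)
    qed
    also have "\<dots> = (1 / eigenvalue k) *\<^sub>R c k"
      by (subst infsum_single[where a = k]) auto
    finally show ?thesis .
  qed
  have "(\<lambda>s. h s - g s) s = 0"
  proof (rule fourier_unique[where v = "\<lambda>s. h s - g s"])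
    show "continuous_on UNIV (\<lambda>s. h s - g s)" by (intro continuous_intros h(1) gc)
    show "h (s + 1) - g (s + 1) = h s - g s" for s by (simp only: h(2) gp)
    show "integral {0..1} (\<lambda>s. trig 0 k s *\<^sub>R (h s - g s)) = 0" for k
    proof -
      have "integral {0..1} (\<lambda>s. trig 0 k s *\<^sub>R h s - trig 0 k s *\<^sub>R g s)
          = integral {0..1} (\<lambda>s. trig 0 k s *\<^sub>R h s) - integral {0..1} (\<lambda>s. trig 0 k s *\<^sub>R g s)"
        by (intro integral_diff integrable_continuous_interval continuous_intros continuous_on_subset[OF h(1)] continuous_on_subset[OF gc]) auto
      also have "\<dots> = 0" unfolding gk c by simp
      finally show ?thesis by (simp only: scaleR_diff_right)
    qed
  qed
  then show ?thesis by (simp add: g_def)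
qed

section \<open>Kernels of a fixed degree\<close>

text \<open>
  Smoothness of the component of degree \<open>n\<close> alone. Integrating out a variable relates components of
  adjacent degrees, so degrees must be treated separately.
\<close>

definition smooth_degree :: "nat \<Rightarrow> ('d, 'k::real_normed_vector) kernel \<Rightarrow> bool" where
  "smooth_degree n F \<longleftrightarrow> (\<forall>js. set js \<subseteq> {..<n} \<longrightarrow>
      (\<forall>a. continuous_on UNIV (\<lambda>s :: nat \<Rightarrow> real. foldr partial js F (map (\<lambda>i. (s i, a i)) [0..<n]))) \<and>
      (\<forall>i<n. \<forall>xs. length xs = n \<longrightarrow>
        (\<lambda>t. foldr partial js F (xs[i := (t, snd (xs ! i))])) differentiable (at (fst (xs ! i)))))"

definition periodic_degree :: "nat \<Rightarrow> ('d, 'k) kernel \<Rightarrow> bool" where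
  "periodic_degree n F \<longleftrightarrow> (\<forall>xs i t a. length xs = n \<longrightarrow> i < n \<longrightarrow> F (xs[i := (t + 1, a)]) = F (xs[i := (t, a)]))"

lemma smooth_kernel_iff: "smooth_kernel F \<longleftrightarrow> (\<forall>n. smooth_degree n F)"
  unfolding smooth_kernel_def smooth_degree_def by blast

lemma periodic_kernel_iff: "periodic_kernel F \<longleftrightarrow> (\<forall>n. periodic_degree n F)"
  unfolding periodic_kernel_def periodic_degree_def by blast

lemma smooth_degree_foldr: assumes "smooth_degree n F" "set is \<subseteq> {..<n}" shows "smooth_degree n (foldr partial is F)"
  unfolding smooth_degree_def
proof (intro allI impI)
  fix js assume "set js \<subseteq> {..<n}"
  then have "set (js @ is) \<subseteq> {..<n}" using assms(2) by simp
  from assms(1)[unfolded smooth_degree_def, rule_format, OF this]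
  show "(\<forall>a. continuous_on UNIV (\<lambda>s :: nat \<Rightarrow> real. foldr partial js (foldr partial is F) (map (\<lambda>i. (s i, a i)) [0..<n]))) \<and>
      (\<forall>i<n. \<forall>xs. length xs = n \<longrightarrow>
        (\<lambda>t. foldr partial js (foldr partial is F) (xs[i := (t, snd (xs ! i))])) differentiable (at (fst (xs ! i))))"
    by simp
qed

lemma smooth_degree_partial: "smooth_degree n F \<Longrightarrow> i < n \<Longrightarrow> smooth_degree n (partial i F)"
  using smooth_degree_foldr[of n F "[i]"] by simp

lemma smooth_degree_continuous:
  fixes p :: "'x::topological_space \<Rightarrow> nat \<Rightarrow> real"
  assumes F: "smooth_degree n F" and p: "\<And>i. i < n \<Longrightarrow> continuous_on U (\<lambda>x. p x i)"
  shows "continuous_on U (\<lambda>x. F (map (\<lambda>i. (p x i, a i)) [0..<n]))"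
proof -
  let ?q = "\<lambda>x i. if i < n then p x i else 0"
  have q: "continuous_on U ?q"
  proof (rule continuous_on_coordinatewise_then_product)
    show "continuous_on U (\<lambda>x. ?q x i)" for i using p by (cases "i < n") auto
  qed
  have "continuous_on UNIV (\<lambda>s :: nat \<Rightarrow> real. F (map (\<lambda>i. (s i, a i)) [0..<n]))"
    using F[unfolded smooth_degree_def, rule_format, of "[]"] by simp
  from continuous_on_compose2[OF this q]
  have "continuous_on U (\<lambda>x. F (map (\<lambda>i. (?q x i, a i)) [0..<n]))" by simp
  moreover have "map (\<lambda>i. (?q x i, a i)) [0..<n] = map (\<lambda>i. (p x i, a i)) [0..<n]" for x
    by simp
  ultimately show ?thesis by (simp only:)
qed

lemma smooth_degree_continuous_list:
  fixes L :: "'x::topological_space \<Rightarrow> (real \<times> ('d + 'd)) list"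
  assumes F: "smooth_degree n F" and len: "\<And>x. length (L x) = n"
    and c: "\<And>i. i < n \<Longrightarrow> continuous_on U (\<lambda>x. fst (L x ! i))"
    and a: "\<And>x i. i < n \<Longrightarrow> snd (L x ! i) = a i"
  shows "continuous_on U (\<lambda>x. F (L x))"
proof -
  have "map (\<lambda>i. (fst (L x ! i), a i)) [0..<n] = L x" for x
    by (rule nth_equalityI) (use len a in \<open>auto simp: prod_eq_iff\<close>)
  then show ?thesis
    using smooth_degree_continuous[OF F, of U "\<lambda>x i. fst (L x ! i)" a] c by simp
qed

lemma smooth_degree_deriv:
  assumes F: "smooth_degree n F" and i: "i < n" and xs: "length xs = n"
  shows "((\<lambda>t. F (xs[i := (t, b)])) has_vector_derivative partial i F (xs[i := (t, b)])) (at t)"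
proof -
  let ?ys = "xs[i := (t, b)]"
  have *: "\<forall>i<n. \<forall>xs. length xs = n \<longrightarrow> (\<lambda>t. F (xs[i := (t, snd (xs ! i))])) differentiable (at (fst (xs ! i)))"
    using F[unfolded smooth_degree_def, rule_format, of "[]"] by simp
  have "(\<lambda>t. F (?ys[i := (t, snd (?ys ! i))])) differentiable (at (fst (?ys ! i)))"
    by (rule *[rule_format]) (use i xs in auto)
  then have "((\<lambda>t. F (?ys[i := (t, snd (?ys ! i))])) has_vector_derivative
      vector_derivative (\<lambda>t. F (?ys[i := (t, snd (?ys ! i))])) (at (fst (?ys ! i)))) (at (fst (?ys ! i)))"
    by (simp only: vector_derivative_works)
  then show ?thesis using i xs by (simp add: partial_def)
qed

definition head_integral :: "('d + 'd) \<Rightarrow> (real \<Rightarrow> real) \<Rightarrow> ('d, 'k::euclidean_space) kernel \<Rightarrow> ('d, 'k) kernel" where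
  "head_integral a g F xs = integral {0..1} (\<lambda>s. g s *\<^sub>R F ((s, a) # xs))"

lemma smooth_degree_head_continuous:
  assumes F: "smooth_degree (Suc n) F" and xs: "length xs = n"
  shows "continuous_on U (\<lambda>s. F ((s, a) # xs))"
proof (rule smooth_degree_continuous_list[OF F, where a = "\<lambda>i. snd (((0, a) # xs) ! i)"])
  show "continuous_on U (\<lambda>s. fst (((s, a) # xs) ! i))" for i by (cases i) auto
  show "snd (((s, a) # xs) ! i) = snd (((0, a) # xs) ! i)" for s i by (cases i) auto
qed (use xs in auto)

lemma partial_head_integral_deriv:
  fixes F :: "('d, 'k::euclidean_space) kernel"
  assumes F: "smooth_degree (Suc n) F" and g: "continuous_on UNIV g" and i: "i < n" and xs: "length xs = n"
  shows "((\<lambda>t. head_integral a g F (xs[i := (t, b)])) has_vector_derivative head_integral a g (partial (Suc i) F) (xs[i := (t, b)])) (at t)"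
proof -
  let ?L = "\<lambda>p. (snd p, a) # xs[i := (fst p, b)]"
  have cP: "continuous_on UNIV (\<lambda>p :: real \<times> real. partial (Suc i) F (?L p))"
  proof (rule smooth_degree_continuous_list[OF smooth_degree_partial[OF F], where a = "\<lambda>j. snd (((0, a) # xs[i := (0, b)]) ! j)"])
    show "continuous_on UNIV (\<lambda>p :: real \<times> real. fst (?L p ! j))" for j
    proof (cases j)
      case 0
      then show ?thesis by (simp add: continuous_on_snd continuous_on_id)
    next
      case (Suc m)
      then show ?thesis using i xs by (cases "m = i") (auto simp: continuous_on_fst continuous_on_id)
    qed
    show "snd (?L p ! j) = snd (((0, a) # xs[i := (0, b)]) ! j)" if "j < Suc n" for p :: "real \<times> real" and j
      using that xs i by (cases j) (auto simp: nth_list_update)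
  qed (use i xs in auto)
  have "((\<lambda>t. integral (cbox 0 1) (\<lambda>s. g s *\<^sub>R F ((s, a) # xs[i := (t, b)]))) has_vector_derivative
      integral (cbox 0 1) (\<lambda>s. g s *\<^sub>R partial (Suc i) F ((s, a) # xs[i := (t, b)]))) (at t within UNIV)"
  proof (rule leibniz_rule_vector_derivative[where U = UNIV])
    show "((\<lambda>t. g s *\<^sub>R F ((s, a) # xs[i := (t, b)])) has_vector_derivative
        g s *\<^sub>R partial (Suc i) F ((s, a) # xs[i := (t, b)])) (at t within UNIV)" for t s
    proof -
      have "((\<lambda>t. F (((s, a) # xs)[Suc i := (t, b)])) has_vector_derivative
          partial (Suc i) F (((s, a) # xs)[Suc i := (t, b)])) (at t)"
        by (rule smooth_degree_deriv[OF F]) (use i xs in auto)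
      then show ?thesis
        by (intro has_vector_derivative_scaleR[where f = "\<lambda>_. g s" and f' = 0, simplified]) simp
    qed
    show "(\<lambda>s. g s *\<^sub>R F ((s, a) # xs[i := (t, b)])) integrable_on cbox 0 1" for t
      by (rule integrable_continuous) (intro continuous_intros continuous_on_subset[OF g] smooth_degree_head_continuous[OF F], use xs in auto)
    have "continuous_on UNIV (\<lambda>p :: real \<times> real. g (snd p) *\<^sub>R partial (Suc i) F (?L p))"
      by (intro continuous_on_scaleR cP continuous_on_compose2[OF g] continuous_on_snd continuous_on_id) auto
    then show "continuous_on (UNIV \<times> cbox 0 1) (\<lambda>(t, s). g s *\<^sub>R partial (Suc i) F ((s, a) # xs[i := (t, b)]))"
      by (rule continuous_on_subset[THEN continuous_on_cong[THEN iffD1, rotated -1]]) (auto simp: case_prod_unfold)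
  qed auto
  then show ?thesis by (simp add: head_integral_def)
qed

lemma partial_head_integral:
  fixes F :: "('d, 'k::euclidean_space) kernel"
  assumes "smooth_degree (Suc n) F" "continuous_on UNIV g" "i < n" "length xs = n"
  shows "partial i (head_integral a g F) xs = head_integral a g (partial (Suc i) F) xs"
proof -
  have "xs[i := (fst (xs ! i), snd (xs ! i))] = xs" by simp
  then show ?thesis
    unfolding partial_def[of i]
    using vector_derivative_at[OF partial_head_integral_deriv[OF assms, of a "snd (xs ! i)" "fst (xs ! i)"]] by metis
qed

lemma foldr_partial_cong:
  assumes "\<And>ys. length ys = length xs \<Longrightarrow> F ys = G ys"
  shows "foldr partial js F xs = foldr partial js G xs"
proof -
  have "\<forall>ys. length ys = length xs \<longrightarrow> foldr partial js F ys = foldr partial js G ys"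
    by (induction js) (use assms in \<open>auto intro!: partial_cong\<close>)
  then show ?thesis by blast
qed

lemma foldr_partial_head_integral:
  fixes F :: "('d, 'k::euclidean_space) kernel"
  assumes F: "smooth_degree (Suc n) F" and g: "continuous_on UNIV g" and js: "set js \<subseteq> {..<n}" and xs: "length xs = n"
  shows "foldr partial js (head_integral a g F) xs = head_integral a g (foldr partial (map Suc js) F) xs"
  using js xs
proof (induction js arbitrary: xs)
  case (Cons i js)
  have S: "set (map Suc js) \<subseteq> {..<Suc n}" using Cons.prems by auto
  have "foldr partial (i # js) (head_integral a g F) xs = partial i (head_integral a g (foldr partial (map Suc js) F)) xs"
    using Cons.prems by (simp, intro partial_cong Cons.IH) auto
  also have "\<dots> = head_integral a g (partial (Suc i) (foldr partial (map Suc js) F)) xs"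
    using Cons.prems by (intro partial_head_integral[OF smooth_degree_foldr[OF F S] g]) auto
  finally show ?case by simp
qed simp

lemma smooth_degree_head_integral:
  fixes F :: "('d, 'k::euclidean_space) kernel"
  assumes F: "smooth_degree (Suc n) F" and g: "continuous_on UNIV g"
  shows "smooth_degree n (head_integral a g F)"
  unfolding smooth_degree_def
proof (intro allI impI conjI)
  fix js and c :: "nat \<Rightarrow> 'd + 'd" assume js: "set js \<subseteq> {..<n}"
  let ?G = "foldr partial (map Suc js) F"
  have G: "smooth_degree (Suc n) ?G" using js by (intro smooth_degree_foldr[OF F]) auto
  let ?L = "\<lambda>p. (snd p, a) # map (\<lambda>i. (fst p i, c i)) [0..<n]"
  have "continuous_on UNIV (\<lambda>p :: (nat \<Rightarrow> real) \<times> real. ?G (?L p))"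
  proof (rule smooth_degree_continuous_list[OF G, where a = "\<lambda>j. case j of 0 \<Rightarrow> a | Suc m \<Rightarrow> c m"])
    show "continuous_on UNIV (\<lambda>p :: (nat \<Rightarrow> real) \<times> real. fst (?L p ! j))" if "j < Suc n" for j
    proof (cases j)
      case 0
      then show ?thesis by (simp add: continuous_on_snd continuous_on_id)
    next
      case (Suc m)
      have "continuous_on UNIV (\<lambda>p :: (nat \<Rightarrow> real) \<times> real. fst p m)"
        by (rule continuous_on_compose2[OF continuous_on_product_coordinates[of m] continuous_on_fst[OF continuous_on_id]]) simp
      then show ?thesis using Suc that by simp
    qed
    show "snd (?L p ! j) = (case j of 0 \<Rightarrow> a | Suc m \<Rightarrow> c m)" if "j < Suc n" for p :: "(nat \<Rightarrow> real) \<times> real" and j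
      using that by (cases j) auto
  qed simp
  then have cL: "continuous_on UNIV (\<lambda>p :: (nat \<Rightarrow> real) \<times> real. g (snd p) *\<^sub>R ?G (?L p))"
    by (intro continuous_on_scaleR continuous_on_compose2[OF g] continuous_on_snd continuous_on_id) auto
  have "continuous_on UNIV (\<lambda>s :: nat \<Rightarrow> real. integral (cbox 0 1) (\<lambda>t. g t *\<^sub>R ?G ((t, a) # map (\<lambda>i. (s i, c i)) [0..<n])))"
  proof (rule integral_continuous_on_param)
    show "continuous_on (UNIV \<times> cbox 0 1) (\<lambda>(s :: nat \<Rightarrow> real, t). g t *\<^sub>R ?G ((t, a) # map (\<lambda>i. (s i, c i)) [0..<n]))"
      using continuous_on_subset[OF cL] by (simp add: case_prod_unfold)
  qed
  then show "continuous_on UNIV (\<lambda>s :: nat \<Rightarrow> real. foldr partial js (head_integral a g F) (map (\<lambda>i. (s i, c i)) [0..<n]))"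
    by (simp add: foldr_partial_head_integral[OF F g js] head_integral_def)
next
  fix js :: "nat list" and i and xs :: "(real \<times> ('d + 'd)) list"
  assume js: "set js \<subseteq> {..<n}" and i: "i < n" and xs: "length xs = n"
  have G: "smooth_degree (Suc n) (foldr partial (map Suc js) F)" using js by (intro smooth_degree_foldr[OF F]) auto
  have eq: "foldr partial js (head_integral a g F) (xs[i := p]) = head_integral a g (foldr partial (map Suc js) F) (xs[i := p])" for p
    using xs by (intro foldr_partial_head_integral[OF F g js]) simp
  show "(\<lambda>t. foldr partial js (head_integral a g F) (xs[i := (t, snd (xs ! i))])) differentiable at (fst (xs ! i))"
    unfolding eq using partial_head_integral_deriv[OF G g i xs] differentiableI_vector by blast
qed

lemma periodic_degree_head_integral: "periodic_degree (Suc n) F \<Longrightarrow> periodic_degree n (head_integral a g F)"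
  unfolding periodic_degree_def
proof (intro allI impI)
  fix xs :: "(real \<times> ('a + 'a)) list" and i t b
  assume F: "\<forall>xs i t a. length xs = Suc n \<longrightarrow> i < Suc n \<longrightarrow> F (xs[i := (t + 1, a)]) = F (xs[i := (t, a)])"
    and xs: "length xs = n" "i < n"
  have "F ((s, a) # xs[i := (t + 1, b)]) = F ((s, a) # xs[i := (t, b)])" for s
    using F[rule_format, of "(s, a) # xs" "Suc i" t b] xs by simp
  then show "head_integral a g F (xs[i := (t + 1, b)]) = head_integral a g F (xs[i := (t, b)])"
    by (simp add: head_integral_def)
qed

lemma vector_derivative_periodic:
  fixes f :: "real \<Rightarrow> 'b::real_normed_vector"
  assumes "\<And>u. f (u + 1) = f u"
  shows "vector_derivative f (at (t + 1)) = vector_derivative f (at t)"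
proof -
  have "f (t + 1 + h) = f (t + h)" for h using assms[of "t + h"] by (simp add: add_ac)
  then have "(f has_vector_derivative D) (at (t + 1)) \<longleftrightarrow> (f has_vector_derivative D) (at t)" for D
    by (simp add: has_vector_derivative_iff_quotient assms)
  then show ?thesis by (simp add: vector_derivative_def)
qed

lemma periodic_degree_partial:
  assumes F: "periodic_degree n F" and i: "i < n" shows "periodic_degree n (partial i F)"
  unfolding periodic_degree_def
proof (intro allI impI)
  fix xs :: "(real \<times> ('a + 'a)) list" and j t b assume xs: "length xs = n" and j: "j < n"
  have F': "F (ys[m := (t + 1, a)]) = F (ys[m := (t, a)])" if "length ys = n" "m < n" for ys m t a
    using F that unfolding periodic_degree_def by blast
  show "partial i F (xs[j := (t + 1, b)]) = partial i F (xs[j := (t, b)])"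
  proof (cases "i = j")
    case True
    have "vector_derivative (\<lambda>u. F (xs[j := (u, b)])) (at (t + 1)) = vector_derivative (\<lambda>u. F (xs[j := (u, b)])) (at t)"
      by (rule vector_derivative_periodic) (rule F'[OF xs j])
    then show ?thesis using True xs j by (simp add: partial_def)
  next
    case False
    have "F (xs[j := (t + 1, b), i := p]) = F (xs[j := (t, b), i := p])" for p
      using F'[of "xs[i := p]" j t b] xs j False by (simp add: list_update_swap)
    then show ?thesis using False xs j by (simp add: partial_def)
  qed
qed

lemma periodic_degree_foldr: "periodic_degree n F \<Longrightarrow> set js \<subseteq> {..<n} \<Longrightarrow> periodic_degree n (foldr partial js F)"
  by (induction js) (auto intro: periodic_degree_partial)

lemma periodic_degree_frac:
  assumes F: "periodic_degree n F" and xs: "length xs = n"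
  shows "F (map (\<lambda>p. (frac (fst p), snd p)) xs) = F xs"
proof -
  have "F (ys @ xs) = F (ys @ map (\<lambda>p. (frac (fst p), snd p)) xs)" if "length ys + length xs = n" for ys
    using that
  proof (induction xs arbitrary: ys)
    case (Cons x xs)
    let ?w = "\<lambda>t. F (ys @ (t, snd x) # xs)"
    have "?w (t + 1) = ?w t" for t
      using F[unfolded periodic_degree_def, rule_format, of "ys @ x # xs" "length ys" t "snd x"] Cons.prems by simp
    then have "?w (frac (fst x) + of_int \<lfloor>fst x\<rfloor>) = ?w (frac (fst x))" by (rule periodic_of_int)
    then have "F (ys @ x # xs) = F ((ys @ [(frac (fst x), snd x)]) @ xs)"
      by (simp add: frac_def)
    also have "\<dots> = F ((ys @ [(frac (fst x), snd x)]) @ map (\<lambda>p. (frac (fst p), snd p)) xs)"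
      using Cons.prems by (intro Cons.IH) simp
    finally show ?case by simp
  qed simp
  from this[of "[]"] xs show ?thesis by simp
qed

text \<open>
  By periodicity the variables may be moved into the unit interval, and the cube is compact. It is taken with
  coordinates for all natural numbers, since smoothness refers to functions of this kind.
\<close>

lemma smooth_degree_periodic_degree_bounded:
  fixes F :: "('d::finite, 'k::euclidean_space) kernel"
  assumes F: "smooth_degree n F" and p: "periodic_degree n F"
  obtains B where "\<And>xs. length xs = n \<Longrightarrow> norm (F xs) \<le> B"
proof -
  let ?A = "{a::('d + 'd) list. length a = n}"
  let ?S = "(\<Pi>\<^sub>E i\<in>UNIV. {0..1}) :: (nat \<Rightarrow> real) set"
  have "compactin (product_topology (\<lambda>_::nat. euclidean) UNIV) ?S"
    by (subst compactin_PiE) auto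
  then have S: "compact ?S" by (simp add: euclidean_product_topology)
  have "\<exists>B. \<forall>s\<in>?S. norm (F (map (\<lambda>i. (s i, a ! i)) [0..<n])) \<le> B" for a
  proof -
    have "continuous_on ?S (\<lambda>s. F (map (\<lambda>i. (s i, a ! i)) [0..<n]))"
      by (rule smooth_degree_continuous[OF F]) (rule continuous_on_subset[OF continuous_on_product_coordinates], simp)
    from compact_imp_bounded[OF compact_continuous_image[OF this S]]
    show ?thesis by (auto simp: bounded_iff)
  qed
  then obtain B where B: "\<And>a s. s \<in> ?S \<Longrightarrow> norm (F (map (\<lambda>i. (s i, a ! i)) [0..<n])) \<le> B a" by metis
  have fin: "finite ?A" using finite_lists_length_eq[of "UNIV :: ('d + 'd) set" n] by simp
  show ?thesis
  proof (rule that[of "Max (B ` ?A)"])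
    fix xs :: "(real \<times> ('d + 'd)) list" assume xs: "length xs = n"
    let ?s = "\<lambda>i. if i < n then frac (fst (xs ! i)) else 0"
    have "map (\<lambda>i. (?s i, map snd xs ! i)) [0..<n] = map (\<lambda>p. (frac (fst p), snd p)) xs"
      by (rule nth_equalityI) (use xs in auto)
    then have "F xs = F (map (\<lambda>i. (?s i, map snd xs ! i)) [0..<n])"
      using periodic_degree_frac[OF p xs] by simp
    moreover have "?s \<in> ?S" by (auto simp: less_imp_le frac_lt_1)
    ultimately have "norm (F xs) \<le> B (map snd xs)" using B[of ?s "map snd xs"] by (simp only:)
    also have "\<dots> \<le> Max (B ` ?A)" using fin xs by (intro Max_ge) auto
    finally show "norm (F xs) \<le> Max (B ` ?A)" .
  qed
qed

lemma
  fixes F :: "('d::finite, 'k::euclidean_space) kernel"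
  assumes F: "smooth_degree n F" and p: "periodic_degree n F"
  shows norm_le_sup_norm: "length xs = n \<Longrightarrow> norm (F xs) \<le> sup_norm n F"
    and sup_norm_nonneg: "0 \<le> sup_norm n F"
    and L2_set_le_sup_norm: "length s = n \<Longrightarrow> L2_set (\<lambda>a. norm (F (zip s a))) {a. length a = n} \<le> sup_norm n F"
proof -
  let ?A = "{a::('d + 'd) list. length a = n}"
  let ?L = "\<lambda>s. L2_set (\<lambda>a. norm (F (zip s a))) ?A"
  have fin: "finite ?A" using finite_lists_length_eq[of "UNIV :: ('d + 'd) set" n] by simp
  obtain B where B: "\<And>xs. length xs = n \<Longrightarrow> norm (F xs) \<le> B" using smooth_degree_periodic_degree_bounded[OF F p] by metis
  have "?L s \<le> (\<Sum>a\<in>?A. B)" if s: "s \<in> {s. length s = n}" for s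
  proof -
    have "?L s \<le> (\<Sum>a\<in>?A. norm (F (zip s a)))" by (rule L2_set_le_sum) simp
    also have "\<dots> \<le> (\<Sum>a\<in>?A. B)" using s by (intro sum_mono B) simp
    finally show ?thesis .
  qed
  then have bdd: "bdd_above (?L ` {s. length s = n})" by (rule bdd_aboveI2)
  have le: "norm (F xs) \<le> sup_norm n F" if xs: "length xs = n" for xs
  proof -
    have "norm (F xs) = norm (F (zip (map fst xs) (map snd xs)))" by (simp add: zip_map_fst_snd)
    also have "\<dots> \<le> ?L (map fst xs)"
      by (rule member_le_L2_set[OF fin, of "map snd xs" "\<lambda>a. norm (F (zip (map fst xs) a))"]) (use xs in simp)
    also have "\<dots> \<le> sup_norm n F"
      unfolding sup_norm_def by (rule cSUP_upper[OF _ bdd]) (use xs in simp)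
    finally show ?thesis .
  qed
  then show "length xs = n \<Longrightarrow> norm (F xs) \<le> sup_norm n F" .
  show "length s = n \<Longrightarrow> ?L s \<le> sup_norm n F"
    unfolding sup_norm_def by (rule cSUP_upper[OF _ bdd]) simp
  show "0 \<le> sup_norm n F"
    by (rule order_trans[OF norm_ge_zero le[of "replicate n undefined"]]) simp
qed

lemma norm_mixed_partial_le_degree_norm:
  fixes F :: "('d::finite, 'k::euclidean_space) kernel"
  assumes F: "smooth_degree n F" and p: "periodic_degree n F" and m: "length m = n" "set m \<subseteq> {0..k}" and xs: "length xs = n"
  shows "norm (mixed_partial m F xs) \<le> degree_norm k n F"
proof -
  have skm: "smooth_degree n (mixed_partial m F)" and pkm: "periodic_degree n (mixed_partial m F)" if "length m = n" for m
    unfolding mixed_partial_eq using set_derivative_word[of m] that F p by (auto intro: smooth_degree_foldr periodic_degree_foldr)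
  have fin: "finite {m. length m = n \<and> set m \<subseteq> {0..k}}"
    using finite_lists_length_eq[of "{0..k}" n] by (simp add: conj_commute)
  have "norm (mixed_partial m F xs) \<le> sup_norm n (mixed_partial m F)"
    by (rule norm_le_sup_norm[OF skm[OF m(1)] pkm[OF m(1)] xs])
  also have "\<dots> \<le> degree_norm k n F"
    unfolding degree_norm_def
    by (rule member_le_sum[OF _ _ fin]) (use m sup_norm_nonneg[OF skm pkm] in auto)
  finally show ?thesis .
qed

section \<open>Coefficients of a kernel\<close>

text \<open>
  There are no boundary terms on the circle.
\<close>

lemma head_integral_by_parts:
  fixes F :: "('d::finite, 'k::euclidean_space) kernel"
  assumes F: "smooth_degree (Suc n) F" and p: "periodic_degree (Suc n) F" and xs: "length xs = n"
  shows "head_integral b (trig (Suc m) k) F xs = - head_integral b (trig m k) (partial 0 F) xs"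
proof -
  let ?h = "\<lambda>s. F ((s, b) # xs)" and ?h' = "\<lambda>s. partial 0 F ((s, b) # xs)"
  have d: "(?h has_vector_derivative ?h' s) (at s)" for s
    using smooth_degree_deriv[OF F, of 0 "(0, b) # xs" b s] xs by simp
  have c: "continuous_on S ?h" "continuous_on S ?h'" for S
    by (rule smooth_degree_head_continuous[OF F xs], rule smooth_degree_head_continuous[OF smooth_degree_partial[OF F] xs]) simp
  have "((\<lambda>s. trig m k s *\<^sub>R ?h' s + trig (Suc m) k s *\<^sub>R ?h s) has_integral
      (trig m k 1 *\<^sub>R ?h 1 - trig m k 0 *\<^sub>R ?h 0)) {0..1}"
  proof (rule fundamental_theorem_of_calculus)
    show "((\<lambda>s. trig m k s *\<^sub>R ?h s) has_vector_derivative trig m k s *\<^sub>R ?h' s + trig (Suc m) k s *\<^sub>R ?h s) (at s within {0..1})" for s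
      by (rule has_vector_derivative_at_within, rule has_vector_derivative_scaleR[OF trig_deriv d])
  qed simp
  moreover have "?h 1 = ?h 0"
    using p[unfolded periodic_degree_def, rule_format, of "(0, b) # xs" 0 0 b] xs by simp
  moreover have "trig m k 1 = trig m k 0" using trig_periodic[of m k 0] by simp
  ultimately have "integral {0..1} (\<lambda>s. trig m k s *\<^sub>R ?h' s + trig (Suc m) k s *\<^sub>R ?h s) = 0"
    by (simp add: integral_unique)
  moreover have "integral {0..1} (\<lambda>s. trig m k s *\<^sub>R ?h' s + trig (Suc m) k s *\<^sub>R ?h s)
      = integral {0..1} (\<lambda>s. trig m k s *\<^sub>R ?h' s) + integral {0..1} (\<lambda>s. trig (Suc m) k s *\<^sub>R ?h s)"
    by (intro integral_add integrable_continuous_interval continuous_intros c)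
  ultimately show ?thesis by (simp add: head_integral_def eq_neg_iff_add_eq_0 add.commute)
qed

lemma foldr_replicate_0: "foldr partial (replicate m i) F = (partial i ^^ m) F"
  by (induction m) simp_all

lemma head_integral_by_parts_iter:
  fixes F :: "('d::finite, 'k::euclidean_space) kernel"
  assumes "smooth_degree (Suc n) F" "periodic_degree (Suc n) F" "length xs = n"
  shows "head_integral b (trig m k) F xs = (-1) ^ m *\<^sub>R head_integral b (trig 0 k) ((partial 0 ^^ m) F) xs"
  using assms
proof (induction m arbitrary: F)
  case (Suc m)
  have "head_integral b (trig (Suc m) k) F xs = - head_integral b (trig m k) (partial 0 F) xs"
    by (rule head_integral_by_parts[OF Suc.prems])
  also have "head_integral b (trig m k) (partial 0 F) xs = (-1) ^ m *\<^sub>R head_integral b (trig 0 k) ((partial 0 ^^ m) (partial 0 F)) xs"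
    using Suc.prems by (intro Suc.IH smooth_degree_partial periodic_degree_partial) auto
  finally show ?case by (simp add: funpow_swap1)
qed simp

lemma trig_even: "trig (2 * N) k s = (-1) ^ N * (2 * pi * of_int k) ^ (2 * N) * trig 0 k s"
proof (induction N)
  case (Suc N)
  have "trig (2 * Suc N) k s = - (2 * pi * of_int k)\<^sup>2 * trig (2 * N) k s"
    using trig_Suc_Suc[of "2 * N" k s] by simp
  also have "\<dots> = (-1) ^ Suc N * ((2 * pi * of_int k) ^ (2 * N) * (2 * pi * of_int k)\<^sup>2) * trig 0 k s"
    by (simp only: Suc.IH) (simp add: mult_ac)
  also have "(2 * pi * of_int k) ^ (2 * N) * (2 * pi * of_int k)\<^sup>2 = (2 * pi * of_int k) ^ (2 * Suc N)"
    by (simp add: power_add[symmetric])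
  finally show ?case .
qed simp

text \<open>
  The Fourier coefficient in the first variable along the mode \<open>j\<close>.
\<close>

definition head_coeff :: "('d + 'd) \<times> int \<Rightarrow> ('d, 'k::euclidean_space) kernel \<Rightarrow> ('d, 'k) kernel" where
  "head_coeff j = head_integral (fst j) (\<lambda>s. eigenvalue (snd j) * trig 0 (snd j) s)"

text \<open>
  The number of integrations by parts that yield decay of order \<open>2 q\<close>: two more are spent on the eigenvalue.
  At frequency 0 there is nothing to gain.
\<close>

definition parts_order :: "nat \<Rightarrow> int \<Rightarrow> nat" where "parts_order q k = (if k = 0 then 0 else 2 * (q + 1))"

text \<open>
  What remains of the eigenvalue after \<open>parts_order q k\<close> integrations by parts.
\<close>

definition decay_factor :: "nat \<Rightarrow> int \<Rightarrow> real" where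
  "decay_factor q k = (if k = 0 then 1 else eigenvalue k * (-1) ^ (q + 1) / (2 * pi * of_int k) ^ (2 * (q + 1)))"

lemma head_integral_scale: "head_integral b (\<lambda>s. c * g s) F xs = c *\<^sub>R head_integral b g F xs"
  unfolding head_integral_def scaleR_scaleR[symmetric] by (rule Henstock_Kurzweil_Integration.integral_cmul)

lemma head_coeff_eq:
  fixes F :: "('d::finite, 'k::euclidean_space) kernel"
  assumes F: "smooth_degree (Suc n) F" "periodic_degree (Suc n) F" and xs: "length xs = n"
  shows "head_coeff (b, k) F xs = head_integral b (\<lambda>s. decay_factor q k * trig 0 k s) ((partial 0 ^^ parts_order q k) F) xs"
proof (cases "k = 0")
  case True
  then show ?thesis by (simp add: head_coeff_def decay_factor_def parts_order_def eigenvalue_def)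
next
  case False
  let ?N = "q + 1"
  let ?w = "(2 * pi * of_int k :: real) ^ (2 * ?N)"
  have w: "?w \<noteq> 0" using False by simp
  have t: "eigenvalue k * trig 0 k s = decay_factor q k * trig (2 * ?N) k s" for s
  proof -
    have "(-1 :: real) ^ ?N * (-1) ^ ?N = 1" by (simp add: power_mult_distrib[symmetric])
    then have "decay_factor q k * trig (2 * ?N) k s = eigenvalue k * (?w / ?w) * trig 0 k s"
      using False unfolding decay_factor_def trig_even by (simp only: if_False) (simp add: field_simps)
    then show ?thesis using w by simp
  qed
  have "head_coeff (b, k) F xs = decay_factor q k *\<^sub>R head_integral b (trig (2 * ?N) k) F xs"
    by (simp add: head_coeff_def t head_integral_scale)
  also have "\<dots> = decay_factor q k *\<^sub>R head_integral b (trig 0 k) ((partial 0 ^^ (2 * ?N)) F) xs"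
    using head_integral_by_parts_iter[OF F xs, of b "2 * ?N" k] by simp
  finally show ?thesis using False by (simp add: head_integral_scale parts_order_def)
qed

text \<open>
  The constant \<open>eigenvalue 1\<close> bounds the eigenvalue by the square of the frequency, and the factor 4 per two
  powers arises from \<open>1 + \<bar>k\<bar> \<le> 2 * \<bar>k\<bar>\<close> for \<open>k \<noteq> 0\<close>.
\<close>

definition decay_const :: "nat \<Rightarrow> real" where "decay_const q = eigenvalue 1 * 4 ^ q"

lemma decay_const_pos: "decay_const q > 0" by (simp add: decay_const_def)

lemma decay_factor_le: "\<bar>decay_factor q (snd j)\<bar> \<le> decay_const q / wt j ^ (2 * q)"
proof (cases "snd j = 0")
  case True
  have "1 * 1 \<le> eigenvalue 1 * (4::real) ^ q"
    by (rule mult_mono[OF eigenvalue_ge_1 one_le_power]) (use less_imp_le[OF eigenvalue_pos(1)] in auto)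
  then show ?thesis using True by (simp add: decay_factor_def decay_const_def wt_def)
next
  case False
  let ?k = "\<bar>real_of_int (snd j)\<bar>"
  have k1: "?k \<ge> 1" using False by linarith
  have w2: "wt j \<le> 2 * ?k" using k1 by (simp add: wt_def)
  have e: "eigenvalue (snd j) \<le> eigenvalue 1 * ?k\<^sup>2"
  proof -
    have "1 \<le> ?k\<^sup>2" using k1 by (rule one_le_power)
    then show ?thesis by (simp add: eigenvalue_def distrib_right)
  qed
  have "?k ^ (2 * (q + 1)) \<le> (2 * pi * ?k) ^ (2 * (q + 1))"
    using k1 one_le_2pi mult_right_mono[of 1 "2 * pi" ?k] by (intro power_mono) auto
  then have den: "?k ^ (2 * (q + 1)) \<le> \<bar>2 * pi * of_int (snd j)\<bar> ^ (2 * (q + 1))"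
    by (simp add: abs_mult)
  have "\<bar>decay_factor q (snd j)\<bar> = eigenvalue (snd j) / \<bar>2 * pi * of_int (snd j)\<bar> ^ (2 * (q + 1))"
    using False by (simp add: decay_factor_def abs_mult power_abs abs_of_pos[OF eigenvalue_pos(1)])
  also have "\<dots> \<le> (eigenvalue 1 * ?k\<^sup>2) / ?k ^ (2 * (q + 1))"
    using e den k1 less_imp_le[OF eigenvalue_pos(1)[of "snd j"]] by (intro frac_le) auto
  also have "\<dots> = eigenvalue 1 / ?k ^ (2 * q)"
  proof -
    have "2 * (q + 1) = 2 * q + 2" by simp
    then have e: "?k ^ (2 * (q + 1)) = ?k ^ (2 * q) * ?k\<^sup>2" by (simp only: power_add)
    have "?k\<^sup>2 \<noteq> 0" using k1 by (intro power_not_zero) linarith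
    then show ?thesis unfolding e by (rule mult_divide_mult_cancel_right)
  qed
  also have "\<dots> \<le> decay_const q / wt j ^ (2 * q)"
  proof -
    have "wt j ^ (2 * q) \<le> (2 * ?k) ^ (2 * q)" by (rule power_mono[OF w2]) simp
    also have "\<dots> = 4 ^ q * ?k ^ (2 * q)" by (simp add: power_mult_distrib power_mult)
    finally have "eigenvalue 1 * wt j ^ (2 * q) \<le> eigenvalue 1 * (4 ^ q * ?k ^ (2 * q))"
      by (intro mult_left_mono) (use less_imp_le[OF eigenvalue_pos(1)[of 1]] in auto)
    then show ?thesis using k1 by (simp add: decay_const_def divide_le_eq le_divide_eq mult_ac)
  qed
  finally show ?thesis .
qed

lemma norm_head_integral_le:
  fixes F :: "('d::finite, 'k::euclidean_space) kernel"
  assumes F: "smooth_degree (Suc n) F" and xs: "length xs = n" and B: "\<And>ys. length ys = Suc n \<Longrightarrow> norm (F ys) \<le> B"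
  shows "norm (head_integral b (\<lambda>s. c * trig 0 k s) F xs) \<le> \<bar>c\<bar> * (2 * B)"
proof -
  have "norm (integral {0..1} (\<lambda>s. trig 0 k s *\<^sub>R F ((s, b) # xs))) \<le> (2 * B) * (1 - 0)"
  proof (rule integral_bound)
    show "continuous_on {0..1} (\<lambda>s. trig 0 k s *\<^sub>R F ((s, b) # xs))"
      by (intro continuous_intros smooth_degree_head_continuous[OF F xs])
    show "norm (trig 0 k s *\<^sub>R F ((s, b) # xs)) \<le> 2 * B" for s
      unfolding norm_scaleR real_norm_def using abs_trig_le[of 0 k s "()"] xs by (intro mult_mono[of "\<bar>trig 0 k s\<bar>"] B) auto
  qed simp
  then show ?thesis
    unfolding head_integral_scale norm_scaleR by (intro mult_left_mono) (simp_all add: head_integral_def)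
qed

lemma smooth_degree_head_coeff:
  fixes F :: "('d::finite, 'k::euclidean_space) kernel"
  shows "smooth_degree (Suc n) F \<Longrightarrow> smooth_degree n (head_coeff j F)"
  unfolding head_coeff_def by (intro smooth_degree_head_integral continuous_intros)

lemma periodic_degree_head_coeff: "periodic_degree (Suc n) F \<Longrightarrow> periodic_degree n (head_coeff j F)"
  unfolding head_coeff_def by (rule periodic_degree_head_integral)

lemma derivative_word_Cons: "derivative_word (p # m) = map Suc (derivative_word m) @ replicate p 0"
proof -
  have "concat (map (\<lambda>i. replicate ((p # m) ! i) i) [0..<length (p # m)])
      = replicate p 0 @ concat (map (\<lambda>i. replicate ((p # m) ! i) i) (map Suc [0..<length m]))"
    by (simp add: map_Suc_upt upt_conv_Cons del: upt_Suc)
  also have "concat (map (\<lambda>i. replicate ((p # m) ! i) i) (map Suc [0..<length m]))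
      = map Suc (concat (map (\<lambda>i. replicate (m ! i) i) [0..<length m]))"
    by (simp add: map_concat o_def)
  finally show ?thesis unfolding derivative_word_def by (simp add: rev_map)
qed

text \<open>
  The derivatives from integration by parts and the given ones combine into one mixed derivative, in
  which each variable is differentiated separately. Hence the order per variable stays bounded by
  \<open>2 * (q + 1)\<close> when all variables are integrated out in turn.
\<close>

lemma mixed_partial_head_coeff:
  fixes F :: "('d::finite, 'k::euclidean_space) kernel"
  assumes F: "smooth_degree (Suc n) F" "periodic_degree (Suc n) F" and m: "length m = n" and xs: "length xs = n"
  shows "mixed_partial m (head_coeff (b, k) F) xs = head_integral b (\<lambda>s. decay_factor q k * trig 0 k s) (mixed_partial (parts_order q k # m) F) xs"
proof -
  have S: "smooth_degree (Suc n) ((partial 0 ^^ parts_order q k) F)"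
    unfolding foldr_replicate_0[symmetric] by (rule smooth_degree_foldr[OF F(1)]) auto
  have "mixed_partial m (head_coeff (b, k) F) xs = foldr partial (derivative_word m) (head_integral b (\<lambda>s. decay_factor q k * trig 0 k s) ((partial 0 ^^ parts_order q k) F)) xs"
    unfolding mixed_partial_eq by (rule foldr_partial_cong) (use xs in \<open>simp add: head_coeff_eq[OF F]\<close>)
  also have "\<dots> = head_integral b (\<lambda>s. decay_factor q k * trig 0 k s) (foldr partial (map Suc (derivative_word m)) ((partial 0 ^^ parts_order q k) F)) xs"
    by (rule foldr_partial_head_integral[OF S]) (use set_derivative_word[of m] m xs in \<open>auto intro!: continuous_intros\<close>)
  also have "foldr partial (map Suc (derivative_word m)) ((partial 0 ^^ parts_order q k) F) = mixed_partial (parts_order q k # m) F"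
    unfolding mixed_partial_eq derivative_word_Cons foldr_append foldr_replicate_0 ..
  finally show ?thesis .
qed

primrec iter_coeff :: "(('d + 'd) \<times> int) list \<Rightarrow> ('d, 'k::euclidean_space) kernel \<Rightarrow> 'k" where
  "iter_coeff [] F = F []"
| "iter_coeff (j # l) F = iter_coeff l (head_coeff j F)"

text \<open>
  Each step replaces the kernel by one with one variable less. The mode is bounded by 2 and the eigenvalue
  leaves the decay factor, so \<open>B\<close> is multiplied by twice that factor.
\<close>

lemma norm_iter_coeff_le:
  fixes F :: "('d::finite, 'k::euclidean_space) kernel"
  assumes "smooth_degree n F" "periodic_degree n F"
    and "\<And>m xs. length m = n \<Longrightarrow> set m \<subseteq> {0..2 * (q + 1)} \<Longrightarrow> length xs = n \<Longrightarrow> norm (mixed_partial m F xs) \<le> B"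
    and "length l = n"
  shows "norm (iter_coeff l F) \<le> B * (\<Prod>j\<leftarrow>l. 2 * decay_const q / wt j ^ (2 * q))"
  using assms
proof (induction l arbitrary: n F B)
  case Nil
  then show ?case using Nil.prems(3)[of "[]" "[]"] by (simp add: mixed_partial_eq derivative_word_def)
next
  case (Cons j l)
  obtain n' where n: "n = Suc n'" using Cons.prems(4) by auto
  obtain b k where j: "j = (b, k)" by (cases j)
  have "norm (mixed_partial (replicate n 0) F (replicate n undefined)) \<le> B"
    by (rule Cons.prems(3)) auto
  then have B0: "B \<ge> 0" by (rule order_trans[OF norm_ge_zero])
  let ?B = "decay_const q / wt j ^ (2 * q) * (2 * B)"
  have "norm (iter_coeff l (head_coeff j F)) \<le> ?B * (\<Prod>j\<leftarrow>l. 2 * decay_const q / wt j ^ (2 * q))"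
  proof (rule Cons.IH)
    show "smooth_degree n' (head_coeff j F)" using Cons.prems(1) n by (intro smooth_degree_head_coeff) simp
    show "periodic_degree n' (head_coeff j F)" using Cons.prems(2) n by (intro periodic_degree_head_coeff) simp
    show "length l = n'" using Cons.prems(4) n by simp
    fix m and xs :: "(real \<times> ('d + 'd)) list" assume m: "length m = n'" "set m \<subseteq> {0..2 * (q + 1)}" and xs: "length xs = n'"
    have S: "smooth_degree (Suc n') (mixed_partial (parts_order q k # m) F)"
      unfolding mixed_partial_eq using Cons.prems(1) n set_derivative_word[of "parts_order q k # m"] m(1) by (intro smooth_degree_foldr) auto
    have "norm (mixed_partial m (head_coeff j F) xs) \<le> \<bar>decay_factor q k\<bar> * (2 * B)"
    proof -
      have "mixed_partial m (head_coeff j F) xs = head_integral b (\<lambda>s. decay_factor q k * trig 0 k s) (mixed_partial (parts_order q k # m) F) xs"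
        unfolding j using Cons.prems n m xs by (intro mixed_partial_head_coeff) auto
      moreover have "norm (head_integral b (\<lambda>s. decay_factor q k * trig 0 k s) (mixed_partial (parts_order q k # m) F) xs) \<le> \<bar>decay_factor q k\<bar> * (2 * B)"
      proof (rule norm_head_integral_le[OF S xs])
        fix ys :: "(real \<times> ('d + 'd)) list" assume "length ys = Suc n'"
        then show "norm (mixed_partial (parts_order q k # m) F ys) \<le> B"
          using m n by (intro Cons.prems(3)) (auto simp: parts_order_def)
      qed
      ultimately show ?thesis by simp
    qed
    also have "\<dots> \<le> ?B" using decay_factor_le[of q j] B0 j by (intro mult_right_mono) auto
    finally show "norm (mixed_partial m (head_coeff j F) xs) \<le> ?B" .
  qed
  then show ?case by (simp add: mult_ac)
qed

text \<open>
  Unlike \<open>connes_kernels\<close>, which also demands summable norms, this class is obviously preserved by taking a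
  coefficient in the first variable. That suffices for the pointwise expansion.
\<close>

definition regular_kernel :: "('d::finite, 'k::euclidean_space) kernel \<Rightarrow> bool" where
  "regular_kernel F \<longleftrightarrow> symm F \<and> (\<forall>n. smooth_degree n F) \<and> (\<forall>n. periodic_degree n F)"

lemma regular_kernel_head_coeff: assumes "regular_kernel F" shows "regular_kernel (head_coeff j F)"
proof -
  have "symm (head_coeff j F)"
  proof (rule symmI)
    fix xs ys :: "(real \<times> ('a + 'a)) list" assume "mset xs = mset ys"
    then have "F ((s, fst j) # xs) = F ((s, fst j) # ys)" for s
      using assms unfolding regular_kernel_def by (intro symmD[of F]) simp_all
    then show "head_coeff j F xs = head_coeff j F ys" by (simp add: head_coeff_def head_integral_def)
  qed
  then show ?thesis using assms unfolding regular_kernel_def by (simp add: smooth_degree_head_coeff periodic_degree_head_coeff)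
qed

text \<open>
  Exchange the two integrals and use the symmetry of \<open>F\<close>.
\<close>

lemma head_coeff_commute:
  fixes F :: "('d::finite, 'k::euclidean_space) kernel"
  assumes "regular_kernel F" shows "head_coeff i (head_coeff j F) = head_coeff j (head_coeff i F)"
proof
  fix xs :: "(real \<times> ('d + 'd)) list"
  let ?g = "\<lambda>j s. eigenvalue (snd j) * trig 0 (snd j) s"
  let ?G = "\<lambda>s t. ?g i s *\<^sub>R ?g j t *\<^sub>R F ((t, fst j) # (s, fst i) # xs)"
  have sym: "F ((t, fst j) # (s, fst i) # xs) = F ((s, fst i) # (t, fst j) # xs)" for s t
    using assms unfolding regular_kernel_def by (intro symmD[of F]) simp_all
  have "continuous_on UNIV (\<lambda>p :: real \<times> real. F ((snd p, fst j) # (fst p, fst i) # xs))"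
  proof (rule smooth_degree_continuous_list[where n = "Suc (Suc (length xs))" and a = "\<lambda>m. snd (((0, fst j) # (0, fst i) # xs) ! m)"])
    show "smooth_degree (Suc (Suc (length xs))) F" using assms by (simp add: regular_kernel_def)
    show "continuous_on UNIV (\<lambda>p :: real \<times> real. fst (((snd p, fst j) # (fst p, fst i) # xs) ! m))" for m
    proof (cases m)
      case 0
      then show ?thesis by (simp add: continuous_on_snd continuous_on_id)
    next
      case (Suc m')
      then show ?thesis by (cases m') (simp_all add: continuous_on_fst continuous_on_id)
    qed
    show "snd (((snd p, fst j) # (fst p, fst i) # xs) ! m) = snd (((0, fst j) # (0, fst i) # xs) ! m)"
      for p :: "real \<times> real" and m
    proof (cases m)
      case (Suc m')
      then show ?thesis by (cases m') simp_all
    qed simp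
  qed simp
  then have c: "continuous_on (cbox (0, 0) (1, 1)) (\<lambda>(s, t). ?G s t)"
    unfolding case_prod_unfold
    by (intro continuous_intros) (auto intro: continuous_on_subset)
  have "head_coeff i (head_coeff j F) xs = integral (cbox 0 1) (\<lambda>s. integral (cbox 0 1) (\<lambda>t. ?G s t))"
    unfolding head_coeff_def head_integral_def box_real by (simp only: Henstock_Kurzweil_Integration.integral_cmul)
  also have "\<dots> = integral (cbox 0 1) (\<lambda>t. integral (cbox 0 1) (\<lambda>s. ?G s t))"
    by (rule integral_swap_continuous[OF c])
  also have "\<dots> = integral (cbox 0 1) (\<lambda>t. integral (cbox 0 1) (\<lambda>s. ?g j t *\<^sub>R ?g i s *\<^sub>R F ((s, fst i) # (t, fst j) # xs)))"
    by (simp only: sym scaleR_left_commute)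
  also have "\<dots> = head_coeff j (head_coeff i F) xs"
    unfolding head_coeff_def head_integral_def box_real by (simp only: Henstock_Kurzweil_Integration.integral_cmul)
  finally show "head_coeff i (head_coeff j F) xs = head_coeff j (head_coeff i F) xs" .
qed

lemma symm_iter_coeff: assumes "regular_kernel F" shows "symm (\<lambda>l. iter_coeff l F)"
proof (rule symmI_swap)
  show "iter_coeff (u @ a # b # v) F = iter_coeff (u @ b # a # v) F" for u a b v
    using assms
  proof (induction u arbitrary: F)
    case Nil
    then show ?case by (simp add: head_coeff_commute)
  next
    case (Cons j u)
    then show ?case by (simp add: Cons.IH[OF regular_kernel_head_coeff[OF Cons.prems]])
  qed
qed

text \<open>
  Two more integrations by parts than for the eigenvalue give quadratic decay, enough for pointwise
  inversion in the first variable.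
\<close>

lemma regular_kernel_head_expansion:
  fixes F :: "('d::finite, 'k::euclidean_space) kernel"
  assumes F: "regular_kernel F"
  shows "F ((s, b) # xs) = (\<Sum>\<^sub>\<infinity>k. trig 0 k s *\<^sub>R head_coeff (b, k) F xs)"
proof -
  let ?n = "length xs"
  have skF: "smooth_degree (Suc ?n) F" and pkF: "periodic_degree (Suc ?n) F" using F by (simp_all add: regular_kernel_def)
  have "\<exists>B. \<forall>ys. length ys = Suc ?n \<longrightarrow> norm (foldr partial (replicate m 0) F ys) \<le> B" for m
  proof -
    have "smooth_degree (Suc ?n) (foldr partial (replicate m 0) F)" by (rule smooth_degree_foldr[OF skF]) auto
    moreover have "periodic_degree (Suc ?n) (foldr partial (replicate m 0) F)" by (rule periodic_degree_foldr[OF pkF]) auto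
    ultimately show ?thesis using smooth_degree_periodic_degree_bounded by metis
  qed
  then obtain Bf where Bf: "\<And>m ys. length ys = Suc ?n \<Longrightarrow> norm ((partial 0 ^^ m) F ys) \<le> Bf m"
    unfolding foldr_replicate_0 by metis
  \<comment> \<open>For \<open>q = 1\<close> the order is 0 or 4.\<close>
  define B where "B = max (max (Bf 0) (Bf 4)) 0"
  have B: "norm ((partial 0 ^^ parts_order 1 k) F ys) \<le> B" if "length ys = Suc ?n" for k ys
    using Bf[OF that, of 0] Bf[OF that, of 4] by (auto simp: B_def parts_order_def simp del: funpow.simps)
  show ?thesis
  proof (rule fourier_inversion[where D = "decay_const 1 * (2 * B)"])
    show "continuous_on UNIV (\<lambda>s. F ((s, b) # xs))" by (rule smooth_degree_head_continuous[OF skF refl])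
    show "F ((s + 1, b) # xs) = F ((s, b) # xs)" for s
      using pkF[unfolded periodic_degree_def, rule_format, of "(s, b) # xs" 0 s b] by simp
    show "head_coeff (b, k) F xs = eigenvalue k *\<^sub>R integral {0..1} (\<lambda>s. trig 0 k s *\<^sub>R F ((s, b) # xs))" for k
      unfolding head_coeff_def fst_conv snd_conv head_integral_scale by (simp add: head_integral_def)
    show "norm (head_coeff (b, k) F xs) \<le> decay_const 1 * (2 * B) * (1 / (1 + real_of_int \<bar>k\<bar>)\<^sup>2)" for k
    proof -
      have S: "smooth_degree (Suc ?n) ((partial 0 ^^ parts_order 1 k) F)"
        unfolding foldr_replicate_0[symmetric] by (rule smooth_degree_foldr[OF skF]) auto
      have "norm (head_coeff (b, k) F xs) \<le> \<bar>decay_factor 1 k\<bar> * (2 * B)"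
        unfolding head_coeff_eq[OF skF pkF refl, where q = 1] by (rule norm_head_integral_le[OF S refl B])
      also have "\<dots> \<le> decay_const 1 / wt (b, k) ^ (2 * 1) * (2 * B)"
        using decay_factor_le[of 1 "(b, k)"] by (intro mult_right_mono) (auto simp: B_def)
      finally show ?thesis by (simp add: wt_def)
    qed
  qed
qed

lemma regular_kernel_expansion:
  fixes F :: "('d::finite, 'k::{real_normed_field,euclidean_space}) kernel"
  assumes "regular_kernel F" "rapid (\<lambda>l. iter_coeff l F)"
  shows "F xs = form_eval (length xs) (\<lambda>l. iter_coeff l F) (\<lambda>i. slot 0 (xs ! i))"
  using assms
proof (induction xs arbitrary: F)
  case Nil
  then show ?case by simp
next
  case (Cons x xs)
  obtain s b where x: "x = (s, b)" by (cases x)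
  have T: "tame 0 (2 * (2 * pi) ^ 0) (slot 0 p :: ('d + 'd) \<times> int \<Rightarrow> 'k)" for p by (rule tame_slot) simp
  have sh: "(\<lambda>l. iter_coeff l (head_coeff j F)) = shift j (\<lambda>l. iter_coeff l F)" for j by (simp add: shift_def fun_eq_iff)
  have IH: "head_coeff j F xs = form_eval (length xs) (shift j (\<lambda>l. iter_coeff l F)) (\<lambda>i. slot 0 (xs ! i))" for j
    using Cons.IH[OF regular_kernel_head_coeff[OF Cons.prems(1)], of j] rapid_shift[OF Cons.prems(2), of j] by (simp add: sh)
  let ?t = "\<lambda>j. slot 0 x j * head_coeff j F xs"
  have "form_eval (length (x # xs)) (\<lambda>l. iter_coeff l F) (\<lambda>i. slot 0 ((x # xs) ! i)) = (\<Sum>\<^sub>\<infinity>j. ?t j)"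
    using form_eval_Suc(1)[OF Cons.prems(2) T, of "length xs" "\<lambda>i. (x # xs) ! i"] by (simp add: IH)
  also have "\<dots> = infsum ?t (range (Pair b))"
    by (rule infsum_cong_neutral) (auto simp: slot_def x)
  also have "\<dots> = (\<Sum>\<^sub>\<infinity>k. ?t (b, k))"
    by (subst infsum_reindex) (auto simp: o_def inj_on_def)
  also have "\<dots> = (\<Sum>\<^sub>\<infinity>k. trig 0 k s *\<^sub>R head_coeff (b, k) F xs)"
    by (simp add: slot_def x scaleR_conv_of_real)
  also have "\<dots> = F (x # xs)" by (simp add: regular_kernel_head_expansion[OF Cons.prems(1)] x)
  finally show ?case by simp
qed

text \<open>
  The factorial matches the one by which \<open>synth\<close> divides.
\<close>

definition fourier :: "('d::finite, 'k::{real_normed_field,euclidean_space}) kernel \<Rightarrow> (('d + 'd) \<times> int) list \<Rightarrow> 'k" where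
  "fourier F l = fact (length l) * iter_coeff l F"

text \<open>
  The iterated coefficients in degree \<open>n\<close> decay with the \<open>n\<close>-th power of a constant times the degree norm;
  the norm of the kernel with parameter enlarged by that constant dominates every single degree.
\<close>

lemma bnd_fourier:
  fixes F :: "('d::finite, 'k::{real_normed_field,euclidean_space}) kernel"
  assumes F: "F \<in> connes_kernels" and C: "C > 0"
  shows "bnd k C (kernel_norm (2 * (k + 1)) (2 * decay_const k * C) F) (fourier F)"
  unfolding bnd_def
proof
  fix l :: "(('d + 'd) \<times> int) list"
  let ?n = "length l" and ?p = "2 * (k + 1)" and ?A = "2 * decay_const k"
  have "smooth_kernel F" "periodic_kernel F"
    using F by (simp_all only: connes_kernels_def mem_Collect_eq)
  then have sp: "smooth_degree n F" "periodic_degree n F" for n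
    unfolding smooth_kernel_iff periodic_kernel_iff by blast+
  have AC: "?A * C > 0" using decay_const_pos[of k] C by simp
  have su: "summable (\<lambda>n. (?A * C) ^ n * degree_norm ?p n F)"
    using F AC by (simp add: connes_kernels_def)
  have dn: "0 \<le> degree_norm ?p n F" for n
  proof -
    have "norm (mixed_partial (replicate n 0) F (replicate n undefined)) \<le> degree_norm ?p n F"
      by (rule norm_mixed_partial_le_degree_norm[OF sp]) auto
    then show ?thesis by (rule order_trans[OF norm_ge_zero])
  qed
  have 1: "norm (iter_coeff l F) \<le> degree_norm ?p ?n F * (\<Prod>j\<leftarrow>l. ?A / wt j ^ (2 * k))"
    by (rule norm_iter_coeff_le[OF sp]) (auto intro: norm_mixed_partial_le_degree_norm[OF sp])
  have 2: "(\<Prod>j\<leftarrow>l. ?A / wt j ^ (2 * k)) * wt_prod k C l \<le> (?A * C) ^ ?n"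
  proof (induction l)
    case (Cons j l)
    have "?A / wt j ^ (2 * k) * (C * wt j ^ k) \<le> ?A * C"
    proof -
      have "wt j ^ k \<le> wt j ^ (2 * k)" by (rule power_increasing) auto
      then have "?A * C * wt j ^ k \<le> ?A * C * wt j ^ (2 * k)" using AC by (intro mult_left_mono) auto
      then show ?thesis by (simp add: divide_le_eq mult_ac)
    qed
    then have "(?A / wt j ^ (2 * k) * (C * wt j ^ k)) * ((\<Prod>j\<leftarrow>l. ?A / wt j ^ (2 * k)) * wt_prod k C l) \<le> (?A * C) * (?A * C) ^ length l"
    proof (rule mult_mono[OF _ Cons.IH])
      have "0 \<le> (\<Prod>j\<leftarrow>l. ?A / wt j ^ (2 * k))"
        by (rule prod_list_nonneg) (use decay_const_pos[of k] in \<open>auto intro!: divide_nonneg_nonneg\<close>)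
      then show "0 \<le> (\<Prod>j\<leftarrow>l. ?A / wt j ^ (2 * k)) * wt_prod k C l"
        using wt_prod_pos[OF C, of k l] by simp
    qed (use AC in auto)
    then show ?case by (simp add: mult_ac)
  qed simp
  have "norm (iter_coeff l F) * wt_prod k C l \<le> degree_norm ?p ?n F * ((\<Prod>j\<leftarrow>l. ?A / wt j ^ (2 * k)) * wt_prod k C l)"
    using mult_right_mono[OF 1 less_imp_le[OF wt_prod_pos[OF C, of k l]]] by (simp add: mult.assoc)
  also have "\<dots> \<le> degree_norm ?p ?n F * (?A * C) ^ ?n"
    by (rule mult_left_mono[OF 2 dn])
  also have "\<dots> \<le> kernel_norm ?p (?A * C) F"
    unfolding kernel_norm_def
    using sum_le_suminf[OF su, of "{?n}"] dn AC by (simp add: mult.commute)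
  finally have "fact ?n * (norm (iter_coeff l F) * wt_prod k C l) \<le> fact ?n * kernel_norm ?p (?A * C) F"
    by (rule mult_left_mono) simp
  then show "norm (fourier F l) * wt_prod k C l \<le> kernel_norm ?p (?A * C) F * fact ?n"
    by (simp add: fourier_def norm_mult mult_ac)
qed

theorem kernel_eq_synth_fourier:
  fixes F :: "('d::finite, 'k::{real_normed_field,euclidean_space}) kernel"
  assumes F: "F \<in> connes_kernels"
  shows "connes_coef (fourier F)" and "synth (fourier F) = F"
proof -
  have "symmetric_kernel F" "smooth_kernel F" "periodic_kernel F"
    using F by (simp_all only: connes_kernels_def mem_Collect_eq)
  then have regular_kernel: "regular_kernel F"
    unfolding regular_kernel_def symmetric_kernel_def symm_def smooth_kernel_iff periodic_kernel_iff by (intro conjI)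
  have r: "rapid (fourier F)"
    unfolding rapid_def using bnd_fourier[OF F] by blast
  have "symm (fourier F)"
  proof (rule symmI)
    fix xs ys :: "(('d + 'd) \<times> int) list" assume m: "mset xs = mset ys"
    then show "fourier F xs = fourier F ys"
      using symmD[OF symm_iter_coeff[OF regular_kernel] m] mset_eq_length[OF m] by (simp add: fourier_def)
  qed
  then show "connes_coef (fourier F)" using r by (simp add: connes_coef_def)
  have rc: "rapid (\<lambda>l. iter_coeff l F)"
    unfolding rapid_def
  proof (intro allI impI)
    fix k :: nat and C :: real assume "C > 0"
    then obtain M where M: "bnd k C M (fourier F)" using r by (auto simp: rapid_def)
    have "bnd k C M (\<lambda>l. iter_coeff l F)"
      unfolding bnd_def
    proof
      fix l
      have "fact (length l) * (norm (iter_coeff l F) * wt_prod k C l) \<le> fact (length l) * M"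
        using bndD[OF M, of l] by (simp add: fourier_def norm_mult mult_ac)
      then have "norm (iter_coeff l F) * wt_prod k C l \<le> M" by (subst (asm) mult_le_cancel_left_pos) auto
      also have "\<dots> \<le> M * fact (length l)"
        using bnd_nonneg[OF M] fact_ge_1[of "length l", where 'a = real] mult_left_mono[of 1 "fact (length l)" M] by simp
      finally show "norm (iter_coeff l F) * wt_prod k C l \<le> M * fact (length l)" .
    qed
    then show "\<exists>M. bnd k C M (\<lambda>l. iter_coeff l F)" by blast
  qed
  show "synth (fourier F) = F"
  proof
    fix xs
    have "form_eval (length xs) (fourier F) (\<lambda>i. slot 0 (xs ! i)) = form_eval (length xs) (\<lambda>l. fact (length xs) * iter_coeff l F) (\<lambda>i. slot 0 (xs ! i))"
      by (rule form_eval_cong) (simp_all add: fourier_def)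
    also have "\<dots> = fact (length xs) * F xs"
      unfolding form_eval_scale regular_kernel_expansion[OF regular_kernel rc, symmetric] ..
    finally show "synth (fourier F) xs = F xs" by (simp add: synth_deriv_def)
  qed
qed

section \<open>The Connes space in terms of coefficients\<close>

lemma stratonovich_fourier:
  fixes F :: "('d::finite, 'k::{real_normed_field,euclidean_space}) kernel"
  assumes "F \<in> connes_kernels" shows "stratonovich F = Phi (fourier F)"
  using stratonovich_synth[OF connes_coefD(1)[OF kernel_eq_synth_fourier(1)[OF assms]]]
  unfolding kernel_eq_synth_fourier(2)[OF assms] .

text \<open>
  Synthesis and Fourier coefficients are inverse to each other between rapidly decreasing symmetric
  coefficients and kernels, and \<open>Phi\<close> is the Stratonovich integral in these terms.
\<close>

lemma connes_eq: "(connes :: ('d::finite, 'k::{real_normed_field,euclidean_space}) functional set) = Phi ` {f. connes_coef f}"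
proof
  show "(connes :: ('d, 'k) functional set) \<subseteq> Phi ` {f. connes_coef f}"
    using kernel_eq_synth_fourier(1) stratonovich_fourier by (force simp: connes_def)
  show "Phi ` {f. connes_coef f} \<subseteq> (connes :: ('d, 'k) functional set)"
    using stratonovich_synth[OF connes_coefD(1)] synth_in_connes_kernels by (force simp: connes_def)
qed

lemma Phi_connes:
  fixes f :: "(('d::finite + 'd) \<times> int) list \<Rightarrow> 'k::{real_normed_field,euclidean_space}"
  shows "connes_coef f \<Longrightarrow> Phi f \<in> connes"
  by (simp add: connes_eq)

lemma inj_stratonovich: "inj_on stratonovich (connes_kernels :: ('d::finite, 'k::{real_normed_field,euclidean_space}) kernel set)"
proof (rule inj_onI)
  fix F G :: "('d, 'k) kernel"
  assume F: "F \<in> connes_kernels" and G: "G \<in> connes_kernels" and eq: "stratonovich F = stratonovich G"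
  have "Phi (fourier F) = Phi (fourier G)"
    using eq by (simp only: stratonovich_fourier[OF F] stratonovich_fourier[OF G])
  then have "fourier F = fourier G"
    by (rule Phi_inj[OF kernel_eq_synth_fourier(1)[OF F] kernel_eq_synth_fourier(1)[OF G]])
  then have "synth (fourier F) = synth (fourier G)" by (simp only:)
  then show "F = G" by (simp only: kernel_eq_synth_fourier(2)[OF F] kernel_eq_synth_fourier(2)[OF G])
qed

lemma connes_norm_Phi:
  fixes f :: "(('d::finite + 'd) \<times> int) list \<Rightarrow> 'k::{real_normed_field,euclidean_space}"
  assumes f: "connes_coef f" shows "connes_norm k C (Phi f) = kernel_norm k C (synth f)"
  unfolding connes_norm_def
  by (simp add: the_inv_into_f_eq[OF inj_stratonovich stratonovich_synth[OF connes_coefD(1)[OF f]] synth_in_connes_kernels[OF f]])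

lemma fourier_synth:
  fixes f :: "(('d::finite + 'd) \<times> int) list \<Rightarrow> 'k::{real_normed_field,euclidean_space}"
  assumes f: "connes_coef f" shows "fourier (synth f) = f"
proof (rule Phi_inj[OF kernel_eq_synth_fourier(1)[OF synth_in_connes_kernels[OF f]] f])
  show "Phi (fourier (synth f)) = Phi f"
    using stratonovich_fourier[OF synth_in_connes_kernels[OF f]] stratonovich_synth[OF connes_coefD(1)[OF f]] by simp
qed

text \<open>
  Together with the next lemma: the seminorms of coefficients and the norms of functionals define the
  same topology.
\<close>

lemma bnd_connes_norm:
  fixes f :: "(('d::finite + 'd) \<times> int) list \<Rightarrow> 'k::{real_normed_field,euclidean_space}"
  assumes f: "connes_coef f" and C: "C > 0"
  shows "bnd k C (connes_norm (2 * (k + 1)) (2 * decay_const k * C) (Phi f)) f"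
  using bnd_fourier[OF synth_in_connes_kernels[OF f] C, of k] by (simp only: fourier_synth[OF f] connes_norm_Phi[OF f])

lemma connes_norm_le:
  fixes f :: "(('d::finite + 'd) \<times> int) list \<Rightarrow> 'k::{real_normed_field,euclidean_space}"
  assumes "connes_coef f" "C > 0" "bnd (k + 2) (2 * C * (synth_const TYPE('d) k + 1)) M f"
  shows "connes_norm k C (Phi f) \<le> 2 * M"
  unfolding connes_norm_Phi[OF assms(1)] by (rule kernel_norm_synth_le[OF connes_coefD(1)[OF assms(1)] assms(3,2) refl])

lemma synth_deriv_add:
  fixes f g :: "(('d::finite + 'd) \<times> int) list \<Rightarrow> 'k::{real_normed_field,banach}"
  assumes "rapid f" "rapid g"
  shows "synth_deriv (\<lambda>l. f l + g l) \<mu> xs = synth_deriv f \<mu> xs + synth_deriv g \<mu> xs"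
proof -
  let ?N = "Max (\<mu> ` {..<length xs})"
  have t: "tame ?N (2 * (2 * pi) ^ ?N) (slot (\<mu> j) (xs ! j) :: ('d + 'd) \<times> int \<Rightarrow> 'k)" if "j < length xs" for j
    using that by (intro tame_slot) simp
  show ?thesis by (simp only: synth_deriv_def form_eval_add[OF assms t] add_divide_distrib)
qed

text \<open>
  The triangle inequality, needed to shift the centre of balls in the Connes topology.
\<close>

lemma kernel_norm_synth_add:
  fixes f g :: "(('d::finite + 'd) \<times> int) list \<Rightarrow> 'k::{real_normed_field,euclidean_space}"
  assumes f: "connes_coef f" and g: "connes_coef g" and C: "C > 0"
  shows "kernel_norm k C (synth (\<lambda>l. f l + g l)) \<le> kernel_norm k C (synth f) + kernel_norm k C (synth g)"
proof -
  let ?h = "\<lambda>l. f l + g l"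
  have h: "connes_coef ?h" by (rule connes_coef_add[OF f g])
  have sm: "summable (\<lambda>n. C ^ n * degree_norm k n (synth f))" if "connes_coef f" for f :: "(('d + 'd) \<times> int) list \<Rightarrow> 'k"
    using synth_in_connes_kernels[OF that] C by (simp add: connes_kernels_def)
  have spf: "smooth_degree n (mixed_partial m (synth f)) \<and> periodic_degree n (mixed_partial m (synth f))" if "connes_coef f" "length m = n"
    for f :: "(('d + 'd) \<times> int) list \<Rightarrow> 'k" and m n
  proof -
    have "smooth_degree n (synth f)" "periodic_degree n (synth f)"
      using smooth_synth[OF connes_coefD(1)[OF that(1)]] periodic_synth[of f] by (auto simp: smooth_kernel_iff periodic_kernel_iff)
    then show ?thesis
      unfolding mixed_partial_eq using set_derivative_word[of m] that(2) by (auto intro: smooth_degree_foldr periodic_degree_foldr)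
  qed
  have "degree_norm k n (synth ?h) \<le> degree_norm k n (synth f) + degree_norm k n (synth g)" for n
    unfolding degree_norm_def sum.distrib[symmetric]
  proof (rule sum_mono)
    fix m assume "m \<in> {m. length m = n \<and> set m \<subseteq> {0..k}}"
    then have m: "length m = n" by simp
    let ?A = "{a::('d + 'd) list. length a = n}"
    show "sup_norm n (mixed_partial m (synth ?h)) \<le> sup_norm n (mixed_partial m (synth f)) + sup_norm n (mixed_partial m (synth g))"
      unfolding sup_norm_def[of n "mixed_partial m (synth ?h)"]
    proof (rule cSUP_least)
      show "{s::real list. length s = n} \<noteq> {}" using length_replicate[of n 0] by blast
      fix s :: "real list" assume "s \<in> {s. length s = n}"
      then have s: "length s = n" by simp
      have "L2_set (\<lambda>a. norm (mixed_partial m (synth ?h) (zip s a))) ?A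
          \<le> L2_set (\<lambda>a. norm (mixed_partial m (synth f) (zip s a)) + norm (mixed_partial m (synth g) (zip s a))) ?A"
      proof (rule L2_set_mono)
        fix a assume "a \<in> ?A"
        then have len: "length m = length (zip s a)" using m s by simp
        show "norm (mixed_partial m (synth ?h) (zip s a)) \<le> norm (mixed_partial m (synth f) (zip s a)) + norm (mixed_partial m (synth g) (zip s a))"
          unfolding mixed_partial_synth[OF connes_coefD(1)[OF h] len] mixed_partial_synth[OF connes_coefD(1)[OF f] len] mixed_partial_synth[OF connes_coefD(1)[OF g] len]
            synth_deriv_add[OF connes_coefD(1)[OF f] connes_coefD(1)[OF g]]
          by (rule norm_triangle_ineq)
      qed simp
      also have "\<dots> \<le> L2_set (\<lambda>a. norm (mixed_partial m (synth f) (zip s a))) ?A + L2_set (\<lambda>a. norm (mixed_partial m (synth g) (zip s a))) ?A"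
        by (rule L2_set_triangle_ineq)
      also have "\<dots> \<le> sup_norm n (mixed_partial m (synth f)) + sup_norm n (mixed_partial m (synth g))"
        using spf[OF f m] spf[OF g m] s by (intro add_mono L2_set_le_sup_norm) auto
      finally show "L2_set (\<lambda>a. norm (mixed_partial m (synth ?h) (zip s a))) ?A
          \<le> sup_norm n (mixed_partial m (synth f)) + sup_norm n (mixed_partial m (synth g))" .
    qed
  qed
  then have "C ^ n * degree_norm k n (synth ?h) \<le> C ^ n * degree_norm k n (synth f) + C ^ n * degree_norm k n (synth g)" for n
    unfolding distrib_left[symmetric] using C by (intro mult_left_mono) auto
  then have "kernel_norm k C (synth ?h) \<le> (\<Sum>n. C ^ n * degree_norm k n (synth f) + C ^ n * degree_norm k n (synth g))"
    unfolding kernel_norm_def by (rule suminf_le[OF _ sm[OF h] summable_add[OF sm[OF f] sm[OF g]]])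
  also have "\<dots> = kernel_norm k C (synth f) + kernel_norm k C (synth g)"
    unfolding kernel_norm_def by (rule suminf_add[OF sm[OF f] sm[OF g], symmetric])
  finally show ?thesis .
qed

lemma connes_coef_diff:
  fixes f g :: "('c \<times> int) list \<Rightarrow> 'k::real_normed_field"
  assumes "connes_coef f" "connes_coef g" shows "connes_coef (\<lambda>l. f l - g l)"
  using connes_coef_add[OF assms(1) connes_coef_scale[OF assms(2), of "-1"]] by simp

lemma Phi_diff:
  fixes f g :: "(('d::finite + 'd) \<times> int) list \<Rightarrow> 'k::{real_normed_field,banach}"
  assumes "connes_coef f" "connes_coef g"
  shows "(\<lambda>X. Phi f X - Phi g X) = Phi (\<lambda>l. f l - g l)"
proof
  fix X
  have "Phi (\<lambda>l. f l + (-1) * g l) X = Phi f X + (-1) * Phi g X"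
    by (simp only: Phi_add[OF connes_coefD(1)[OF assms(1)] rapid_scale[OF connes_coefD(1)[OF assms(2)]]] Phi_scale[OF connes_coefD(1)[OF assms(2)]])
  then show "Phi f X - Phi g X = Phi (\<lambda>l. f l - g l) X" by simp
qed

lemma Phi_0: "Phi (\<lambda>l. 0) = (\<lambda>X. 0)"
  by (simp add: Phi_def taylor_eval_def form_eval_def fun_eq_iff)

lemma Phi_sum:
  fixes F :: "'n \<Rightarrow> (('d::finite + 'd) \<times> int) list \<Rightarrow> 'k::{real_normed_field,banach}"
  assumes "finite J" "\<And>j. j \<in> J \<Longrightarrow> connes_coef (F j)"
  shows "Phi (\<lambda>l. \<Sum>j\<in>J. F j l) X = (\<Sum>j\<in>J. Phi (F j) X)"
  using assms
proof (induction J rule: finite_induct)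
  case empty
  then show ?case by (simp add: Phi_0)
next
  case (insert j J)
  have "rapid (\<lambda>l. \<Sum>j\<in>J. F j l)" by (rule connes_coefD(1)[OF connes_coef_sum]) (use insert in auto)
  from Phi_add[OF connes_coefD(1) this, of "F j" X] show ?case using insert by simp
qed

lemma connes_ball_center:
  fixes f :: "(('d::finite + 'd) \<times> int) list \<Rightarrow> 'k::{real_normed_field,euclidean_space}"
  assumes f: "connes_coef f" and C: "C > 0" and e: "\<epsilon> > 0"
  shows "Phi f \<in> {\<Psi> \<in> connes. connes_norm k C (\<lambda>X. \<Psi> X - Phi f X) < \<epsilon>}"
proof -
  have "connes_norm k C (Phi (\<lambda>l. 0 :: 'k) :: ('d, 'k) functional) \<le> 2 * 0"
    by (rule connes_norm_le[OF connes_coef_0 C]) (simp add: bnd_def)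
  then show ?thesis using Phi_connes[OF f] e by (simp add: Phi_0)
qed

lemma topspace_connes: "topspace connes_topology = (connes :: ('d::finite, 'k::{real_normed_field,euclidean_space}) functional set)"
proof -
  have "\<Phi> \<in> \<Union> {{\<Psi> \<in> connes. connes_norm k C (\<lambda>X. \<Psi> X - \<Phi> X) < \<epsilon>} | \<Phi> k C \<epsilon>. \<Phi> \<in> connes \<and> C > 0 \<and> \<epsilon> > 0}"
    if mem: "\<Phi> \<in> connes" for \<Phi> :: "('d, 'k) functional"
  proof -
    obtain f where "\<Phi> = Phi f" "connes_coef f" using mem unfolding connes_eq by blast
    then have "\<Phi> \<in> {\<Psi> \<in> connes. connes_norm 0 1 (\<lambda>X. \<Psi> X - \<Phi> X) < 1}"
      using connes_ball_center[of f 1 1 0] by simp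
    then show ?thesis using mem zero_less_one by blast
  qed
  then show ?thesis
    unfolding connes_topology_def topology_generated_by_topspace by blast
qed

text \<open>
  An operator that is linear on differences and bounded for the seminorms of coefficients is Lipschitz for the norms of
  functionals, with other parameters on the right-hand side. So a small enough ball around a point of a preimage of
  a ball stays in that preimage.
\<close>

lemma continuous_on_connes:
  fixes \<tau> :: "((('d::finite + 'd) \<times> int) list \<Rightarrow> 'k::{real_normed_field,euclidean_space}) \<Rightarrow> (('d + 'd) \<times> int) list \<Rightarrow> 'k"
  assumes S: "\<And>f. connes_coef f \<Longrightarrow> S (Phi f) = Phi (\<tau> f)" and connes_coef: "\<And>f. connes_coef f \<Longrightarrow> connes_coef (\<tau> f)"
    and diff: "\<And>f g. connes_coef f \<Longrightarrow> connes_coef g \<Longrightarrow> \<tau> (\<lambda>l. f l - g l) = (\<lambda>l. \<tau> f l - \<tau> g l)"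
    and bound: "\<And>k C. C > 0 \<Longrightarrow> \<exists>c k' C'. c \<ge> 0 \<and> C' > 0 \<and> (\<forall>M f. bnd k' C' M f \<longrightarrow> bnd k C (c * M) (\<tau> f))"
  shows "continuous_map connes_topology connes_topology S"
proof -
  let ?B = "\<lambda>\<Phi> k C \<epsilon>. {\<Psi> \<in> (connes :: ('d, 'k) functional set). connes_norm k C (\<lambda>X. \<Psi> X - \<Phi> X) < \<epsilon>}"
  have ball_open: "openin connes_topology (?B \<Phi> k C \<epsilon>)" if "\<Phi> \<in> connes" "C > 0" "\<epsilon> > 0" for \<Phi> k C \<epsilon>
    unfolding connes_topology_def by (rule topology_generated_by_Basis) (use that in blast)
  have Sc: "S \<Phi> \<in> connes" if "\<Phi> \<in> connes" for \<Phi>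
    using that S connes_coef by (auto simp: connes_eq)
  have norm_bound: "\<exists>c k' C'. c \<ge> 0 \<and> C' > 0 \<and> (\<forall>f. connes_coef f \<longrightarrow> connes_norm k C (Phi (\<tau> f)) \<le> c * connes_norm k' C' (Phi f))"
    if C: "C > 0" for k C
  proof -
    have "2 * C * (synth_const TYPE('d) k + 1) > 0" using C synth_const_nonneg[where 'd = 'd, of k] by simp
    from bound[OF this, of "k + 2"] obtain c k' C' where c: "c \<ge> 0" "C' > 0"
      and b: "\<And>M f. bnd k' C' M f \<Longrightarrow> bnd (k + 2) (2 * C * (synth_const TYPE('d) k + 1)) (c * M) (\<tau> f)" by blast
    have "connes_norm k C (Phi (\<tau> f)) \<le> (2 * c) * connes_norm (2 * (k' + 1)) (2 * decay_const k' * C') (Phi f)" if f: "connes_coef f" for f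
      using connes_norm_le[OF connes_coef[OF f] C b[OF bnd_connes_norm[OF f c(2)]]] by simp
    moreover have "2 * decay_const k' * C' > 0" using decay_const_pos[of k'] c by simp
    moreover have "2 * c \<ge> 0" using c by simp
    ultimately show ?thesis by blast
  qed
  have pre: "openin connes_topology (S -` ?B \<Phi> k C \<epsilon> \<inter> topspace connes_topology)" if \<Phi>: "\<Phi> \<in> connes" and C: "C > 0" for \<Phi> k C \<epsilon>
    unfolding openin_subopen[of _ "S -` ?B \<Phi> k C \<epsilon> \<inter> topspace connes_topology"]
  proof
    fix \<Theta> assume \<Theta>: "\<Theta> \<in> S -` ?B \<Phi> k C \<epsilon> \<inter> topspace connes_topology"
    then obtain f where f: "connes_coef f" "\<Theta> = Phi f" by (auto simp: topspace_connes connes_eq)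
    obtain g where g: "connes_coef g" "\<Phi> = Phi g" using \<Phi> by (auto simp: connes_eq)
    obtain c k' C' where c: "c \<ge> 0" "C' > 0"
      and b: "\<And>f. connes_coef f \<Longrightarrow> connes_norm k C (Phi (\<tau> f)) \<le> c * connes_norm k' C' (Phi f)"
      using norm_bound[OF C] by blast
    let ?d = "connes_norm k C (Phi (\<lambda>l. \<tau> f l - g l))"
    have "?d < \<epsilon>" using \<Theta> f g by (simp add: S Phi_diff[OF connes_coef[OF f(1)] g(1)])
    \<comment> \<open>A denominator \<open>c + 1\<close> instead of \<open>c\<close> covers \<open>c = 0\<close>.\<close>
    define \<eta> where "\<eta> = (\<epsilon> - ?d) / (c + 1)"
    have \<eta>: "\<eta> > 0" using \<open>?d < \<epsilon>\<close> c by (simp add: \<eta>_def)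
    have "?B \<Theta> k' C' \<eta> \<subseteq> S -` ?B \<Phi> k C \<epsilon> \<inter> topspace connes_topology"
    proof
      fix \<Psi> assume \<Psi>: "\<Psi> \<in> ?B \<Theta> k' C' \<eta>"
      then obtain h where h: "connes_coef h" "\<Psi> = Phi h" by (auto simp: connes_eq)
      have n: "connes_norm k' C' (Phi (\<lambda>l. h l - f l)) < \<eta>"
        using \<Psi> h f by (simp add: Phi_diff[OF h(1) f(1)])
      have gd: "connes_coef (\<lambda>l. \<tau> h l - \<tau> f l)" "connes_coef (\<lambda>l. \<tau> f l - g l)"
        by (intro connes_coef_diff connes_coef h f g)+
      have "connes_norm k C (Phi (\<lambda>l. \<tau> h l - g l)) = kernel_norm k C (synth (\<lambda>l. (\<tau> h l - \<tau> f l) + (\<tau> f l - g l)))"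
        using connes_norm_Phi[OF connes_coef_diff[OF connes_coef[OF h(1)] g(1)]] by simp
      also have "\<dots> \<le> connes_norm k C (Phi (\<lambda>l. \<tau> h l - \<tau> f l)) + ?d"
        unfolding connes_norm_Phi[OF gd(1)] connes_norm_Phi[OF gd(2)] by (rule kernel_norm_synth_add[OF gd C])
      also have "connes_norm k C (Phi (\<lambda>l. \<tau> h l - \<tau> f l)) \<le> c * connes_norm k' C' (Phi (\<lambda>l. h l - f l))"
        using b[OF connes_coef_diff[OF h(1) f(1)]] by (simp only: diff[OF h(1) f(1)])
      also have "\<dots> \<le> c * \<eta>" using n c by (intro mult_left_mono) auto
      also have "c * \<eta> + ?d < \<epsilon>"
      proof -
        have "(c + 1) * \<eta> = \<epsilon> - ?d" using c by (simp add: \<eta>_def)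
        then show ?thesis using \<eta> by (simp add: distrib_right)
      qed
      finally have "connes_norm k C (\<lambda>X. S \<Psi> X - \<Phi> X) < \<epsilon>"
        using h g by (simp add: S Phi_diff[OF connes_coef[OF h(1)] g(1)])
      then show "\<Psi> \<in> S -` ?B \<Phi> k C \<epsilon> \<inter> topspace connes_topology"
        using \<Psi> Sc by (simp add: topspace_connes)
    qed
    moreover have "\<Theta> \<in> ?B \<Theta> k' C' \<eta>" unfolding f(2) by (rule connes_ball_center[OF f(1) c(2) \<eta>])
    moreover have "openin connes_topology (?B \<Theta> k' C' \<eta>)"
      by (rule ball_open[OF _ c(2) \<eta>]) (use f Phi_connes in simp)
    ultimately show "\<exists>T. openin connes_topology T \<and> \<Theta> \<in> T \<and> T \<subseteq> S -` ?B \<Phi> k C \<epsilon> \<inter> topspace connes_topology"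
      by blast
  qed
  show ?thesis
    unfolding connes_topology_def[where 'd = 'd and 'k = 'k]
  proof (subst connes_topology_def[symmetric], rule continuous_on_generated_topo)
    fix U assume "U \<in> {?B \<Phi> k C \<epsilon> | \<Phi> k C \<epsilon>. \<Phi> \<in> connes \<and> C > 0 \<and> \<epsilon> > 0}"
    then show "openin connes_topology (S -` U \<inter> topspace connes_topology)" using pre by blast
  next
    show "S ` topspace connes_topology \<subseteq> \<Union> {?B \<Phi> k C \<epsilon> | \<Phi> k C \<epsilon>. \<Phi> \<in> connes \<and> C > 0 \<and> \<epsilon> > 0}"
      using Sc topspace_connes[where 'd = 'd and 'k = 'k]
      unfolding connes_topology_def topology_generated_by_topspace by blast
  qed
qed

lemma T_coef_add:
  fixes f g :: "('c \<times> int) list \<Rightarrow> 'k::{real_normed_field,banach}" and u :: "'q::finite \<Rightarrow> 'c"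
  assumes \<alpha>: "tame N A \<alpha>" and fg: "connes_coef f" "connes_coef g"
  shows "T_coef \<alpha> u v r (\<lambda>l. f l + g l) = (\<lambda>l. T_coef \<alpha> u v r f l + T_coef \<alpha> u v r g l)"
proof -
  note d = tame_uminus[OF \<alpha>]
  have "(contract (\<lambda>t. - \<alpha> t) u v ^^ r) (\<lambda>l. f l + g l) = (\<lambda>l. (contract (\<lambda>t. - \<alpha> t) u v ^^ r) f l + (contract (\<lambda>t. - \<alpha> t) u v ^^ r) g l)"
    by (induction r) (simp_all add: contract_add[OF d connes_coefD(1)[OF connes_coef_contract_pow[OF d fg(1)]] connes_coefD(1)[OF connes_coef_contract_pow[OF d fg(2)]]])
  then show ?thesis by (simp add: T_coef_def fun_eq_iff add_divide_distrib)
qed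

lemma T_coef_scale: "T_coef \<alpha> u v r (\<lambda>l. c * f l) = (\<lambda>l. c * T_coef \<alpha> u v r f l)"
proof -
  have "(contract (\<lambda>t. - \<alpha> t) u v ^^ r) (\<lambda>l. c * f l) = (\<lambda>l. c * (contract (\<lambda>t. - \<alpha> t) u v ^^ r) f l)"
    by (induction r) (simp_all add: contract_scale)
  then show ?thesis by (simp add: T_coef_def fun_eq_iff)
qed

lemma T_coef_0: "T_coef \<alpha> u v r (\<lambda>l. 0) = (\<lambda>l. 0)"
  using T_coef_scale[of \<alpha> u v r 0 "\<lambda>l. 0"] by simp

lemma T_coef_sum:
  fixes F :: "'n \<Rightarrow> ('c \<times> int) list \<Rightarrow> 'k::{real_normed_field,banach}" and u :: "'q::finite \<Rightarrow> 'c"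
  assumes \<alpha>: "tame N A \<alpha>" and J: "finite J" "\<And>j. j \<in> J \<Longrightarrow> connes_coef (F j)"
  shows "T_coef \<alpha> u v r (\<lambda>l. \<Sum>j\<in>J. F j l) = (\<lambda>l. \<Sum>j\<in>J. T_coef \<alpha> u v r (F j) l)"
  using J
proof (induction J rule: finite_induct)
  case empty
  then show ?case by (simp add: T_coef_0)
next
  case (insert j J)
  have "connes_coef (\<lambda>l. \<Sum>j\<in>J. F j l)" by (rule connes_coef_sum) (use insert in auto)
  then show ?case using insert T_coef_add[OF \<alpha>, of "F j" "\<lambda>l. \<Sum>j\<in>J. F j l" u v r] by simp
qed

lemma T_coef_at_0 [simp]: "T_coef \<alpha> u v 0 f = f"
  by (simp add: T_coef_def fun_eq_iff)

lemma diagonal_zero: "diagonal (\<lambda>l. 0 :: 'k::real_normed_field) l = 0"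
  using diagonal_scale[of 0 "\<lambda>l. 0 :: 'k" l] by simp

lemma star_coef_zero:
  "star_coef \<alpha> u v r (\<lambda>l. 0) g = (\<lambda>l. 0)" "star_coef \<alpha> u v r f (\<lambda>l. 0) = (\<lambda>l. 0)"
proof -
  have 0: "(bidiff_op \<alpha> u v ^^ r) (\<lambda>l. 0) = (\<lambda>l. 0)"
    by (induction r) (simp_all add: bidiff_op_def contract_def fun_eq_iff)
  have t: "tens (\<lambda>l. 0) g = (\<lambda>l. 0)" "tens f (\<lambda>l. 0) = (\<lambda>l. 0)" by (simp_all add: tens_def fun_eq_iff)
  show "star_coef \<alpha> u v r (\<lambda>l. 0) g = (\<lambda>l. 0)" "star_coef \<alpha> u v r f (\<lambda>l. 0) = (\<lambda>l. 0)"
    unfolding star_coef_def t 0 by (simp_all add: diagonal_zero)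
qed

lemma star_Phi:
  fixes f g :: "nat \<Rightarrow> (('d::finite + 'd) \<times> int) list \<Rightarrow> 'k::{real_normed_field,banach}"
  assumes \<alpha>: "tame N A (\<lambda>t::'d \<times> int. \<alpha> (snd t))" and fg: "\<And>n. connes_coef (f n)" "\<And>n. connes_coef (g n)"
  shows "star \<alpha> (\<lambda>n. Phi (f n)) (\<lambda>n. Phi (g n)) n =
    Phi (\<lambda>l. \<Sum>p\<le>n. \<Sum>q\<le>n - p. star_coef (\<lambda>t. \<alpha> (snd t)) Inl Inr (n - p - q) (f p) (g q) l)"
proof
  fix X
  have g: "connes_coef (star_coef (\<lambda>t. \<alpha> (snd t)) Inl Inr r (f p) (g q))" for r p q
    by (rule connes_coef_star_coef[OF \<alpha> fg])
  then show "star \<alpha> (\<lambda>n. Phi (f n)) (\<lambda>n. Phi (g n)) n X =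
    Phi (\<lambda>l. \<Sum>p\<le>n. \<Sum>q\<le>n - p. star_coef (\<lambda>t. \<alpha> (snd t)) Inl Inr (n - p - q) (f p) (g q) l) X"
    by (simp add: star_def star_term_Phi[OF \<alpha> fg] Phi_sum connes_coef_sum)
qed

lemma hconst_Phi: "hconst (Phi f) = (\<lambda>n. Phi (if n = 0 then f else (\<lambda>l. 0)))"
  by (simp add: hconst_def fun_eq_iff Phi_0)

lemma sum_triangle_swap:
  fixes G :: "nat \<Rightarrow> nat \<Rightarrow> 'a::comm_monoid_add"
  shows "(\<Sum>r\<le>n. \<Sum>j\<le>n - r. G r j) = (\<Sum>j\<le>n. \<Sum>r\<le>n - j. G r j)"
proof -
  have "(\<Sum>r\<le>n. \<Sum>j\<le>n - r. G r j) = (\<Sum>(r, j)\<in>(SIGMA r:{..n}. {..n - r}). G r j)"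
    by (simp add: sum.Sigma)
  also have "\<dots> = (\<Sum>(j, r)\<in>(SIGMA j:{..n}. {..n - j}). G r j)"
    by (rule sum.reindex_bij_witness[where j = prod.swap and i = prod.swap]) auto
  also have "\<dots> = (\<Sum>j\<le>n. \<Sum>r\<le>n - j. G r j)"
    by (simp add: sum.Sigma)
  finally show ?thesis .
qed

text \<open>
  The value at frequency 0 is not controlled by the growth condition and is absorbed in the constant.
\<close>

lemma tame_of_powr_bound:
  fixes \<alpha> :: "int \<Rightarrow> 'k::real_normed_field"
  assumes "B > 0" and b: "\<And>k. k \<noteq> 0 \<Longrightarrow> norm (\<alpha> k) \<le> B * (real_of_int \<bar>k\<bar>) powr \<mu>"
  obtains N A where "tame N A (\<lambda>t::'d \<times> int. \<alpha> (snd t))"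
proof -
  let ?N = "nat \<lceil>\<mu>\<rceil>" and ?A = "B + norm (\<alpha> 0)"
  have "tame ?N ?A (\<lambda>t::'d \<times> int. \<alpha> (snd t))"
    unfolding tame_def
  proof
    fix j :: "'d \<times> int"
    show "norm (\<alpha> (snd j)) \<le> ?A * wt j ^ ?N"
    proof (cases "snd j = 0")
      case True
      have "norm (\<alpha> 0) * 1 \<le> ?A * wt j ^ ?N"
        using assms(1) by (intro mult_mono one_le_power) auto
      then show ?thesis using True by simp
    next
      case False
      let ?k = "real_of_int \<bar>snd j\<bar>"
      have k: "?k \<ge> 1" using False by linarith
      have "?k powr \<mu> \<le> ?k powr real ?N" by (rule powr_mono[OF _ k]) linarith
      also have "\<dots> = ?k ^ ?N" using k by (intro powr_realpow) linarith
      also have "\<dots> \<le> wt j ^ ?N" by (rule power_mono) (simp_all add: wt_def)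
      finally have "B * ?k powr \<mu> \<le> ?A * wt j ^ ?N"
        using assms(1) by (intro mult_mono) auto
      then show ?thesis using b[OF False] by linarith
    qed
  qed
  then show ?thesis by (rule that)
qed

theorem proposition5:
  fixes \<alpha> :: "int \<Rightarrow> 'k::{real_normed_field, euclidean_space}"
    and K \<mu> :: real
  assumes "K > 0" and "\<mu> > 0"
    and "\<And>k. k \<noteq> 0 \<Longrightarrow> norm (\<alpha> k) \<le> K * (real_of_int \<bar>k\<bar>) powr \<mu>"
  shows "\<exists>(T :: ('d::finite, 'k) hseries \<Rightarrow> ('d, 'k) hseries)
          (T' :: nat \<Rightarrow> ('d, 'k) functional \<Rightarrow> ('d, 'k) functional).
      T \<in> connes_hseries \<rightarrow> connes_hseries \<and>
      hlinear_on_connes T \<and>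
      (\<forall>r\<ge>1. continuous_map connes_topology connes_topology (T' r) \<and> linear_on_connes (T' r)) \<and>
      (\<forall>\<Phi>\<in>connes_hseries. \<forall>n X. T \<Phi> n X = \<Phi> n X + (\<Sum>r=1..n. T' r (\<Phi> (n - r)) X)) \<and>
      (\<forall>F\<in>connes. \<forall>G\<in>connes.
        star \<alpha> (hconst F) (hconst G) \<in> connes_hseries \<and>
        T (star \<alpha> (hconst F) (hconst G)) = moyal (T (hconst F)) (T (hconst G)))"
proof -
  obtain N A where a: "tame N A (\<lambda>t::'d \<times> int. \<alpha> (snd t))" using tame_of_powr_bound[OF assms(1,3)] .
  define \<tau> where "\<tau> r = T_coef (\<lambda>t::'d \<times> int. \<alpha> (snd t)) Inl (Inr :: 'd \<Rightarrow> 'd + 'd) r" for r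
  \<comment> \<open>Functionals in the Connes space determine their coefficients, so operators on coefficients descend.\<close>
  define T' :: "nat \<Rightarrow> ('d, 'k) functional \<Rightarrow> ('d, 'k) functional" where
    "T' r \<Phi> = Phi (\<tau> r (the_inv_into {f. connes_coef f} Phi \<Phi>))" for r \<Phi>
  define T :: "('d, 'k) hseries \<Rightarrow> ('d, 'k) hseries" where
    "T \<Phi> n X = \<Phi> n X + (\<Sum>r=1..n. T' r (\<Phi> (n - r)) X)" for \<Phi> n X
  have inj: "inj_on Phi {f :: (('d + 'd) \<times> int) list \<Rightarrow> 'k. connes_coef f}"
    by (rule inj_onI) (use Phi_inj in auto)
  have T': "T' r (Phi f) = Phi (\<tau> r f)" if "connes_coef f" for r f
    using the_inv_into_f_f[OF inj] that by (simp add: T'_def)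
  have g\<tau>: "connes_coef (\<tau> r f)" if "connes_coef f" for r f
    unfolding \<tau>_def by (rule connes_coef_T_coef[OF a that])
  have add\<tau>: "\<tau> r (\<lambda>l. f l + g l) = (\<lambda>l. \<tau> r f l + \<tau> r g l)" if "connes_coef f" "connes_coef g" for r f g
    unfolding \<tau>_def by (rule T_coef_add[OF a that])
  have scale\<tau>: "\<tau> r (\<lambda>l. c * f l) = (\<lambda>l. c * \<tau> r f l)" for r c f
    unfolding \<tau>_def by (rule T_coef_scale)
  have sum\<tau>: "\<tau> r (\<lambda>l. \<Sum>j\<le>m. F j l) = (\<lambda>l. \<Sum>j\<le>m. \<tau> r (F j) l)" if "\<And>j. connes_coef (F j)" for r F and m :: nat
    unfolding \<tau>_def by (rule T_coef_sum[OF a finite_atMost]) (rule that)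
  have zero\<tau>: "\<tau> r (\<lambda>l. 0) = (\<lambda>l. 0)" for r unfolding \<tau>_def by (rule T_coef_0)
  have diff\<tau>: "\<tau> r (\<lambda>l. f l - g l) = (\<lambda>l. \<tau> r f l - \<tau> r g l)" if "connes_coef f" "connes_coef g" for r f g
    using add\<tau>[OF that(1) connes_coef_scale[OF that(2)], of r "-1"] scale\<tau>[of r "-1" g] by simp
  have cont: "continuous_map connes_topology connes_topology (T' r)" for r
  proof (rule continuous_on_connes[where \<tau> = "\<tau> r", OF T' g\<tau> diff\<tau>])
    fix k :: nat and C :: real assume C: "C > 0"
    show "\<exists>c k' C'. c \<ge> 0 \<and> C' > 0 \<and> (\<forall>M f. bnd k' C' M f \<longrightarrow> bnd k C (c * M) (\<tau> r f))"
      unfolding \<tau>_def by (rule bnd_T_coef[OF a C, where u = Inl and v = "Inr :: 'd \<Rightarrow> 'd + 'd" and r = r and k = k]) blast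
  qed
  have lin: "linear_on_connes (T' r)" for r
    unfolding linear_on_connes_def
  proof (intro ballI allI)
    fix \<Phi> \<Psi> :: "('d, 'k) functional" and x y :: 'k assume "\<Phi> \<in> connes" "\<Psi> \<in> connes"
    then obtain f g where f: "connes_coef f" "\<Phi> = Phi f" and g: "connes_coef g" "\<Psi> = Phi g" by (auto simp: connes_eq)
    have PL: "(\<lambda>X. x * Phi f X + y * Phi g X) = Phi (\<lambda>l. x * f l + y * g l)" if "connes_coef f" "connes_coef g" for f g
      using that by (simp add: fun_eq_iff Phi_add[OF rapid_scale[OF connes_coefD(1)] rapid_scale[OF connes_coefD(1)]] Phi_scale[OF connes_coefD(1)])
    have "T' r (\<lambda>X. x * \<Phi> X + y * \<Psi> X) = Phi (\<tau> r (\<lambda>l. x * f l + y * g l))"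
      unfolding f(2) g(2) PL[OF f(1) g(1)] by (intro T' connes_coef_add connes_coef_scale f g)
    also have "\<tau> r (\<lambda>l. x * f l + y * g l) = (\<lambda>l. x * \<tau> r f l + y * \<tau> r g l)"
      by (simp only: add\<tau>[OF connes_coef_scale[OF f(1)] connes_coef_scale[OF g(1)]] scale\<tau>)
    finally show "T' r (\<lambda>X. x * \<Phi> X + y * \<Psi> X) = (\<lambda>X. x * T' r \<Phi> X + y * T' r \<Psi> X)"
      unfolding f(2) g(2) T'[OF f(1)] T'[OF g(1)] PL[OF g\<tau>[OF f(1)] g\<tau>[OF g(1)]] .
  qed
  have TPhi: "T (\<lambda>n. Phi (\<phi> n)) = (\<lambda>n. Phi (\<lambda>l. \<Sum>r\<le>n. \<tau> r (\<phi> (n - r)) l))" if \<phi>: "\<And>n. connes_coef (\<phi> n)" for \<phi>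
  proof (intro ext)
    fix n :: nat and X
    have "{..n} = insert 0 {1..n}" by auto
    have "Phi (\<lambda>l. \<Sum>r\<le>n. \<tau> r (\<phi> (n - r)) l) X = (\<Sum>r\<le>n. Phi (\<tau> r (\<phi> (n - r))) X)"
      by (rule Phi_sum) (simp_all add: g\<tau> \<phi>)
    also have "\<dots> = Phi (\<tau> 0 (\<phi> n)) X + (\<Sum>r=1..n. Phi (\<tau> r (\<phi> (n - r))) X)"
      by (simp add: \<open>{..n} = insert 0 {1..n}\<close>)
    finally have "Phi (\<lambda>l. \<Sum>r\<le>n. \<tau> r (\<phi> (n - r)) l) X = Phi (\<tau> 0 (\<phi> n)) X + (\<Sum>r=1..n. Phi (\<tau> r (\<phi> (n - r))) X)" .
    then show "T (\<lambda>n. Phi (\<phi> n)) n X = Phi (\<lambda>l. \<Sum>r\<le>n. \<tau> r (\<phi> (n - r)) l) X"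
      by (simp add: T_def T'[OF \<phi>] \<tau>_def)
  qed
  have g\<Sigma>: "connes_coef (\<lambda>l. \<Sum>r\<le>n. \<tau> r (\<phi> (n - r)) l)" if "\<And>n. connes_coef (\<phi> n)" for \<phi> n
    by (rule connes_coef_sum) (auto intro: g\<tau> that)
  have series: "\<exists>\<phi>. (\<forall>n. connes_coef (\<phi> n)) \<and> \<Phi> = (\<lambda>n. Phi (\<phi> n))" if "\<Phi> \<in> connes_hseries" for \<Phi> :: "('d, 'k) hseries"
  proof -
    have "\<forall>n. \<exists>f. connes_coef f \<and> \<Phi> n = Phi f" using that by (auto simp: connes_hseries_def connes_eq)
    then obtain \<phi> where "\<forall>n. connes_coef (\<phi> n) \<and> \<Phi> n = Phi (\<phi> n)" by metis
    then show ?thesis by (intro exI[of _ \<phi>]) auto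
  qed
  have maps: "T \<in> connes_hseries \<rightarrow> connes_hseries"
  proof
    fix \<Phi> :: "('d, 'k) hseries" assume "\<Phi> \<in> connes_hseries"
    then obtain \<phi> where \<phi>: "\<And>n. connes_coef (\<phi> n)" "\<Phi> = (\<lambda>n. Phi (\<phi> n))" using series by blast
    show "T \<Phi> \<in> connes_hseries"
      unfolding \<phi>(2) TPhi[of \<phi>, OF \<phi>(1)] connes_hseries_def using Phi_connes[OF g\<Sigma>[of \<phi>, OF \<phi>(1)]] by simp
  qed
  have hlin: "hlinear_on_connes T"
    unfolding hlinear_on_connes_def
  proof (intro conjI ballI allI)
    fix \<Phi> \<Psi> :: "('d, 'k) hseries" assume "\<Phi> \<in> connes_hseries" "\<Psi> \<in> connes_hseries"
    then obtain \<phi> \<psi> where \<phi>: "\<And>n. connes_coef (\<phi> n)" "\<Phi> = (\<lambda>n. Phi (\<phi> n))" and \<psi>: "\<And>n. connes_coef (\<psi> n)" "\<Psi> = (\<lambda>n. Phi (\<psi> n))"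
      using series by metis
    have eq: "(\<lambda>n X. Phi (f n) X + Phi (g n) X) = (\<lambda>n. Phi (\<lambda>l. f n l + g n l))" if "\<And>n. connes_coef (f n)" "\<And>n. connes_coef (g n)" for f g :: "nat \<Rightarrow> (('d + 'd) \<times> int) list \<Rightarrow> 'k"
      by (simp add: fun_eq_iff Phi_add[OF connes_coefD(1)[OF that(1)] connes_coefD(1)[OF that(2)]])
    show "T (\<lambda>n X. \<Phi> n X + \<Psi> n X) = (\<lambda>n X. T \<Phi> n X + T \<Psi> n X)"
      unfolding \<phi>(2) \<psi>(2) eq[OF \<phi>(1) \<psi>(1)] TPhi[of \<phi>, OF \<phi>(1)] TPhi[of \<psi>, OF \<psi>(1)] TPhi[OF connes_coef_add[OF \<phi>(1) \<psi>(1)]]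
        eq[OF g\<Sigma>[of \<phi>, OF \<phi>(1)] g\<Sigma>[of \<psi>, OF \<psi>(1)]]
      by (simp add: add\<tau>[OF \<phi>(1) \<psi>(1)] sum.distrib)
  next
    fix c :: "'k fps" and \<Phi> :: "('d, 'k) hseries" assume "\<Phi> \<in> connes_hseries"
    then obtain \<phi> where \<phi>: "\<And>n. connes_coef (\<phi> n)" "\<Phi> = (\<lambda>n. Phi (\<phi> n))" using series by blast
    have eq: "hscale c (\<lambda>n. Phi (f n)) = (\<lambda>n. Phi (\<lambda>l. \<Sum>j\<le>n. fps_nth c j * f (n - j) l))" if f: "\<And>n. connes_coef (f n)" for f :: "nat \<Rightarrow> (('d + 'd) \<times> int) list \<Rightarrow> 'k"
      by (simp add: fun_eq_iff hscale_def Phi_sum connes_coef_scale[OF f] Phi_scale[OF connes_coefD(1)[OF f]])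
    have gs: "connes_coef (\<lambda>l. \<Sum>j\<le>n. fps_nth c j * \<phi> (n - j) l)" for n
      by (rule connes_coef_sum) (auto intro: connes_coef_scale \<phi>)
    have "(\<Sum>r\<le>n. \<tau> r (\<lambda>l. \<Sum>j\<le>n - r. fps_nth c j * \<phi> (n - r - j) l) l)
        = (\<Sum>j\<le>n. fps_nth c j * (\<Sum>r\<le>n - j. \<tau> r (\<phi> (n - j - r)) l))" for n :: nat and l
    proof -
      have "(\<Sum>r\<le>n. \<tau> r (\<lambda>l. \<Sum>j\<le>n - r. fps_nth c j * \<phi> (n - r - j) l) l)
          = (\<Sum>r\<le>n. \<Sum>j\<le>n - r. fps_nth c j * \<tau> r (\<phi> (n - r - j)) l)"
        by (simp add: sum\<tau>[OF connes_coef_scale[OF \<phi>(1)]] scale\<tau>)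
      also have "\<dots> = (\<Sum>j\<le>n. \<Sum>r\<le>n - j. fps_nth c j * \<tau> r (\<phi> (n - r - j)) l)"
        by (rule sum_triangle_swap)
      finally show ?thesis by (simp add: sum_distrib_left add.commute)
    qed
    then show "T (hscale c \<Phi>) = hscale c (T \<Phi>)"
      unfolding \<phi>(2) eq[OF \<phi>(1)] TPhi[of \<phi>, OF \<phi>(1)] TPhi[OF gs] eq[OF g\<Sigma>[of \<phi>, OF \<phi>(1)]] by (simp only:)
  qed
  have equiv: "star \<alpha> (hconst F) (hconst G) \<in> connes_hseries \<and>
      T (star \<alpha> (hconst F) (hconst G)) = moyal (T (hconst F)) (T (hconst G))"
    if mem: "F \<in> connes" "G \<in> connes" for F G :: "('d, 'k) functional"
  proof -
    obtain f g where f: "connes_coef f" "F = Phi f" and g: "connes_coef g" "G = Phi g" using mem by (auto simp: connes_eq)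
    let ?c = "\<lambda>f n. if n = 0 then f else (\<lambda>l. 0 :: 'k)"
    have gc: "connes_coef (?c f n)" if "connes_coef f" for f :: "(('d + 'd) \<times> int) list \<Rightarrow> 'k" and n :: nat
      using that connes_coef_0 by auto
    let ?s = "\<lambda>n. star_coef (\<lambda>t::'d \<times> int. \<alpha> (snd t)) Inl Inr n f g"
    have gS: "connes_coef (?s n)" for n by (rule connes_coef_star_coef[OF a f(1) g(1)])
    have star: "star \<alpha> (hconst F) (hconst G) = (\<lambda>n. Phi (?s n))"
    proof
      fix n :: nat
      have "(\<Sum>p\<le>n. \<Sum>q\<le>n - p. star_coef (\<lambda>t::'d \<times> int. \<alpha> (snd t)) Inl Inr (n - p - q) (?c f p) (?c g q) l) = ?s n l" for l
      proof -
        have "(\<Sum>q\<le>n. star_coef (\<lambda>t::'d \<times> int. \<alpha> (snd t)) Inl Inr (n - 0 - q) f (?c g q) l) = ?s n l"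
          by (subst sum_eq_single[where a = 0]) (auto simp: star_coef_zero)
        then show ?thesis
          by (subst sum_eq_single[where a = 0]) (auto simp: star_coef_zero)
      qed
      then show "star \<alpha> (hconst F) (hconst G) n = Phi (?s n)"
        unfolding f(2) g(2) hconst_Phi star_Phi[OF a gc[OF f(1)] gc[OF g(1)]] by (simp only:)
    qed
    have Th: "T (hconst (Phi f)) = (\<lambda>n. Phi (\<tau> n f))" if f: "connes_coef f" for f
    proof -
      have "(\<Sum>r\<le>n. \<tau> r (?c f (n - r)) l) = \<tau> n f l" for n :: nat and l
        by (subst sum_eq_single[where a = n]) (auto simp: zero\<tau>)
      then show ?thesis unfolding hconst_Phi TPhi[OF gc[OF f]] by (simp only:)
    qed
    have z: "tame 0 0 (\<lambda>t::'d \<times> int. (\<lambda>_. 0 :: 'k) (snd t))" by (simp add: tame_def)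
    have "T (star \<alpha> (hconst F) (hconst G)) = moyal (T (hconst F)) (T (hconst G))"
      unfolding star TPhi[of ?s, OF gS]
      unfolding f(2) g(2) Th[OF f(1)] Th[OF g(1)] moyal_def
    proof
      fix n
      show "Phi (\<lambda>l. \<Sum>r\<le>n. \<tau> r (?s (n - r)) l) = star (\<lambda>_. 0) (\<lambda>n. Phi (\<tau> n f)) (\<lambda>n. Phi (\<tau> n g)) n"
        unfolding star_Phi[OF z g\<tau>[OF f(1)] g\<tau>[OF g(1)]]
        unfolding \<tau>_def by (simp only: star_coef_equivalence[OF a f(1) g(1)])
    qed
    moreover have "star \<alpha> (hconst F) (hconst G) \<in> connes_hseries"
      unfolding star connes_hseries_def using Phi_connes[OF gS] by simp
    ultimately show ?thesis by blast
  qed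
  show ?thesis
    by (rule exI[of _ T], rule exI[of _ T']) (use maps hlin cont lin equiv T_def in auto)
qed

end
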